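(* Let $R$ be a finite $S_{\mathbb{Q}}$-ring of rank $n$ as a $\mathbb{Z}$-module, and let $p$ be a prime. Let $f_p$ be the number of $\overline{\mathbb{F}}_p$-valued points of $\mathrm{Spec}(R)$. Then $f_p\ge n-\nu_p(\delta_R)$. Moreover, equality holds if and only if the index of $R$ in its integral closure $\tilde R$ in $R\otimes\mathbb{Q}$ is prime to $p$ and $p$ is tamely ramified in each factor field of $R\otimes\mathbb{Q}$.
   Context: A finite $S_{\mathbb{Q}}$-ring is a commutative ring $R$ with identity which is finitely generated and free as a $\mathbb{Z}$-module and such that $R\otimes\mathbb{Q}$ is isomorphic to a product of (number) fields; its rank is its rank as a $\mathbb{Z}$-module. Its discriminant $\delta_R$ is the determinant of the bilinear form $(x,y)\mapsto\mathrm{tr}(xy)$ on a $\mathbb{Z}$-basis of $R$, where $\mathrm{tr}(a)$ is the trace of the $\mathbb{Q}$-linear map of multiplication by $a\otimes 1$ on $R\otimes\mathbb{Q}$. $\nu_p$ is the $p$-adic valuation with $\nu_p(p)=1$. $p$ tamely ramified in a number field means every prime above $p$ in its ring of integers has ramification index prime to $p$. *)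

theory Defs
  imports
    "Jordan_Normal_Form.Determinant"
    "HOL-Number_Theory.Residues"
    "HOL-Algebra.Algebraic_Closure_Type"
    "HOL-Algebra.Algebra"
begin

section \<open>The tensor product with the rationals\<close>

text \<open>
  For a commutative ring \<open>R\<close>, the ring \<open>R \<otimes> \<rat>\<close> (tensor product over the integers) is the quotient
  of the monoid ring \<open>\<int>[R \<times> \<rat>]\<close> of the multiplicative monoid \<open>R \<times> \<rat>\<close> by the bilinearity
  relations. The ideal generated by these relations is their additive span, because the product of
  a relation with a generator \<open>(x, q)\<close> is again a relation; hence the additive group of the quotient
  is the usual tensor product of abelian groups.
\<close>

definition pair_monoid_ring :: "'a ring \<Rightarrow> ('a \<times> rat \<Rightarrow>\<^sub>0 int) ring" where
  "pair_monoid_ring R =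
    \<lparr> carrier = {f. Poly_Mapping.keys f \<subseteq> carrier R \<times> UNIV},
      monoid.mult = (\<lambda>f g. frag_extend (\<lambda>(x, q). frag_extend (\<lambda>(y, r). frag_of (x \<otimes>\<^bsub>R\<^esub> y, q * r)) g) f),
      monoid.one = frag_of (\<one>\<^bsub>R\<^esub>, 1),
      ring.zero = 0,
      ring.add = (+) \<rparr>"

definition bilinear_relations :: "'a ring \<Rightarrow> ('a \<times> rat \<Rightarrow>\<^sub>0 int) set" where
  "bilinear_relations R =
    {frag_of (x \<oplus>\<^bsub>R\<^esub> y, q) - frag_of (x, q) - frag_of (y, q) | x y q. x \<in> carrier R \<and> y \<in> carrier R} \<union>
    {frag_of (x, q + r) - frag_of (x, q) - frag_of (x, r) | x q r. x \<in> carrier R}"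

definition bilinear_ideal :: "'a ring \<Rightarrow> ('a \<times> rat \<Rightarrow>\<^sub>0 int) set" where
  "bilinear_ideal R = genideal (pair_monoid_ring R) (bilinear_relations R)"

definition rat_tensor :: "'a ring \<Rightarrow> ('a \<times> rat \<Rightarrow>\<^sub>0 int) set ring" where
  "rat_tensor R = pair_monoid_ring R Quot bilinear_ideal R"

definition pure_tensor :: "'a ring \<Rightarrow> 'a \<Rightarrow> rat \<Rightarrow> ('a \<times> rat \<Rightarrow>\<^sub>0 int) set" where
  "pure_tensor R x q = bilinear_ideal R +>\<^bsub>pair_monoid_ring R\<^esub> frag_of (x, q)"

definition rat_scale :: "'a ring \<Rightarrow> rat \<Rightarrow> ('a \<times> rat \<Rightarrow>\<^sub>0 int) set \<Rightarrow> ('a \<times> rat \<Rightarrow>\<^sub>0 int) set" where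
  "rat_scale R q u = pure_tensor R \<one>\<^bsub>R\<^esub> q \<otimes>\<^bsub>rat_tensor R\<^esub> u"


section \<open>Bases, trace and discriminant\<close>

text \<open>
  \<open>b 0, \<dots>, b (n - 1)\<close> is a basis of the additive group of \<open>A\<close> for the scalar action \<open>smul\<close>.
\<close>

definition free_basis :: "('b, 'm) ring_scheme \<Rightarrow> ('s \<Rightarrow> 'b \<Rightarrow> 'b) \<Rightarrow> nat \<Rightarrow> (nat \<Rightarrow> 'b) \<Rightarrow> bool" where
  "free_basis A smul n b \<longleftrightarrow>
    b \<in> {..<n} \<rightarrow> carrier A \<and>
    (\<forall>x \<in> carrier A. \<exists>!c. c \<in> {..<n} \<rightarrow>\<^sub>E UNIV \<and> x = (\<Oplus>\<^bsub>A\<^esub>i\<in>{..<n}. smul (c i) (b i)))"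

definition int_basis :: "'a ring \<Rightarrow> nat \<Rightarrow> (nat \<Rightarrow> 'a) \<Rightarrow> bool" where
  "int_basis R n b \<longleftrightarrow> free_basis R (\<lambda>(k::int) x. [k] \<cdot>\<^bsub>R\<^esub> x) n b"

definition has_int_rank :: "'a ring \<Rightarrow> nat \<Rightarrow> bool" where
  "has_int_rank R n \<longleftrightarrow> (\<exists>b. int_basis R n b)"

text \<open>
  The trace of a \<open>\<rat>\<close>-linear endomorphism of \<open>R \<otimes> \<rat>\<close>, where \<open>M i j\<close> are the entries of its matrix
  in some \<open>\<rat>\<close>-basis.
\<close>

definition rat_linear_trace ::
    "'a ring \<Rightarrow> (('a \<times> rat \<Rightarrow>\<^sub>0 int) set \<Rightarrow> ('a \<times> rat \<Rightarrow>\<^sub>0 int) set) \<Rightarrow> rat" where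
  "rat_linear_trace R \<phi> = (THE t. \<exists>n b M.
     free_basis (rat_tensor R) (rat_scale R) n b \<and>
     (\<forall>j<n. \<phi> (b j) = (\<Oplus>\<^bsub>rat_tensor R\<^esub>i\<in>{..<n}. rat_scale R (M i j) (b i))) \<and>
     t = (\<Sum>i<n. M i i))"

definition ring_trace :: "'a ring \<Rightarrow> 'a \<Rightarrow> rat" where
  "ring_trace R a = rat_linear_trace R (\<lambda>u. pure_tensor R a 1 \<otimes>\<^bsub>rat_tensor R\<^esub> u)"

text \<open>
  The discriminant does not depend on the basis, and it is an integer because multiplication by
  \<open>a \<otimes> 1\<close> has an integral matrix in the basis \<open>b i \<otimes> 1\<close>. For a finite \<open>S\<^sub>\<rat>\<close>-ring it is nonzero, so
  the library's \<open>multiplicity\<close> (with the value 0 at 0) gives its \<open>p\<close>-adic valuation.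
\<close>

definition discriminant :: "'a ring \<Rightarrow> int" where
  "discriminant R = (THE d. \<exists>n b. int_basis R n b \<and>
     of_int d = Determinant.det (Matrix.mat n n (\<lambda>(i, j). ring_trace R (b i \<otimes>\<^bsub>R\<^esub> b j))))"


section \<open>Integral closure\<close>

text \<open>
  Polynomials are coefficient lists with the leading coefficient first. Only \<open>set f \<subseteq> S\<close> and monicity
  are required, instead of membership in the library's polynomial ring, since the latter excludes
  the polynomial \<open>1\<close> over the zero ring.
\<close>

definition integral_closure_in :: "'b set \<Rightarrow> ('b, 'm) ring_scheme \<Rightarrow> 'b set" where
  "integral_closure_in S A =
    {x \<in> carrier A. \<exists>f. f \<noteq> [] \<and> set f \<subseteq> S \<and> hd f = \<one>\<^bsub>A\<^esub> \<and> ring.eval A f x = \<zero>\<^bsub>A\<^esub>}"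

definition tensor_image :: "'a ring \<Rightarrow> ('a \<times> rat \<Rightarrow>\<^sub>0 int) set set" where
  "tensor_image R = (\<lambda>x. pure_tensor R x 1) ` carrier R"

definition normalization_carrier :: "'a ring \<Rightarrow> ('a \<times> rat \<Rightarrow>\<^sub>0 int) set set" where
  "normalization_carrier R = integral_closure_in (tensor_image R) (rat_tensor R)"

definition normalization_index :: "'a ring \<Rightarrow> nat" where
  "normalization_index R =
    card (a_rcosets\<^bsub>(rat_tensor R)\<lparr>carrier := normalization_carrier R\<rparr>\<^esub> (tensor_image R))"


section \<open>Number fields and tame ramification\<close>

definition number_field :: "'k ring \<Rightarrow> bool" where
  "number_field K \<longleftrightarrow> field K \<and>
    (\<exists>h \<in> ring_hom (ring_of_type_algebra :: rat ring) K.
       ring.finite_dimension K (range h) (carrier K))"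

definition ring_of_integers :: "'k ring \<Rightarrow> 'k ring" where
  "ring_of_integers K = K\<lparr>carrier := integral_closure_in (range (\<lambda>k::int. [k] \<cdot>\<^bsub>K\<^esub> \<one>\<^bsub>K\<^esub>)) K\<rparr>"

text \<open>The exponent of \<open>P\<close> in \<open>p \<O>\<close>, i.e. the largest \<open>e\<close> such that \<open>P\<^sup>e\<close> divides \<open>p \<O>\<close>.\<close>

definition ramification_index :: "'k ring \<Rightarrow> nat \<Rightarrow> 'k set \<Rightarrow> nat" where
  "ramification_index \<O> p P = (GREATEST e::nat. \<exists>J. ideal J \<O> \<and>
     PIdl\<^bsub>\<O>\<^esub> ([p] \<cdot>\<^bsub>\<O>\<^esub> \<one>\<^bsub>\<O>\<^esub>) = (P [^]\<^bsub>ideals_set \<O>\<^esub> e) \<cdot>\<^bsub>\<O>\<^esub> J)"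

definition tamely_ramified :: "nat \<Rightarrow> 'k ring \<Rightarrow> bool" where
  "tamely_ramified p K \<longleftrightarrow> (\<forall>P. primeideal P (ring_of_integers K) \<and> [p] \<cdot>\<^bsub>K\<^esub> \<one>\<^bsub>K\<^esub> \<in> P \<longrightarrow>
     coprime (ramification_index (ring_of_integers K) p P) p)"


section \<open>Finite \<open>S\<^sub>\<rat>\<close>-rings and their geometric points\<close>

text \<open>
  The list \<open>Ks\<close> of factor fields is a parameter, so that its element type is not fixed; as a
  hypothesis for arbitrary \<open>Ks\<close> this expresses that some such list exists. The empty product is
  allowed, so the zero ring counts as a finite \<open>S\<^sub>\<rat>\<close>-ring of rank 0.
\<close>

definition finite_SQ_ring :: "'a ring \<Rightarrow> 'k ring list \<Rightarrow> bool" where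
  "finite_SQ_ring R Ks \<longleftrightarrow>
    cring R \<and> (\<exists>n. has_int_rank R n) \<and>
    (\<forall>K \<in> set Ks. number_field K) \<and> rat_tensor R \<simeq> RDirProd_list Ks"

text \<open>
  Points of \<open>Spec R\<close> with values in a field are ring homomorphisms from \<open>R\<close>. The library's
  homomorphisms are arbitrary outside the carrier, so they are made extensional before counting.
\<close>

definition geometric_points :: "nat \<Rightarrow> 'a ring \<Rightarrow> ('a \<Rightarrow> (int list \<times> nat) multiset \<Rightarrow> int) set" where
  "geometric_points p R =
    ring_hom R (field.alg_closure (residue_ring (int p))) \<inter> extensional (carrier R)"

end

theory Submission
  imports Defs "HOL-Library.Function_Algebras"
begin

text \<open>
  Let \<open>J\<close> be the radical of \<open>p R\<close>. Counting roots of minimal polynomials in the algebraic closure of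
  \<open>\<F>\<^sub>p\<close> shows that \<open>R / J\<close> has dimension \<open>f\<^sub>p\<close> over \<open>\<F>\<^sub>p\<close>. Elements of \<open>J\<close> have trace divisible by \<open>p\<close>, so
  \<open>tr (w r) / p\<close> is an integral pairing of \<open>J\<close> with \<open>R\<close>; its determinant is, up to a unit at \<open>p\<close>, the
  discriminant divided by the power \<open>n - f\<^sub>p\<close> of \<open>p\<close>. This gives the inequality, and equality means that
  the pairing is nondegenerate modulo \<open>p\<close>.

  A nondegenerate pairing forces the index of \<open>R\<close> in its integral closure to be prime to \<open>p\<close>: if \<open>p x\<close>
  lies in \<open>R\<close> with \<open>x\<close> integral, then \<open>w x\<close> is nilpotent modulo \<open>p\<close> for all \<open>w\<close> in \<open>J\<close>, so that
  \<open>tr (w p x)\<close> is divisible by \<open>p\<^sup>2\<close>. If that index is prime to \<open>p\<close>, nondegeneracy amounts to: every \<open>u\<close>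
  with all \<open>tr (u r)\<close> divisible by \<open>p\<close> is nilpotent modulo \<open>p\<close>. This can be checked one prime \<open>P\<close> above
  \<open>p\<close> at a time. Write \<open>(p) = P\<^sup>e I\<close> with \<open>I\<close> not contained in \<open>P\<close>. For \<open>y\<close> in \<open>I\<close> the filtration by the
  powers of \<open>P\<close> yields \<open>tr y = e t\<close> modulo \<open>p\<close>, where \<open>t\<close> is the trace of \<open>y\<close> on the residue field.
  Residue field traces do not vanish identically, since finite fields are perfect; hence the condition
  says that no \<open>e\<close> is divisible by \<open>p\<close>.
\<close>

section \<open>Lattice quotients of exponent p and their traces\<close>

text \<open>R, its integral closure and the factors of the latter have to be compared inside R
  tensor Q, while reduction modulo p happens on many different quotients. So all these rings become
  subsets of one type of coordinate vectors with a single bilinear product, and linear algebra over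
  F_p is done on quotients L/M of subgroups, with integer coefficients read modulo p. Traces add
  along chains of subgroups, and the trace over Q reduces to the trace on L/pL for every stable full
  lattice L.

  Integrality is treated as boundedness of the denominators of all powers. It holds as soon as a
  full lattice is stable under multiplication by the element, which yields both the invertibility of
  primes above p and the passage from maximality at p together with the condition on u back to a
  nondegenerate pairing.

  The factor fields enter through their idempotents: each cuts out of the integral closure a direct
  factor that is isomorphic to the ring of integers of the field. The discriminant is nonzero
  because the trace of a nonzero idempotent is its rank, as is seen modulo large primes.\<close>

abbreviation lincomb :: "nat \<Rightarrow> (nat \<Rightarrow> int) \<Rightarrow> (nat \<Rightarrow> 'a::ring_1) \<Rightarrow> 'a" where
  "lincomb r c v \<equiv> \<Sum>i<r. of_int (c i) * v i"

lemma sum_lessThan_add_split: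
  fixes f :: "nat \<Rightarrow> 'b::comm_monoid_add"
  shows "(\<Sum>i<r + s. f i) = (\<Sum>i<r. f i) + (\<Sum>i<s. f (r + i))"
  by (induction s) (auto simp: add.assoc)

section \<open>Additive subgroups, cosets and bases of quotients\<close>

definition is_subgroup :: "'v::comm_ring_1 set \<Rightarrow> bool" where
  "is_subgroup L \<longleftrightarrow> 0 \<in> L \<and> (\<forall>x\<in>L. \<forall>y\<in>L. x - y \<in> L)"

lemma is_subgroupI:
  assumes "0 \<in> L" "\<And>x y. x \<in> L \<Longrightarrow> y \<in> L \<Longrightarrow> x - y \<in> L"
  shows "is_subgroup L"
  using assms unfolding is_subgroup_def by blast

lemma is_subgroup_zero: "is_subgroup L \<Longrightarrow> 0 \<in> L"
  unfolding is_subgroup_def by blast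

lemma is_subgroup_diff: "is_subgroup L \<Longrightarrow> x \<in> L \<Longrightarrow> y \<in> L \<Longrightarrow> x - y \<in> L"
  unfolding is_subgroup_def by blast

lemma is_subgroup_uminus: "is_subgroup L \<Longrightarrow> x \<in> L \<Longrightarrow> - x \<in> L"
  using is_subgroup_diff[of L 0 x] is_subgroup_zero[of L] by simp

lemma is_subgroup_add: "is_subgroup L \<Longrightarrow> x \<in> L \<Longrightarrow> y \<in> L \<Longrightarrow> x + y \<in> L"
  using is_subgroup_diff[of L x "- y"] is_subgroup_uminus[of L y] by simp

lemma is_subgroup_of_nat: "is_subgroup L \<Longrightarrow> x \<in> L \<Longrightarrow> of_nat k * x \<in> L"
  by (induction k) (auto simp: algebra_simps intro: is_subgroup_zero is_subgroup_add)

lemma is_subgroup_of_int: "is_subgroup L \<Longrightarrow> x \<in> L \<Longrightarrow> of_int k * x \<in> L"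
  by (cases k) (auto intro: is_subgroup_of_nat is_subgroup_uminus simp del: of_nat_Suc)

lemma is_subgroup_sum: "is_subgroup L \<Longrightarrow> (\<And>i. i \<in> I \<Longrightarrow> f i \<in> L) \<Longrightarrow> sum f I \<in> L"
  by (induction I rule: infinite_finite_induct) (auto intro: is_subgroup_zero is_subgroup_add)

lemmas is_subgroup_closed = is_subgroup_zero is_subgroup_diff is_subgroup_uminus is_subgroup_add
  is_subgroup_of_nat is_subgroup_of_int is_subgroup_sum

text \<open>The coset of x is cut down to L, so that M need not lie in L; in this way
  \<open>piece e\<close> is taken modulo p times the whole integral closure.\<close>

definition cosets_mod :: "'v::comm_ring_1 set \<Rightarrow> 'v set \<Rightarrow> 'v set set" where
  "cosets_mod L M = (\<lambda>x. {y \<in> L. y - x \<in> M}) ` L"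

lemma coset_eq_iff:
  assumes "is_subgroup M" "x \<in> L" "y \<in> L"
  shows "{z \<in> L. z - x \<in> M} = {z \<in> L. z - y \<in> M} \<longleftrightarrow> x - y \<in> M"
proof
  assume "{z \<in> L. z - x \<in> M} = {z \<in> L. z - y \<in> M}"
  moreover have "x \<in> {z \<in> L. z - x \<in> M}" using assms is_subgroup_zero by auto
  ultimately show "x - y \<in> M" by auto
next
  assume xy: "x - y \<in> M"
  have "z - x \<in> M \<longleftrightarrow> z - y \<in> M" for z
    using is_subgroup_add[OF assms(1) _ xy, of "z - x"] is_subgroup_diff[OF assms(1) _ xy, of "z - y"]
    by (auto simp: algebra_simps)
  then show "{z \<in> L. z - x \<in> M} = {z \<in> L. z - y \<in> M}" by auto
qed

text \<open>The class modulo M of an element of L' determines its class modulo M': the latter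
  consists of the elements of L' that are congruent modulo M' to a member of the former in
  L'.\<close>

lemma finite_cosets_mod_mono:
  assumes fin: "finite (cosets_mod L M)" and sub: "L' \<subseteq> L" "M \<subseteq> M'" and sg: "is_subgroup M" "is_subgroup M'"
  shows "finite (cosets_mod L' M')"
proof -
  have "cosets_mod L' M' \<subseteq> (\<lambda>C. {y \<in> L'. \<exists>x\<in>C \<inter> L'. y - x \<in> M'}) ` cosets_mod L M"
  proof
    fix C assume "C \<in> cosets_mod L' M'"
    then obtain x where x: "x \<in> L'" "C = {y \<in> L'. y - x \<in> M'}" unfolding cosets_mod_def by auto
    have "y - x \<in> M'" if "z - x \<in> M" "y - z \<in> M'" for y z
      using is_subgroup_add[OF sg(2), of "y - z" "z - x"] that sub by auto
    then have "C = {y \<in> L'. \<exists>z\<in>{z \<in> L. z - x \<in> M} \<inter> L'. y - z \<in> M'}"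
      using x sub is_subgroup_zero[OF sg(1)] by fastforce
    then show "C \<in> (\<lambda>C. {y \<in> L'. \<exists>x\<in>C \<inter> L'. y - x \<in> M'}) ` cosets_mod L M"
      using x sub unfolding cosets_mod_def by auto
  qed
  then show ?thesis using fin finite_surj by blast
qed

text \<open>
  \<open>pbasis p L M r v\<close>: the classes of \<open>v 0, \<dots>, v (r - 1)\<close> form a basis of the \<open>\<F>\<^sub>p\<close>-vector space \<open>L / M\<close>.
\<close>

definition pbasis :: "nat \<Rightarrow> 'v::comm_ring_1 set \<Rightarrow> 'v set \<Rightarrow> nat \<Rightarrow> (nat \<Rightarrow> 'v) \<Rightarrow> bool" where
  "pbasis p L M r v \<longleftrightarrow> (\<forall>i<r. v i \<in> L) \<and>
     (\<forall>x\<in>L. \<exists>c. x - lincomb r c v \<in> M) \<and>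
     (\<forall>c. (lincomb r c v) \<in> M \<longrightarrow> (\<forall>i<r. int p dvd c i))"

text \<open>A relation and not a function, since the basis and the integral lifts of the matrix
  entries are chosen. By \<open>ptrace_unique\<close> the value is unique modulo p once the map is
  additive and preserves M.\<close>

definition ptrace :: "nat \<Rightarrow> 'v::comm_ring_1 set \<Rightarrow> 'v set \<Rightarrow> ('v \<Rightarrow> 'v) \<Rightarrow> int \<Rightarrow> bool" where
  "ptrace p L M \<phi> t \<longleftrightarrow> (\<exists>r v A. pbasis p L M r v \<and>
     (\<forall>j<r. \<phi> (v j) - (\<Sum>i<r. of_int (A i j) * v i) \<in> M) \<and> [t = (\<Sum>i<r. A i i)] (mod int p))"

lemma pbasisD:
  assumes "pbasis p L M r v"
  shows "i < r \<Longrightarrow> v i \<in> L" "x \<in> L \<Longrightarrow> \<exists>c. x - lincomb r c v \<in> M"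
    "lincomb r c v \<in> M \<Longrightarrow> i < r \<Longrightarrow> int p dvd c i"
  using assms unfolding pbasis_def by blast+

definition cat_seq :: "nat \<Rightarrow> (nat \<Rightarrow> 'v) \<Rightarrow> (nat \<Rightarrow> 'v) \<Rightarrow> nat \<Rightarrow> 'v" where
  "cat_seq r v w i = (if i < r then v i else w (i - r))"

lemma cat_seq_simps [simp]: "i < r \<Longrightarrow> cat_seq r v w i = v i" "cat_seq r v w (r + i) = w i"
  unfolding cat_seq_def by auto

lemma sum_cat_seq:
  "(\<Sum>i<r + s. of_int (c i) * cat_seq r v w i)
     = lincomb r c v + (\<Sum>i<s. of_int (c (r + i)) * w i :: 'v::comm_ring_1)"
  by (simp add: sum_lessThan_add_split)

lemma pmult_combination_mem:
  assumes "is_subgroup N" "\<And>i. i < r \<Longrightarrow> v i \<in> L" "\<And>x. x \<in> L \<Longrightarrow> of_nat p * x \<in> N" "\<And>i. i < r \<Longrightarrow> int p dvd c i"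
  shows "lincomb r c v \<in> N"
proof (rule is_subgroup_sum[OF assms(1)])
  fix i assume "i \<in> {..<r}"
  then obtain k where "c i = int p * k" using assms(4) by auto
  then have "of_int (c i) * v i = of_int k * (of_nat p * v i)" by (simp add: ac_simps)
  then show "of_int (c i) * v i \<in> N"
    using assms \<open>i \<in> {..<r}\<close> is_subgroup_of_int by (metis lessThan_iff)
qed

text \<open>That p kills the whole of L/N is what makes independence work: once the coefficients at
  \<open>v\<close> are known to be divisible by p, their part of a relation lies in N and only the
  part in \<open>w\<close> is left.\<close>

lemma pbasis_cat:
  assumes sg: "is_subgroup L" "is_subgroup M" "is_subgroup N" and sub: "M \<subseteq> L" "N \<subseteq> M"
    and pL: "\<And>x. x \<in> L \<Longrightarrow> of_nat p * x \<in> N"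
    and v: "pbasis p L M r v" and w: "pbasis p M N s w"
  shows "pbasis p L N (r + s) (cat_seq r v w)"
  unfolding pbasis_def
proof (intro conjI allI ballI impI)
  fix i assume "i < r + s"
  then show "cat_seq r v w i \<in> L"
    using pbasisD(1)[OF v] pbasisD(1)[OF w] sub unfolding cat_seq_def by auto
next
  fix x assume "x \<in> L"
  then obtain c where c: "x - lincomb r c v \<in> M" using pbasisD(2)[OF v] by blast
  then obtain d where d: "x - lincomb r c v - lincomb s d w \<in> N"
    using pbasisD(2)[OF w] by blast
  have "(\<Sum>i<r + s. of_int (cat_seq r c d i) * cat_seq r v w i)
      = lincomb r c v + lincomb s d w"
    by (simp add: sum_cat_seq)
  then show "\<exists>c. x - (\<Sum>i<r + s. of_int (c i) * cat_seq r v w i) \<in> N"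
    using d by (metis diff_diff_eq)
next
  fix c i assume mem: "(\<Sum>i<r + s. of_int (c i) * cat_seq r v w i) \<in> N" and i: "i < r + s"
  let ?a = "\<Sum>i<r. of_int (c i) * v i" and ?b = "\<Sum>i<s. of_int (c (r + i)) * w i"
  have ab: "?a + ?b \<in> N" using mem by (simp add: sum_cat_seq)
  have b: "?b \<in> M" using pbasisD(1)[OF w] sg by (auto intro: is_subgroup_closed)
  then have "?a \<in> M" using is_subgroup_diff[OF sg(2) _ b, of "?a + ?b"] ab sub by auto
  then have dc: "int p dvd c i" if "i < r" for i using pbasisD(3)[OF v] that by blast
  have "?a \<in> N"
    by (rule pmult_combination_mem[OF sg(3) _ pL dc]) (use pbasisD(1)[OF v] in auto)
  then have "?b \<in> N" using is_subgroup_diff[OF sg(3) ab, of ?a] by simp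
  then have "int p dvd c (r + i)" if "i < s" for i
    using pbasisD(3)[OF w, of "\<lambda>i. c (r + i)"] that by blast
  then have dd: "r \<le> i \<Longrightarrow> int p dvd c i"
    using i by (metis le_add_diff_inverse nat_add_left_cancel_less)
  then show "int p dvd c i" using dc by (cases "i < r") auto
qed

lemma ptrace_cat:
  assumes sg: "is_subgroup L" "is_subgroup M" "is_subgroup N" and sub: "M \<subseteq> L" "N \<subseteq> M"
    and pL: "\<And>x. x \<in> L \<Longrightarrow> of_nat p * x \<in> N"
    and t: "ptrace p L M \<phi> t" and u: "ptrace p M N \<phi> u"
  shows "ptrace p L N \<phi> (t + u)"
proof -
  obtain r v A where v: "pbasis p L M r v" and A: "\<And>j. j < r \<Longrightarrow> \<phi> (v j) - (\<Sum>i<r. of_int (A i j) * v i) \<in> M"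
    and t: "[t = (\<Sum>i<r. A i i)] (mod int p)" using t unfolding ptrace_def by blast
  obtain s w Y where w: "pbasis p M N s w" and Y: "\<And>j. j < s \<Longrightarrow> \<phi> (w j) - (\<Sum>i<s. of_int (Y i j) * w i) \<in> N"
    and u: "[u = (\<Sum>i<s. Y i i)] (mod int p)" using u unfolding ptrace_def by blast
  have "\<forall>j\<in>{..<r}. \<exists>c. \<phi> (v j) - (\<Sum>i<r. of_int (A i j) * v i) - lincomb s c w \<in> N"
    using A pbasisD(2)[OF w] by blast
  then obtain Z where Z: "\<And>j. j < r \<Longrightarrow> \<phi> (v j) - (\<Sum>i<r. of_int (A i j) * v i) - lincomb s (Z j) w \<in> N"
    by (metis lessThan_iff)
  \<comment> \<open>A block triangular matrix: the diagonal blocks are A and Y, and Z records the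
    part of the images of the \<open>v j\<close> that falls into M.\<close>
  define B where "B i j = (if j < r then cat_seq r (\<lambda>i. A i j) (Z j) i else cat_seq r (\<lambda>_. 0) (\<lambda>i. Y i (j - r)) i)" for i j
  have "\<phi> (cat_seq r v w j) - (\<Sum>i<r + s. of_int (B i j) * cat_seq r v w i) \<in> N" if "j < r + s" for j
  proof (cases "j < r")
    case True
    then show ?thesis using Z[OF True] by (simp add: sum_cat_seq B_def diff_diff_eq)
  next
    case False
    then have "j = r + (j - r)" "j - r < s" using that by auto
    then obtain k where "j = r + k" "k < s" by blast
    then show ?thesis using Y[of k] by (simp add: sum_cat_seq B_def)
  qed
  moreover
  have "(\<Sum>i<r + s. B i i) = (\<Sum>i<r. A i i) + (\<Sum>i<s. Y i i)"
    by (simp add: sum_lessThan_add_split B_def)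
  then have "[t + u = (\<Sum>i<r + s. B i i)] (mod int p)" using cong_add[OF t u] by simp
  ultimately show ?thesis
    unfolding ptrace_def using pbasis_cat[OF sg sub pL v w] by blast
qed


lemma pbasis_self: "is_subgroup L \<Longrightarrow> pbasis p L L 0 v"
  unfolding pbasis_def by (auto intro: is_subgroup_closed)

lemma pbasis_nontrivial_pos:
  assumes "pbasis p L M r v" "x \<in> L" "x \<notin> M"
  shows "r > 0"
  using pbasisD(2)[OF assms(1,2)] assms(3) by (cases r) auto

lemma ptrace_zeroI:
  assumes "pbasis p L M r v" "\<And>x. x \<in> L \<Longrightarrow> \<phi> x \<in> M"
  shows "ptrace p L M \<phi> 0"
  unfolding ptrace_def using assms pbasisD(1)[OF assms(1)]
  by (intro exI[of _ r] exI[of _ v] exI[of _ "\<lambda>_ _. 0"]) auto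

lemma ptrace_identityI:
  assumes "pbasis p L M r v" "\<And>x. x \<in> L \<Longrightarrow> \<phi> x - x \<in> M"
  shows "ptrace p L M \<phi> (int r)"
proof -
  have "\<phi> (v j) - (\<Sum>i<r. of_int (if i = j then 1 else 0) * v i) \<in> M" if "j < r" for j
  proof -
    have "(\<Sum>i<r. of_int (if i = j then 1 else 0) * v i) = (\<Sum>i<r. if i = j then v i else 0)"
      by (intro sum.cong) auto
    then show ?thesis using that assms(2) pbasisD(1)[OF assms(1)] by simp
  qed
  then show ?thesis unfolding ptrace_def using assms(1)
    by (intro exI[of _ r] exI[of _ v] exI[of _ "\<lambda>i j. if i = j then 1 else 0"]) auto
qed

lemma sum_combination_diff:
  "lincomb r c v - lincomb r d v = (\<Sum>i<r. of_int (c i - d i) * v i :: 'v::comm_ring_1)"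
  by (simp add: sum_subtractf left_diff_distrib)

lemma pbasis_spanning_reduced:
  assumes p: "p > 0" and sg: "is_subgroup M" and pL: "\<And>x. x \<in> L \<Longrightarrow> of_nat p * x \<in> M"
    and v: "\<And>i. i < r \<Longrightarrow> v i \<in> L" and x: "x - lincomb r c v \<in> M"
  shows "\<exists>d \<in> {..<r} \<rightarrow>\<^sub>E {0..<int p}. x - lincomb r d v \<in> M"
proof -
  define d where "d i = (if i < r then c i mod int p else undefined)" for i
  have "lincomb r c v - lincomb r d v \<in> M"
    unfolding sum_combination_diff
    by (rule pmult_combination_mem[OF sg, where L = L and p = p]) (use v pL in \<open>auto simp: d_def minus_mod_eq_mult_div\<close>)
  then have "x - lincomb r d v \<in> M"
    using is_subgroup_add[OF sg x, of "lincomb r c v - lincomb r d v"] by simp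
  then show ?thesis using p by (intro bexI[of _ d]) (auto simp: d_def)
qed

lemma inj_on_independent_cosets:
  assumes sg: "is_subgroup L" "is_subgroup M"
    and v: "\<And>i. i < r \<Longrightarrow> v i \<in> L" and ind: "\<And>c. (lincomb r c v) \<in> M \<Longrightarrow> (\<forall>i<r. int p dvd c i)"
  shows "inj_on (\<lambda>c. {y \<in> L. y - lincomb r c v \<in> M}) ({..<r} \<rightarrow>\<^sub>E {0..<int p})"
proof (rule inj_onI)
  fix c d assume cd: "c \<in> {..<r} \<rightarrow>\<^sub>E {0..<int p}" "d \<in> {..<r} \<rightarrow>\<^sub>E {0..<int p}"
    and eq: "{y \<in> L. y - lincomb r c v \<in> M} = {y \<in> L. y - lincomb r d v \<in> M}"
  have inL: "lincomb r c v \<in> L" for c using v sg by (auto intro: is_subgroup_closed)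
  have "(\<Sum>i<r. of_int (c i - d i) * v i) \<in> M"
    using eq unfolding coset_eq_iff[OF sg(2) inL inL] sum_combination_diff .
  then have "\<forall>i<r. int p dvd c i - d i" by (rule ind)
  then have "c i = d i" if "i < r" for i
    using that cd PiE_mem[OF cd(1), of i] PiE_mem[OF cd(2), of i]
    by (metis atLeastLessThan_iff lessThan_iff mod_eq_dvd_iff mod_pos_pos_trivial)
  then show "c = d" using cd by (intro PiE_ext) auto
qed

lemma card_cosets_mod:
  assumes p: "p > 0" and sg: "is_subgroup L" "is_subgroup M" and pL: "\<And>x. x \<in> L \<Longrightarrow> of_nat p * x \<in> M"
    and v: "pbasis p L M r v"
  shows "finite (cosets_mod L M)" "card (cosets_mod L M) = p ^ r"
proof -
  let ?f = "\<lambda>c. {y \<in> L. y - lincomb r c v \<in> M}"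
  let ?C = "{..<r} \<rightarrow>\<^sub>E {0..<int p}"
  have inL: "lincomb r c v \<in> L" for c using pbasisD(1)[OF v] sg by (auto intro: is_subgroup_closed)
  have "?f ` ?C = cosets_mod L M"
  proof (intro equalityI subsetI)
    fix C assume "C \<in> ?f ` ?C" then show "C \<in> cosets_mod L M" unfolding cosets_mod_def using inL by auto
  next
    fix C assume "C \<in> cosets_mod L M"
    then obtain x where x: "x \<in> L" "C = {y \<in> L. y - x \<in> M}" unfolding cosets_mod_def by auto
    obtain c where "x - lincomb r c v \<in> M" using pbasisD(2)[OF v x(1)] by blast
    then obtain d where d: "d \<in> ?C" "x - lincomb r d v \<in> M"
      using pbasis_spanning_reduced[OF p sg(2) pL] pbasisD(1)[OF v] by blast
    then show "C \<in> ?f ` ?C" using coset_eq_iff[OF sg(2) x(1) inL] x by blast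
  qed
  moreover have "inj_on ?f ?C"
    by (rule inj_on_independent_cosets[OF sg]) (use v in \<open>auto simp: pbasis_def\<close>)
  moreover have "card ?C = p ^ r" by (simp add: card_PiE)
  moreover have "finite ?C" by (intro finite_PiE) auto
  ultimately show "finite (cosets_mod L M)" "card (cosets_mod L M) = p ^ r"
    using card_image[of ?f ?C] finite_imageI[of ?C ?f] by simp_all
qed

text \<open>Counting replaces an exchange argument: the two bases give the order of L/M as p^r and
  as p^s.\<close>

lemma pbasis_unique_dim:
  assumes p: "p > 1" and sg: "is_subgroup L" "is_subgroup M" and pL: "\<And>x. x \<in> L \<Longrightarrow> of_nat p * x \<in> M"
    and v: "pbasis p L M r v" and w: "pbasis p L M s w"
  shows "r = s"
proof -
  have "p > 0" using p by simp
  then have "p ^ r = p ^ s"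
    using card_cosets_mod(2)[OF _ sg pL v] card_cosets_mod(2)[OF _ sg pL w] by simp
  then show ?thesis using power_inject_exp[OF p] by blast
qed

text \<open>An independent family of length r has p^r incongruent combinations, so r is bounded by
  the number of cosets and a longest independent family exists. Adding any further x to it creates a
  relation.\<close>

lemma pbasis_exists:
  assumes p: "Factorial_Ring.prime p" and sg: "is_subgroup L" "is_subgroup M"
    and pL: "\<And>x. x \<in> L \<Longrightarrow> of_nat p * x \<in> M" and fin: "finite (cosets_mod L M)"
  shows "\<exists>r v. pbasis p L M r v"
proof -
  define ind where "ind r v \<longleftrightarrow> (\<forall>i<r. v i \<in> L) \<and> (\<forall>c. (lincomb r c v) \<in> M \<longrightarrow> (\<forall>i<r. int p dvd c i))" for r :: nat and v
  have p1: "p > 1" using p prime_gt_1_nat by blast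
  have bound: "r \<le> card (cosets_mod L M)" if "ind r v" for r v
  proof -
    have inL: "lincomb r c v \<in> L" for c using that sg unfolding ind_def by (auto intro: is_subgroup_closed)
    have "(\<lambda>c. {y \<in> L. y - lincomb r c v \<in> M}) ` ({..<r} \<rightarrow>\<^sub>E {0..<int p}) \<subseteq> cosets_mod L M"
      unfolding cosets_mod_def using inL by auto
    moreover have "inj_on (\<lambda>c. {y \<in> L. y - lincomb r c v \<in> M}) ({..<r} \<rightarrow>\<^sub>E {0..<int p})"
      by (rule inj_on_independent_cosets[OF sg]) (use that in \<open>auto simp: ind_def\<close>)
    ultimately have "card ({..<r} \<rightarrow>\<^sub>E {0..<int p}) \<le> card (cosets_mod L M)" using fin card_inj_on_le by blast
    then have "p ^ r \<le> card (cosets_mod L M)" by (simp add: card_PiE)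
    moreover have "r < p ^ r" using power_gt_expt[of p r] p1 by simp
    ultimately show ?thesis by simp
  qed
  have "\<exists>v. ind 0 v" unfolding ind_def by auto
  then obtain r where r: "\<exists>v. ind r v" "\<And>s. \<exists>v. ind s v \<Longrightarrow> s \<le> r"
    using GreatestI_ex_nat[of "\<lambda>r. \<exists>v. ind r v"] Greatest_le_nat[of "\<lambda>r. \<exists>v. ind r v"] bound by blast
  then obtain v where v: "ind r v" by blast
  have "\<exists>c. x - lincomb r c v \<in> M" if x: "x \<in> L" for x
  proof -
    have "\<not> ind (Suc r) (cat_seq r v (\<lambda>_. x))" using r(2)[of "Suc r"] by auto
    moreover have "\<forall>i<Suc r. cat_seq r v (\<lambda>_. x) i \<in> L" using v x unfolding ind_def cat_seq_def by auto
    ultimately obtain c i where c: "(\<Sum>i<Suc r. of_int (c i) * cat_seq r v (\<lambda>_. x) i) \<in> M" "i < Suc r" "\<not> int p dvd c i"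
      unfolding ind_def by blast
    let ?s = "\<Sum>i<r. of_int (c i) * v i"
    have s: "?s + of_int (c r) * x \<in> M" using c(1) by (simp add: cat_seq_def)
    have ncr: "\<not> int p dvd c r"
    proof
      assume "int p dvd c r"
      then obtain k where "c r = int p * k" by auto
      then have "of_int (c r) * x = of_int k * (of_nat p * x)" by (simp add: ac_simps)
      then have "of_int (c r) * x \<in> M" using pL[OF x] is_subgroup_of_int[OF sg(2)] by metis
      then have "?s \<in> M" using is_subgroup_diff[OF sg(2) s] by fastforce
      then have "\<forall>i<r. int p dvd c i" using v unfolding ind_def by blast
      then show False using c \<open>int p dvd c r\<close> less_Suc_eq by metis
    qed
    \<comment> \<open>The coefficient of x is a unit modulo p, for otherwise its term lies in M and
      a relation among the \<open>v i\<close> remains. Multiplying by its inverse u solves the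
      relation for x.\<close>
    have "coprime (c r) (int p)"
      using ncr p by (metis coprime_commute prime_imp_coprime prime_nat_int_transfer)
    then obtain u where u: "[c r * u = 1] (mod int p)" using cong_solve_coprime_int by blast
    then obtain k where k: "c r * u = 1 + int p * k"
      by (metis cong_iff_lin cong_sym)
    have eq1: "(\<Sum>i<r. of_int (- u * c i) * v i) = - (of_int u * ?s)"
      by (simp add: sum_distrib_left sum_negf mult.assoc)
    have "of_int (c r * u) * x = x + of_int k * (of_nat p * x)"
      unfolding k by (simp add: algebra_simps)
    then have "x - (\<Sum>i<r. of_int (- u * c i) * v i)
        = of_int u * (?s + of_int (c r) * x) - of_int k * (of_nat p * x)"
      unfolding eq1 by (simp add: algebra_simps)
    then have "x - (\<Sum>i<r. of_int (- u * c i) * v i) \<in> M"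
      using s pL[OF x] is_subgroup_closed(2,6)[OF sg(2)] by metis
    then show ?thesis by (rule exI[of _ "\<lambda>i. - u * c i"])
  qed
  then have "pbasis p L M r v" using v unfolding pbasis_def ind_def by blast
  then show ?thesis by blast
qed

section \<open>Additive maps and the independence of traces from the basis\<close>

definition additive_map :: "('v::comm_ring_1 \<Rightarrow> 'w::comm_ring_1) \<Rightarrow> bool" where
  "additive_map \<phi> \<longleftrightarrow> (\<forall>x y. \<phi> (x + y) = \<phi> x + \<phi> y)"

lemma additive_map_add: "additive_map \<phi> \<Longrightarrow> \<phi> (x + y) = \<phi> x + \<phi> y"
  unfolding additive_map_def by blast

lemma additive_map_zero: "additive_map \<phi> \<Longrightarrow> \<phi> 0 = 0"
  using additive_map_add[of \<phi> 0 0] by simp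

lemma additive_map_uminus: "additive_map \<phi> \<Longrightarrow> \<phi> (- x) = - \<phi> x"
  using additive_map_add[of \<phi> x "- x"] additive_map_zero[of \<phi>] by (simp add: minus_unique)

lemma additive_map_diff: "additive_map \<phi> \<Longrightarrow> \<phi> (x - y) = \<phi> x - \<phi> y"
  using additive_map_add[of \<phi> x "- y"] additive_map_uminus[of \<phi> y] by simp

lemma additive_map_of_nat: "additive_map \<phi> \<Longrightarrow> \<phi> (of_nat k * x) = of_nat k * \<phi> x"
  by (induction k) (auto simp: algebra_simps additive_map_add additive_map_zero)

lemma additive_map_of_int: "additive_map \<phi> \<Longrightarrow> \<phi> (of_int k * x) = of_int k * \<phi> x"
  by (cases k) (auto simp: additive_map_of_nat additive_map_uminus simp del: of_nat_Suc)

lemma additive_map_sum: "additive_map \<phi> \<Longrightarrow> \<phi> (sum f I) = (\<Sum>i\<in>I. \<phi> (f i))"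
  by (induction I rule: infinite_finite_induct) (auto simp: additive_map_add additive_map_zero)

lemma additive_map_combination:
  "additive_map \<phi> \<Longrightarrow> \<phi> (\<Sum>i\<in>I. of_int (c i) * v i) = (\<Sum>i\<in>I. of_int (c i) * \<phi> (v i))"
  by (simp add: additive_map_sum additive_map_of_int)

lemma sum_combination_swap:
  "(\<Sum>i\<in>I. of_int (c i) * (\<Sum>j\<in>J. of_int (B j i) * w j))
     = (\<Sum>j\<in>J. of_int (\<Sum>i\<in>I. B j i * c i) * (w j :: 'v::comm_ring_1))"
proof -
  have "(\<Sum>i\<in>I. of_int (c i) * (\<Sum>j\<in>J. of_int (B j i) * w j)) = (\<Sum>i\<in>I. \<Sum>j\<in>J. of_int (B j i * c i) * w j)"
    by (simp add: sum_distrib_left ac_simps)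
  also have "\<dots> = (\<Sum>j\<in>J. \<Sum>i\<in>I. of_int (B j i * c i) * w j)" by (rule sum.swap)
  finally show ?thesis by (simp only: of_int_sum sum_distrib_right)
qed

lemma sum_combination_cong_mod:
  assumes sg: "is_subgroup M" and w: "\<And>i. i \<in> I \<Longrightarrow> v i - w i \<in> M"
  shows "(\<Sum>i\<in>I. of_int (c i) * v i) - (\<Sum>i\<in>I. of_int (c i) * w i) \<in> M"
proof -
  have "(\<Sum>i\<in>I. of_int (c i) * v i) - (\<Sum>i\<in>I. of_int (c i) * w i) = (\<Sum>i\<in>I. of_int (c i) * (v i - w i))"
    by (simp add: sum_subtractf right_diff_distrib)
  moreover have "\<dots> \<in> M" by (intro is_subgroup_sum[OF sg] is_subgroup_of_int[OF sg] w)
  ultimately show ?thesis by simp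
qed

lemma pbasis_coeff_cong:
  assumes v: "pbasis p L M r v" and sg: "is_subgroup M"
    and x: "x - lincomb r c v \<in> M" and y: "y - lincomb r d v \<in> M"
    and xy: "x - y \<in> M" and i: "i < r"
  shows "[c i = d i] (mod int p)"
proof -
  have "(\<Sum>i<r. of_int (c i - d i) * v i)
      = (x - y) - (x - lincomb r c v) + (y - lincomb r d v)"
    unfolding sum_combination_diff[symmetric] by simp
  moreover have "\<dots> \<in> M" by (intro is_subgroup_add[OF sg] is_subgroup_diff[OF sg] x y xy)
  ultimately have "(\<Sum>i<r. of_int (c i - d i) * v i) \<in> M" by simp
  then have "int p dvd c i - d i" using pbasisD(3)[OF v _ i, of "\<lambda>i. c i - d i"] by blast
  then show ?thesis by (simp add: cong_iff_dvd_diff)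
qed

lemma cong_mult_delta_sum:
  fixes a :: "nat \<Rightarrow> int"
  assumes "\<And>i. i < r \<Longrightarrow> [d i = (if i = k then 1 else 0)] (mod m)" "k < r"
  shows "[(\<Sum>i<r. d i * a i) = a k] (mod m)"
proof -
  have "[(\<Sum>i<r. d i * a i) = (\<Sum>i<r. (if i = k then 1 else 0) * a i)] (mod m)"
    using assms(1) by (intro cong_sum cong_mult) auto
  then show ?thesis using assms(2) by (simp add: if_distrib if_distribR cong: if_cong)
qed

text \<open>With \<open>C B = 1\<close>, \<open>B C = 1\<close> and \<open>N B = B A\<close> one has \<open>tr A = tr (C B A) = tr (C N B) = tr (N B C) = tr N\<close>.\<close>

lemma trace_conjugate_cong:
  fixes A B C N :: "nat \<Rightarrow> nat \<Rightarrow> int"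
  assumes CB: "\<And>i j. i < r \<Longrightarrow> j < r \<Longrightarrow> [(\<Sum>k<s. C i k * B k j) = (if i = j then 1 else 0)] (mod m)"
    and BC: "\<And>i j. i < s \<Longrightarrow> j < s \<Longrightarrow> [(\<Sum>k<r. B i k * C k j) = (if i = j then 1 else 0)] (mod m)"
    and NB: "\<And>i j. i < s \<Longrightarrow> j < r \<Longrightarrow> [(\<Sum>k<s. N i k * B k j) = (\<Sum>k<r. B i k * A k j)] (mod m)"
  shows "[(\<Sum>i<r. A i i) = (\<Sum>i<s. N i i)] (mod m)"
proof -
  have s1: "[(\<Sum>j<r. \<Sum>i<r. (\<Sum>k<s. C i k * B k j) * A j i) = (\<Sum>j<r. A j j)] (mod m)"
    using CB by (intro cong_sum cong_mult_delta_sum) auto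
  have e1: "(\<Sum>j<r. \<Sum>i<r. (\<Sum>k<s. C i k * B k j) * A j i) = (\<Sum>i<r. \<Sum>k<s. C i k * (\<Sum>j<r. B k j * A j i))"
  proof -
    have "(\<Sum>j<r. \<Sum>i<r. (\<Sum>k<s. C i k * B k j) * A j i) = (\<Sum>j<r. \<Sum>i<r. \<Sum>k<s. C i k * (B k j * A j i))"
      by (simp add: sum_distrib_right mult.assoc)
    also have "\<dots> = (\<Sum>i<r. \<Sum>j<r. \<Sum>k<s. C i k * (B k j * A j i))" by (rule sum.swap)
    also have "\<dots> = (\<Sum>i<r. \<Sum>k<s. \<Sum>j<r. C i k * (B k j * A j i))"
      by (intro sum.cong refl sum.swap)
    finally show ?thesis by (simp add: sum_distrib_left)
  qed
  have s2: "[(\<Sum>i<r. \<Sum>k<s. C i k * (\<Sum>j<r. B k j * A j i)) = (\<Sum>i<r. \<Sum>k<s. C i k * (\<Sum>l<s. N k l * B l i))] (mod m)"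
    using NB by (intro cong_sum cong_mult cong_refl) (auto simp: cong_sym_eq)
  have e2: "(\<Sum>i<r. \<Sum>k<s. C i k * (\<Sum>l<s. N k l * B l i)) = (\<Sum>k<s. \<Sum>l<s. (\<Sum>i<r. B l i * C i k) * N k l)"
  proof -
    have "(\<Sum>i<r. \<Sum>k<s. C i k * (\<Sum>l<s. N k l * B l i)) = (\<Sum>i<r. \<Sum>k<s. \<Sum>l<s. B l i * C i k * N k l)"
      by (simp add: sum_distrib_left ac_simps)
    also have "\<dots> = (\<Sum>k<s. \<Sum>i<r. \<Sum>l<s. B l i * C i k * N k l)" by (rule sum.swap)
    also have "\<dots> = (\<Sum>k<s. \<Sum>l<s. \<Sum>i<r. B l i * C i k * N k l)"
      by (intro sum.cong refl sum.swap)
    finally show ?thesis by (simp add: sum_distrib_right)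
  qed
  have s3: "[(\<Sum>k<s. \<Sum>l<s. (\<Sum>i<r. B l i * C i k) * N k l) = (\<Sum>k<s. N k k)] (mod m)"
    using BC by (intro cong_sum cong_mult_delta_sum) auto
  show ?thesis
    by (rule cong_trans[OF cong_trans[OF cong_sym[OF s1[unfolded e1]] s2] s3[folded e2]])
qed

text \<open>B expresses \<open>v\<close> through \<open>w\<close>, and C expresses \<open>w\<close>
  through \<open>v\<close>. Comparing coefficients modulo p shows that they are inverse to each
  other and, after the map is applied to the expansion of \<open>v j\<close>, that B intertwines the
  two matrices. Invariance of M keeps the error terms in M.\<close>

lemma ptrace_unique:
  assumes sg: "is_subgroup M" and \<phi>: "additive_map \<phi>" and \<phi>M: "\<And>x. x \<in> M \<Longrightarrow> \<phi> x \<in> M"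
    and t: "ptrace p L M \<phi> t" and u: "ptrace p L M \<phi> u"
  shows "[t = u] (mod int p)"
proof -
  obtain r v A where v: "pbasis p L M r v" and A: "\<And>j. j < r \<Longrightarrow> \<phi> (v j) - (\<Sum>i<r. of_int (A i j) * v i) \<in> M"
    and t: "[t = (\<Sum>i<r. A i i)] (mod int p)" using t unfolding ptrace_def by blast
  obtain s w N where w: "pbasis p L M s w" and N: "\<And>j. j < s \<Longrightarrow> \<phi> (w j) - (\<Sum>i<s. of_int (N i j) * w i) \<in> M"
    and u: "[u = (\<Sum>i<s. N i i)] (mod int p)" using u unfolding ptrace_def by blast
  have "\<forall>j\<in>{..<r}. \<exists>c. v j - lincomb s c w \<in> M" using pbasisD(2)[OF w] pbasisD(1)[OF v] by blast
  then obtain B' where "\<And>j. j < r \<Longrightarrow> v j - lincomb s (B' j) w \<in> M" by (metis lessThan_iff)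
  then obtain B where B: "\<And>j. j < r \<Longrightarrow> v j - (\<Sum>i<s. of_int (B i j) * w i) \<in> M"
    by (meson that[of "\<lambda>i j. B' j i"])
  have "\<forall>j\<in>{..<s}. \<exists>c. w j - lincomb r c v \<in> M" using pbasisD(2)[OF v] pbasisD(1)[OF w] by blast
  then obtain C' where "\<And>j. j < s \<Longrightarrow> w j - lincomb r (C' j) v \<in> M" by (metis lessThan_iff)
  then obtain C where C: "\<And>j. j < s \<Longrightarrow> w j - (\<Sum>i<r. of_int (C i j) * v i) \<in> M"
    by (meson that[of "\<lambda>i j. C' j i"])
  have comb: "x - (\<Sum>i<b. of_int (\<Sum>k<a. F i k * c k) * z i) \<in> M"
    if "x - lincomb a c y \<in> M" "\<And>k. k < a \<Longrightarrow> y k - (\<Sum>i<b. of_int (F i k) * z i) \<in> M"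
    for x :: 'a and a b :: nat and c y z F
  proof -
    have "lincomb a c y - (\<Sum>k<a. of_int (c k) * (\<Sum>i<b. of_int (F i k) * z i)) \<in> M"
      using that(2) by (intro sum_combination_cong_mod[OF sg]) auto
    from is_subgroup_add[OF sg that(1) this] show ?thesis by (simp add: sum_combination_swap)
  qed
  have single: "z j - (\<Sum>i<a. of_int (if i = j then 1 else 0) * z i) \<in> M" if "j < a" for z :: "nat \<Rightarrow> 'a" and j a
  proof -
    have "(\<Sum>i<a. of_int (if i = j then 1 else 0) * z i) = (\<Sum>i<a. if i = j then z i else 0)"
      by (intro sum.cong) auto
    then show ?thesis using that is_subgroup_zero[OF sg] by simp
  qed
  have zero: "x - x \<in> M" for x using is_subgroup_zero[OF sg] by simp
  have CB: "[(\<Sum>k<s. C i k * B k j) = (if i = j then 1 else 0)] (mod int p)" if "i < r" "j < r" for i j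
    by (rule pbasis_coeff_cong[OF v sg comb[OF B[OF that(2)] C] single[OF that(2)] zero that(1)])
  have BC: "[(\<Sum>k<r. B i k * C k j) = (if i = j then 1 else 0)] (mod int p)" if "i < s" "j < s" for i j
    by (rule pbasis_coeff_cong[OF w sg comb[OF C[OF that(2)] B] single[OF that(2)] zero that(1)])
  have NB: "[(\<Sum>k<s. N i k * B k j) = (\<Sum>k<r. B i k * A k j)] (mod int p)" if "i < s" "j < r" for i j
  proof -
    have "\<phi> (v j - (\<Sum>i<s. of_int (B i j) * w i)) \<in> M" by (rule \<phi>M[OF B[OF that(2)]])
    then have 1: "\<phi> (v j) - (\<Sum>i<s. of_int (B i j) * \<phi> (w i)) \<in> M"
      by (simp add: additive_map_diff[OF \<phi>] additive_map_combination[OF \<phi>])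
    show ?thesis
      by (rule pbasis_coeff_cong[OF w sg comb[OF 1 N] comb[OF A[OF that(2)] B] zero that(1)])
  qed
  show ?thesis using t u trace_conjugate_cong[OF CB BC NB] by (metis cong_trans cong_sym)
qed

section \<open>Lattices in rational vector spaces\<close>

text \<open>
  Vectors are functions \<open>nat \<Rightarrow> rat\<close> with the pointwise ring structure; scalar multiplication is
  multiplication by a constant function \<open>cst q\<close>, and \<open>of_int k\<close> is the constant function \<open>k\<close>.
\<close>

type_synonym qvec = "nat \<Rightarrow> rat"

definition cst :: "rat \<Rightarrow> qvec" where "cst q = (\<lambda>_. q)"

lemma cst_apply [simp]: "cst q i = q" by (simp add: cst_def)

lemma of_int_fun_apply [simp]: "(of_int k :: qvec) i = of_int k"
  by (cases k) (simp_all add: fun_Compl_def flip: of_nat_Suc)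

lemma sum_fun_apply [simp]: "(sum f I :: qvec) i = (\<Sum>j\<in>I. f j i)"
  by (induction I rule: infinite_finite_induct) auto

lemma cst_simps: "cst (of_int k) = of_int k" "cst (of_nat m) = of_nat m" "cst 0 = 0" "cst 1 = 1"
  "cst (a + b) = cst a + cst b" "cst (a - b) = cst a - cst b" "cst (a * b) = cst a * cst b" "cst (- a) = - cst a"
  by (auto simp: cst_def)

lemma cst_sum: "cst (sum f I) = (\<Sum>i\<in>I. cst (f i))"
  by (auto simp: fun_eq_iff)

lemma qvec_of_int_mult_cancel: "k \<noteq> 0 \<Longrightarrow> of_int k * x = of_int k * (y :: qvec) \<longleftrightarrow> x = y"
  by (auto simp: fun_eq_iff)

lemma qvec_of_nat_mult_cancel: "k \<noteq> 0 \<Longrightarrow> of_nat k * x = of_nat k * (y :: qvec) \<longleftrightarrow> x = y"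
  by (auto simp: fun_eq_iff)

lemma of_nat_mult_cst: "k \<noteq> 0 \<Longrightarrow> of_nat k * (cst (1 / of_nat k) * x) = x" "k \<noteq> 0 \<Longrightarrow> cst (1 / of_nat k) * (of_nat k * x) = x"
  by (auto simp: fun_eq_iff)

lemma rat_fraction: "\<exists>a b :: int. (q :: rat) = of_int a / of_int b \<and> b > 0"
  by (cases q) (auto simp: Fract_of_int_quotient)

text \<open>Additive maps are linear over Q because the denominator b of q can be cleared and
  cancelled again.\<close>

lemma additive_map_cst:
  assumes "additive_map (\<phi> :: qvec \<Rightarrow> qvec)" shows "\<phi> (cst q * x) = cst q * \<phi> x"
proof -
  obtain a b :: int where ab: "q = of_int a / of_int b" "b > 0" using rat_fraction by blast
  have eq: "of_int b * (cst q * y) = of_int a * y" for y using ab by (auto simp: fun_eq_iff)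
  have "of_int b * \<phi> (cst q * x) = of_int b * (cst q * \<phi> x)"
    unfolding additive_map_of_int[OF assms, symmetric] eq by (simp only: additive_map_of_int[OF assms])
  then show ?thesis using ab(2) qvec_of_int_mult_cancel[of b] by blast
qed

definition qspace :: "nat \<Rightarrow> qvec set" where
  "qspace n = {v. \<forall>i\<ge>n. v i = 0}"

definition intvecs :: "nat \<Rightarrow> qvec set" where
  "intvecs n = {v \<in> qspace n. \<forall>i. v i \<in> \<int>}"

definition evec :: "nat \<Rightarrow> qvec" where
  "evec i = (\<lambda>j. if j = i then 1 else 0)"

lemma is_subgroup_qspace: "is_subgroup (qspace n)"
  unfolding is_subgroup_def qspace_def by auto

lemma qspace_cst: "v \<in> qspace n \<Longrightarrow> cst q * v \<in> qspace n"
  unfolding qspace_def by auto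

lemma is_subgroup_intvecs: "is_subgroup (intvecs n)"
  using is_subgroup_qspace[of n] unfolding is_subgroup_def intvecs_def by auto

lemma intvecs_subset_qspace: "intvecs n \<subseteq> qspace n"
  unfolding intvecs_def by auto

lemma evec_mem: "i < n \<Longrightarrow> evec i \<in> intvecs n"
  unfolding evec_def intvecs_def qspace_def by auto

lemma evec_qspace: "i < n \<Longrightarrow> evec i \<in> qspace n"
  using evec_mem intvecs_subset_qspace by blast

lemma qspace_expansion: "v \<in> qspace n \<Longrightarrow> v = (\<Sum>i<n. cst (v i) * evec i)"
  unfolding qspace_def evec_def
proof (rule ext)
  fix j assume v: "v \<in> {v. \<forall>i\<ge>n. v i = 0}"
  have "(\<Sum>i<n. v i * (if j = i then 1 else 0)) = (\<Sum>i<n. if j = i then v i else 0)"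
    by (intro sum.cong) auto
  then show "v j = (\<Sum>i<n. cst (v i) * (\<lambda>j. if j = i then 1 else 0)) j"
    using v by (auto simp: not_less)
qed

lemma intvecs_expansion: "v \<in> intvecs n \<Longrightarrow> v = (\<Sum>i<n. of_int \<lfloor>v i\<rfloor> * evec i)"
proof -
  assume v: "v \<in> intvecs n"
  then have "v i = of_int \<lfloor>v i\<rfloor>" for i unfolding intvecs_def by (auto simp: of_int_floor)
  then have "cst (v i) = of_int \<lfloor>v i\<rfloor>" for i by (simp add: cst_def fun_eq_iff)
  then show ?thesis using qspace_expansion[of v n] v unfolding intvecs_def by simp
qed

lemma qspace_common_denominator:
  assumes "v \<in> qspace n" shows "\<exists>N>0. of_nat N * v \<in> intvecs n"
proof -
  have "\<exists>d>0. of_nat d * v i \<in> \<int>" for i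
  proof -
    obtain a b :: int where ab: "v i = of_int a / of_int b" "b > 0" using rat_fraction by blast
    then have "of_nat (nat b) * v i = of_int a" by simp
    then show ?thesis using ab(2) by (intro exI[of _ "nat b"]) auto
  qed
  then obtain d where d: "\<And>i. d i > 0" "\<And>i. of_nat (d i) * v i \<in> \<int>" by metis
  have "of_nat (\<Prod>i<n. d i) * v i \<in> \<int>" for i
  proof (cases "i < n")
    case True
    then have "(\<Prod>i<n. d i) = (\<Prod>j\<in>{..<n} - {i}. d j) * d i" by (simp add: prod.remove[of "{..<n}" i])
    then have "of_nat (\<Prod>i<n. d i) * v i = of_nat (\<Prod>j\<in>{..<n} - {i}. d j) * (of_nat (d i) * v i)"
      by (simp only: of_nat_mult mult.assoc)
    then show ?thesis using d(2)[of i] by (metis Ints_mult Ints_of_nat)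
  next
    case False
    then show ?thesis using assms unfolding qspace_def by auto
  qed
  then show ?thesis using assms d(1) unfolding intvecs_def qspace_def
    by (intro exI[of _ "\<Prod>i<n. d i"]) (auto simp: prod_pos simp del: of_nat_prod)
qed

lemma left_inverse_right_inverse:
  fixes a b :: "nat \<Rightarrow> nat \<Rightarrow> 'f::field"
  assumes ab: "\<And>i j. i < n \<Longrightarrow> j < n \<Longrightarrow> (\<Sum>k<n. a i k * b k j) = (if i = j then 1 else 0)"
    and ij: "i < n" "j < n"
  shows "(\<Sum>k<n. b i k * a k j) = (if i = j then 1 else 0)"
proof -
  define A where "A = Matrix.mat n n (\<lambda>(i,j). a i j)"
  define B where "B = Matrix.mat n n (\<lambda>(i,j). b i j)"
  have carr: "A \<in> carrier_mat n n" "B \<in> carrier_mat n n" unfolding A_def B_def by auto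
  have "A * B = 1\<^sub>m n"
    using ab by (intro eq_matI) (auto simp: A_def B_def scalar_prod_def atLeast0LessThan)
  then have "B * A = 1\<^sub>m n" by (rule mat_mult_left_right_inverse[OF carr])
  then have "(B * A) $$ (i, j) = (1\<^sub>m n :: 'f mat) $$ (i, j)" by simp
  then show ?thesis using ij by (simp add: A_def B_def scalar_prod_def atLeast0LessThan)
qed

section \<open>Traces in rational bases\<close>

definition trace_on :: "nat \<Rightarrow> (qvec \<Rightarrow> qvec) \<Rightarrow> rat" where
  "trace_on n \<phi> = (\<Sum>i<n. \<phi> (evec i) i)"

text \<open>A basis presented together with its coordinate functionals \<open>m j\<close>: the
  second clause is spanning, the third is independence. The length r is kept apart from n because
  the trace in the statement is taken over bases of unspecified length.\<close>

definition qbasis :: "nat \<Rightarrow> nat \<Rightarrow> (nat \<Rightarrow> qvec) \<Rightarrow> (nat \<Rightarrow> nat \<Rightarrow> rat) \<Rightarrow> bool" where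
  "qbasis n r l m \<longleftrightarrow> (\<forall>i<r. l i \<in> qspace n) \<and> (\<forall>k<n. evec k = (\<Sum>j<r. cst (m j k) * l j)) \<and>
     (\<forall>i<r. \<forall>j<r. (\<Sum>k<n. m j k * l i k) = (if i = j then 1 else 0))"

text \<open>In the k-th diagonal entry expand \<open>evec k\<close> by the functionals. Summing over
  k first leaves the pairing of \<open>m j\<close> with \<open>l i\<close>, a Kronecker
  delta.\<close>

lemma trace_on_qbasis:
  assumes \<phi>: "additive_map \<phi>" and l: "qbasis n r l m"
    and A: "\<And>j. j < r \<Longrightarrow> \<phi> (l j) = (\<Sum>i<r. cst (A i j) * l i)"
  shows "trace_on n \<phi> = (\<Sum>i<r. A i i)"
proof -
  have "\<phi> (evec k) k = (\<Sum>j<r. \<Sum>i<r. m j k * (A i j * l i k))" if "k < n" for k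
  proof -
    have "evec k = (\<Sum>j<r. cst (m j k) * l j)" using l that unfolding qbasis_def by blast
    then have "\<phi> (evec k) = (\<Sum>j<r. cst (m j k) * \<phi> (l j))"
      by (simp add: additive_map_sum[OF \<phi>] additive_map_cst[OF \<phi>])
    then show ?thesis using A by (simp add: sum_distrib_left)
  qed
  then have "trace_on n \<phi> = (\<Sum>k<n. \<Sum>j<r. \<Sum>i<r. m j k * (A i j * l i k))" unfolding trace_on_def by simp
  also have "\<dots> = (\<Sum>j<r. \<Sum>k<n. \<Sum>i<r. m j k * (A i j * l i k))" by (rule sum.swap)
  also have "\<dots> = (\<Sum>j<r. \<Sum>i<r. \<Sum>k<n. m j k * (A i j * l i k))" by (intro sum.cong refl sum.swap)
  also have "\<dots> = (\<Sum>j<r. \<Sum>i<r. A i j * (\<Sum>k<n. m j k * l i k))" by (simp add: sum_distrib_left ac_simps)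
  also have "\<dots> = (\<Sum>j<r. \<Sum>i<r. if i = j then A i j else 0)"
    using l unfolding qbasis_def by (intro sum.cong refl) (auto simp del: cst_apply)
  finally show ?thesis by simp
qed

lemma qbasis_independent:
  assumes l: "qbasis n r l m" and eq: "(\<Sum>i<r. cst (c i) * l i) = (\<Sum>i<r. cst (d i) * l i)" and j: "j < r"
  shows "c j = d j"
proof -
  have "(\<Sum>k<n. m j k * (\<Sum>i<r. cst (c i) * l i) k) = c j" for c
  proof -
    have "(\<Sum>k<n. m j k * (\<Sum>i<r. cst (c i) * l i) k) = (\<Sum>k<n. \<Sum>i<r. m j k * (c i * l i k))"
      by (simp add: sum_distrib_left)
    also have "\<dots> = (\<Sum>i<r. \<Sum>k<n. m j k * (c i * l i k))" by (rule sum.swap)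
    also have "\<dots> = (\<Sum>i<r. c i * (\<Sum>k<n. m j k * l i k))" by (simp add: sum_distrib_left ac_simps)
    also have "\<dots> = (\<Sum>i<r. if i = j then c i else 0)"
      using l j unfolding qbasis_def by (intro sum.cong refl) auto
    finally show ?thesis using j by simp
  qed
  then show ?thesis using eq by metis
qed

section \<open>Integral bases of full lattices\<close>

definition zbasis :: "nat \<Rightarrow> qvec set \<Rightarrow> (nat \<Rightarrow> qvec) \<Rightarrow> bool" where
  "zbasis n L l \<longleftrightarrow> (\<exists>m. qbasis n n l m) \<and> (\<forall>i<n. l i \<in> L) \<and> (\<forall>x\<in>L. \<exists>c. x = lincomb n c l)"

lemma zbasis_evec: "zbasis n (intvecs n) evec"
  unfolding zbasis_def
proof (intro conjI)
  have "(\<Sum>j<n. cst (if j = k then 1 else 0) * evec j) = evec k" if "k < n" for k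
  proof -
    have "(\<Sum>j<n. cst (if j = k then 1 else 0) * evec j) = (\<Sum>j<n. if j = k then evec j else 0)"
      by (intro sum.cong refl) (auto simp: cst_simps)
    then show ?thesis using that by simp
  qed
  moreover have "(\<Sum>k<n. (if j = k then 1 else 0) * evec i k) = (if i = j then 1 else 0)" if "i < n" "j < n" for i j
  proof -
    have "(\<Sum>k<n. (if j = k then 1 else 0) * evec i k) = (\<Sum>k<n. if j = k then evec i k else 0)"
      by (intro sum.cong) auto
    then show ?thesis using that by (auto simp: evec_def)
  qed
  ultimately show "\<exists>m. qbasis n n evec m"
    unfolding qbasis_def using evec_qspace
    by (intro exI[of _ "\<lambda>j k. if j = k then 1 else 0"]) auto
  show "\<forall>x\<in>intvecs n. \<exists>c. x = lincomb n c evec"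
    using intvecs_expansion by (intro ballI exI)
qed (simp add: evec_mem)

text \<open>As for the Hermite normal form, generators are found one coordinate at a time.\<close>

lemma intvecs_subgroup_generators:
  assumes L: "is_subgroup L" "L \<subseteq> intvecs n"
  shows "\<exists>B. (\<forall>i<n. B i \<in> L) \<and> (\<forall>x\<in>L. \<exists>c. x = lincomb n c B)"
proof -
  have "\<exists>B. (\<forall>i<k. B i \<in> L) \<and> (\<forall>x\<in>L \<inter> qspace k. \<exists>c. x = lincomb k c B)" for k
  proof (induction k)
    case 0
    then show ?case unfolding qspace_def by (auto simp: fun_eq_iff)
  next
    case (Suc k)
    then obtain B where B: "\<And>i. i < k \<Longrightarrow> B i \<in> L" "\<And>x. x \<in> L \<inter> qspace k \<Longrightarrow> \<exists>c. x = lincomb k c B"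
      by blast
    \<comment> \<open>D collects the positive k-th coordinates of elements of L that vanish beyond
      k. If it is empty, 0 serves as new generator, which keeps the number of generators equal to
      the dimension; otherwise an element attaining the least member of D does, by division with
      remainder.\<close>
    define D where "D = {d::nat. d > 0 \<and> (\<exists>v\<in>L \<inter> qspace (Suc k). v k = of_nat d)}"
    have "\<exists>b\<in>L. \<forall>x\<in>L \<inter> qspace (Suc k). \<exists>q::int. x - of_int q * b \<in> L \<inter> qspace k"
    proof (cases "D = {}")
      case True
      have "x \<in> qspace k" if x: "x \<in> L \<inter> qspace (Suc k)" for x
      proof -
        have "x k \<in> \<int>" using x L(2) unfolding intvecs_def by auto
        then obtain z where z: "x k = of_int z" by (rule Ints_cases)
        have "z = 0"
        proof (rule ccontr)
          assume "z \<noteq> 0"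
          define y where "y = (if z > 0 then x else - x)"
          have "y \<in> L \<inter> qspace (Suc k)"
            using x is_subgroup_uminus[OF L(1)] unfolding y_def qspace_def by auto
          moreover have "y k = of_nat (nat \<bar>z\<bar>)" unfolding y_def using z by auto
          ultimately have "nat \<bar>z\<bar> \<in> D" unfolding D_def using \<open>z \<noteq> 0\<close> by auto
          then show False using True by blast
        qed
        then show ?thesis using x z unfolding qspace_def by (auto simp: le_Suc_eq Suc_le_eq) (metis le_neq_implies_less Suc_leI)
      qed
      then show ?thesis using is_subgroup_zero[OF L(1)] by (intro bexI[of _ 0]) auto
    next
      case False
      define d where "d = (LEAST d. d \<in> D)"
      have dD: "d \<in> D" using False unfolding d_def by (metis LeastI ex_in_conv)
      have dmin: "e \<in> D \<Longrightarrow> d \<le> e" for e unfolding d_def by (rule Least_le)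
      obtain b where b: "b \<in> L" "b \<in> qspace (Suc k)" "b k = of_nat d" "d > 0" using dD unfolding D_def by blast
      have "\<exists>q::int. x - of_int q * b \<in> L \<inter> qspace k" if x: "x \<in> L \<inter> qspace (Suc k)" for x
      proof -
        have "x k \<in> \<int>" using x L(2) unfolding intvecs_def by auto
        then obtain z where z: "x k = of_int z" by (rule Ints_cases)
        define q where "q = z div int d"
        define y where "y = x - of_int q * b"
        have yL: "y \<in> L" unfolding y_def using x b is_subgroup_closed(2,6)[OF L(1)] by blast
        have yk: "y \<in> qspace (Suc k)" using x b unfolding y_def qspace_def by auto
        have "y k = of_int (z mod int d)" unfolding y_def q_def using z b
          by (simp add: minus_div_mult_eq_mod[symmetric])
        then have ykk: "y k = of_nat (nat (z mod int d))" using b(4) by simp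
        have "nat (z mod int d) \<notin> D"
          using dmin[of "nat (z mod int d)"] b(4) pos_mod_bound[of "int d" z] by linarith
        moreover have "nat (z mod int d) \<in> D" if "0 < nat (z mod int d)"
          unfolding D_def using that yL yk ykk by (intro CollectI conjI bexI[of _ y] IntI)
        ultimately have "\<not> 0 < nat (z mod int d)" by blast
        then have "y k = 0" using ykk by simp
        then have "y \<in> qspace k" using yk unfolding qspace_def by (auto simp: le_Suc_eq Suc_le_eq) (metis le_neq_implies_less Suc_leI)
        then show ?thesis using yL unfolding y_def by blast
      qed
      then show ?thesis using b(1) by blast
    qed
    then obtain b where b: "b \<in> L" "\<And>x. x \<in> L \<inter> qspace (Suc k) \<Longrightarrow> \<exists>q::int. x - of_int q * b \<in> L \<inter> qspace k" by blast
    show ?case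
    proof (intro exI[of _ "B(k := b)"] conjI ballI allI impI)
      fix i assume "i < Suc k" then show "(B(k := b)) i \<in> L" using B b by auto
    next
      fix x assume "x \<in> L \<inter> qspace (Suc k)"
      then obtain q :: int where "x - of_int q * b \<in> L \<inter> qspace k" using b(2) by blast
      then obtain c where c: "x - of_int q * b = lincomb k c B" using B(2) by blast
      have "(\<Sum>i<Suc k. of_int ((c(k := q)) i) * (B(k := b)) i) = lincomb k c B + of_int q * b" by simp
      then show "\<exists>c. x = (\<Sum>i<Suc k. of_int (c i) * (B(k := b)) i)" using c by (metis diff_add_cancel)
    qed
  qed
  from this[of n] show ?thesis using L(2) intvecs_subset_qspace by blast
qed

text \<open>Scaled by D, the group L lies in Z^n and has n generators. Since L contains N Z^n, these
  span Q^n, and n spanning vectors are independent because a one-sided inverse of a square matrix is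
  two-sided.\<close>

lemma full_lattice_zbasis:
  assumes L: "is_subgroup L" and N: "N > 0" "\<And>x. x \<in> intvecs n \<Longrightarrow> of_nat N * x \<in> L"
    and D: "D > 0" "\<And>x. x \<in> L \<Longrightarrow> of_nat D * x \<in> intvecs n"
  shows "\<exists>l. zbasis n L l"
proof -
  define L' where "L' = (\<lambda>x. of_nat D * x) ` L"
  have "is_subgroup L'"
  proof (rule is_subgroupI)
    show "0 \<in> L'" unfolding L'_def using is_subgroup_zero[OF L] by (intro image_eqI[of _ _ 0]) auto
    fix x y assume "x \<in> L'" "y \<in> L'"
    then show "x - y \<in> L'" unfolding L'_def using is_subgroup_diff[OF L] by (auto simp flip: right_diff_distrib)
  qed
  moreover have "L' \<subseteq> intvecs n" unfolding L'_def using D by auto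
  ultimately obtain B where B: "\<And>i. i < n \<Longrightarrow> B i \<in> L'" "\<And>x. x \<in> L' \<Longrightarrow> \<exists>c. x = lincomb n c B"
    using intvecs_subgroup_generators by metis
  define l where "l i = cst (1 / of_nat D) * B i" for i
  have Bl: "B i = of_nat D * l i" for i unfolding l_def using D(1) by (simp add: of_nat_mult_cst)
  have lL: "l i \<in> L" if "i < n" for i
    using B(1)[OF that] D(1) unfolding L'_def l_def by (auto simp: of_nat_mult_cst)
  have span: "\<exists>c. x = lincomb n c l" if "x \<in> L" for x
  proof -
    have "of_nat D * x \<in> L'" unfolding L'_def using that by blast
    then obtain c where c: "of_nat D * x = lincomb n c B" using B(2) by blast
    have eq: "of_nat D * x = of_nat D * (lincomb n c l)"
      unfolding c Bl by (simp add: sum_distrib_left ac_simps)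
    have "D \<noteq> 0" using D(1) by simp
    then have "x = lincomb n c l" by (rule iffD1[OF qvec_of_nat_mult_cancel eq])
    then show ?thesis by blast
  qed
  have lq: "l i \<in> qspace n" if "i < n" for i
    using B(1)[OF that] \<open>L' \<subseteq> intvecs n\<close> intvecs_subset_qspace qspace_cst unfolding l_def by blast
  have "\<forall>k\<in>{..<n}. \<exists>c. of_nat N * evec k = lincomb n c l" using N(2) evec_mem span by blast
  then obtain C where C: "\<And>k. k < n \<Longrightarrow> of_nat N * evec k = lincomb n (C k) l" by (metis lessThan_iff)
  define m where "m j k = of_int (C k j) / (of_nat N :: rat)" for j k
  have m: "evec k = (\<Sum>j<n. cst (m j k) * l j)" if "k < n" for k
  proof -
    have "of_nat N * (\<Sum>j<n. cst (m j k) * l j) = (\<Sum>j<n. of_nat N * (cst (m j k) * l j))" by (rule sum_distrib_left)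
    also have "\<dots> = lincomb n (C k) l"
      using N(1) by (intro sum.cong refl) (auto simp: m_def fun_eq_iff)
    finally have eq: "of_nat N * evec k = of_nat N * (\<Sum>j<n. cst (m j k) * l j)"
      unfolding C[OF that] by (rule sym)
    have "N \<noteq> 0" using N(1) by simp
    then show ?thesis by (rule iffD1[OF qvec_of_nat_mult_cancel eq])
  qed
  have "(\<Sum>j<n. l j i * m j k) = (if i = k then 1 else 0)" if "i < n" "k < n" for i k
  proof -
    have "evec k i = (\<Sum>j<n. cst (m j k) * l j) i" using m[OF that(2)] by simp
    then show ?thesis by (simp add: evec_def mult.commute)
  qed
  then have "(\<Sum>k<n. m i k * l j k) = (if i = j then 1 else 0)" if "i < n" "j < n" for i j
    using left_inverse_right_inverse[of n "\<lambda>i j. l j i" "\<lambda>j k. m j k" i j] that by blast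
  then have "qbasis n n l m" unfolding qbasis_def using lq m by auto
  then show ?thesis unfolding zbasis_def using lL span by blast
qed

lemma zbasis_independent:
  assumes l: "zbasis n L l" and eq: "lincomb n c l = lincomb n d l" and j: "j < n"
  shows "c j = d j"
proof -
  obtain m where m: "qbasis n n l m" using l unfolding zbasis_def by blast
  show ?thesis using qbasis_independent[OF m, of "\<lambda>i. of_int (c i)" "\<lambda>i. of_int (d i)" j] eq j by (simp add: cst_simps)
qed

definition smultiple :: "nat \<Rightarrow> 'v::comm_ring_1 set \<Rightarrow> 'v set" where
  "smultiple p L = (\<lambda>x. of_nat p * x) ` L"

lemma smultiple_mem: "x \<in> L \<Longrightarrow> of_nat p * x \<in> smultiple p L"
  unfolding smultiple_def by blast

lemma is_subgroup_smultiple: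
  assumes "is_subgroup L" shows "is_subgroup (smultiple p L)"
proof (rule is_subgroupI)
  show "0 \<in> smultiple p L" unfolding smultiple_def using is_subgroup_zero[OF assms] by (intro image_eqI[of _ _ 0]) auto
  fix x y assume "x \<in> smultiple p L" "y \<in> smultiple p L"
  then show "x - y \<in> smultiple p L" unfolding smultiple_def using is_subgroup_diff[OF assms] by (auto simp flip: right_diff_distrib)
qed

lemma smultiple_subset: "is_subgroup L \<Longrightarrow> smultiple p L \<subseteq> L"
  unfolding smultiple_def by (auto intro: is_subgroup_of_nat)

lemma zbasis_pbasis:
  assumes L: "is_subgroup L" and l: "zbasis n L l"
  shows "pbasis p L (smultiple p L) n l"
  unfolding pbasis_def
proof (intro conjI allI impI ballI)
  fix i assume "i < n" then show "l i \<in> L" using l unfolding zbasis_def by blast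
next
  fix x assume "x \<in> L"
  then obtain c where "x = lincomb n c l" using l unfolding zbasis_def by blast
  then show "\<exists>c. x - lincomb n c l \<in> smultiple p L"
    using is_subgroup_zero[OF is_subgroup_smultiple[OF L]] by (intro exI[of _ c]) simp
next
  fix c i assume "lincomb n c l \<in> smultiple p L" and i: "i < n"
  then obtain y where y: "y \<in> L" "lincomb n c l = of_nat p * y" unfolding smultiple_def by blast
  then obtain d where "y = lincomb n d l" using l unfolding zbasis_def by blast
  then have "lincomb n c l = (\<Sum>i<n. of_int (int p * d i) * l i)"
    using y by (simp add: sum_distrib_left mult.assoc)
  then have "c i = int p * d i" using zbasis_independent[OF l, of c "\<lambda>i. int p * d i"] i by blast
  then show "int p dvd c i" by simp
qed

lemma zbasis_finite_cosets:
  assumes L: "is_subgroup L" and l: "zbasis n L l" and p: "p > 0"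
  shows "finite (cosets_mod L (smultiple p L))"
  using card_cosets_mod(1)[OF p L is_subgroup_smultiple[OF L] smultiple_mem zbasis_pbasis[OF L l]] .

lemma zbasis_matrix:
  assumes l: "zbasis n L l" and \<phi>: "additive_map \<phi>" "\<And>x. x \<in> L \<Longrightarrow> \<phi> x \<in> L"
  obtains A where "\<And>j. j < n \<Longrightarrow> \<phi> (l j) = (\<Sum>i<n. of_int (A i j) * l i)" "trace_on n \<phi> = of_int (\<Sum>i<n. A i i)"
proof -
  obtain m where m: "qbasis n n l m" using l unfolding zbasis_def by blast
  have "\<forall>j\<in>{..<n}. \<exists>c. \<phi> (l j) = lincomb n c l" using l \<phi>(2) unfolding zbasis_def by blast
  then obtain C where "\<And>j. j < n \<Longrightarrow> \<phi> (l j) = lincomb n (C j) l" by (metis lessThan_iff)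
  moreover from this have "trace_on n \<phi> = of_int (\<Sum>i<n. C i i)"
    using trace_on_qbasis[OF \<phi>(1) m, of "\<lambda>i j. of_int (C j i)"] by (simp add: cst_simps)
  ultimately show ?thesis using that[of "\<lambda>i j. C j i"] by blast
qed

lemma trace_on_lattice_Ints:
  assumes l: "zbasis n L l" and \<phi>: "additive_map \<phi>" "\<And>x. x \<in> L \<Longrightarrow> \<phi> x \<in> L"
  shows "trace_on n \<phi> \<in> \<int>"
  using zbasis_matrix[OF assms] by (metis Ints_of_int)

text \<open>The bridge between characteristic 0 and p: a trace over Q may be reduced modulo p on any
  stable full lattice, and there it can be computed along a filtration of L/pL.\<close>

lemma trace_on_lattice_cong:
  assumes L: "is_subgroup L" and l: "zbasis n L l" and \<phi>: "additive_map \<phi>" "\<And>x. x \<in> L \<Longrightarrow> \<phi> x \<in> L"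
    and t: "ptrace p L (smultiple p L) \<phi> t"
  shows "\<exists>k. trace_on n \<phi> = of_int k \<and> [k = t] (mod int p)"
proof -
  obtain A where A: "\<And>j. j < n \<Longrightarrow> \<phi> (l j) = (\<Sum>i<n. of_int (A i j) * l i)" "trace_on n \<phi> = of_int (\<Sum>i<n. A i i)"
    using zbasis_matrix[OF l \<phi>] by blast
  have "ptrace p L (smultiple p L) \<phi> (\<Sum>i<n. A i i)"
    unfolding ptrace_def using zbasis_pbasis[OF L l, of p] A(1) is_subgroup_zero[OF is_subgroup_smultiple[OF L, of p]]
    by (intro exI[of _ n] exI[of _ l] exI[of _ A]) auto
  moreover have "\<phi> x \<in> smultiple p L" if "x \<in> smultiple p L" for x
    using that \<phi>(2) unfolding smultiple_def by (auto simp: additive_map_of_nat[OF \<phi>(1)])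
  ultimately have "[(\<Sum>i<n. A i i) = t] (mod int p)"
    using ptrace_unique[OF is_subgroup_smultiple[OF L] \<phi>(1) _ _ t] by blast
  then show ?thesis using A(2) by blast
qed

section \<open>Orders and their primes above p\<close>

lemmas qvec_apply = plus_fun_apply zero_fun_apply one_fun_apply times_fun_apply minus_apply uminus_apply
  of_int_fun_apply of_nat_fun_apply sum_fun_apply cst_apply numeral_fun_apply

declare qvec_apply [simp del]

text \<open>
  An order: \<open>L\<close> is closed under a second product \<open>\<star>\<close>, while \<open>*\<close> remains pointwise and serves as the
  scalar action only. The ring laws hold on all vectors, but \<open>one\<close> is neutral on \<open>L\<close> only; so several
  orders with different units can share the product.
\<close>

locale mring =
  fixes mul :: "qvec \<Rightarrow> qvec \<Rightarrow> qvec" (infixl "\<star>" 70) and one :: qvec and L :: "qvec set"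
  assumes mul_assoc: "(x \<star> y) \<star> z = x \<star> (y \<star> z)" and mul_comm: "x \<star> y = y \<star> x"
    and mul_add_left: "(x + y) \<star> z = x \<star> z + y \<star> z"
    and subgroup_L: "is_subgroup L" and mul_mem: "x \<in> L \<Longrightarrow> y \<in> L \<Longrightarrow> x \<star> y \<in> L"
    and one_mem: "one \<in> L" and one_mul: "x \<in> L \<Longrightarrow> one \<star> x = x"
begin

lemma mul_left_comm: "x \<star> (y \<star> z) = y \<star> (x \<star> z)"
  by (metis mul_assoc mul_comm)

lemmas mul_ac = mul_assoc mul_comm mul_left_comm

lemma additive_map_mul_left: "additive_map (\<lambda>x. x \<star> y)"
  unfolding additive_map_def by (simp add: mul_add_left)

lemma mul_add_right: "x \<star> (y + z) = x \<star> y + x \<star> z"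
  by (metis mul_comm mul_add_left)

lemma additive_map_mul: "additive_map (\<lambda>y. x \<star> y)"
  unfolding additive_map_def by (simp add: mul_add_right)

lemmas mul_diff_left = additive_map_diff[OF additive_map_mul_left]
lemmas mul_diff_right = additive_map_diff[OF additive_map_mul]
lemmas mul_minus_left = additive_map_uminus[OF additive_map_mul_left]
lemmas mul_minus_right = additive_map_uminus[OF additive_map_mul]
lemmas mul_zero_left [simp] = additive_map_zero[OF additive_map_mul_left]
lemmas mul_zero_right [simp] = additive_map_zero[OF additive_map_mul]
lemmas mul_of_int_left = additive_map_of_int[OF additive_map_mul_left]
lemmas mul_of_int_right = additive_map_of_int[OF additive_map_mul]
lemmas mul_of_nat_left = additive_map_of_nat[OF additive_map_mul_left]
lemmas mul_of_nat_right = additive_map_of_nat[OF additive_map_mul]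
lemmas mul_cst_left = additive_map_cst[OF additive_map_mul_left]
lemmas mul_cst_right = additive_map_cst[OF additive_map_mul]
lemmas mul_sum_left = additive_map_sum[OF additive_map_mul_left]
lemmas mul_sum_right = additive_map_sum[OF additive_map_mul]
lemmas mul_distribs = mul_add_left mul_add_right mul_diff_left mul_diff_right mul_minus_left mul_minus_right
lemmas mul_scalars = mul_of_int_left mul_of_int_right mul_of_nat_left mul_of_nat_right mul_cst_left mul_cst_right

lemmas L_closed = is_subgroup_closed[OF subgroup_L]

lemma mul_one: "x \<in> L \<Longrightarrow> x \<star> one = x"
  using one_mul mul_comm by metis

text \<open>The zeroth power is the unit of the order at hand, so orders that share the product have
  different zeroth powers; positive powers agree on common elements.\<close>

definition pw :: "qvec \<Rightarrow> nat \<Rightarrow> qvec" where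
  "pw x k = ((\<star>) x ^^ k) one"

lemma pw_0 [simp]: "pw x 0 = one" by (simp add: pw_def)
lemma pw_Suc: "pw x (Suc k) = x \<star> pw x k" by (simp add: pw_def)

lemma pw_mem: "x \<in> L \<Longrightarrow> pw x k \<in> L"
  by (induction k) (auto simp: pw_Suc one_mem mul_mem)

lemma pw_1: "x \<in> L \<Longrightarrow> pw x (Suc 0) = x"
  by (simp add: pw_Suc mul_one)

lemma pw_add: "x \<in> L \<Longrightarrow> pw x (j + k) = pw x j \<star> pw x k"
  by (induction j) (auto simp: pw_Suc mul_assoc one_mul pw_mem)

lemma pw_mult_distrib: "x \<in> L \<Longrightarrow> y \<in> L \<Longrightarrow> pw (x \<star> y) k = pw x k \<star> pw y k"
  by (induction k) (auto simp: pw_Suc mul_ac one_mul one_mem)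

lemma pw_pw: "x \<in> L \<Longrightarrow> pw (pw x j) k = pw x (j * k)"
  by (induction k) (auto simp: pw_Suc pw_add)

lemma pw_one: "pw one k = one"
  by (induction k) (auto simp: pw_Suc one_mul one_mem)

section \<open>Ideals, primes and the Frobenius of an order\<close>

definition idl :: "qvec set \<Rightarrow> bool" where
  "idl I \<longleftrightarrow> is_subgroup I \<and> I \<subseteq> L \<and> (\<forall>r\<in>L. \<forall>x\<in>I. r \<star> x \<in> I)"

lemma idlD: "idl I \<Longrightarrow> is_subgroup I" "idl I \<Longrightarrow> x \<in> I \<Longrightarrow> x \<in> L" "idl I \<Longrightarrow> r \<in> L \<Longrightarrow> x \<in> I \<Longrightarrow> r \<star> x \<in> I"
  "idl I \<Longrightarrow> r \<in> L \<Longrightarrow> x \<in> I \<Longrightarrow> x \<star> r \<in> I"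
  unfolding idl_def using mul_comm by auto

lemma idl_L: "idl L"
  unfolding idl_def using subgroup_L mul_mem by blast

lemma idl_smultiple: "idl I \<Longrightarrow> idl (smultiple p I)"
  unfolding idl_def using is_subgroup_smultiple[of I p] smultiple_subset[of I p]
  by (auto simp: smultiple_def mul_of_nat_right)

lemma idl_inter: "idl I \<Longrightarrow> idl K \<Longrightarrow> idl (I \<inter> K)"
  unfolding idl_def is_subgroup_def by blast

lemma idl_colon: "idl I \<Longrightarrow> y \<in> L \<Longrightarrow> idl {r \<in> L. r \<star> y \<in> I}"
  unfolding idl_def is_subgroup_def
  by (auto simp: mul_diff_left mul_mem L_closed mul_assoc)

lemma idl_add_principal:
  assumes I: "idl I" and a: "a \<in> L" shows "idl {i + a \<star> s |i s. i \<in> I \<and> s \<in> L}"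
proof -
  note assms = I a
  have "is_subgroup {i + a \<star> s |i s. i \<in> I \<and> s \<in> L}"
  proof (rule is_subgroupI)
    show "0 \<in> {i + a \<star> s |i s. i \<in> I \<and> s \<in> L}"
      using is_subgroup_zero[OF idlD(1)[OF assms(1)]] is_subgroup_zero[OF subgroup_L] by force
    fix x y assume "x \<in> {i + a \<star> s |i s. i \<in> I \<and> s \<in> L}" "y \<in> {i + a \<star> s |i s. i \<in> I \<and> s \<in> L}"
    then obtain i s j t where *: "x = i + a \<star> s" "y = j + a \<star> t" "i \<in> I" "j \<in> I" "s \<in> L" "t \<in> L" by blast
    have "x - y = (i - j) + a \<star> (s - t)" using * by (simp add: mul_diff_right)
    moreover have "i - j \<in> I" "s - t \<in> L"
      using * is_subgroup_diff[OF idlD(1)[OF assms(1)]] L_closed by blast+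
    ultimately show "x - y \<in> {i + a \<star> s |i s. i \<in> I \<and> s \<in> L}" by blast
  qed
  moreover have "{i + a \<star> s |i s. i \<in> I \<and> s \<in> L} \<subseteq> L"
    using idlD(2)[OF I] L_closed(4) mul_mem[OF a] by blast
  moreover have "r \<star> x \<in> {i + a \<star> s |i s. i \<in> I \<and> s \<in> L}" if r: "r \<in> L" and "x \<in> {i + a \<star> s |i s. i \<in> I \<and> s \<in> L}" for r x
  proof -
    have "\<exists>i s. x = i + a \<star> s \<and> i \<in> I \<and> s \<in> L" using that(2) by simp
    then obtain i s where *: "x = i + a \<star> s" "i \<in> I" "s \<in> L" by blast
    have "r \<star> x = r \<star> i + a \<star> (r \<star> s)" unfolding * by (simp add: mul_add_right mul_left_comm)
    then show ?thesis using idlD(3)[OF assms(1) that(1) *(2)] mul_mem[OF that(1) *(3)] by blast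
  qed
  ultimately show ?thesis unfolding idl_def by blast
qed

definition prm :: "qvec set \<Rightarrow> bool" where
  "prm P \<longleftrightarrow> idl P \<and> one \<notin> P \<and> (\<forall>x\<in>L. \<forall>y\<in>L. x \<star> y \<in> P \<longrightarrow> x \<in> P \<or> y \<in> P)"

lemma prmD: "prm P \<Longrightarrow> idl P" "prm P \<Longrightarrow> one \<notin> P"
  "prm P \<Longrightarrow> x \<in> L \<Longrightarrow> y \<in> L \<Longrightarrow> x \<star> y \<in> P \<Longrightarrow> x \<in> P \<or> y \<in> P"
  unfolding prm_def by blast+

lemma prm_pw: "prm P \<Longrightarrow> x \<in> L \<Longrightarrow> pw x k \<in> P \<Longrightarrow> x \<in> P"
  by (induction k) (auto simp: pw_Suc dest: prmD(2) prmD(3)[OF _ _ pw_mem])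

lemma idl_pw: "idl I \<Longrightarrow> x \<in> I \<Longrightarrow> k > 0 \<Longrightarrow> pw x k \<in> I"
  by (cases k) (auto simp: pw_Suc intro!: idlD(4) pw_mem dest: idlD(2))

text \<open>The binomial theorem for \<star>, by Pascal's rule.\<close>

lemma sum_choose_step:
  assumes x: "x \<in> L" and y: "y \<in> L"
  shows "pw (x + y) k = (\<Sum>i\<le>k. of_nat (k choose i) * (pw x i \<star> pw y (k - i)))"
proof (induction k)
  case 0
  then show ?case by (simp add: one_mul one_mem)
next
  case (Suc k)
  let ?t = "\<lambda>k i. pw x i \<star> pw y (k - i)"
  have "pw (x + y) (Suc k) = (\<Sum>i\<le>k. of_nat (k choose i) * ?t (Suc k) (Suc i)) + (\<Sum>i\<le>k. of_nat (k choose i) * ?t (Suc k) i)"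
  proof -
    have "y \<star> ?t k i = ?t (Suc k) i" if "i \<le> k" for i
      using that by (simp add: Suc_diff_le pw_Suc mul_left_comm)
    moreover have "x \<star> ?t k i = ?t (Suc k) (Suc i)" for i by (simp add: pw_Suc mul_assoc)
    ultimately show ?thesis
      unfolding pw_Suc Suc.IH
      by (simp add: mul_add_left mul_sum_right mul_of_nat_right sum.distrib[symmetric] distrib_left[symmetric] del: diff_Suc_Suc)
  qed
  also have "(\<Sum>i\<le>k. of_nat (k choose i) * ?t (Suc k) (Suc i)) = (\<Sum>i\<in>{1..Suc k}. of_nat (k choose (i - 1)) * ?t (Suc k) i)"
    by (rule sum.reindex_bij_witness[of _ "\<lambda>i. i - 1" Suc]) auto
  also have "(\<Sum>i\<le>k. of_nat (k choose i) * ?t (Suc k) i) = ?t (Suc k) 0 + (\<Sum>i\<in>{1..k}. of_nat (k choose i) * ?t (Suc k) i)"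
    by (simp add: sum.atMost_shift sum.atLeast1_atMost_eq lessThan_Suc_atMost)
  also have "(\<Sum>i\<in>{1..k}. of_nat (k choose i) * ?t (Suc k) i) = (\<Sum>i\<in>{1..Suc k}. of_nat (k choose i) * ?t (Suc k) i)"
    by (simp add: binomial_eq_0)
  finally have "pw (x + y) (Suc k) = ?t (Suc k) 0 + (\<Sum>i\<in>{1..Suc k}. of_nat ((k choose (i - 1)) + (k choose i)) * ?t (Suc k) i)"
    by (simp add: sum.distrib algebra_simps)
  also have "(\<Sum>i\<in>{1..Suc k}. of_nat ((k choose (i - 1)) + (k choose i)) * ?t (Suc k) i) = (\<Sum>i\<in>{1..Suc k}. of_nat (Suc k choose i) * ?t (Suc k) i)"
  proof (intro sum.cong refl)
    fix i assume "i \<in> {1..Suc k}"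
    then obtain j where "i = Suc j" by (cases i) auto
    then show "of_nat ((k choose (i - 1)) + (k choose i)) * ?t (Suc k) i = of_nat (Suc k choose i) * ?t (Suc k) i"
      by simp
  qed
  also have "?t (Suc k) 0 + \<dots> = (\<Sum>i\<in>insert 0 {1..Suc k}. of_nat (Suc k choose i) * ?t (Suc k) i)"
    by (subst sum.insert) auto
  also have "insert 0 {1..Suc k} = {..Suc k}" by auto
  finally show ?case .
qed

lemma frobenius_add:
  assumes p: "Factorial_Ring.prime p" and x: "x \<in> L" and y: "y \<in> L"
  shows "pw (x + y) p - (pw x p + pw y p) \<in> smultiple p L"
proof -
  have sg: "is_subgroup (smultiple p L)" by (rule is_subgroup_smultiple[OF subgroup_L])
  let ?t = "\<lambda>i. of_nat (p choose i) * (pw x i \<star> pw y (p - i))"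
  have p1: "p > 1" using p prime_gt_1_nat by blast
  have "(\<Sum>i\<le>p. ?t i) = ?t 0 + ?t p + (\<Sum>i\<in>{1..<p}. ?t i)"
  proof -
    have "{..p} = insert 0 (insert p {1..<p})" using p1 by auto
    then show ?thesis using p1 by (simp add: add.assoc)
  qed
  then have "pw (x + y) p - (pw x p + pw y p) = (\<Sum>i\<in>{1..<p}. ?t i)"
    unfolding sum_choose_step[OF x y] by (simp add: one_mul mul_one pw_mem x y)
  moreover have "?t i \<in> smultiple p L" if "i \<in> {1..<p}" for i
  proof -
    have "p dvd p choose i" using that p by (intro dvd_choose_prime) auto
    then obtain c where "p choose i = p * c" by (auto simp: dvd_def)
    then have eq: "?t i = of_nat p * (of_nat c * (pw x i \<star> pw y (p - i)))" by (simp add: mult.assoc)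
    show ?thesis unfolding eq by (intro smultiple_mem L_closed(5) mul_mem pw_mem x y)
  qed
  then have "(\<Sum>i\<in>{1..<p}. ?t i) \<in> smultiple p L" by (rule is_subgroup_sum[OF sg])
  ultimately show ?thesis by (simp only:)
qed

lemma idl_pw_cong:
  assumes I: "idl I" and x: "x \<in> L" and y: "y \<in> L" and xy: "x - y \<in> I"
  shows "pw x k - pw y k \<in> I"
proof (induction k)
  case 0
  then show ?case using is_subgroup_zero[OF idlD(1)[OF I]] by simp
next
  case (Suc k)
  have "pw x (Suc k) - pw y (Suc k) = x \<star> (pw x k - pw y k) + pw y k \<star> (x - y)"
    by (simp add: pw_Suc mul_diff_right mul_diff_left mul_comm[of "pw y k"])
  then show ?case
    using is_subgroup_add[OF idlD(1)[OF I]] idlD(3)[OF I x Suc] idlD(3)[OF I pw_mem[OF y] xy] by metis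
qed

lemma fermat_int: "Factorial_Ring.prime p \<Longrightarrow> int p dvd c ^ p - c"
proof -
  assume p: "Factorial_Ring.prime p"
  have nat: "[a ^ p = a] (mod p)" for a :: nat
  proof (cases "p dvd a")
    case True
    then have "p dvd a ^ p" using p by (simp add: prime_dvd_power_iff prime_gt_0_nat)
    then show ?thesis using True by (simp add: cong_def)
  next
    case False
    then have "[a ^ (p - 1) * a = 1 * a] (mod p)" using fermat_theorem[OF p] cong_mult cong_refl by blast
    then show ?thesis using p by (metis mult_1 power_minus_mult prime_gt_0_nat)
  qed
  define a where "a = nat (c mod int p)"
  have ac: "[int a = c] (mod int p)" unfolding a_def using p by (simp add: cong_def prime_gt_0_nat)
  have "[int a ^ p = int a] (mod int p)" using nat[of a] by (metis cong_int_iff of_nat_power)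
  then have "[c ^ p = c] (mod int p)" using ac by (metis cong_pow cong_sym cong_trans)
  then show ?thesis by (simp add: cong_iff_dvd_diff)
qed

lemma pw_of_int: "x \<in> L \<Longrightarrow> pw (of_int c * x) k = of_int (c ^ k) * pw x k"
proof (induction k)
  case (Suc k)
  then have "pw (of_int c * x) (Suc k) = of_int c * (of_int (c ^ k) * (x \<star> pw x k))"
    by (simp only: pw_Suc mul_scalars mult.left_commute)
  then show ?case by (simp only: pw_Suc ac_simps of_int_mult power_Suc)
qed simp

lemma frobenius_sum:
  assumes p: "Factorial_Ring.prime p" and x: "\<And>j. j \<in> J \<Longrightarrow> x j \<in> L"
  shows "pw (\<Sum>j\<in>J. of_int (c j) * x j) p - (\<Sum>j\<in>J. of_int (c j) * pw (x j) p) \<in> smultiple p L"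
proof -
  have sg: "is_subgroup (smultiple p L)" by (rule is_subgroup_smultiple[OF subgroup_L])
  have pos: "p > 0" using p prime_gt_0_nat by blast
  have zero: "pw 0 p = 0" using pos by (cases p) (auto simp: pw_Suc)
  show ?thesis using x
  proof (induction J rule: infinite_finite_induct)
    case (infinite J) then show ?case using is_subgroup_zero[OF sg] zero by simp
  next
    case empty then show ?case using is_subgroup_zero[OF sg] zero by simp
  next
    case (insert a J)
    let ?s = "\<Sum>j\<in>J. of_int (c j) * x j" and ?t = "\<Sum>j\<in>J. of_int (c j) * pw (x j) p"
    have aL: "of_int (c a) * x a \<in> L" using insert.prems L_closed by auto
    have sL: "?s \<in> L" by (intro L_closed(6,7)) (use insert.prems in auto)
    have 1: "pw (of_int (c a) * x a + ?s) p - (pw (of_int (c a) * x a) p + pw ?s p) \<in> smultiple p L"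
      by (rule frobenius_add[OF p aL sL])
    have 2: "pw (of_int (c a) * x a) p - of_int (c a) * pw (x a) p \<in> smultiple p L"
    proof -
      \<comment> \<open>By Fermat's little theorem the Frobenius fixes integer coefficients modulo
        p, which makes it linear over F_p.\<close>
      obtain k where k: "c a ^ p - c a = int p * k" using fermat_int[OF p, of "c a"] by (auto simp: dvd_def)
      have "pw (of_int (c a) * x a) p - of_int (c a) * pw (x a) p = of_int (c a ^ p - c a) * pw (x a) p"
        using insert.prems by (simp add: pw_of_int left_diff_distrib)
      also have "\<dots> = of_nat p * (of_int k * pw (x a) p)" unfolding k by (simp add: mult.assoc)
      finally show ?thesis using smultiple_mem[OF L_closed(6)[OF pw_mem]] insert.prems by simp
    qed
    have 3: "pw ?s p - ?t \<in> smultiple p L" using insert by auto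
    have eq: "pw (\<Sum>j\<in>insert a J. of_int (c j) * x j) p - (\<Sum>j\<in>insert a J. of_int (c j) * pw (x j) p)
      = (pw (of_int (c a) * x a + ?s) p - (pw (of_int (c a) * x a) p + pw ?s p))
        + ((pw (of_int (c a) * x a) p - of_int (c a) * pw (x a) p) + (pw ?s p - ?t))"
      using insert.hyps by simp
    show ?case unfolding eq by (intro is_subgroup_add[OF sg] 1 2 3)
  qed
qed

end

lemma cosets_pigeonhole:
  fixes s :: "nat \<Rightarrow> 'v::comm_ring_1"
  assumes fin: "finite (cosets_mod L M)" and M: "is_subgroup M" and s: "\<And>i. s i \<in> L"
  obtains i j where "i < j" "s i - s j \<in> M"
proof -
  have "(\<lambda>i. {y \<in> L. y - s i \<in> M}) ` UNIV \<subseteq> cosets_mod L M" unfolding cosets_mod_def using s by auto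
  then have "finite ((\<lambda>i. {y \<in> L. y - s i \<in> M}) ` UNIV)" using fin finite_subset by blast
  then have "\<not> inj (\<lambda>i. {y \<in> L. y - s i \<in> M})" using finite_imageD infinite_UNIV_nat by blast
  then obtain i j where ij: "i \<noteq> j" "{y \<in> L. y - s i \<in> M} = {y \<in> L. y - s j \<in> M}" unfolding inj_def by blast
  then have "s i - s j \<in> M" "s j - s i \<in> M"
    using coset_eq_iff[OF M s s] by blast+
  then show ?thesis using that ij(1) by (metis linorder_neqE_nat)
qed

section \<open>Primes above p and the radical of p\<close>

locale pring = mring +
  fixes p :: nat
  assumes prime_p: "Factorial_Ring.prime p" and finite_mod_p: "finite (cosets_mod L (smultiple p L))"
begin

lemma p_gt: "p > 1" "p > 0" "p \<noteq> 0"
  using prime_p prime_gt_1_nat prime_gt_0_nat by auto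

abbreviation pL :: "qvec set" where "pL \<equiv> smultiple p L"

lemma idl_pL: "idl pL"
  by (rule idl_smultiple[OF idl_L])

lemma pL_memI: "pL \<subseteq> I \<Longrightarrow> x \<in> L \<Longrightarrow> of_nat p * x \<in> I"
  using smultiple_mem by blast

lemma ideal_finite_cosets: "idl K \<Longrightarrow> idl I \<Longrightarrow> pL \<subseteq> I \<Longrightarrow> finite (cosets_mod K I)"
  using finite_cosets_mod_mono[OF finite_mod_p] idlD idl_pL by blast

lemma ideal_pbasis:
  assumes "idl K" "idl I" "pL \<subseteq> I" shows "\<exists>r v. pbasis p K I r v"
  using pbasis_exists[OF prime_p idlD(1)[OF assms(1)] idlD(1)[OF assms(2)]] ideal_finite_cosets[OF assms]
    pL_memI[OF assms(3)] idlD(2)[OF assms(1)] by blast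

text \<open>The dimension of L/I over F_p, hence a codimension: it drops when I grows, and an ideal
  of least \<open>pdim\<close> is a largest one.\<close>

definition pdim :: "qvec set \<Rightarrow> nat" where
  "pdim I = (THE r. \<exists>v. pbasis p L I r v)"

lemma pdim_eq:
  assumes "idl I" "pL \<subseteq> I" "pbasis p L I r v" shows "pdim I = r"
  unfolding pdim_def
proof (rule the_equality)
  show "\<exists>v. pbasis p L I r v" using assms by blast
  fix s assume "\<exists>v. pbasis p L I s v"
  then show "s = r" using pbasis_unique_dim[OF p_gt(1) subgroup_L idlD(1)[OF assms(1)] pL_memI[OF assms(2)]] assms(3) by blast
qed

lemma pdim_basis: "idl I \<Longrightarrow> pL \<subseteq> I \<Longrightarrow> \<exists>v. pbasis p L I (pdim I) v"
  using ideal_pbasis[OF idl_L] pdim_eq by metis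

lemma pdim_strict:
  assumes I: "idl I" "pL \<subseteq> I" and K: "idl K" "I \<subset> K" shows "pdim K < pdim I"
proof -
  have pK: "pL \<subseteq> K" using I(2) K(2) by blast
  obtain v where v: "pbasis p L K (pdim K) v" using pdim_basis[OF K(1) pK] by blast
  obtain s w where w: "pbasis p K I s w" using ideal_pbasis[OF K(1) I] by blast
  obtain x where "x \<in> K" "x \<notin> I" using K(2) by blast
  then have "s > 0" using pbasis_nontrivial_pos[OF w] by blast
  moreover have "pdim I = pdim K + s"
    using pdim_eq[OF I pbasis_cat[OF subgroup_L idlD(1)[OF K(1)] idlD(1)[OF I(1)] _ _ _ v w]]
      pL_memI[OF I(2)] K idlD(2) by blast
  ultimately show ?thesis by simp
qed

text \<open>L/P is a finite domain: two powers of x agree modulo P, and x^i (1 - x^(j-i)) in P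
  forces the second factor into P. So x^(j-i-1) inverts x.\<close>

lemma prime_inverse:
  assumes P: "prm P" "pL \<subseteq> P" and x: "x \<in> L" "x \<notin> P"
  obtains y where "y \<in> L" "x \<star> y - one \<in> P"
proof -
  obtain i j where ij: "i < j" "pw x i - pw x j \<in> P"
    using cosets_pigeonhole[OF ideal_finite_cosets[OF idl_L prmD(1)[OF P(1)] P(2)] idlD(1)[OF prmD(1)[OF P(1)]], of "pw x"]
      pw_mem[OF x(1)] by blast
  define y where "y = pw x (j - i - 1)"
  have yL: "y \<in> L" unfolding y_def by (rule pw_mem[OF x(1)])
  have "j = i + Suc (j - i - 1)" using ij by simp
  then have "pw x j = pw x i \<star> (x \<star> y)" unfolding y_def using pw_add[OF x(1)] pw_Suc by metis
  then have "pw x i - pw x j = pw x i \<star> (one - x \<star> y)" by (simp add: mul_diff_right mul_one pw_mem x)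
  then have "pw x i \<in> P \<or> one - x \<star> y \<in> P"
    using prmD(3)[OF P(1) pw_mem[OF x(1)], of "one - x \<star> y"] ij(2) L_closed(2)[OF one_mem mul_mem[OF x(1) yL]] by metis
  then have "one - x \<star> y \<in> P" using prm_pw[OF P(1) x(1)] x(2) by blast
  then have "x \<star> y - one \<in> P" using is_subgroup_uminus[OF idlD(1)[OF prmD(1)[OF P(1)]]] by fastforce
  then show ?thesis using that yL by blast
qed

text \<open>An element of Q outside P is invertible modulo P, so Q would contain
  \<open>one\<close>.\<close>

lemma prime_not_subset:
  assumes P: "prm P" "pL \<subseteq> P" and Q: "prm Q" "P \<subseteq> Q" shows "P = Q"
proof (rule ccontr)
  assume "P \<noteq> Q"
  then obtain x where x: "x \<in> Q" "x \<notin> P" using Q(2) by blast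
  have xL: "x \<in> L" using x(1) idlD(2)[OF prmD(1)[OF Q(1)]] by blast
  obtain y where y: "y \<in> L" "x \<star> y - one \<in> P" using prime_inverse[OF P xL x(2)] by blast
  have "x \<star> y - (x \<star> y - one) \<in> Q"
    using is_subgroup_diff[OF idlD(1)[OF prmD(1)[OF Q(1)]]] idlD(4)[OF prmD(1)[OF Q(1)] y(1) x(1)] y(2) Q(2) by blast
  then show False using prmD(2)[OF Q(1)] by simp
qed

definition nilrad :: "qvec set" where
  "nilrad = {x \<in> L. \<exists>k. pw x k \<in> pL}"

text \<open>Among the ideals that contain pL and no power of x, one of least codimension is maximal,
  and such an ideal is prime.\<close>

lemma exists_prime_avoiding:
  assumes x: "x \<in> L" "x \<notin> nilrad"
  obtains P where "prm P" "pL \<subseteq> P" "x \<notin> P"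
proof -
  define \<A> where "\<A> = {I. idl I \<and> pL \<subseteq> I \<and> (\<forall>k. pw x k \<notin> I)}"
  have "pL \<in> \<A>" unfolding \<A>_def using idl_pL x unfolding nilrad_def by blast
  then obtain I where I: "I \<in> \<A>" "\<And>K. K \<in> \<A> \<Longrightarrow> pdim I \<le> pdim K"
    using ex_has_least_nat[of "\<lambda>I. I \<in> \<A>" pL pdim] by blast
  have I': "idl I" "pL \<subseteq> I" "\<And>k. pw x k \<notin> I" using I(1) unfolding \<A>_def by blast+
  have grow: "\<exists>k. \<exists>i\<in>I. \<exists>s\<in>L. pw x k = i + a \<star> s" if a: "a \<in> L" "a \<notin> I" for a
  proof -
    let ?K = "{i + a \<star> s |i s. i \<in> I \<and> s \<in> L}"
    have K: "idl ?K" by (rule idl_add_principal[OF I'(1) a(1)])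
    have "I \<subseteq> ?K" using is_subgroup_zero[OF subgroup_L] by force
    moreover have "0 + a \<star> one \<in> ?K" using is_subgroup_zero[OF idlD(1)[OF I'(1)]] one_mem by blast
    then have "a \<in> ?K" using mul_one[OF a(1)] by simp
    ultimately have "I \<subset> ?K" using a(2) by blast
    then have "?K \<notin> \<A>" using pdim_strict[OF I'(1,2) K] I(2) by fastforce
    then show ?thesis unfolding \<A>_def using K \<open>I \<subseteq> ?K\<close> I'(2) by blast
  qed
  have "a \<in> I \<or> b \<in> I" if ab: "a \<in> L" "b \<in> L" "a \<star> b \<in> I" for a b
  proof (rule ccontr)
    assume "\<not> (a \<in> I \<or> b \<in> I)"
    then obtain k i s l i' s' where *: "i \<in> I" "s \<in> L" "pw x k = i + a \<star> s" "i' \<in> I" "s' \<in> L" "pw x l = i' + b \<star> s'"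
      using grow[OF ab(1)] grow[OF ab(2)] by blast
    \<comment> \<open>The product of i + a s and i' + b s', arranged so that each summand contains
      i, i' or a b, all of which lie in I.\<close>
    have "pw x (k + l) = i \<star> (i' + b \<star> s') + ((a \<star> s) \<star> i' + (s \<star> s') \<star> (a \<star> b))"
      unfolding pw_add[OF x(1)] *(3,6) by (simp add: mul_distribs mul_ac)
    moreover have "i \<star> (i' + b \<star> s') \<in> I" using idlD(4)[OF I'(1) _ *(1)] pw_mem[OF x(1)] *(6) by metis
    moreover have "(a \<star> s) \<star> i' \<in> I" using idlD(3)[OF I'(1) _ *(4)] mul_mem ab * by blast
    moreover have "(s \<star> s') \<star> (a \<star> b) \<in> I" using idlD(3)[OF I'(1) _ ab(3)] mul_mem * by blast
    ultimately have "pw x (k + l) \<in> I" using is_subgroup_add[OF idlD(1)[OF I'(1)]] by metis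
    then show False using I'(3) by blast
  qed
  moreover have "one \<notin> I" using I'(3)[of 0] by simp
  ultimately have "prm I" unfolding prm_def using I'(1) by blast
  moreover have "x \<notin> I" using I'(3)[of 1] pw_1[OF x(1)] by simp
  ultimately show ?thesis using that I'(2) by blast
qed

definition primes_above :: "qvec set set" where
  "primes_above = {P. prm P \<and> pL \<subseteq> P}"

lemma nilrad_eq: "nilrad = L \<inter> \<Inter> primes_above"
proof (intro equalityI subsetI)
  fix x assume "x \<in> nilrad"
  then show "x \<in> L \<inter> \<Inter> primes_above" unfolding nilrad_def primes_above_def using prm_pw by blast
next
  fix x assume "x \<in> L \<inter> \<Inter> primes_above"
  then show "x \<in> nilrad" using exists_prime_avoiding[of x] unfolding primes_above_def by blast
qed

text \<open>The dimension count of the Chinese remainder theorem. With I the intersection over S, an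
  element u of I that is 1 modulo Q turns a basis of L/Q into a basis of the quotient of I by its
  intersection with Q.\<close>

lemma prime_inter_dims:
  assumes "finite S" "S \<subseteq> primes_above"
  shows "idl (L \<inter> \<Inter> S) \<and> pL \<subseteq> L \<inter> \<Inter> S \<and> pdim (L \<inter> \<Inter> S) = (\<Sum>P\<in>S. pdim P)"
  using assms
proof (induction S rule: finite_induct)
  case empty
  have "pdim L = 0" using pdim_eq[OF idl_L _ pbasis_self[OF subgroup_L]] smultiple_subset[OF subgroup_L] by blast
  then show ?case using idl_L smultiple_subset[OF subgroup_L] by simp
next
  case (insert Q S)
  define I where "I = L \<inter> \<Inter> S"
  have I: "idl I" "pL \<subseteq> I" "pdim I = (\<Sum>P\<in>S. pdim P)" using insert unfolding I_def by auto
  have Q: "prm Q" "pL \<subseteq> Q" "idl Q" using insert.prems prmD(1) unfolding primes_above_def by auto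
  have IQ: "L \<inter> \<Inter> (insert Q S) = I \<inter> Q" unfolding I_def by blast
  have idIQ: "idl (I \<inter> Q)" by (rule idl_inter[OF I(1) Q(3)])
  have pIQ: "pL \<subseteq> I \<inter> Q" using I(2) Q(2) by blast
  \<comment> \<open>One prime of T at a time: a product of elements chosen in these primes and
    outside Q stays outside Q.\<close>
  have "\<exists>a. a \<in> L \<inter> \<Inter> T \<and> a \<notin> Q" if "T \<subseteq> S" for T
    using finite_subset[OF that insert.hyps(1)] that
  proof (induction T rule: finite_induct)
    case empty then show ?case using one_mem prmD(2)[OF Q(1)] by blast
  next
    case (insert P T)
    then obtain a where a: "a \<in> L \<inter> \<Inter> T" "a \<notin> Q" by blast
    have P: "prm P" "pL \<subseteq> P" using insert.prems \<open>insert Q S \<subseteq> primes_above\<close> unfolding primes_above_def by auto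
    have "P \<noteq> Q" using insert.prems \<open>Q \<notin> S\<close> by blast
    then obtain b where b: "b \<in> P" "b \<notin> Q" using prime_not_subset[OF P Q(1)] by blast
    have bL: "b \<in> L" using b idlD(2)[OF prmD(1)[OF P(1)]] by blast
    have "b \<star> a \<notin> Q" using prmD(3)[OF Q(1) bL] a b by blast
    moreover have "b \<star> a \<in> P" using idlD(4)[OF prmD(1)[OF P(1)] _ b(1)] a by blast
    moreover have "b \<star> a \<in> P'" if "P' \<in> T" for P'
    proof -
      have "prm P'" using that insert.prems \<open>insert Q S \<subseteq> primes_above\<close> unfolding primes_above_def by blast
      then show ?thesis using idlD(3)[OF prmD(1) bL] a that by blast
    qed
    ultimately show ?case using mul_mem[OF bL] a by blast
  qed
  then obtain a where a: "a \<in> I" "a \<notin> Q" unfolding I_def by blast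
  then have aL: "a \<in> L" unfolding I_def by blast
  obtain b where b: "b \<in> L" "a \<star> b - one \<in> Q" using prime_inverse[OF Q(1,2) aL a(2)] by blast
  define u where "u = a \<star> b"
  have u: "u \<in> I" "u - one \<in> Q" "u \<in> L" unfolding u_def using idlD(4)[OF I(1) b(1) a(1)] b mul_mem aL by auto
  have uQ: "u \<star> x - x \<in> Q" if "x \<in> L" for x
    using idlD(4)[OF Q(3) that u(2)] that by (simp add: mul_diff_left one_mul)
  obtain w where w: "pbasis p L Q (pdim Q) w" using pdim_basis[OF Q(3,2)] by blast
  let ?s = "\<lambda>c. \<Sum>i<pdim Q. of_int (c i) * w i"
  let ?t = "\<lambda>c. \<Sum>i<pdim Q. of_int (c i) * (u \<star> w i)"
  have tu: "?t c = u \<star> ?s c" for c by (simp add: mul_sum_right mul_of_int_right)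
  have sL: "?s c \<in> L" for c by (intro L_closed(6,7)) (use pbasisD(1)[OF w] in auto)
  have w': "pbasis p I (I \<inter> Q) (pdim Q) (\<lambda>i. u \<star> w i)"
    unfolding pbasis_def
  proof (intro conjI allI impI ballI)
    fix i assume "i < pdim Q" then show "u \<star> w i \<in> I" using pbasisD(1)[OF w] idlD(4)[OF I(1) _ u(1)] by blast
  next
    fix x assume x: "x \<in> I"
    then obtain c where c: "x - ?s c \<in> Q" using pbasisD(2)[OF w] idlD(2)[OF I(1)] by blast
    have eq: "x - ?t c = (x - ?s c) - (u \<star> ?s c - ?s c)" unfolding tu by simp
    have "x - ?t c \<in> Q" unfolding eq by (rule is_subgroup_diff[OF idlD(1)[OF Q(3)] c uQ[OF sL]])
    moreover have "x - ?t c \<in> I"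
      unfolding tu using is_subgroup_diff[OF idlD(1)[OF I(1)] x idlD(4)[OF I(1) sL u(1)]] .
    ultimately show "\<exists>c. x - ?t c \<in> I \<inter> Q" by blast
  next
    fix c i assume "?t c \<in> I \<inter> Q" and i: "i < pdim Q"
    then have "u \<star> ?s c \<in> Q" unfolding tu by blast
    then have "u \<star> ?s c - (u \<star> ?s c - ?s c) \<in> Q" by (rule is_subgroup_diff[OF idlD(1)[OF Q(3)] _ uQ[OF sL]])
    then show "int p dvd c i" using pbasisD(3)[OF w _ i] by simp
  qed
  obtain v where v: "pbasis p L I (pdim I) v" using pdim_basis[OF I(1,2)] by blast
  have "pbasis p L (I \<inter> Q) (pdim I + pdim Q) (cat_seq (pdim I) v (\<lambda>i. u \<star> w i))"
    by (rule pbasis_cat[OF subgroup_L idlD(1)[OF I(1)] idlD(1)[OF idIQ] _ _ pL_memI[OF pIQ] v w'])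
      (use idlD(2)[OF I(1)] in auto)
  then have "pdim (I \<inter> Q) = pdim I + pdim Q" by (rule pdim_eq[OF idIQ pIQ])
  then show ?case unfolding IQ using idIQ pIQ I(3) insert.hyps by simp
qed

lemma pdim_prime_pos: "P \<in> primes_above \<Longrightarrow> pdim P > 0"
  using pdim_strict[of P L] prmD(1,2)[of P] idl_L idlD(2)[of P] one_mem unfolding primes_above_def by fastforce

lemma pdim_mono: "idl I \<Longrightarrow> pL \<subseteq> I \<Longrightarrow> idl K \<Longrightarrow> I \<subseteq> K \<Longrightarrow> pdim K \<le> pdim I"
  using pdim_strict[of I K] by (cases "I = K") (auto simp: psubset_eq less_imp_le)

text \<open>Every prime adds at least 1 to the codimension of the intersection, which cannot exceed
  that of pL.\<close>

lemma finite_primes_above: "finite primes_above"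
proof (rule ccontr)
  assume "infinite primes_above"
  then obtain S where S: "S \<subseteq> primes_above" "finite S" "card S = Suc (pdim pL)"
    using infinite_arbitrarily_large by blast
  have "Suc (pdim pL) = (\<Sum>P\<in>S. 1)" using S by simp
  also have "\<dots> \<le> (\<Sum>P\<in>S. pdim P)" using pdim_prime_pos S(1) by (intro sum_mono) (auto simp: Suc_le_eq)
  also have "\<dots> = pdim (L \<inter> \<Inter> S)" using prime_inter_dims[OF S(2,1)] by simp
  also have "\<dots> \<le> pdim pL" using prime_inter_dims[OF S(2,1)] pdim_mono[OF idl_pL] by blast
  finally show False by simp
qed

lemma pdim_nilrad: "pdim nilrad = (\<Sum>P\<in>primes_above. pdim P)"
  using prime_inter_dims[OF finite_primes_above] unfolding nilrad_eq by simp

lemma idl_nilrad: "idl nilrad" "pL \<subseteq> nilrad"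
  using prime_inter_dims[OF finite_primes_above] unfolding nilrad_eq by simp_all

end

section \<open>Residue fields\<close>

lemma hom_add_pow:
  assumes "ring A" "ring B" "h \<in> ring_hom A B" "x \<in> carrier A"
  shows "h (add_pow A (k::nat) x) = add_pow B k (h x)" "h (add_pow A (l::int) x) = add_pow B l (h x)"
proof -
  interpret H: ring_hom_ring A B h by (rule ring_hom_ringI2[OF assms(1-3)])
  show "h (add_pow A (k::nat) x) = add_pow B k (h x)" "h (add_pow A (l::int) x) = add_pow B l (h x)"
    using group_hom.hom_nat_pow[OF H.a_group_hom, of x k] group_hom.hom_int_pow[OF H.a_group_hom, of x l] assms(4)
    by (simp_all add: add_pow_def)
qed

context mring
begin

definition rng :: "qvec ring" where
  "rng = \<lparr>carrier = L, monoid.mult = (\<star>), monoid.one = one, ring.zero = 0, ring.add = (+)\<rparr>"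

lemma rng_simps [simp]: "carrier rng = L" "x \<otimes>\<^bsub>rng\<^esub> y = x \<star> y" "\<one>\<^bsub>rng\<^esub> = one" "\<zero>\<^bsub>rng\<^esub> = 0" "x \<oplus>\<^bsub>rng\<^esub> y = x + y"
  by (simp_all add: rng_def)

lemma cring_rng: "cring rng"
proof (rule cringI)
  show "abelian_group rng"
  proof (rule abelian_groupI)
    fix x assume "x \<in> carrier rng"
    then show "\<exists>y\<in>carrier rng. y \<oplus>\<^bsub>rng\<^esub> x = \<zero>\<^bsub>rng\<^esub>" using L_closed(3) by (intro bexI[of _ "- x"]) auto
  qed (auto simp: L_closed add.assoc add.commute)
  show "comm_monoid rng"
  proof (rule comm_monoidI)
    fix x y assume "x \<in> carrier rng" "y \<in> carrier rng"
    then show "x \<otimes>\<^bsub>rng\<^esub> y = y \<otimes>\<^bsub>rng\<^esub> x" using mul_comm by simp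
  qed (simp_all add: mul_mem one_mem mul_assoc one_mul)
qed (auto simp: mul_add_left)

lemma rng_nat_multiple: "x \<in> L \<Longrightarrow> add_pow rng (k::nat) x = of_nat k * x"
proof (induction k)
  case 0
  then show ?case by (simp add: add_pow_def nat_pow_def)
next
  case (Suc k)
  then show ?case by (simp add: add_pow_def nat_pow_def algebra_simps)
qed

lemma rng_int_multiple: "x \<in> L \<Longrightarrow> add_pow rng (k::int) x = of_int k * x"
proof -
  assume x: "x \<in> L"
  interpret R: cring rng by (rule cring_rng)
  have "\<ominus>\<^bsub>rng\<^esub> y = - y" if "y \<in> L" for y
    using R.minus_equality[of "- y" y] that L_closed(3) by simp
  then have "\<ominus>\<^bsub>rng\<^esub> (of_nat (nat (- k)) * x) = - (of_nat (nat (- k)) * x)" using L_closed(5)[OF x] by blast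
  then show ?thesis
    using x by (cases "k \<ge> 0") (simp_all add: add_pow_int_ge add_pow_int_lt rng_nat_multiple of_nat_nat)
qed

lemma ideal_rng_iff: "ideal I rng \<longleftrightarrow> idl I"
proof
  assume I: "ideal I rng"
  interpret R: cring rng by (rule cring_rng)
  have minus: "\<ominus>\<^bsub>rng\<^esub> y = - y" if "y \<in> L" for y
    using R.minus_equality[of "- y" y] that L_closed(3) by simp
  have sub: "additive_subgroup I rng" by (rule ideal.axioms(1)[OF I])
  have IL: "x \<in> L" if "x \<in> I" for x using ideal.Icarr[OF I that] by simp
  have "x - y \<in> I" if "x \<in> I" "y \<in> I" for x y
  proof -
    have "x \<oplus>\<^bsub>rng\<^esub> \<ominus>\<^bsub>rng\<^esub> y \<in> I"
      by (intro additive_subgroup.a_closed[OF sub] additive_subgroup.a_inv_closed[OF sub] that)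
    then show ?thesis using minus[OF IL[OF that(2)]] by simp
  qed
  moreover have "0 \<in> I" using additive_subgroup.zero_closed[OF sub] by simp
  moreover have "r \<star> x \<in> I" if "r \<in> L" "x \<in> I" for r x using ideal.I_l_closed[OF I that(2), of r] that(1) by simp
  ultimately show "idl I" unfolding idl_def is_subgroup_def using IL by blast
next
  assume I: "idl I"
  interpret R: cring rng by (rule cring_rng)
  have "subgroup I (add_monoid rng)"
  proof (rule group.subgroupI[OF R.add.is_group])
    show "I \<subseteq> carrier (add_monoid rng)" "I \<noteq> {}" using idlD(2)[OF I] is_subgroup_zero[OF idlD(1)[OF I]] by auto
    fix a b assume ab: "a \<in> I" "b \<in> I"
    show "a \<otimes>\<^bsub>add_monoid rng\<^esub> b \<in> I" using is_subgroup_add[OF idlD(1)[OF I] ab] by simp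
    have "inv\<^bsub>add_monoid rng\<^esub> a = - a"
      using R.minus_equality[of "- a" a] idlD(2)[OF I ab(1)] L_closed(3) by (simp add: a_inv_def)
    then show "inv\<^bsub>add_monoid rng\<^esub> a \<in> I" using is_subgroup_uminus[OF idlD(1)[OF I] ab(1)] by simp
  qed
  then show "ideal I rng"
    using idlD(3,4)[OF I] by (intro idealI R.ring_axioms) auto
qed

lemma rng_coset: "idl I \<Longrightarrow> x \<in> L \<Longrightarrow> I +>\<^bsub>rng\<^esub> x = {y \<in> L. y - x \<in> I}"
  unfolding a_r_coset_def' by (auto simp: idlD(2) L_closed intro!: bexI[of _ "_ - x"])

lemma rng_coset_eq_iff: "idl I \<Longrightarrow> x \<in> L \<Longrightarrow> y \<in> L \<Longrightarrow> I +>\<^bsub>rng\<^esub> x = I +>\<^bsub>rng\<^esub> y \<longleftrightarrow> x - y \<in> I"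
  by (simp add: rng_coset coset_eq_iff idlD(1))

lemma carrier_rng_Quot: "idl I \<Longrightarrow> carrier (rng Quot I) = cosets_mod L I"
  unfolding FactRing_def A_RCOSETS_def' cosets_mod_def by (auto simp: rng_coset)

lemma rng_coset_pw:
  assumes I: "idl I" and x: "x \<in> L"
  shows "I +>\<^bsub>rng\<^esub> pw x k = (I +>\<^bsub>rng\<^esub> x) [^]\<^bsub>rng Quot I\<^esub> k"
proof (induction k)
  case 0
  then show ?case by (simp add: FactRing_def nat_pow_def)
next
  case (Suc k)
  have id: "ideal I rng" using I ideal_rng_iff by blast
  have "I +>\<^bsub>rng\<^esub> pw x (Suc k) = I +>\<^bsub>rng\<^esub> (pw x k \<otimes>\<^bsub>rng\<^esub> x)" by (simp add: pw_Suc mul_comm)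
  also have "\<dots> = (I +>\<^bsub>rng\<^esub> pw x k) \<otimes>\<^bsub>rng Quot I\<^esub> (I +>\<^bsub>rng\<^esub> x)"
    using ring_hom_mult[OF ideal.rcos_ring_hom[OF id]] x pw_mem by simp
  also have "\<dots> = (I +>\<^bsub>rng\<^esub> x) [^]\<^bsub>rng Quot I\<^esub> Suc k" unfolding Suc by (simp add: nat_pow_def)
  finally show ?case .
qed

end

context pring
begin

text \<open>Primes above p are maximal, so L/P is a finite field; g lifts a generator of its cyclic
  multiplicative group.\<close>

lemma residue_field_generator:
  assumes P: "prm P" "pL \<subseteq> P"
  obtains g where "g \<in> L" "\<And>x. x \<in> L \<Longrightarrow> x \<notin> P \<Longrightarrow> \<exists>i. x - pw g i \<in> P"
proof -
  have id: "idl P" by (rule prmD(1)[OF P(1)])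
  have "maximalideal P rng"
  proof (rule maximalidealI)
    show "ideal P rng" using id ideal_rng_iff by blast
    show "carrier rng \<noteq> P" using prmD(2)[OF P(1)] one_mem by auto
    fix J assume J: "ideal J rng" "P \<subseteq> J" "J \<subseteq> carrier rng"
    have J': "idl J" using J ideal_rng_iff by blast
    show "J = P \<or> J = carrier rng"
    proof (rule disjCI)
      assume "J \<noteq> carrier rng"
      show "J = P"
      proof (rule ccontr)
        assume "J \<noteq> P"
        then obtain x where x: "x \<in> J" "x \<notin> P" using J(2) by blast
        obtain y where y: "y \<in> L" "x \<star> y - one \<in> P" using prime_inverse[OF P _ x(2)] idlD(2)[OF J' x(1)] by blast
        have "x \<star> y - (x \<star> y - one) \<in> J"
          using is_subgroup_diff[OF idlD(1)[OF J'] idlD(4)[OF J' y(1) x(1)]] y(2) J(2) by blast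
        then have one: "one \<in> J" by simp
        have "r \<in> J" if "r \<in> L" for r using idlD(3)[OF J' that one] mul_one[OF that] by simp
        then show False using \<open>J \<noteq> carrier rng\<close> J(3) by auto
      qed
    qed
  qed
  then have F: "field (rng Quot P)" by (rule maximalideal.quotient_is_field[OF _ cring_rng])
  interpret F: field "rng Quot P" by (rule F)
  have carr: "carrier (rng Quot P) = cosets_mod L P" by (rule carrier_rng_Quot[OF id])
  have "finite (carrier (rng Quot P))" unfolding carr by (rule ideal_finite_cosets[OF idl_L id P(2)])
  then have "\<exists>a\<in>carrier (Multiplicative_Group.mult_of (rng Quot P)). carrier (Multiplicative_Group.mult_of (rng Quot P)) = {a [^]\<^bsub>rng Quot P\<^esub> i |i::nat. i \<in> UNIV}"
    by (rule F.finite_field_mult_group_has_gen)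
  then obtain a where a: "a \<in> carrier (Multiplicative_Group.mult_of (rng Quot P))" "carrier (Multiplicative_Group.mult_of (rng Quot P)) = {a [^]\<^bsub>rng Quot P\<^esub> i |i::nat. i \<in> UNIV}"
    by blast
  have "a \<in> carrier (rng Quot P)" using a(1) by simp
  then obtain g where g: "g \<in> L" "a = {y \<in> L. y - g \<in> P}" unfolding carr cosets_mod_def by blast
  then have ga: "a = P +>\<^bsub>rng\<^esub> g" using rng_coset[OF id] by simp
  have "\<exists>i. x - pw g i \<in> P" if x: "x \<in> L" "x \<notin> P" for x
  proof -
    have "P +>\<^bsub>rng\<^esub> 0 = P" using rng_coset[OF id L_closed(1)] idlD(2)[OF id] by auto
    then have "\<zero>\<^bsub>rng Quot P\<^esub> = P +>\<^bsub>rng\<^esub> 0" by (simp add: FactRing_def)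
    then have "P +>\<^bsub>rng\<^esub> x \<noteq> \<zero>\<^bsub>rng Quot P\<^esub>" using rng_coset_eq_iff[OF id x(1) L_closed(1)] x(2) by simp
    moreover have "P +>\<^bsub>rng\<^esub> x \<in> carrier (rng Quot P)" unfolding carr cosets_mod_def using rng_coset[OF id x(1)] x(1) by auto
    ultimately have "P +>\<^bsub>rng\<^esub> x \<in> carrier (Multiplicative_Group.mult_of (rng Quot P))" by simp
    then obtain i :: nat where "P +>\<^bsub>rng\<^esub> x = a [^]\<^bsub>rng Quot P\<^esub> i" using a(2) by auto
    then have "P +>\<^bsub>rng\<^esub> x = P +>\<^bsub>rng\<^esub> pw g i" using rng_coset_pw[OF id g(1)] ga by simp
    then show ?thesis using rng_coset_eq_iff[OF id x(1) pw_mem[OF g(1)]] by blast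
  qed
  then show ?thesis using that g(1) by blast
qed

lemma combination_mem: "g \<in> L \<Longrightarrow> (\<Sum>i\<in>I. of_int (c i) * pw g (s i)) \<in> L"
  by (intro L_closed(6,7) pw_mem)

lemma residue_power_basis:
  assumes P: "prm P" "pL \<subseteq> P" and g: "g \<in> L" "\<And>x. x \<in> L \<Longrightarrow> x \<notin> P \<Longrightarrow> \<exists>i. x - pw g i \<in> P"
  obtains d where "pbasis p L P d (pw g)"
proof -
  have id: "idl P" and sg: "is_subgroup P" using prmD(1)[OF P(1)] idlD(1) by blast+
  define sp where "sp k \<longleftrightarrow> (\<exists>c. pw g k - lincomb k c (pw g) \<in> P)" for k
  have "\<exists>k. sp k"
  proof -
    obtain i j where ij: "i < j" "pw g i - pw g j \<in> P"
      using cosets_pigeonhole[OF ideal_finite_cosets[OF idl_L id P(2)] sg, of "pw g"] pw_mem[OF g(1)] by blast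
    have "(\<Sum>k<j. of_int (if k = i then 1 else 0) * pw g k) = (\<Sum>k<j. if k = i then pw g k else 0)"
      by (intro sum.cong) auto
    then have "pw g j - (\<Sum>k<j. of_int (if k = i then 1 else 0) * pw g k) = - (pw g i - pw g j)" using ij(1) by simp
    then have "pw g j - (\<Sum>k<j. of_int (if k = i then 1 else 0) * pw g k) \<in> P"
      using is_subgroup_uminus[OF sg ij(2)] by (simp only:)
    then show ?thesis unfolding sp_def by (intro exI)
  qed
  \<comment> \<open>The degree of the minimal polynomial of g over F_p. A relation of smaller degree
    whose top coefficient is a unit modulo p would put a smaller power of g into the span of its
    predecessors.\<close>
  define d where "d = (LEAST k. sp k)"
  have spd: "sp d" unfolding d_def using \<open>\<exists>k. sp k\<close> by (rule LeastI_ex)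
  have nsp: "\<not> sp k" if "k < d" for k using that not_less_Least unfolding d_def by blast
  have ind: "lincomb m c (pw g) \<in> P \<Longrightarrow> m \<le> d \<Longrightarrow> \<forall>i<m. int p dvd c i" for m c
  proof (induction m)
    case (Suc m)
    let ?s = "\<Sum>i<m. of_int (c i) * pw g i"
    have s: "?s + of_int (c m) * pw g m \<in> P" using Suc.prems by simp
    have "int p dvd c m"
    proof (rule ccontr)
      assume "\<not> int p dvd c m"
      then have "coprime (c m) (int p)" using prime_p by (metis coprime_commute prime_imp_coprime prime_nat_int_transfer)
      then obtain u where "[c m * u = 1] (mod int p)" using cong_solve_coprime_int by blast
      then obtain k where k: "c m * u = 1 + int p * k" by (metis cong_iff_lin cong_sym)
      have eq1: "(\<Sum>i<m. of_int (- u * c i) * pw g i) = - (of_int u * ?s)"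
        by (simp add: sum_distrib_left sum_negf mult.assoc)
      have "of_int (c m * u) * pw g m = pw g m + of_int k * (of_nat p * pw g m)" unfolding k by (simp add: algebra_simps)
      then have eq2: "pw g m - (\<Sum>i<m. of_int (- u * c i) * pw g i)
          = of_int u * (?s + of_int (c m) * pw g m) - of_int k * (of_nat p * pw g m)"
        unfolding eq1 by (simp add: algebra_simps)
      have "pw g m - (\<Sum>i<m. of_int (- u * c i) * pw g i) \<in> P"
        unfolding eq2 by (intro is_subgroup_diff[OF sg] is_subgroup_of_int[OF sg] s pL_memI[OF P(2)] pw_mem g)
      then have "sp m" unfolding sp_def by (intro exI[of _ "\<lambda>i. - u * c i"])
      then show False using nsp Suc.prems by simp
    qed
    moreover have "?s \<in> P"
    proof -
      obtain k where k: "c m = int p * k" using \<open>int p dvd c m\<close> by auto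
      have eq: "?s = (?s + of_int (c m) * pw g m) - of_int k * (of_nat p * pw g m)"
        unfolding k by (simp add: algebra_simps)
      show ?thesis by (subst eq) (intro is_subgroup_diff[OF sg] is_subgroup_of_int[OF sg] s pL_memI[OF P(2)] pw_mem g)
    qed
    ultimately show ?case using Suc by (auto simp: less_Suc_eq)
  qed simp
  \<comment> \<open>The span of 1, ..., g^(d-1) modulo P. It contains g^d, hence all powers of g,
    and these together with 0 exhaust L/P.\<close>
  define S where "S = {x \<in> L. \<exists>c. x - lincomb d c (pw g) \<in> P}"
  have S_sg: "is_subgroup S"
  proof (rule is_subgroupI)
    show "0 \<in> S" unfolding S_def using L_closed(1) is_subgroup_zero[OF sg] by (auto intro!: exI[of _ "\<lambda>_. 0"])
    fix x y assume "x \<in> S" "y \<in> S"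
    then obtain c e where c: "x \<in> L" "y \<in> L" "x - lincomb d c (pw g) \<in> P" "y - lincomb d e (pw g) \<in> P"
      unfolding S_def by blast
    have eq: "(x - y) - (\<Sum>i<d. of_int (c i - e i) * pw g i) = (x - lincomb d c (pw g)) - (y - lincomb d e (pw g))"
      unfolding sum_combination_diff[symmetric] by simp
    have "(x - y) - (\<Sum>i<d. of_int (c i - e i) * pw g i) \<in> P" unfolding eq by (intro is_subgroup_diff[OF sg] c)
    then show "x - y \<in> S" unfolding S_def using L_closed(2)[OF c(1,2)] by (auto intro!: exI[of _ "\<lambda>i. c i - e i"])
  qed
  have S_cong: "x \<in> S" if "x \<in> L" "x - y \<in> P" "y \<in> S" for x y
  proof -
    have "y \<in> S" by (rule that(3))
    then obtain c where c: "y - lincomb d c (pw g) \<in> P" unfolding S_def by blast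
    have eq: "x - lincomb d c (pw g) = (x - y) + (y - lincomb d c (pw g))" by simp
    have "x - lincomb d c (pw g) \<in> P" unfolding eq by (intro is_subgroup_add[OF sg] that c)
    then show ?thesis unfolding S_def using that(1) by blast
  qed
  have S_small: "pw g k \<in> S" if "k \<le> d" for k
  proof (cases "k = d")
    case True
    then show ?thesis unfolding S_def using spd pw_mem[OF g(1)] unfolding sp_def by auto
  next
    case False
    have "(\<Sum>i<d. of_int (if i = k then 1 else 0) * pw g i) = (\<Sum>i<d. if i = k then pw g i else 0)" by (intro sum.cong) auto
    then have "pw g k - (\<Sum>i<d. of_int (if i = k then 1 else 0) * pw g i) \<in> P" using that False is_subgroup_zero[OF sg] by simp
    then show ?thesis unfolding S_def using pw_mem[OF g(1)] by (intro CollectI conjI exI)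
  qed
  have S_pw: "pw g k \<in> S" for k
  proof (induction k)
    case 0 then show ?case using S_small[of 0] by simp
  next
    case (Suc k)
    then obtain c where c: "pw g k - lincomb d c (pw g) \<in> P" unfolding S_def by blast
    have "g \<star> (pw g k - lincomb d c (pw g)) \<in> P" by (rule idlD(3)[OF id g(1) c])
    then have "pw g (Suc k) - (\<Sum>i<d. of_int (c i) * pw g (Suc i)) \<in> P"
      by (simp add: mul_diff_right mul_sum_right mul_of_int_right pw_Suc)
    moreover have "(\<Sum>i<d. of_int (c i) * pw g (Suc i)) \<in> S"
      by (intro is_subgroup_sum[OF S_sg] is_subgroup_of_int[OF S_sg] S_small) auto
    ultimately show ?case using S_cong pw_mem[OF g(1)] by blast
  qed
  have "x \<in> S" if "x \<in> L" for x
  proof (cases "x \<in> P")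
    case True then show ?thesis using S_cong[OF that, of 0] is_subgroup_zero[OF S_sg] by simp
  next
    case False then show ?thesis using g(2)[OF that] S_cong[OF that] S_pw by blast
  qed
  then have "pbasis p L P d (pw g)" unfolding pbasis_def using ind pw_mem[OF g(1)] unfolding S_def by blast
  then show ?thesis using that by blast
qed

text \<open>Euler's formula: if h is the minimal polynomial of g, the trace of c is the coefficient
  of g^(d-1) in c h'(g). As h'(g) is a unit modulo P, there is a c with c h'(g) = g^(d-1) modulo P,
  and its trace is 1.\<close>

lemma residue_trace_nonzero:
  assumes P: "prm P" "pL \<subseteq> P"
  obtains c t where "c \<in> L" "ptrace p L P (\<lambda>x. c \<star> x) t" "\<not> int p dvd t"
proof -
  have id: "idl P" and sg: "is_subgroup P" using prmD(1)[OF P(1)] idlD(1) by blast+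
  obtain g where g: "g \<in> L" "\<And>x. x \<in> L \<Longrightarrow> x \<notin> P \<Longrightarrow> \<exists>i. x - pw g i \<in> P" using residue_field_generator[OF P] by blast
  obtain d where b: "pbasis p L P d (pw g)" using residue_power_basis[OF P g] by blast
  have d: "d > 0" using pbasis_nontrivial_pos[OF b one_mem prmD(2)[OF P(1)]] .
  have zero: "x - x \<in> P" for x using is_subgroup_zero[OF sg] by simp
  \<comment> \<open>Representatives of the coefficients of x in the basis of powers;
    \<open>co_cong\<close> makes them well defined modulo p.\<close>
  define co where "co x = (SOME c. x - lincomb d c (pw g) \<in> P)" for x
  have co: "x - lincomb d (co x) (pw g) \<in> P" if "x \<in> L" for x
    unfolding co_def by (rule someI_ex[OF pbasisD(2)[OF b that]])
  have co_cong: "[co x e = c e] (mod int p)" if "x \<in> L" "x - lincomb d c (pw g) \<in> P" "e < d" for x c e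
    by (rule pbasis_coeff_cong[OF b sg co[OF that(1)] that(2) zero that(3)])
  have co_sum: "[co x e = (\<Sum>i\<in>{i\<in>I. s i = e}. a i)] (mod int p)"
    if "x \<in> L" "finite I" "\<And>i. i \<in> I \<Longrightarrow> s i < d" "x - (\<Sum>i\<in>I. of_int (a i) * pw g (s i)) \<in> P" "e < d"
    for x and I :: "nat set" and s a e
  proof (rule co_cong[OF that(1) _ that(5)])
    have "(\<Sum>e<d. of_int (\<Sum>i\<in>{i\<in>I. s i = e}. a i) * pw g e) = (\<Sum>e<d. \<Sum>i\<in>{i\<in>I. s i = e}. of_int (a i) * pw g (s i))"
      unfolding of_int_sum sum_distrib_right by (intro sum.cong refl) auto
    also have "\<dots> = (\<Sum>i\<in>I. of_int (a i) * pw g (s i))"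
      using that(3) by (intro sum.group that(2)) auto
    finally show "x - (\<Sum>e<d. of_int (\<Sum>i\<in>{i\<in>I. s i = e}. a i) * pw g e) \<in> P" using that(4) by simp
  qed
  have co_lin: "[co x e = (\<Sum>l\<in>I. c l * co (y l) e)] (mod int p)"
    if "x \<in> L" "\<And>l. l \<in> I \<Longrightarrow> y l \<in> L" "x - (\<Sum>l\<in>I. of_int (c l) * y l) \<in> P" "e < d"
    for x and I :: "nat set" and c y e
  proof -
    have 1: "(\<Sum>l\<in>I. of_int (c l) * y l) - (\<Sum>l\<in>I. of_int (c l) * (\<Sum>i<d. of_int (co (y l) i) * pw g i)) \<in> P"
      using co that(2) by (intro sum_combination_cong_mod[OF sg]) auto
    have 2: "(\<Sum>l\<in>I. of_int (c l) * (\<Sum>i<d. of_int (co (y l) i) * pw g i)) = (\<Sum>i<d. of_int (\<Sum>l\<in>I. co (y l) i * c l) * pw g i)"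
      by (rule sum_combination_swap)
    have "x - (\<Sum>i<d. of_int (\<Sum>l\<in>I. co (y l) i * c l) * pw g i) \<in> P"
      using is_subgroup_add[OF sg that(3) 1] unfolding 2 by simp
    from co_cong[OF that(1) this that(4)] show ?thesis by (simp add: mult.commute)
  qed
  \<comment> \<open>The coefficients of the minimal polynomial h of g, monic of degree d.\<close>
  define hc where "hc i = (if i = d then 1 else - co (pw g d) i)" for i
  have "(\<Sum>i\<le>d. of_int (hc i) * pw g i) = pw g d - (\<Sum>i<d. of_int (co (pw g d) i) * pw g i)"
  proof -
    have "lincomb d hc (pw g) = (\<Sum>i<d. - (of_int (co (pw g d) i) * pw g i))"
      by (intro sum.cong refl) (auto simp: hc_def)
    then show ?thesis by (simp add: lessThan_Suc_atMost[symmetric] hc_def sum_negf)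
  qed
  then have hcP: "(\<Sum>i\<le>d. of_int (hc i) * pw g i) \<in> P" using co[OF pw_mem[OF g(1)], of d] by simp
  \<comment> \<open>The coefficient of X^j in h(X)/(X - g).\<close>
  define \<beta> where "\<beta> j = (\<Sum>i\<in>{j<..d}. of_int (hc i) * pw g (i - j - 1))" for j
  have \<beta>L: "\<beta> j \<in> L" for j unfolding \<beta>_def by (rule combination_mem[OF g(1)])
  text \<open>\<open>\<beta> 0, \<dots>, \<beta> (d - 1)\<close> is the dual basis of the powers of \<open>g\<close> for the coefficient functional of \<open>g\<^sup>d\<^sup>-\<^sup>1\<close>.\<close>
  have dual: "[co (pw g l \<star> \<beta> j) (d - 1) = (if l = j then 1 else 0)] (mod int p)" if lj: "l < d" "j < d" for l j
  proof (cases "l \<le> j")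
    \<comment> \<open>For l \<le> j no exponent in the product exceeds d - 1, and d - 1 itself
      occurs only for l = j and i = d, with coefficient 1.\<close>
    case True
    have "pw g l \<star> \<beta> j = (\<Sum>i\<in>{j<..d}. of_int (hc i) * pw g (l + (i - j - 1)))"
      by (simp only: \<beta>_def mul_sum_right mul_of_int_right pw_add[OF g(1)])
    then have "[co (pw g l \<star> \<beta> j) (d - 1) = (\<Sum>i\<in>{i\<in>{j<..d}. l + (i - j - 1) = d - 1}. hc i)] (mod int p)"
      using d True lj zero by (intro co_sum mul_mem pw_mem g \<beta>L) auto
    moreover have "{i\<in>{j<..d}. l + (i - j - 1) = d - 1} = (if l = j then {d} else {})" using True lj by auto
    ultimately show ?thesis by (simp add: hc_def split: if_splits)
  next
    case False
    \<comment> \<open>For l > j, g^(j+1) \<open>\<beta> j\<close> is the part of h(g) above degree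
      j, hence minus the part up to degree j modulo P. After the further factor g^k all exponents
      stay below d - 1.\<close>
    define k where "k = l - j - 1"
    have l: "l = k + Suc j" using False unfolding k_def by simp
    have "pw g (Suc j) \<star> \<beta> j = (\<Sum>i\<in>{j<..d}. of_int (hc i) * pw g i)"
      unfolding \<beta>_def by (auto simp: mul_sum_right mul_of_int_right simp flip: pw_add[OF g(1)] intro!: sum.cong)
    moreover have "(\<Sum>i\<le>d. of_int (hc i) * pw g i) = (\<Sum>i\<in>{j<..d}. of_int (hc i) * pw g i) + (\<Sum>i\<le>j. of_int (hc i) * pw g i)"
    proof -
      have "{..d} = {j<..d} \<union> {..j}" using lj by auto
      then show ?thesis by (simp only:) (intro sum.union_disjoint, auto)
    qed
    ultimately have "pw g (Suc j) \<star> \<beta> j + (\<Sum>i\<le>j. of_int (hc i) * pw g i) \<in> P" using hcP by simp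
    from idlD(3)[OF id pw_mem[OF g(1)] this, of k]
    moreover have gl: "pw g l = pw g k \<star> pw g (Suc j)" using pw_add[OF g(1), of k "Suc j"] l by simp
    ultimately have "pw g l \<star> \<beta> j + (\<Sum>i\<le>j. of_int (hc i) * pw g (k + i)) \<in> P"
      by (simp add: mul_distribs mul_sum_right mul_of_int_right pw_add[OF g(1), of k] mul_assoc)
    then have "pw g l \<star> \<beta> j - (\<Sum>i\<in>{..j}. of_int (- hc i) * pw g (k + i)) \<in> P" by (simp add: sum_negf)
    then have "[co (pw g l \<star> \<beta> j) (d - 1) = (\<Sum>i\<in>{i\<in>{..j}. k + i = d - 1}. - hc i)] (mod int p)"
      using d False lj l by (intro co_sum mul_mem pw_mem g \<beta>L) auto
    moreover have "{i\<in>{..j}. k + i = d - 1} = {}" using lj l by auto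
    ultimately show ?thesis using False by (simp only: sum.empty) auto
  qed
  have coeff: "[co x j = co (x \<star> \<beta> j) (d - 1)] (mod int p)" if x: "x \<in> L" and j: "j < d" for x j
  proof -
    have "\<beta> j \<star> (x - lincomb d (co x) (pw g)) \<in> P" by (rule idlD(3)[OF id \<beta>L co[OF x]])
    then have "x \<star> \<beta> j - (\<Sum>l<d. of_int (co x l) * (pw g l \<star> \<beta> j)) \<in> P"
      by (simp add: mul_diff_right mul_sum_right mul_of_int_right mul_comm[of "\<beta> j"])
    then have "[co (x \<star> \<beta> j) (d - 1) = (\<Sum>l<d. co x l * co (pw g l \<star> \<beta> j) (d - 1))] (mod int p)"
      using d by (intro co_lin mul_mem x \<beta>L pw_mem g) auto
    also have "[(\<Sum>l<d. co x l * co (pw g l \<star> \<beta> j) (d - 1)) = (\<Sum>l<d. co x l * (if l = j then 1 else 0))] (mod int p)"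
      using dual j by (intro cong_sum cong_mult cong_refl) auto
    also have "(\<Sum>l<d. co x l * (if l = j then 1 else 0)) = co x j" using j by (simp add: mult_delta_right)
    finally show ?thesis by (rule cong_sym)
  qed
  define \<delta> where "\<delta> = (\<Sum>j<d. pw g j \<star> \<beta> j)"
  have \<delta>L: "\<delta> \<in> L" unfolding \<delta>_def by (intro L_closed(7) mul_mem pw_mem g \<beta>L)
  have trace: "ptrace p L P (\<lambda>x. c \<star> x) (co (c \<star> \<delta>) (d - 1))" if c: "c \<in> L" for c
  proof -
    have "c \<star> \<delta> - (\<Sum>j<d. of_int 1 * ((c \<star> pw g j) \<star> \<beta> j)) \<in> P"
      unfolding \<delta>_def using zero by (simp add: mul_sum_right mul_assoc)
    then have "[co (c \<star> \<delta>) (d - 1) = (\<Sum>j<d. 1 * co ((c \<star> pw g j) \<star> \<beta> j) (d - 1))] (mod int p)"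
      using d by (intro co_lin mul_mem c \<delta>L pw_mem g \<beta>L) auto
    also have "[(\<Sum>j<d. 1 * co ((c \<star> pw g j) \<star> \<beta> j) (d - 1)) = (\<Sum>j<d. co (c \<star> pw g j) j)] (mod int p)"
    proof (intro cong_sum)
      fix j assume "j \<in> {..<d}"
      then show "[1 * co ((c \<star> pw g j) \<star> \<beta> j) (d - 1) = co (c \<star> pw g j) j] (mod int p)"
        using cong_sym[OF coeff[OF mul_mem[OF c pw_mem[OF g(1)]], of j j]] by simp
    qed
    finally have "[co (c \<star> \<delta>) (d - 1) = (\<Sum>j<d. co (c \<star> pw g j) j)] (mod int p)" .
    moreover have "\<forall>j<d. c \<star> pw g j - (\<Sum>i<d. of_int (co (c \<star> pw g j) i) * pw g i) \<in> P"
      using co mul_mem c pw_mem g by blast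
    ultimately show ?thesis
      unfolding ptrace_def using b by (intro exI[of _ d] exI[of _ "pw g"] exI[of _ "\<lambda>i j. co (c \<star> pw g j) i"]) simp
  qed
  text \<open>\<open>\<delta>\<close> is the derivative of the minimal polynomial of \<open>g\<close>; it does not vanish because finite fields are perfect.\<close>
  have \<delta>_eq: "\<delta> = (\<Sum>k<d. of_int (int (Suc k) * hc (Suc k)) * pw g k)"
  proof -
    have "\<delta> = (\<Sum>j<d. \<Sum>i\<in>{j<..d}. of_int (hc i) * pw g (i - 1))"
      unfolding \<delta>_def \<beta>_def
      by (auto simp: mul_sum_right mul_of_int_right simp flip: pw_add[OF g(1)] intro!: sum.cong)
    also have "\<dots> = (\<Sum>(j, i)\<in>Sigma {..<d} (\<lambda>j. {j<..d}). of_int (hc i) * pw g (i - 1))" by (simp add: sum.Sigma)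
    also have "\<dots> = (\<Sum>(k, j)\<in>Sigma {..<d} (\<lambda>k. {..k}). of_int (hc (Suc k)) * pw g k)"
      by (rule sum.reindex_bij_witness[of _ "\<lambda>(k, j). (j, Suc k)" "\<lambda>(j, i). (i - 1, j)"]) auto
    also have "\<dots> = (\<Sum>k<d. \<Sum>j\<le>k. of_int (hc (Suc k)) * pw g k)" by (rule sum.Sigma[symmetric]) auto
    also have "\<dots> = (\<Sum>k<d. of_int (int (Suc k) * hc (Suc k)) * pw g k)"
      by (intro sum.cong refl) (simp add: mult.assoc)
    finally show ?thesis .
  qed
  have "\<delta> \<notin> P"
  proof
    assume "\<delta> \<in> P"
    then have div: "int p dvd int (Suc k) * hc (Suc k)" if "k < d" for k
      using pbasisD(3)[OF b _ that, of "\<lambda>k. int (Suc k) * hc (Suc k)"] unfolding \<delta>_eq by blast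
    have "int p dvd int d" using div[of "d - 1"] d by (simp add: hc_def)
    then have "p dvd d" by simp
    then obtain m where m: "d = p * m" by (auto simp: dvd_def)
    have m0: "m > 0" using d m by simp
    have hcdiv: "int p dvd hc i" if "i \<le> d" "\<not> p dvd i" for i
    proof -
      have "i > 0" using that(2) by (cases i) auto
      then have "int p dvd int i * hc i" using div[of "i - 1"] that(1) by simp
      moreover have "\<not> int p dvd int i" using that(2) by simp
      ultimately show ?thesis using prime_p by (metis prime_dvd_multD prime_nat_int_transfer)
    qed
    \<comment> \<open>A p-th root of h(g): if modulo p only exponents divisible by p survive in h,
      the Frobenius gives \<open>?s\<close>^p = h(g) modulo P. So \<open>?s\<close> lies in P, which
      is a relation of degree m < d with leading coefficient 1.\<close>
    let ?s = "\<Sum>j\<le>m. of_int (hc (p * j)) * pw g j"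
    have sL: "?s \<in> L" by (rule combination_mem[OF g(1)])
    have split: "(\<Sum>i\<le>d. of_int (hc i) * pw g i) = (\<Sum>i\<in>{i. i \<le> d \<and> p dvd i}. of_int (hc i) * pw g i) + (\<Sum>i\<in>{i. i \<le> d \<and> \<not> p dvd i}. of_int (hc i) * pw g i)"
    proof -
      have "{..d} = {i. i \<le> d \<and> p dvd i} \<union> {i. i \<le> d \<and> \<not> p dvd i}" by auto
      then show ?thesis by (simp only:) (intro sum.union_disjoint, auto)
    qed
    have "(\<Sum>i\<in>{i. i \<le> d \<and> p dvd i}. of_int (hc i) * pw g i) = (\<Sum>j\<le>m. of_int (hc (p * j)) * pw g (p * j))"
      by (rule sum.reindex_bij_witness[of _ "\<lambda>j. p * j" "\<lambda>i. i div p"]) (use m p_gt in \<open>auto simp: less_eq_div_iff_mult_less_eq div_le_mono\<close>)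
    moreover have "(\<Sum>i\<in>{i. i \<le> d \<and> \<not> p dvd i}. of_int (hc i) * pw g i) \<in> P"
    proof (rule is_subgroup_sum[OF sg])
      fix i assume "i \<in> {i. i \<le> d \<and> \<not> p dvd i}"
      then obtain k where k: "hc i = int p * k" using hcdiv by blast
      have eq: "of_int (hc i) * pw g i = of_int k * (of_nat p * pw g i)" unfolding k by (simp add: ac_simps)
      show "of_int (hc i) * pw g i \<in> P" unfolding eq by (intro is_subgroup_of_int[OF sg] pL_memI[OF P(2)] pw_mem g)
    qed
    ultimately have 1: "(\<Sum>j\<le>m. of_int (hc (p * j)) * pw g (p * j)) \<in> P"
      using is_subgroup_diff[OF sg hcP] unfolding split by fastforce
    have "pw ?s p - (\<Sum>j\<le>m. of_int (hc (p * j)) * pw (pw g j) p) \<in> P"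
      using frobenius_sum[OF prime_p, of "{..m}" "pw g" "\<lambda>j. hc (p * j)"] pw_mem[OF g(1)] P(2) by blast
    then have "pw ?s p - (\<Sum>j\<le>m. of_int (hc (p * j)) * pw g (p * j)) \<in> P"
      by (simp add: pw_pw[OF g(1)] mult.commute)
    from is_subgroup_add[OF sg this 1] have "pw ?s p \<in> P" by simp
    then have sP: "?s \<in> P" using prm_pw[OF P(1) sL] by blast
    have "m < d" using m m0 p_gt by simp
    let ?c = "\<lambda>j. if j \<le> m then hc (p * j) else 0"
    have "(\<Sum>i<d. of_int (?c i) * pw g i) = (\<Sum>i\<in>{..m}. of_int (?c i) * pw g i)"
      by (rule sum.mono_neutral_right) (use \<open>m < d\<close> in auto)
    then have "(\<Sum>i<d. of_int (?c i) * pw g i) \<in> P" using sP by simp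
    then have "int p dvd ?c m" by (rule pbasisD(3)[OF b _ \<open>m < d\<close>])
    then have "int p dvd 1" using m by (simp add: hc_def)
    then show False using p_gt by simp
  qed
  then obtain y where y: "y \<in> L" "\<delta> \<star> y - one \<in> P" using prime_inverse[OF P \<delta>L] by blast
  \<comment> \<open>With y inverse to \<delta> modulo P, the product c \<delta> is congruent to
    g^(d-1), whose top coefficient is 1.\<close>
  define c where "c = y \<star> pw g (d - 1)"
  have cL: "c \<in> L" unfolding c_def by (intro mul_mem y pw_mem g)
  have "c \<star> \<delta> - pw g (d - 1) = pw g (d - 1) \<star> (\<delta> \<star> y - one)"
    unfolding c_def by (simp add: mul_diff_left mul_diff_right mul_one one_mul pw_mem g mul_ac)
  then have "c \<star> \<delta> - pw g (d - 1) \<in> P" using idlD(3)[OF id pw_mem[OF g(1)] y(2)] by simp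
  then have "[co (c \<star> \<delta>) (d - 1) = (\<Sum>i\<in>{i\<in>{0::nat}. d - 1 = d - 1}. 1)] (mod int p)"
    using d by (intro co_sum mul_mem cL \<delta>L) auto
  then have "[co (c \<star> \<delta>) (d - 1) = 1] (mod int p)" by simp
  then have "\<not> int p dvd co (c \<star> \<delta>) (d - 1)" using p_gt by (metis cong_dvd_iff int_dvd_int_iff int_ops(2) nat_dvd_1_iff_1 less_irrefl)
  then show ?thesis using that cL trace by blast
qed

end

section \<open>Counting points by residue fields\<close>

text \<open>The value at \<open>a\<close> of an integer polynomial of degree less than m, in a ring
  given as a record.\<close>

fun int_comb :: "('k, 'm) ring_scheme \<Rightarrow> (nat \<Rightarrow> int) \<Rightarrow> nat \<Rightarrow> 'k \<Rightarrow> 'k" where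
  "int_comb K c 0 a = \<zero>\<^bsub>K\<^esub>"
| "int_comb K c (Suc m) a = int_comb K c m a \<oplus>\<^bsub>K\<^esub> [c m] \<cdot>\<^bsub>K\<^esub> (a [^]\<^bsub>K\<^esub> m)"

context cring
begin

lemma int_comb_closed [simp]: "a \<in> carrier R \<Longrightarrow> int_comb R c m a \<in> carrier R"
  by (induction m) auto

lemma int_comb_add:
  "a \<in> carrier R \<Longrightarrow> int_comb R (\<lambda>i. c i + d i) m a = int_comb R c m a \<oplus> int_comb R d m a"
  by (induction m) (auto simp: add.int_pow_mult a_ac)

lemma int_comb_smult:
  "a \<in> carrier R \<Longrightarrow> int_comb R (\<lambda>i. k * c i) m a = [k] \<cdot> int_comb R c m a"
proof (induction m)
  case 0 then show ?case by (simp add: add.int_pow_one)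
next
  case (Suc m)
  then show ?case by (simp add: add.int_pow_distrib add.int_pow_pow mult.commute)
qed

lemma int_comb_cong_mod:
  assumes p: "[p] \<cdot> \<one> = \<zero>" and a: "a \<in> carrier R" and c: "\<And>i. i < m \<Longrightarrow> [c i = d i] (mod int p)"
  shows "int_comb R c m a = int_comb R d m a"
  using c
proof (induction m)
  case (Suc m)
  obtain k where k: "c m = d m + int p * k" using Suc.prems[of m] by (metis cong_iff_lin cong_sym lessI)
  have px: "[int p] \<cdot> x = \<zero>" if "x \<in> carrier R" for x
  proof -
    have "[p] \<cdot> x = [p] \<cdot> (\<one> \<otimes> x)" using that by simp
    also have "\<dots> = ([p] \<cdot> \<one>) \<otimes> x" using that by (simp add: add_pow_ldistr)
    finally show ?thesis using p that by (simp add: add_pow_int_ge)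
  qed
  have "[c m] \<cdot> (a [^] m) = [d m] \<cdot> (a [^] m) \<oplus> [k] \<cdot> ([int p] \<cdot> (a [^] m))"
    unfolding k using a by (simp add: add.int_pow_mult add.int_pow_pow)
  then have "[c m] \<cdot> (a [^] m) = [d m] \<cdot> (a [^] m)" using px[of "a [^] m"] a by (simp add: add.int_pow_one)
  then show ?case using Suc by simp
qed simp

lemma int_comb_single:
  "a \<in> carrier R \<Longrightarrow> int_comb R (\<lambda>i. if i = j then k else 0) m a = (if j < m then [k] \<cdot> (a [^] j) else \<zero>)"
  by (induction m) (auto simp: less_Suc_eq add_pow_int_ge)

lemma int_comb_shift:
  assumes a: "a \<in> carrier R"
  shows "a \<otimes> int_comb R c m a = int_comb R (\<lambda>i. if i = 0 then 0 else c (i - 1)) (Suc m) a"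
proof (induction m)
  case 0 then show ?case using a by (simp add: add_pow_int_ge)
next
  case (Suc m)
  have "a \<otimes> ([c m] \<cdot> (a [^] m)) = [c m] \<cdot> (a [^] Suc m)"
    using a by (simp add: add_pow_rdistr_int m_comm)
  then show ?case using a Suc by (simp add: r_distr)
qed

end

lemma (in ring) eval_map_rev:
  assumes "a \<in> carrier R" "\<And>i. i < m \<Longrightarrow> c i \<in> carrier R"
  shows "eval (map (\<lambda>i. [k i] \<cdot> \<one>) (rev [0..<m])) a = int_comb R k m a"
  using assms(1)
proof (induction m)
  case (Suc m)
  have "eval (map (\<lambda>i. [k i] \<cdot> \<one>) (rev [0..<Suc m])) a = ([k m] \<cdot> \<one>) \<otimes> a [^] m \<oplus> int_comb R k m a"
    using Suc by simp
  also have "\<dots> = int_comb R k m a \<oplus> [k m] \<cdot> (a [^] m)"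
  proof -
    have "int_comb R k m a \<in> carrier R" using assms(1) by (induction m) auto
    then show ?thesis using assms(1) by (simp add: add_pow_ldistr_int a_comm)
  qed
  finally show ?case by simp
qed simp

section \<open>Points with values in an algebraically closed field of characteristic p\<close>

context pring
begin

definition points :: "'k ring \<Rightarrow> (qvec \<Rightarrow> 'k) set" where
  "points K = ring_hom rng K \<inter> extensional L"

definition point_kernel :: "'k ring \<Rightarrow> (qvec \<Rightarrow> 'k) \<Rightarrow> qvec set" where
  "point_kernel K \<phi> = {x \<in> L. \<phi> x = \<zero>\<^bsub>K\<^esub>}"

context
  fixes K :: "'k ring"
  assumes K: "algebraically_closed K" and pK: "[p] \<cdot>\<^bsub>K\<^esub> \<one>\<^bsub>K\<^esub> = \<zero>\<^bsub>K\<^esub>"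
begin

interpretation K: algebraically_closed K by (rule K)

lemma hom_closed: "\<phi> \<in> ring_hom rng K \<Longrightarrow> x \<in> L \<Longrightarrow> \<phi> x \<in> carrier K"
  using ring_hom_closed[of \<phi> rng K x] by simp

lemma hom_add: "\<phi> \<in> ring_hom rng K \<Longrightarrow> x \<in> L \<Longrightarrow> y \<in> L \<Longrightarrow> \<phi> (x + y) = \<phi> x \<oplus>\<^bsub>K\<^esub> \<phi> y"
  using ring_hom_add[of \<phi> rng K x y] by simp

lemma hom_mult: "\<phi> \<in> ring_hom rng K \<Longrightarrow> x \<in> L \<Longrightarrow> y \<in> L \<Longrightarrow> \<phi> (x \<star> y) = \<phi> x \<otimes>\<^bsub>K\<^esub> \<phi> y"
  using ring_hom_mult[of \<phi> rng K x y] by simp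

lemma hom_one: "\<phi> \<in> ring_hom rng K \<Longrightarrow> \<phi> one = \<one>\<^bsub>K\<^esub>"
  using ring_hom_one[of \<phi> rng K] by simp

lemma hom_zero: "\<phi> \<in> ring_hom rng K \<Longrightarrow> \<phi> 0 = \<zero>\<^bsub>K\<^esub>"
  using ring_hom_zero[of \<phi> rng K] cring.axioms(1)[OF cring_rng] K.ring_axioms by simp

lemma hom_minus: "\<phi> \<in> ring_hom rng K \<Longrightarrow> x \<in> L \<Longrightarrow> \<phi> (- x) = \<ominus>\<^bsub>K\<^esub> \<phi> x"
  using hom_add[of \<phi> "- x" x] hom_zero[of \<phi>] hom_closed[of \<phi> x] hom_closed[of \<phi> "- x"] L_closed(3)[of x]
    K.minus_equality[of "\<phi> (- x)" "\<phi> x"] by simp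

lemma hom_of_nat: "\<phi> \<in> ring_hom rng K \<Longrightarrow> x \<in> L \<Longrightarrow> \<phi> (of_nat m * x) = [m] \<cdot>\<^bsub>K\<^esub> \<phi> x"
  using hom_add_pow(1)[OF cring.axioms(1)[OF cring_rng] K.ring_axioms, of \<phi> x m] rng_nat_multiple[of x m] by simp

lemma hom_of_int: "\<phi> \<in> ring_hom rng K \<Longrightarrow> x \<in> L \<Longrightarrow> \<phi> (of_int k * x) = [k] \<cdot>\<^bsub>K\<^esub> \<phi> x"
  using hom_add_pow(2)[OF cring.axioms(1)[OF cring_rng] K.ring_axioms, of \<phi> x k] rng_int_multiple[of x k] by simp

lemma hom_pw: "\<phi> \<in> ring_hom rng K \<Longrightarrow> x \<in> L \<Longrightarrow> \<phi> (pw x k) = \<phi> x [^]\<^bsub>K\<^esub> k"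
proof (induction k)
  case 0 then show ?case by (simp add: hom_one)
next
  case (Suc k)
  then show ?case using hom_mult[OF Suc.prems pw_mem] hom_closed by (simp add: pw_Suc K.m_comm)
qed

lemma hom_combination: "\<phi> \<in> ring_hom rng K \<Longrightarrow> g \<in> L \<Longrightarrow> \<phi> (lincomb m c (pw g)) = int_comb K c m (\<phi> g)"
proof (induction m)
  case 0 then show ?case by (simp add: hom_zero)
next
  case (Suc m)
  have "lincomb m c (pw g) \<in> L" by (rule combination_mem[OF Suc.prems(2)])
  then show ?case
    using Suc hom_add[OF Suc.prems(1) _ L_closed(6)[OF pw_mem[OF Suc.prems(2)]]]
      hom_of_int[OF Suc.prems(1) pw_mem[OF Suc.prems(2)]] hom_pw[OF Suc.prems] by simp
qed

lemma prm_point_kernel: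
  assumes \<phi>: "\<phi> \<in> ring_hom rng K" shows "point_kernel K \<phi> \<in> primes_above"
proof -
  have "is_subgroup (point_kernel K \<phi>)"
  proof (rule is_subgroupI)
    show "0 \<in> point_kernel K \<phi>" unfolding point_kernel_def using hom_zero[OF \<phi>] L_closed(1) by simp
    fix x y assume "x \<in> point_kernel K \<phi>" "y \<in> point_kernel K \<phi>"
    then have *: "x \<in> L" "y \<in> L" "\<phi> x = \<zero>\<^bsub>K\<^esub>" "\<phi> y = \<zero>\<^bsub>K\<^esub>" unfolding point_kernel_def by auto
    have "\<phi> (x + - y) = \<zero>\<^bsub>K\<^esub>" using * hom_add[OF \<phi> *(1) L_closed(3)[OF *(2)]] hom_minus[OF \<phi> *(2)] by simp
    then show "x - y \<in> point_kernel K \<phi>" unfolding point_kernel_def using L_closed(2)[OF *(1,2)] by simp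
  qed
  moreover have "r \<star> x \<in> point_kernel K \<phi>" if "r \<in> L" "x \<in> point_kernel K \<phi>" for r x
    using that hom_mult[OF \<phi>, of r x] hom_closed[OF \<phi>] mul_mem unfolding point_kernel_def by simp
  ultimately have "idl (point_kernel K \<phi>)" unfolding idl_def point_kernel_def by blast
  moreover have "one \<notin> point_kernel K \<phi>" unfolding point_kernel_def using hom_one[OF \<phi>] by simp
  moreover have "x \<in> point_kernel K \<phi> \<or> y \<in> point_kernel K \<phi>" if "x \<in> L" "y \<in> L" "x \<star> y \<in> point_kernel K \<phi>" for x y
    using that hom_mult[OF \<phi>, of x y] hom_closed[OF \<phi>] K.integral[of "\<phi> x" "\<phi> y"] unfolding point_kernel_def by simp
  moreover have "pL \<subseteq> point_kernel K \<phi>"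
  proof
    fix x assume "x \<in> pL"
    then obtain y where y: "y \<in> L" "x = of_nat p * y" unfolding smultiple_def by blast
    have "\<phi> x = [p] \<cdot>\<^bsub>K\<^esub> (\<one>\<^bsub>K\<^esub> \<otimes>\<^bsub>K\<^esub> \<phi> y)" using hom_of_nat[OF \<phi> y(1)] y hom_closed[OF \<phi> y(1)] by simp
    also have "\<dots> = ([p] \<cdot>\<^bsub>K\<^esub> \<one>\<^bsub>K\<^esub>) \<otimes>\<^bsub>K\<^esub> \<phi> y" using hom_closed[OF \<phi> y(1)] by (simp add: K.add_pow_ldistr)
    finally show "x \<in> point_kernel K \<phi>"
      unfolding point_kernel_def using pK y hom_closed[OF \<phi> y(1)] L_closed(5)[OF y(1)] by simp
  qed
  ultimately show ?thesis unfolding primes_above_def prm_def by blast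
qed

lemma frobenius_iter:
  assumes x: "x \<in> L" and y: "y \<in> L"
  shows "pw (x + y) (p ^ i) - (pw x (p ^ i) + pw y (p ^ i)) \<in> pL"
proof (induction i)
  case 0
  then show ?case using x y L_closed(4)[OF x y] is_subgroup_zero[OF idlD(1)[OF idl_pL]] by (simp add: pw_1)
next
  case (Suc i)
  let ?a = "pw x (p ^ i)" and ?b = "pw y (p ^ i)"
  have ab: "?a \<in> L" "?b \<in> L" using x y pw_mem by auto
  have 1: "pw (pw (x + y) (p ^ i)) p - pw (?a + ?b) p \<in> pL"
    by (rule idl_pw_cong[OF idl_pL pw_mem[OF L_closed(4)[OF x y]] L_closed(4)[OF ab] Suc])
  have 2: "pw (?a + ?b) p - (pw ?a p + pw ?b p) \<in> pL" by (rule frobenius_add[OF prime_p ab])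
  have "pw (pw (x + y) (p ^ i)) p - (pw ?a p + pw ?b p) \<in> pL"
    using is_subgroup_add[OF idlD(1)[OF idl_pL] 1 2] by (simp only: diff_add_cancel add_diff_eq)
  then show ?case by (simp add: pw_pw x y L_closed(4) mult.commute)
qed

text \<open>The points with kernel P are the embeddings of the finite field L/P into K. Evaluation
  at g identifies them with the roots of the minimal polynomial of g, so there are at most d;
  composing one of them with powers of the Frobenius yields d different ones.\<close>

lemma card_points_with_kernel:
  assumes PA: "P \<in> primes_above"
  shows "finite {\<phi> \<in> points K. point_kernel K \<phi> = P}" "card {\<phi> \<in> points K. point_kernel K \<phi> = P} = pdim P"
proof -
  have P: "prm P" "pL \<subseteq> P" using PA unfolding primes_above_def by auto
  have id: "idl P" and sg: "is_subgroup P" using prmD(1)[OF P(1)] idlD(1) by blast+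
  obtain g where g: "g \<in> L" "\<And>x. x \<in> L \<Longrightarrow> x \<notin> P \<Longrightarrow> \<exists>i. x - pw g i \<in> P" using residue_field_generator[OF P] by blast
  obtain d where b: "pbasis p L P d (pw g)" using residue_power_basis[OF P g] by blast
  have d: "d > 0" using pbasis_nontrivial_pos[OF b one_mem prmD(2)[OF P(1)]] .
  have pd: "pdim P = d" by (rule pdim_eq[OF id P(2) b])
  have zero: "x - x \<in> P" for x using is_subgroup_zero[OF sg] by simp
  define co where "co x = (SOME c. x - lincomb d c (pw g) \<in> P)" for x
  have co: "x - lincomb d (co x) (pw g) \<in> P" if "x \<in> L" for x
    unfolding co_def by (rule someI_ex[OF pbasisD(2)[OF b that]])
  have co_cong: "[co x e = c e] (mod int p)" if "x \<in> L" "x - lincomb d c (pw g) \<in> P" "e < d" for x c e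
    by (rule pbasis_coeff_cong[OF b sg co[OF that(1)] that(2) zero that(3)])
  \<comment> \<open>The minimal polynomial of g is X^d minus the polynomial with coefficients
    \<open>a\<close>. Z is its set of roots in K, and \<open>\<Phi> \<alpha>\<close> will be the
    point that sends g to \<alpha>.\<close>
  define a where "a = co (pw g d)"
  define Z where "Z = {\<alpha> \<in> carrier K. \<alpha> [^]\<^bsub>K\<^esub> d = int_comb K a d \<alpha>}"
  define W where "W = {\<phi> \<in> points K. point_kernel K \<phi> = P}"
  define \<Phi> where "\<Phi> \<alpha> = (\<lambda>x\<in>L. int_comb K (co x) d \<alpha>)" for \<alpha>
  have \<Phi>_eq: "\<Phi> \<alpha> x = int_comb K c d \<alpha>" if "\<alpha> \<in> carrier K" "x \<in> L" "x - lincomb d c (pw g) \<in> P" for \<alpha> x c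
    unfolding \<Phi>_def using that K.int_comb_cong_mod[OF pK that(1), of d "co x" c] co_cong by simp
  have \<Phi>_at: "\<Phi> \<alpha> x = int_comb K (co x) d \<alpha>" if "x \<in> L" for \<alpha> x using that by (simp add: \<Phi>_def)
  have \<Phi>_add: "\<Phi> \<alpha> (x + y) = \<Phi> \<alpha> x \<oplus>\<^bsub>K\<^esub> \<Phi> \<alpha> y" if "\<alpha> \<in> carrier K" "x \<in> L" "y \<in> L" for \<alpha> x y
  proof -
    have eq: "x + y - (\<Sum>i<d. of_int (co x i + co y i) * pw g i)
      = (x - lincomb d (co x) (pw g)) + (y - lincomb d (co y) (pw g))"
      by (simp add: sum.distrib algebra_simps)
    have "x + y - (\<Sum>i<d. of_int (co x i + co y i) * pw g i) \<in> P" unfolding eq by (intro is_subgroup_add[OF sg] co that)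
    from \<Phi>_eq[OF that(1) L_closed(4)[OF that(2,3)] this]
    show ?thesis unfolding K.int_comb_add[OF that(1)] \<Phi>_at[OF that(2)] \<Phi>_at[OF that(3)] .
  qed
  have \<Phi>_smult: "\<Phi> \<alpha> (of_int k * x) = [k] \<cdot>\<^bsub>K\<^esub> \<Phi> \<alpha> x" if "\<alpha> \<in> carrier K" "x \<in> L" for \<alpha> x k
  proof -
    have eq: "of_int k * x - (\<Sum>i<d. of_int (k * co x i) * pw g i) = of_int k * (x - lincomb d (co x) (pw g))"
      by (simp add: sum_distrib_left right_diff_distrib mult.assoc)
    have "of_int k * x - (\<Sum>i<d. of_int (k * co x i) * pw g i) \<in> P" unfolding eq by (intro is_subgroup_of_int[OF sg] co that)
    from \<Phi>_eq[OF that(1) L_closed(6)[OF that(2)] this]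
    show ?thesis unfolding K.int_comb_smult[OF that(1)] \<Phi>_at[OF that(2)] .
  qed
  have \<Phi>_P: "\<Phi> \<alpha> x = \<zero>\<^bsub>K\<^esub>" if "\<alpha> \<in> carrier K" "x \<in> P" for \<alpha> x
  proof -
    have "int_comb K (\<lambda>i. 0 * (0::int)) d \<alpha> = \<zero>\<^bsub>K\<^esub>"
      using K.int_comb_smult[OF that(1), of 0 "\<lambda>_. 0" d] that(1) by (simp add: add_pow_int_ge)
    then show ?thesis using \<Phi>_eq[OF that(1) idlD(2)[OF id that(2)], of "\<lambda>_. 0"] that(2) by simp
  qed
  have \<Phi>_cong: "\<Phi> \<alpha> x = \<Phi> \<alpha> y" if "\<alpha> \<in> carrier K" "x \<in> L" "y \<in> L" "x - y \<in> P" for \<alpha> x y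
    using \<Phi>_add[OF that(1) that(3) idlD(2)[OF id that(4)]] \<Phi>_P[OF that(1,4)] that(1,3) by (simp add: \<Phi>_def)
  have \<Phi>_one: "\<Phi> \<alpha> one = \<one>\<^bsub>K\<^esub>" if "\<alpha> \<in> carrier K" for \<alpha>
  proof -
    have "(\<Sum>i<d. of_int (if i = 0 then 1 else 0) * pw g i) = (\<Sum>i<d. if i = 0 then pw g i else 0)" by (intro sum.cong) auto
    then have "one - (\<Sum>i<d. of_int (if i = 0 then 1 else 0) * pw g i) \<in> P" using d zero by simp
    then show ?thesis using \<Phi>_eq[OF that one_mem] K.int_comb_single[OF that, of 0 1 d] d that by simp
  qed
  have \<Phi>_g: "\<Phi> \<alpha> (g \<star> x) = \<alpha> \<otimes>\<^bsub>K\<^esub> \<Phi> \<alpha> x" if \<alpha>: "\<alpha> \<in> Z" and x: "x \<in> L" for \<alpha> x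
  proof -
    have \<alpha>K: "\<alpha> \<in> carrier K" and \<alpha>d: "\<alpha> [^]\<^bsub>K\<^esub> d = int_comb K a d \<alpha>" using \<alpha> unfolding Z_def by auto
    let ?c = "co x"
    \<comment> \<open>Multiplication by g shifts the coefficients of x up by one; the one that
      reaches g^d is distributed over the lower powers by means of \<open>a\<close>.\<close>
    let ?s = "\<lambda>i. if i = 0 then 0 else ?c (i - 1)"
    let ?e = "\<lambda>i. ?s i + ?c (d - 1) * a i"
    have "(\<Sum>i<Suc d. of_int (?s i) * pw g i) = (\<Sum>i<d. of_int (?c i) * pw g (Suc i))"
      by (subst sum.lessThan_Suc_shift) simp
    then have "(\<Sum>i<d. of_int (?s i) * pw g i) + of_int (?c (d - 1)) * pw g d = g \<star> (\<Sum>i<d. of_int (?c i) * pw g i)"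
      using d by (simp add: mul_sum_right mul_of_int_right pw_Suc)
    moreover have "(\<Sum>i<d. of_int (?e i) * pw g i) = (\<Sum>i<d. of_int (?s i) * pw g i) + of_int (?c (d - 1)) * (lincomb d a (pw g))"
      by (simp add: sum.distrib sum_distrib_left algebra_simps)
    ultimately have eq: "g \<star> x - (\<Sum>i<d. of_int (?e i) * pw g i)
      = g \<star> (x - (\<Sum>i<d. of_int (?c i) * pw g i)) + of_int (?c (d - 1)) * (pw g d - lincomb d a (pw g))"
      by (simp add: mul_diff_right algebra_simps)
    have aP: "pw g d - lincomb d a (pw g) \<in> P" unfolding a_def by (rule co[OF pw_mem[OF g(1)]])
    have "g \<star> x - (\<Sum>i<d. of_int (?e i) * pw g i) \<in> P"
      unfolding eq by (intro is_subgroup_add[OF sg] is_subgroup_of_int[OF sg] idlD(3)[OF id g(1)] co[OF x] aP)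
    then have "\<Phi> \<alpha> (g \<star> x) = int_comb K ?e d \<alpha>" by (rule \<Phi>_eq[OF \<alpha>K mul_mem[OF g(1) x]])
    also have "\<dots> = int_comb K ?s d \<alpha> \<oplus>\<^bsub>K\<^esub> [?c (d - 1)] \<cdot>\<^bsub>K\<^esub> (\<alpha> [^]\<^bsub>K\<^esub> d)"
      unfolding \<alpha>d K.int_comb_add[OF \<alpha>K] K.int_comb_smult[OF \<alpha>K] ..
    also have "\<dots> = int_comb K ?s (Suc d) \<alpha>" using d by simp
    also have "\<dots> = \<alpha> \<otimes>\<^bsub>K\<^esub> \<Phi> \<alpha> x" using K.int_comb_shift[OF \<alpha>K, of ?c d] x by (simp add: \<Phi>_def)
    finally show ?thesis .
  qed
  have \<Phi>_carr: "\<Phi> \<alpha> x \<in> carrier K" if "\<alpha> \<in> carrier K" "x \<in> L" for \<alpha> x using that by (simp add: \<Phi>_def)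
  have \<Phi>_pw: "\<Phi> \<alpha> (pw g i \<star> x) = \<alpha> [^]\<^bsub>K\<^esub> i \<otimes>\<^bsub>K\<^esub> \<Phi> \<alpha> x" if "\<alpha> \<in> Z" "x \<in> L" for \<alpha> x i
  proof (induction i)
    case 0 then show ?case using that \<Phi>_carr[of \<alpha> x] by (simp add: one_mul Z_def)
  next
    case (Suc i)
    have "\<Phi> \<alpha> (pw g (Suc i) \<star> x) = \<alpha> \<otimes>\<^bsub>K\<^esub> \<Phi> \<alpha> (pw g i \<star> x)"
      using \<Phi>_g[OF that(1) mul_mem[OF pw_mem[OF g(1)] that(2)]] by (simp add: pw_Suc mul_assoc)
    also have "\<dots> = \<alpha> [^]\<^bsub>K\<^esub> Suc i \<otimes>\<^bsub>K\<^esub> \<Phi> \<alpha> x"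
    proof -
      have "\<alpha> \<in> carrier K" using that unfolding Z_def by auto
      then show ?thesis unfolding Suc using that(2) \<Phi>_carr[of \<alpha> x] K.m_comm[of \<alpha> "\<alpha> [^]\<^bsub>K\<^esub> i"]
        by (simp add: K.m_assoc[symmetric])
    qed
    finally show ?case .
  qed
  have \<Phi>_comb: "\<Phi> \<alpha> ((lincomb m c (pw g)) \<star> x) = int_comb K c m \<alpha> \<otimes>\<^bsub>K\<^esub> \<Phi> \<alpha> x" if "\<alpha> \<in> Z" "x \<in> L" for \<alpha> x m c
  proof (induction m)
    case 0 then show ?case using that \<Phi>_carr[of \<alpha> x] \<Phi>_P[of \<alpha> 0] is_subgroup_zero[OF sg] by (simp add: Z_def)
  next
    case (Suc m)
    have \<alpha>K: "\<alpha> \<in> carrier K" using that unfolding Z_def by auto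
    have "\<Phi> \<alpha> ((lincomb (Suc m) c (pw g)) \<star> x) = \<Phi> \<alpha> ((lincomb m c (pw g)) \<star> x) \<oplus>\<^bsub>K\<^esub> \<Phi> \<alpha> (of_int (c m) * (pw g m \<star> x))"
      using \<Phi>_add[OF \<alpha>K mul_mem[OF combination_mem[OF g(1)] that(2)] L_closed(6)[OF mul_mem[OF pw_mem[OF g(1)] that(2)]]]
      by (simp add: mul_add_left mul_of_int_left)
    also have "\<dots> = int_comb K c m \<alpha> \<otimes>\<^bsub>K\<^esub> \<Phi> \<alpha> x \<oplus>\<^bsub>K\<^esub> ([c m] \<cdot>\<^bsub>K\<^esub> (\<alpha> [^]\<^bsub>K\<^esub> m)) \<otimes>\<^bsub>K\<^esub> \<Phi> \<alpha> x"
      unfolding Suc \<Phi>_smult[OF \<alpha>K mul_mem[OF pw_mem[OF g(1)] that(2)]] \<Phi>_pw[OF that]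
      using \<alpha>K \<Phi>_carr[OF \<alpha>K that(2)] by (simp add: K.add_pow_ldistr_int)
    also have "\<dots> = int_comb K c (Suc m) \<alpha> \<otimes>\<^bsub>K\<^esub> \<Phi> \<alpha> x" using \<alpha>K \<Phi>_carr[OF \<alpha>K that(2)] by (simp add: K.l_distr)
    finally show ?case .
  qed
  have \<Phi>_mult: "\<Phi> \<alpha> (y \<star> x) = \<Phi> \<alpha> y \<otimes>\<^bsub>K\<^esub> \<Phi> \<alpha> x" if "\<alpha> \<in> Z" "x \<in> L" "y \<in> L" for \<alpha> x y
  proof -
    have \<alpha>K: "\<alpha> \<in> carrier K" using that unfolding Z_def by auto
    have "y \<star> x - lincomb d (co y) (pw g) \<star> x \<in> P"
      using idlD(4)[OF id that(2) co[OF that(3)]] by (simp add: mul_diff_left)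
    from \<Phi>_cong[OF \<alpha>K mul_mem[OF that(3,2)] mul_mem[OF combination_mem[OF g(1)] that(2)] this]
    show ?thesis unfolding \<Phi>_comb[OF that(1,2)] using that(3) by (simp add: \<Phi>_def)
  qed
  have \<Phi>_hom: "\<Phi> \<alpha> \<in> ring_hom rng K" if "\<alpha> \<in> Z" for \<alpha>
    using that \<Phi>_carr \<Phi>_mult \<Phi>_add \<Phi>_one by (intro ring_hom_memI) (auto simp: Z_def)
  have \<Phi>_X: "\<Phi> \<alpha> \<in> W" if "\<alpha> \<in> Z" for \<alpha>
  proof -
    have "P \<subseteq> point_kernel K (\<Phi> \<alpha>)" unfolding point_kernel_def using \<Phi>_P that idlD(2)[OF id] by (auto simp: Z_def)
    then have "P = point_kernel K (\<Phi> \<alpha>)"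
      using prime_not_subset[OF P] prm_point_kernel[OF \<Phi>_hom[OF that]] unfolding primes_above_def by blast
    then show ?thesis unfolding W_def points_def using \<Phi>_hom[OF that] by (simp add: \<Phi>_def)
  qed
  have \<Phi>_at_g: "\<Phi> \<alpha> g = \<alpha>" if "\<alpha> \<in> Z" for \<alpha>
    using \<Phi>_g[OF that one_mem] \<Phi>_one[of \<alpha>] that g(1) by (simp add: Z_def mul_one)
  have ker: "x \<in> P \<longleftrightarrow> \<phi> x = \<zero>\<^bsub>K\<^esub>" if "\<phi> \<in> W" "x \<in> L" for \<phi> x
    using that unfolding W_def point_kernel_def by blast
  have X_hom: "\<phi> \<in> ring_hom rng K" if "\<phi> \<in> W" for \<phi> using that unfolding W_def points_def by blast
  have X_eq: "\<phi> x = \<phi> y" if "\<phi> \<in> W" "x \<in> L" "y \<in> L" "x - y \<in> P" for \<phi> x y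
  proof -
    have "\<phi> (x - y) = \<zero>\<^bsub>K\<^esub>" using ker[OF that(1) idlD(2)[OF id that(4)]] that(4) by blast
    moreover have "\<phi> x = \<phi> (x - y) \<oplus>\<^bsub>K\<^esub> \<phi> y"
      using hom_add[OF X_hom[OF that(1)] idlD(2)[OF id that(4)] that(3)] by simp
    ultimately show ?thesis using hom_closed[OF X_hom[OF that(1)] that(3)] by simp
  qed
  have X_Z: "\<phi> g \<in> Z" if "\<phi> \<in> W" for \<phi>
    using X_eq[OF that pw_mem[OF g(1)] combination_mem[OF g(1)] co[OF pw_mem[OF g(1)], of d]]
      hom_pw[OF X_hom[OF that] g(1)] hom_combination[OF X_hom[OF that] g(1)] hom_closed[OF X_hom[OF that] g(1)]
    unfolding Z_def a_def by simp
  have X_\<Phi>: "\<phi> = \<Phi> (\<phi> g)" if "\<phi> \<in> W" for \<phi>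
  proof
    fix x show "\<phi> x = \<Phi> (\<phi> g) x"
    proof (cases "x \<in> L")
      case True
      then show ?thesis
        using X_eq[OF that True combination_mem[OF g(1)] co[OF True]] hom_combination[OF X_hom[OF that] g(1)]
        by (simp add: \<Phi>_def)
    next
      case False
      then show ?thesis using that unfolding W_def points_def \<Phi>_def by (auto simp: extensional_def)
    qed
  qed
  have bij: "bij_betw \<Phi> Z W"
    using \<Phi>_X \<Phi>_at_g X_Z X_\<Phi> by (intro bij_betw_byWitness[where f' = "\<lambda>\<phi>. \<phi> g"]) auto
  define F where "F = map (\<lambda>i. [(if i = d then 1 else - a i)] \<cdot>\<^bsub>K\<^esub> \<one>\<^bsub>K\<^esub>) (rev [0..<Suc d])"
  have F_poly: "F \<in> carrier (poly_ring K)"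
  proof -
    have "set F \<subseteq> carrier K" unfolding F_def using K.add.int_pow_closed[OF K.one_closed] by auto
    moreover have "hd F = \<one>\<^bsub>K\<^esub>" unfolding F_def by (simp add: add_pow_int_ge)
    ultimately show ?thesis unfolding univ_poly_carrier[symmetric] polynomial_def by simp
  qed
  have F_deg: "length F - 1 = d" unfolding F_def by simp
  have F_eval: "K.eval F \<alpha> = \<zero>\<^bsub>K\<^esub> \<longleftrightarrow> \<alpha> \<in> Z" if "\<alpha> \<in> carrier K" for \<alpha>
  proof -
    have "K.eval F \<alpha> = int_comb K (\<lambda>i. if i = d then 1 else - a i) (Suc d) \<alpha>"
      unfolding F_def by (rule K.eval_map_rev[OF that]) (auto simp: K.zero_closed)
    also have "\<dots> = int_comb K (\<lambda>i. - 1 * a i) d \<alpha> \<oplus>\<^bsub>K\<^esub> \<alpha> [^]\<^bsub>K\<^esub> d"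
    proof -
      have "int_comb K (\<lambda>i. if i = d then 1 else - a i) m \<alpha> = int_comb K (\<lambda>i. - 1 * a i) m \<alpha>" if "m \<le> d" for m
        using that by (induction m) auto
      then show ?thesis using that by simp
    qed
    also have "\<dots> = \<ominus>\<^bsub>K\<^esub> int_comb K a d \<alpha> \<oplus>\<^bsub>K\<^esub> \<alpha> [^]\<^bsub>K\<^esub> d"
      unfolding K.int_comb_smult[OF that] using that by (simp add: K.add.int_pow_neg)
    finally have ev: "K.eval F \<alpha> = \<ominus>\<^bsub>K\<^esub> int_comb K a d \<alpha> \<oplus>\<^bsub>K\<^esub> \<alpha> [^]\<^bsub>K\<^esub> d" .
    show ?thesis
    proof
      assume "K.eval F \<alpha> = \<zero>\<^bsub>K\<^esub>"
      then have "\<ominus>\<^bsub>K\<^esub> (\<alpha> [^]\<^bsub>K\<^esub> d) = \<ominus>\<^bsub>K\<^esub> int_comb K a d \<alpha>"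
        using ev that K.minus_equality[of "\<ominus>\<^bsub>K\<^esub> int_comb K a d \<alpha>" "\<alpha> [^]\<^bsub>K\<^esub> d"] by simp
      then have "\<alpha> [^]\<^bsub>K\<^esub> d = int_comb K a d \<alpha>"
        by (metis K.minus_minus K.nat_pow_closed K.int_comb_closed that)
      then show "\<alpha> \<in> Z" using that unfolding Z_def by simp
    next
      assume "\<alpha> \<in> Z" then show "K.eval F \<alpha> = \<zero>\<^bsub>K\<^esub>" unfolding ev using that by (simp add: Z_def K.l_neg)
    qed
  qed
  have Fne: "F \<noteq> []" unfolding F_def by simp
  have Z_roots: "Z = set_mset (K.roots F)"
    using K.roots_mem_iff_is_root[OF F_poly] F_eval Fne unfolding K.is_root_def Z_def by auto
  have Zfin: "finite Z" unfolding Z_roots by simp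
  have "card Z \<le> size (K.roots F)"
    using size_mset_mono[OF mset_set_set_mset_msubset[of "K.roots F"]] unfolding Z_roots by simp
  then have card_le: "card Z \<le> d" using K.size_roots_le_degree[OF F_poly] F_deg by simp
  \<comment> \<open>Roots are counted with multiplicity here, so this gives only the existence of
    one point; the Frobenius provides distinct ones.\<close>
  have "size (K.roots F) = d" using K.roots_over_carrier[OF F_poly] F_deg unfolding K.splitted_def by simp
  then have "K.roots F \<noteq> {#}" using d by auto
  then obtain \<alpha> where \<alpha>: "\<alpha> \<in> Z" unfolding Z_roots by blast
  define \<phi> where "\<phi> = \<Phi> \<alpha>"
  have \<phi>W: "\<phi> \<in> W" unfolding \<phi>_def by (rule \<Phi>_X[OF \<alpha>])
  have \<phi>h: "\<phi> \<in> ring_hom rng K" by (rule X_hom[OF \<phi>W])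
  \<comment> \<open>The composite of \<phi> with the i-th iterate of the Frobenius of L/P.\<close>
  define \<psi> where "\<psi> i = (\<lambda>x\<in>L. \<phi> (pw x (p ^ i)))" for i
  have ppos: "p ^ i > 0" for i using p_gt by simp
  have \<psi>h: "\<psi> i \<in> ring_hom rng K" for i
  proof (rule ring_hom_memI)
    fix x y assume xy: "x \<in> carrier rng" "y \<in> carrier rng"
    then have xy': "x \<in> L" "y \<in> L" by auto
    show "\<psi> i x \<in> carrier K" using xy' hom_closed[OF \<phi>h pw_mem] by (simp add: \<psi>_def)
    show "\<psi> i (x \<otimes>\<^bsub>rng\<^esub> y) = \<psi> i x \<otimes>\<^bsub>K\<^esub> \<psi> i y"
      using xy' hom_mult[OF \<phi>h pw_mem pw_mem] mul_mem by (simp add: \<psi>_def pw_mult_distrib)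
    have "\<phi> (pw (x + y) (p ^ i)) = \<phi> (pw x (p ^ i) + pw y (p ^ i))"
      using frobenius_iter[OF xy'] P(2) by (intro X_eq[OF \<phi>W] pw_mem L_closed(4) xy') blast
    then show "\<psi> i (x \<oplus>\<^bsub>rng\<^esub> y) = \<psi> i x \<oplus>\<^bsub>K\<^esub> \<psi> i y"
      using xy' hom_add[OF \<phi>h pw_mem pw_mem] L_closed(4)[OF xy'] by (simp add: \<psi>_def)
  next
    show "\<psi> i \<one>\<^bsub>rng\<^esub> = \<one>\<^bsub>K\<^esub>" using one_mem hom_one[OF \<phi>h] by (simp add: \<psi>_def pw_one)
  qed
  have \<psi>W: "\<psi> i \<in> W" for i
  proof -
    have "point_kernel K (\<psi> i) = P"
    proof (intro equalityI subsetI)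
      fix x assume "x \<in> point_kernel K (\<psi> i)"
      then have "x \<in> L" "pw x (p ^ i) \<in> P" using ker[OF \<phi>W pw_mem] unfolding point_kernel_def \<psi>_def by auto
      then show "x \<in> P" using prm_pw[OF P(1)] by blast
    next
      fix x assume x: "x \<in> P"
      then have "pw x (p ^ i) \<in> P" using idl_pw[OF id _ ppos] by blast
      then show "x \<in> point_kernel K (\<psi> i)"
        using ker[OF \<phi>W pw_mem] idlD(2)[OF id x] unfolding point_kernel_def \<psi>_def by auto
    qed
    then show ?thesis using \<psi>h unfolding W_def points_def \<psi>_def by simp
  qed
  have inj: "inj_on (\<lambda>i. \<psi> i g) {..<d}"
  proof (rule linorder_inj_onI')
    fix i j assume ij: "i \<in> {..<d}" "j \<in> {..<d}" "i < j"
    show "\<psi> i g \<noteq> \<psi> j g"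
    proof
      assume eq: "\<psi> i g = \<psi> j g"
      define k where "k = j - i"
      have k: "k > 0" "k < d" "j = k + i" using ij unfolding k_def by auto
      let ?y = "pw g (p ^ k)"
      have yL: "?y \<in> L" by (rule pw_mem[OF g(1)])
      have "\<psi> i g = \<psi> i ?y" using eq g(1) yL by (simp add: \<psi>_def pw_pw k(3) power_add)
      moreover have "g - ?y \<in> L" by (intro L_closed(2) g yL)
      moreover have "\<psi> i g = \<psi> i (g - ?y) \<oplus>\<^bsub>K\<^esub> \<psi> i ?y" using hom_add[OF \<psi>h[of i] \<open>g - ?y \<in> L\<close> yL] by simp
      ultimately have "\<psi> i (g - ?y) = \<zero>\<^bsub>K\<^esub>"
        using hom_closed[OF \<psi>h[of i]] yL g(1) K.add.r_cancel_one'[of "\<psi> i ?y" "\<psi> i (g - ?y)"] by simp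
      then have gy: "g - ?y \<in> P" using ker[OF \<psi>W \<open>g - ?y \<in> L\<close>] by blast
      have "g \<notin> P"
      proof
        assume "g \<in> P"
        have "(\<Sum>i<d. of_int (if i = 1 then 1 else 0) * pw g i) = (\<Sum>i<d. if i = 1 then pw g i else 0)" by (intro sum.cong) auto
        then have "(\<Sum>i<d. of_int (if i = 1 then 1 else 0) * pw g i) \<in> P" using k \<open>g \<in> P\<close> pw_1[OF g(1)] by simp
        then have "int p dvd (if (1::nat) = 1 then 1 else 0)" by (rule pbasisD(3)[OF b]) (use k in simp)
        then show False using p_gt by simp
      qed
      \<comment> \<open>Agreement of two conjugates at g means g^(p^k) = g modulo P with 0 < k < d,
        so g^q = 1. As the powers of g exhaust the nonzero classes, L/P would have at most 1 + q =
        p^k < p^d elements.\<close>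
      define q where "q = p ^ k - 1"
      have qS: "p ^ k = Suc q" unfolding q_def using ppos[of k] by simp
      have "g \<star> (one - pw g q) = g - ?y" unfolding qS by (simp add: mul_diff_right mul_one g pw_Suc)
      then have "g \<star> (one - pw g q) \<in> P" using gy by simp
      then have gq: "one - pw g q \<in> P"
        using prmD(3)[OF P(1) g(1) L_closed(2)[OF one_mem pw_mem[OF g(1)]]] \<open>g \<notin> P\<close> by blast
      have step: "pw g (m + q * t) - pw g m \<in> P" for m t
      proof (induction t)
        case 0 then show ?case using zero by simp
      next
        case (Suc t)
        have "pw g (m + q * Suc t) = pw g (m + q * t) \<star> pw g q"
          using pw_add[OF g(1), of "m + q * t" q] by (simp add: algebra_simps)
        then have eq2: "pw g (m + q * Suc t) - pw g m = (pw g (m + q * t) - pw g m) - pw g (m + q * t) \<star> (one - pw g q)"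
          by (simp add: mul_diff_right mul_one pw_mem g)
        show ?case unfolding eq2 by (intro is_subgroup_diff[OF sg] Suc idlD(3)[OF id pw_mem[OF g(1)] gq])
      qed
      have q0: "q > 0" using power_gt_expt[of p k] p_gt k unfolding q_def by simp
      let ?C = "\<lambda>x. {y \<in> L. y - x \<in> P}"
      have "cosets_mod L P \<subseteq> insert (?C 0) ((\<lambda>m. ?C (pw g m)) ` {..<q})"
      proof
        fix C assume "C \<in> cosets_mod L P"
        then obtain x where x: "x \<in> L" "C = ?C x" unfolding cosets_mod_def by blast
        show "C \<in> insert (?C 0) ((\<lambda>m. ?C (pw g m)) ` {..<q})"
        proof (cases "x \<in> P")
          case True
          then show ?thesis using coset_eq_iff[OF sg x(1) L_closed(1)] x(2) by simp
        next
          case False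
          then obtain m where m: "x - pw g m \<in> P" using g(2) x(1) by blast
          have "pw g m - pw g (m mod q) \<in> P" using step[of "m mod q" "m div q"] by simp
          from is_subgroup_add[OF sg m this] have "x - pw g (m mod q) \<in> P" by simp
          then have "C = ?C (pw g (m mod q))" using coset_eq_iff[OF sg x(1) pw_mem[OF g(1)]] x(2) by blast
          then show ?thesis using q0 by auto
        qed
      qed
      then have "card (cosets_mod L P) \<le> card (insert (?C 0) ((\<lambda>m. ?C (pw g m)) ` {..<q}))" by (intro card_mono) auto
      also have "\<dots> \<le> Suc (card ((\<lambda>m. ?C (pw g m)) ` {..<q}))" by (rule card_insert_le_m1) auto
      also have "\<dots> \<le> Suc q" using card_image_le[of "{..<q}" "\<lambda>m. ?C (pw g m)"] by simp
      finally have "p ^ d \<le> p ^ k" using card_cosets_mod(2)[OF p_gt(2) subgroup_L sg pL_memI[OF P(2)] b] qS by simp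
      then show False using k(2) p_gt power_increasing_iff[of p d k] by simp
    qed
  qed
  have "(\<lambda>i. \<psi> i g) ` {..<d} \<subseteq> Z" using X_Z \<psi>W by blast
  then have "card ((\<lambda>i. \<psi> i g) ` {..<d}) \<le> card Z" by (rule card_mono[OF Zfin])
  then have "d \<le> card Z" using card_image[OF inj] by simp
  then have "card Z = d" using card_le by simp
  then have "card W = d" using bij_betw_same_card[OF bij] by simp
  moreover have "finite W" using bij_betw_finite[OF bij] Zfin by blast
  ultimately show "finite {\<phi> \<in> points K. point_kernel K \<phi> = P}" "card {\<phi> \<in> points K. point_kernel K \<phi> = P} = pdim P"
    unfolding W_def pd by auto
qed

theorem card_points: "card (points K) = pdim nilrad"
proof -
  have "points K = (\<Union>P\<in>primes_above. {\<phi> \<in> points K. point_kernel K \<phi> = P})"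
    using prm_point_kernel unfolding points_def by blast
  then have "card (points K) = (\<Sum>P\<in>primes_above. card {\<phi> \<in> points K. point_kernel K \<phi> = P})"
    using card_UN_disjoint[OF finite_primes_above, of "\<lambda>P. {\<phi> \<in> points K. point_kernel K \<phi> = P}"] card_points_with_kernel(1) by auto
  then show ?thesis unfolding pdim_nilrad by (simp add: card_points_with_kernel(2))
qed

end

end

section \<open>The discriminant\<close>

definition fmat :: "nat \<Rightarrow> (nat \<Rightarrow> nat \<Rightarrow> 'a) \<Rightarrow> 'a mat" where
  "fmat n M = Matrix.mat n n (\<lambda>(i, j). M i j)"

lemma fmat_carrier [simp]: "fmat n M \<in> carrier_mat n n"
  by (simp add: fmat_def)

lemma fmat_dims [simp]: "dim_row (fmat n M) = n" "dim_col (fmat n M) = n"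
  by (simp_all add: fmat_def)

lemma fmat_index [simp]: "i < n \<Longrightarrow> j < n \<Longrightarrow> fmat n M $$ (i, j) = M i j"
  by (simp add: fmat_def)

lemma fmat_mult: "fmat n M * fmat n N = fmat n (\<lambda>i j. \<Sum>k<n. M i k * N k j :: 'a::semiring_0)"
  by (rule eq_matI) (auto simp: scalar_prod_def atLeast0LessThan)

lemma fmat_transpose: "transpose_mat (fmat n M) = fmat n (\<lambda>i j. M j i)"
  by (rule eq_matI) auto

lemma fmat_cong: "(\<And>i j. i < n \<Longrightarrow> j < n \<Longrightarrow> M i j = N i j) \<Longrightarrow> fmat n M = fmat n N"
  by (rule eq_matI) auto

lemma det_fmat_cong_mod:
  assumes "\<And>i j. i < n \<Longrightarrow> j < n \<Longrightarrow> [M i j = N i j] (mod (m :: int))"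
  shows "[Determinant.det (fmat n M) = Determinant.det (fmat n N)] (mod m)"
proof -
  have "[(\<Sum>\<pi> | \<pi> permutes {0..<n}. signof \<pi> * (\<Prod>i = 0..<n. fmat n M $$ (i, \<pi> i)))
      = (\<Sum>\<pi> | \<pi> permutes {0..<n}. signof \<pi> * (\<Prod>i = 0..<n. fmat n N $$ (i, \<pi> i)))] (mod m)"
  proof (intro cong_sum cong_mult cong_refl cong_prod)
    fix \<pi> i assume "\<pi> \<in> {\<pi>. \<pi> permutes {0..<n}}" "i \<in> {0..<n}"
    then have "i < n" "\<pi> i < n" by (auto simp: permutes_in_image)
    then show "[fmat n M $$ (i, \<pi> i) = fmat n N $$ (i, \<pi> i)] (mod m)" using assms by simp
  qed
  then show ?thesis by (simp add: Determinant.det_def)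
qed

lemma det_fmat_scale_rows:
  "Determinant.det (fmat n (\<lambda>i j. s i * M i j)) = (\<Prod>i<n. s i) * Determinant.det (fmat n M :: 'a::comm_ring_1 mat)"
proof -
  have "Determinant.det (fmat n (\<lambda>i j. s i * M i j))
    = (\<Sum>\<pi> | \<pi> permutes {0..<n}. signof \<pi> * (\<Prod>i = 0..<n. s i * fmat n M $$ (i, \<pi> i)))"
    unfolding Determinant.det_def
    by (auto intro!: sum.cong prod.cong simp: permutes_in_image)
  also have "\<dots> = (\<Prod>i<n. s i) * Determinant.det (fmat n M)"
    by (simp add: Determinant.det_def prod.distrib sum_distrib_left ac_simps atLeast0LessThan)
  finally show ?thesis .
qed

text \<open>Multiplying by the adjugate shows that the determinant annihilates kernel vectors modulo
  p. Conversely, a trivial kernel makes the matrix an injective, hence surjective, self-map of the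
  finite set (Z/p)^n; preimages of the unit vectors form a right inverse, so the determinant is a
  unit modulo p.\<close>

lemma prime_dvd_det_iff_kernel:
  fixes M :: "nat \<Rightarrow> nat \<Rightarrow> int"
  assumes p: "Factorial_Ring.prime p"
  shows "int p dvd Determinant.det (fmat n M) \<longleftrightarrow>
    (\<exists>c. (\<exists>i<n. \<not> int p dvd c i) \<and> (\<forall>i<n. int p dvd (\<Sum>j<n. M i j * c j)))"
proof
  assume "\<exists>c. (\<exists>i<n. \<not> int p dvd c i) \<and> (\<forall>i<n. int p dvd (\<Sum>j<n. M i j * c j))"
  then obtain c i where c: "i < n" "\<not> int p dvd c i" "\<And>i. i < n \<Longrightarrow> int p dvd (\<Sum>j<n. M i j * c j)" by blast
  define N where "N = adj_mat (fmat n M)"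
  have Nc: "N \<in> carrier_mat n n" and NM: "N * fmat n M = Determinant.det (fmat n M) \<cdot>\<^sub>m 1\<^sub>m n"
    unfolding N_def using adj_mat[OF fmat_carrier, of n M] by auto
  have entry: "(\<Sum>k<n. N $$ (i, k) * M k j) = (if i = j then Determinant.det (fmat n M) else 0)" if "j < n" for j
  proof -
    have "(N * fmat n M) $$ (i, j) = (Determinant.det (fmat n M) \<cdot>\<^sub>m 1\<^sub>m n) $$ (i, j)" unfolding NM ..
    then show ?thesis using that c(1) Nc by (simp add: scalar_prod_def atLeast0LessThan)
  qed
  have "(\<Sum>k<n. N $$ (i, k) * (\<Sum>j<n. M k j * c j)) = (\<Sum>j<n. (\<Sum>k<n. N $$ (i, k) * M k j) * c j)"
    by (simp add: sum_distrib_left sum_distrib_right mult.assoc) (rule sum.swap)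
  also have "\<dots> = (\<Sum>j<n. if i = j then Determinant.det (fmat n M) * c j else 0)"
    by (intro sum.cong refl) (auto simp: entry)
  also have "\<dots> = Determinant.det (fmat n M) * c i" using c(1) by simp
  finally have sum_eq: "(\<Sum>k<n. N $$ (i, k) * (\<Sum>j<n. M k j * c j)) = Determinant.det (fmat n M) * c i" .
  have "int p dvd (\<Sum>k<n. N $$ (i, k) * (\<Sum>j<n. M k j * c j))"
    by (rule dvd_sum) (use c(3) in \<open>blast intro: dvd_mult\<close>)
  then have "int p dvd Determinant.det (fmat n M) * c i" unfolding sum_eq .
  then show "int p dvd Determinant.det (fmat n M)" using c(2) p by (metis prime_dvd_multD prime_nat_int_transfer)
next
  assume dvd: "int p dvd Determinant.det (fmat n M)"
  have p0: "int p > 0" "int p > 1" using p prime_gt_0_nat prime_gt_1_nat by auto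
  show "\<exists>c. (\<exists>i<n. \<not> int p dvd c i) \<and> (\<forall>i<n. int p dvd (\<Sum>j<n. M i j * c j))"
  proof (rule ccontr)
    assume none: "\<nexists>c. (\<exists>i<n. \<not> int p dvd c i) \<and> (\<forall>i<n. int p dvd (\<Sum>j<n. M i j * c j))"
    have ker: "\<forall>i<n. int p dvd c i" if "\<And>i. i < n \<Longrightarrow> int p dvd (\<Sum>j<n. M i j * c j)" for c
      using spec[OF none[unfolded not_ex], of c] that by blast
    let ?C = "{..<n} \<rightarrow>\<^sub>E {0..<int p}"
    define f where "f c = (\<lambda>i\<in>{..<n}. (\<Sum>j<n. M i j * c j) mod int p)" for c
    have fC: "f ` ?C \<subseteq> ?C"
    proof
      fix z assume "z \<in> f ` ?C"
      then obtain c where "z = f c" by blast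
      then show "z \<in> ?C" unfolding f_def using p0 by (auto simp: restrict_def PiE_def extensional_def)
    qed
    have "inj_on f ?C"
    proof (rule inj_onI)
      fix c d assume cd: "c \<in> ?C" "d \<in> ?C" "f c = f d"
      have "int p dvd (\<Sum>j<n. M i j * (c j - d j))" if "i < n" for i
      proof -
        have "f c i = f d i" using cd(3) by simp
        then have "(\<Sum>j<n. M i j * c j) mod int p = (\<Sum>j<n. M i j * d j) mod int p" using that unfolding f_def by simp
        then show ?thesis by (simp add: mod_eq_dvd_iff right_diff_distrib sum_subtractf)
      qed
      then have "\<forall>i<n. int p dvd c i - d i" by (rule ker)
      then have "c i = d i" if "i < n" for i
        using that cd PiE_mem[OF cd(1), of i] PiE_mem[OF cd(2), of i]
        by (metis atLeastLessThan_iff lessThan_iff mod_eq_dvd_iff mod_pos_pos_trivial)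
      then show "c = d" using cd by (intro PiE_ext) auto
    qed
    moreover have "finite ?C" by (intro finite_PiE) auto
    ultimately have surj: "f ` ?C = ?C" using fC by (simp add: endo_inj_surj)
    have "\<exists>c. \<forall>i<n. [(\<Sum>j<n. M i j * c j) = (if i = k then 1 else 0)] (mod int p)" for k
    proof -
      have "(\<lambda>i\<in>{..<n}. if i = k then 1 else 0) \<in> ?C" using p0 by auto
      then have "(\<lambda>i\<in>{..<n}. if i = k then 1 else 0) \<in> f ` ?C" using surj by simp
      then obtain c where c: "(\<lambda>i\<in>{..<n}. if i = k then 1 else 0) = f c" "c \<in> ?C" by (rule imageE)
      have "[(\<Sum>j<n. M i j * c j) = (if i = k then 1 else 0)] (mod int p)" if "i < n" for i
        using fun_cong[OF c(1), of i] that p0 unfolding f_def cong_def by (auto split: if_splits)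
      then show ?thesis by blast
    qed
    then obtain N where N: "\<And>k i. i < n \<Longrightarrow> [(\<Sum>j<n. M i j * N k j) = (if i = k then 1 else 0)] (mod int p)" by metis
    have "fmat n M * fmat n (\<lambda>j k. N k j) = fmat n (\<lambda>i k. \<Sum>j<n. M i j * N k j)" by (rule fmat_mult)
    then have "Determinant.det (fmat n M) * Determinant.det (fmat n (\<lambda>j k. N k j)) = Determinant.det (fmat n (\<lambda>i k. \<Sum>j<n. M i j * N k j))"
      using det_mult[OF fmat_carrier fmat_carrier] by metis
    moreover have "[Determinant.det (fmat n (\<lambda>i k. \<Sum>j<n. M i j * N k j)) = Determinant.det (fmat n (\<lambda>i k. if i = k then 1 else 0))] (mod int p)"
      using N by (intro det_fmat_cong_mod)
    moreover have "fmat n (\<lambda>i k. if i = k then 1 else 0) = (1\<^sub>m n :: int mat)" by (rule eq_matI) auto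
    ultimately have "[Determinant.det (fmat n M) * Determinant.det (fmat n (\<lambda>j k. N k j)) = 1] (mod int p)" by simp
    moreover have "int p dvd Determinant.det (fmat n M) * Determinant.det (fmat n (\<lambda>j k. N k j))" using dvd by simp
    ultimately have "int p dvd 1" using cong_dvd_iff by blast
    then show False using p0 by simp
  qed
qed


text \<open>With M i = \<phi>^i(L) + pL, the map sends M i into M (i+1), so every graded piece
  contributes trace 0; nilpotence makes the chain end at pL.\<close>

lemma nilpotent_trace:
  assumes p: "Factorial_Ring.prime p" and L: "is_subgroup L" and l: "zbasis n L l"
    and \<phi>: "additive_map \<phi>" "\<And>x. x \<in> L \<Longrightarrow> \<phi> x \<in> L" and nil: "\<And>x. x \<in> L \<Longrightarrow> (\<phi> ^^ k) x \<in> smultiple p L"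
  shows "\<exists>t. trace_on n \<phi> = of_int (int p * t)"
proof -
  have pL: "is_subgroup (smultiple p L)" by (rule is_subgroup_smultiple[OF L])
  have add: "additive_map (\<phi> ^^ i)" for i
    by (induction i) (auto simp: additive_map_def additive_map_add[OF \<phi>(1)])
  have mem: "(\<phi> ^^ i) x \<in> L" if "x \<in> L" for i x using that \<phi>(2) by (induction i) auto
  define M where "M i = {x \<in> L. \<exists>y\<in>L. x - (\<phi> ^^ i) y \<in> smultiple p L}" for i
  have MI: "x \<in> M i" if "y \<in> L" "x \<in> L" "x - (\<phi> ^^ i) y \<in> smultiple p L" for x y i using that unfolding M_def by blast
  have M_sg: "is_subgroup (M i)" for i
  proof (rule is_subgroupI)
    show "0 \<in> M i" by (rule MI[of 0]) (simp_all add: additive_map_zero[OF add] is_subgroup_zero[OF L] is_subgroup_zero[OF pL])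
    fix x y assume "x \<in> M i" "y \<in> M i"
    then obtain a b where ab: "x \<in> L" "y \<in> L" "a \<in> L" "b \<in> L" "x - (\<phi> ^^ i) a \<in> smultiple p L" "y - (\<phi> ^^ i) b \<in> smultiple p L"
      unfolding M_def by blast
    have eq: "x - y - (\<phi> ^^ i) (a - b) = (x - (\<phi> ^^ i) a) - (y - (\<phi> ^^ i) b)" by (simp add: additive_map_diff[OF add])
    show "x - y \<in> M i"
      by (rule MI[of "a - b"]) (use ab is_subgroup_diff[OF L] is_subgroup_diff[OF pL] in \<open>auto simp only: eq\<close>)
  qed
  have pM: "smultiple p L \<subseteq> M i" for i
    using smultiple_subset[OF L, of p] is_subgroup_zero[OF L]
    by (auto intro!: MI[of 0] simp: additive_map_zero[OF add])
  have M_dec: "M (Suc i) \<subseteq> M i" for i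
  proof
    fix x assume "x \<in> M (Suc i)"
    then obtain y where y: "x \<in> L" "y \<in> L" "x - (\<phi> ^^ Suc i) y \<in> smultiple p L" unfolding M_def by blast
    then show "x \<in> M i" using MI[of "\<phi> y" x i] \<phi>(2) by (simp add: funpow_swap1)
  qed
  have M_sub: "M i \<subseteq> L" for i unfolding M_def by blast
  have \<phi>M: "\<phi> x \<in> M (Suc i)" if x: "x \<in> M i" for x i
  proof -
    obtain y where y: "x \<in> L" "y \<in> L" "x - (\<phi> ^^ i) y \<in> smultiple p L" using x unfolding M_def by blast
    have "\<phi> (x - (\<phi> ^^ i) y) \<in> smultiple p L"
      using y(3) \<phi>(2) unfolding smultiple_def by (auto simp: additive_map_of_nat[OF \<phi>(1)])
    then have "\<phi> x - (\<phi> ^^ Suc i) y \<in> smultiple p L" by (simp add: additive_map_diff[OF \<phi>(1)])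
    then show ?thesis using MI y \<phi>(2) by blast
  qed
  have fin: "finite (cosets_mod L (smultiple p L))" by (rule zbasis_finite_cosets[OF L l]) (use p prime_gt_0_nat in auto)
  have pm: "of_nat p * x \<in> M i" if "x \<in> L" for x i using smultiple_mem[OF that] pM by blast
  have "ptrace p L (M i) \<phi> 0" for i
  proof (induction i)
    case 0
    have "M 0 = L"
    proof (intro equalityI M_sub subsetI)
      fix x assume "x \<in> L" then show "x \<in> M 0" using MI[of x x 0] is_subgroup_zero[OF pL] by simp
    qed
    then show ?case using ptrace_zeroI[OF pbasis_self[OF L]] \<phi>(2) by metis
  next
    case (Suc i)
    have "finite (cosets_mod (M i) (M (Suc i)))" by (rule finite_cosets_mod_mono[OF fin M_sub pM pL M_sg])
    then obtain r v where "pbasis p (M i) (M (Suc i)) r v"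
      using pbasis_exists[OF p M_sg M_sg] pm M_sub by blast
    then have "ptrace p (M i) (M (Suc i)) \<phi> 0" using ptrace_zeroI \<phi>M by blast
    then show ?case using ptrace_cat[OF L M_sg M_sg M_sub M_dec pm Suc] by simp
  qed
  moreover have "M k = smultiple p L"
  proof
    show "M k \<subseteq> smultiple p L"
    proof
      fix x assume "x \<in> M k"
      then obtain y where "y \<in> L" "x - (\<phi> ^^ k) y \<in> smultiple p L" unfolding M_def by blast
      then show "x \<in> smultiple p L" using is_subgroup_add[OF pL, of "x - (\<phi> ^^ k) y"] nil by fastforce
    qed
  qed (rule pM)
  ultimately have "ptrace p L (smultiple p L) \<phi> 0" by metis
  from trace_on_lattice_cong[OF L l \<phi> this] obtain t where t: "trace_on n \<phi> = of_int t" "[t = 0] (mod int p)" by blast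
  then obtain s where "t = int p * s" by (auto simp: cong_0_iff)
  then show ?thesis using t(1) by blast
qed

section \<open>Rational algebras with integral structure constants\<close>

locale qalg =
  fixes n :: nat and mul :: "qvec \<Rightarrow> qvec \<Rightarrow> qvec" (infixl "\<star>" 70) and one :: qvec
  assumes Z_ring: "mring mul one (intvecs n)"
begin

sublocale Z: mring mul one "intvecs n" by (rule Z_ring)

lemma mul_qspace: "x \<in> qspace n \<Longrightarrow> y \<in> qspace n \<Longrightarrow> x \<star> y \<in> qspace n"
proof -
  assume "x \<in> qspace n" "y \<in> qspace n"
  then obtain M N where MN: "M > 0" "of_nat M * x \<in> intvecs n" "N > 0" "of_nat N * y \<in> intvecs n"
    using qspace_common_denominator by blast
  have "of_nat (M * N) * (x \<star> y) = (of_nat M * x) \<star> (of_nat N * y)" by (simp add: Z.mul_scalars mult.assoc)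
  then have "of_nat (M * N) * (x \<star> y) \<in> qspace n" using Z.mul_mem[OF MN(2,4)] intvecs_subset_qspace by auto
  then have "cst (1 / of_nat (M * N)) * (of_nat (M * N) * (x \<star> y)) \<in> qspace n" by (rule qspace_cst)
  then show ?thesis using MN of_nat_mult_cst(2)[of "M * N"] by simp
qed

lemma one_mul_qspace: "x \<in> qspace n \<Longrightarrow> one \<star> x = x"
proof -
  assume "x \<in> qspace n"
  then obtain N where N: "N > 0" "of_nat N * x \<in> intvecs n" using qspace_common_denominator by blast
  have "of_nat N * (one \<star> x) = of_nat N * x" using Z.one_mul[OF N(2)] by (simp add: Z.mul_scalars)
  moreover have "N \<noteq> 0" using N(1) by simp
  ultimately show ?thesis using qvec_of_nat_mult_cancel by blast
qed

sublocale Q: mring mul one "qspace n"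
  by unfold_locales
    (fact Z.mul_assoc Z.mul_comm Z.mul_add_left is_subgroup_qspace mul_qspace one_mul_qspace
      subsetD[OF intvecs_subset_qspace Z.one_mem])+

definition tr :: "qvec \<Rightarrow> rat" where
  "tr a = trace_on n (\<lambda>x. a \<star> x)"

lemma tr_add: "tr (a + b) = tr a + tr b"
  by (simp add: tr_def trace_on_def Z.mul_add_left sum.distrib qvec_apply)

lemma tr_cst: "tr (cst q * a) = q * tr a"
  by (simp add: tr_def trace_on_def Z.mul_cst_left sum_distrib_left qvec_apply)

lemma tr_of_int: "tr (of_int k * a) = of_int k * tr a"
  using tr_cst[of "of_int k" a] by (simp add: cst_simps)

lemma tr_of_nat: "tr (of_nat k * a) = of_nat k * tr a"
  using tr_cst[of "of_nat k" a] by (simp add: cst_simps)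

lemma tr_diff: "tr (a - b) = tr a - tr b"
  using tr_add[of "a - b" b] by simp

lemma tr_sum: "tr (sum f I) = (\<Sum>i\<in>I. tr (f i))"
proof -
  have "tr 0 = 0" using tr_diff[of 0 0] by simp
  then show ?thesis by (induction I rule: infinite_finite_induct) (auto simp: tr_add)
qed

lemma tr_Ints: "a \<in> intvecs n \<Longrightarrow> tr a \<in> \<int>"
  unfolding tr_def using trace_on_lattice_Ints[OF zbasis_evec Z.additive_map_mul] Z.mul_mem by blast

text \<open>The floor is exact on \<open>intvecs n\<close>, where the trace is integral.\<close>

definition itr :: "qvec \<Rightarrow> int" where "itr a = \<lfloor>tr a\<rfloor>"

lemma of_int_itr: "a \<in> intvecs n \<Longrightarrow> of_int (itr a) = tr a"
  unfolding itr_def using tr_Ints of_int_floor by blast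

lemma itr_add: "a \<in> intvecs n \<Longrightarrow> b \<in> intvecs n \<Longrightarrow> itr (a + b) = itr a + itr b"
  using of_int_itr[of a] of_int_itr[of b] of_int_itr[of "a + b"] Z.L_closed(4)[of a b] tr_add[of a b]
  by (metis of_int_add of_int_eq_iff)

lemma itr_of_int: "a \<in> intvecs n \<Longrightarrow> itr (of_int k * a) = k * itr a"
  using of_int_itr[of a] of_int_itr[of "of_int k * a"] Z.L_closed(6)[of a k] tr_of_int[of k a]
  by (metis of_int_mult of_int_eq_iff)

lemma itr_of_nat: "a \<in> intvecs n \<Longrightarrow> itr (of_nat k * a) = int k * itr a"
  using itr_of_int[of a "int k"] by simp

lemma itr_diff: "a \<in> intvecs n \<Longrightarrow> b \<in> intvecs n \<Longrightarrow> itr (a - b) = itr a - itr b"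
  using itr_add[of "a - b" b] Z.L_closed(2)[of a b] by simp

lemma itr_sum: "(\<And>i. i \<in> I \<Longrightarrow> f i \<in> intvecs n) \<Longrightarrow> itr (sum f I) = (\<Sum>i\<in>I. itr (f i))"
proof (induction I rule: infinite_finite_induct)
  case (insert i I)
  then show ?case using itr_add[of "f i" "sum f I"] Z.L_closed(7)[of I f] by simp
qed (use itr_of_int[OF Z.L_closed(1), of 0] in simp_all)

lemma itr_combination:
  "(\<And>i. i \<in> I \<Longrightarrow> y i \<in> intvecs n) \<Longrightarrow> itr (\<Sum>i\<in>I. of_int (c i) * y i) = (\<Sum>i\<in>I. c i * itr (y i))"
  using itr_sum[of I "\<lambda>i. of_int (c i) * y i"] Z.L_closed(6) itr_of_int by simp

definition disc :: int where
  "disc = Determinant.det (fmat n (\<lambda>i j. itr (evec i \<star> evec j)))"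

end

section \<open>The discriminant at p\<close>

locale qalg_prime = qalg +
  fixes p :: nat
  assumes prime_p': "Factorial_Ring.prime p"
begin

sublocale Zp: pring mul one "intvecs n" p
  by unfold_locales (use prime_p' zbasis_finite_cosets[OF is_subgroup_intvecs zbasis_evec] prime_gt_0_nat in auto)

abbreviation "R \<equiv> intvecs n"
abbreviation "J \<equiv> Zp.nilrad"

lemma nilrad_trace: "u \<in> J \<Longrightarrow> int p dvd itr u"
proof -
  assume "u \<in> J"
  then obtain k where u: "u \<in> R" "Z.pw u k \<in> smultiple p R" unfolding Zp.nilrad_def by blast
  have iter: "((\<lambda>x. u \<star> x) ^^ k) x = Z.pw u k \<star> x" if "x \<in> R" for x k
    using that by (induction k) (auto simp: Z.one_mul Z.pw_Suc Z.mul_assoc)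
  have "\<exists>t. trace_on n (\<lambda>x. u \<star> x) = of_int (int p * t)"
  proof (rule nilpotent_trace[OF prime_p' is_subgroup_intvecs zbasis_evec Z.additive_map_mul])
    show "u \<star> x \<in> R" if "x \<in> R" for x by (rule Z.mul_mem[OF u(1) that])
    show "((\<lambda>x. u \<star> x) ^^ k) x \<in> smultiple p R" if "x \<in> R" for x
      unfolding iter[OF that] by (rule Z.idlD(4)[OF Zp.idl_pL that u(2)])
  qed
  then obtain t where "tr u = of_int (int p * t)" unfolding tr_def by blast
  then have "itr u = int p * t" unfolding itr_def by (metis floor_of_int)
  then show ?thesis by simp
qed

text \<open>Nondegeneracy modulo \<open>p\<close> of the pairing \<open>(w, r) \<mapsto> tr (w r) / p\<close> between \<open>J\<close> and \<open>R\<close>.\<close>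

definition cond_E :: bool where
  "cond_E \<longleftrightarrow> (\<forall>w\<in>J. (\<forall>r\<in>R. int p ^ 2 dvd itr (w \<star> r)) \<longrightarrow> w \<in> smultiple p J)"

text \<open>Take a basis \<open>w\<close> of R/pR adapted to J: f vectors for R/J, then m = n - f
  vectors of J. In its Gram matrix the rows of the latter are divisible by p, so up to a square
  prime to p the discriminant is p^m det T, with T the matrix of the pairing in bases of J/pJ and
  R/pR. The last two claims are nondegeneracy of T modulo p on the side of J and on the side of
  R.\<close>

lemma discriminant_criterion:
  assumes d0: "disc \<noteq> 0"
  shows "n \<le> Zp.pdim J + multiplicity (int p) disc"
    and "n = Zp.pdim J + multiplicity (int p) disc \<longleftrightarrow> cond_E"
    and "n = Zp.pdim J + multiplicity (int p) disc \<Longrightarrow> y \<in> R \<Longrightarrow> (\<And>w. w \<in> J \<Longrightarrow> int p ^ 2 dvd itr (w \<star> y)) \<Longrightarrow> y \<in> smultiple p R"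
proof -
  note p_gt = Zp.p_gt
  have idJ: "Z.idl J" "smultiple p R \<subseteq> J" by (rule Zp.idl_nilrad)+
  have sgJ: "is_subgroup J" and sgp: "is_subgroup (smultiple p R)" and sgR: "is_subgroup R"
    using Z.idlD(1)[OF idJ(1)] Z.idlD(1)[OF Zp.idl_pL] is_subgroup_intvecs by blast+
  have JR: "J \<subseteq> R" using Z.idlD(2)[OF idJ(1)] by blast
  define f where "f = Zp.pdim J"
  obtain v where v: "pbasis p R J f v" using Zp.pdim_basis[OF idJ] unfolding f_def by blast
  obtain m x where x: "pbasis p J (smultiple p R) m x" using Zp.ideal_pbasis[OF idJ(1) Zp.idl_pL] by blast
  define w where "w = cat_seq f v x"
  have w: "pbasis p R (smultiple p R) (f + m) w"
    unfolding w_def by (rule pbasis_cat[OF sgR sgJ sgp JR idJ(2) smultiple_mem v x])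
  have n: "n = f + m"
    using pbasis_unique_dim[OF p_gt(1) sgR sgp smultiple_mem zbasis_pbasis[OF sgR zbasis_evec] w] .
  have wR: "w i \<in> R" if "i < n" for i using pbasisD(1)[OF w] that n by simp
  have wJ: "w i \<in> J" if "f \<le> i" "i < n" for i
  proof -
    have "w i = x (i - f)" using that unfolding w_def cat_seq_def by simp
    then show ?thesis using pbasisD(1)[OF x, of "i - f"] that n by simp
  qed
  \<comment> \<open>\<open>w\<close> is a basis modulo p only, so this base change matrix has
    determinant prime to p rather than 1 or -1.\<close>
  define B where "B i j = \<lfloor>w j i\<rfloor>" for i j
  have wB: "w j = (\<Sum>i<n. of_int (B i j) * evec i)" if "j < n" for j
    unfolding B_def by (rule intvecs_expansion[OF wR[OF that]])
  define G where "G i j = itr (evec i \<star> evec j)" for i j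
  have itr_w: "itr (w i \<star> w j) = (\<Sum>k<n. (\<Sum>l<n. B l i * G l k) * B k j)" if "i < n" "j < n" for i j
  proof -
    have "w i \<star> w j = w i \<star> (\<Sum>k<n. of_int (B k j) * evec k)" using wB[OF that(2)] by simp
    then have "w i \<star> w j = (\<Sum>k<n. of_int (B k j) * (w i \<star> evec k))" by (simp add: Z.mul_sum_right Z.mul_of_int_right)
    then have "itr (w i \<star> w j) = (\<Sum>k<n. B k j * itr (w i \<star> evec k))"
      using wR[OF that(1)] itr_combination[of "{..<n}" "\<lambda>k. w i \<star> evec k" "\<lambda>k. B k j"] by (simp add: Z.mul_mem evec_mem)
    moreover have "itr (w i \<star> evec k) = (\<Sum>l<n. B l i * G l k)" if "k < n" for k
    proof -
      have "w i \<star> evec k = (\<Sum>l<n. of_int (B l i) * evec l) \<star> evec k" using wB[OF \<open>i < n\<close>] by simp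
      then have "w i \<star> evec k = (\<Sum>l<n. of_int (B l i) * (evec l \<star> evec k))" by (simp add: Z.mul_sum_left Z.mul_of_int_left)
      then show ?thesis
        using that itr_combination[of "{..<n}" "\<lambda>l. evec l \<star> evec k" "\<lambda>l. B l i"] by (simp add: Z.mul_mem evec_mem G_def)
    qed
    ultimately show ?thesis by (simp add: mult.commute)
  qed
  \<comment> \<open>Row scaling factors: a row that belongs to J is divisible by p by
    \<open>nilrad_trace\<close>.\<close>
  define s where "s i = (if i < f then 1 else int p)" for i
  define T where "T i j = itr (w i \<star> w j) div s i" for i j
  have T: "itr (w i \<star> w j) = s i * T i j" if "i < n" "j < n" for i j
  proof (cases "i < f")
    case False
    have "w i \<star> w j \<in> J" using Z.idlD(4)[OF idJ(1) wR[OF that(2)]] wJ that False by simp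
    then show ?thesis using nilrad_trace False unfolding T_def s_def by simp
  qed (simp add: T_def s_def)
  have sprod: "(\<Prod>i<n. s i) = int p ^ m"
  proof -
    have "(\<Prod>i<f + m. s i) = (\<Prod>i<f. s i) * (\<Prod>i<m. s (f + i))" by (induction m) (auto simp: ac_simps)
    then show ?thesis unfolding n by (simp add: s_def)
  qed
  have pB: "\<not> int p dvd Determinant.det (fmat n B)"
  proof
    assume "int p dvd Determinant.det (fmat n B)"
    then obtain c i where c: "i < n" "\<not> int p dvd c i" "\<And>i. i < n \<Longrightarrow> int p dvd (\<Sum>j<n. B i j * c j)"
      using prime_dvd_det_iff_kernel[OF prime_p'] by blast
    have "lincomb n c w = (\<Sum>i<n. of_int (\<Sum>j<n. B i j * c j) * evec i)"
      unfolding sum_combination_swap[symmetric] by (intro sum.cong refl) (use wB in auto)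
    moreover have "\<dots> \<in> smultiple p R"
      by (rule pmult_combination_mem[OF sgp, where L = R and p = p]) (use evec_mem smultiple_mem c(3) in auto)
    ultimately have "(\<Sum>j<f + m. of_int (c j) * w j) \<in> smultiple p R" using n by simp
    then show False using pbasisD(3)[OF w, of c i] c n by simp
  qed
  have eq: "disc * Determinant.det (fmat n B) ^ 2 = int p ^ m * Determinant.det (fmat n T)"
  proof -
    have "fmat n (\<lambda>i j. itr (w i \<star> w j)) = fmat n (\<lambda>i j. \<Sum>k<n. (\<Sum>l<n. B l i * G l k) * B k j)"
      using itr_w by (rule fmat_cong)
    also have "\<dots> = (transpose_mat (fmat n B) * fmat n G) * fmat n B" by (simp add: fmat_transpose fmat_mult)
    finally have e1: "fmat n (\<lambda>i j. itr (w i \<star> w j)) = (transpose_mat (fmat n B) * fmat n G) * fmat n B" .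
    have "transpose_mat (fmat n B) * fmat n G \<in> carrier_mat n n" by (simp add: fmat_transpose fmat_mult)
    then have "Determinant.det (fmat n (\<lambda>i j. itr (w i \<star> w j))) = Determinant.det (transpose_mat (fmat n B) * fmat n G) * Determinant.det (fmat n B)"
      unfolding e1 by (rule det_mult[OF _ fmat_carrier])
    also have "Determinant.det (transpose_mat (fmat n B) * fmat n G) = Determinant.det (fmat n B) * disc"
      using det_mult[of "transpose_mat (fmat n B)" n "fmat n G"] det_transpose[of "fmat n B" n]
      by (simp add: disc_def G_def[abs_def])
    finally have "Determinant.det (fmat n (\<lambda>i j. itr (w i \<star> w j))) = disc * Determinant.det (fmat n B) ^ 2"
      by (simp add: power2_eq_square)
    moreover have "fmat n (\<lambda>i j. itr (w i \<star> w j)) = fmat n (\<lambda>i j. s i * T i j)" using T by (rule fmat_cong)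
    ultimately show ?thesis using det_fmat_scale_rows[of n s T] sprod by simp
  qed
  have ip: "prime_elem (int p)" using prime_p' by simp
  have B0: "Determinant.det (fmat n B) \<noteq> 0" using pB by auto
  then have T0: "Determinant.det (fmat n T) \<noteq> 0" using eq d0 by auto
  have "\<not> int p dvd Determinant.det (fmat n B) ^ 2" using pB prime_elem_dvd_power[OF ip] by blast
  then have "multiplicity (int p) (Determinant.det (fmat n B) ^ 2) = 0" by (rule not_dvd_imp_multiplicity_0)
  moreover have "Determinant.det (fmat n B) ^ 2 \<noteq> 0" using B0 by simp
  ultimately have m1: "multiplicity (int p) (disc * Determinant.det (fmat n B) ^ 2) = multiplicity (int p) disc"
    using prime_elem_multiplicity_mult_distrib[OF ip d0] by simp
  have m2: "multiplicity (int p) (int p ^ m * Determinant.det (fmat n T)) = m + multiplicity (int p) (Determinant.det (fmat n T))"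
  proof -
    have nz: "int p ^ m \<noteq> 0" and nu: "\<not> is_unit (int p)" and n0: "int p \<noteq> 0" using p_gt by auto
    show ?thesis
      unfolding prime_elem_multiplicity_mult_distrib[OF ip nz T0] multiplicity_same_power[OF n0 nu] ..
  qed
  have mult: "multiplicity (int p) disc = m + multiplicity (int p) (Determinant.det (fmat n T))"
    by (rule trans[OF m1[symmetric] trans[OF arg_cong[where f = "multiplicity (int p)", OF eq] m2]])
  show "n \<le> Zp.pdim J + multiplicity (int p) disc" using mult n f_def by linarith
  have iff1: "n = Zp.pdim J + multiplicity (int p) disc \<longleftrightarrow> \<not> int p dvd Determinant.det (fmat n T)"
  proof -
    have "\<not> is_unit (int p)" using p_gt by auto
    then have "multiplicity (int p) (Determinant.det (fmat n T)) = 0 \<longleftrightarrow> \<not> int p dvd Determinant.det (fmat n T)"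
      using multiplicity_eq_zero_iff[OF T0] by blast
    then show ?thesis using mult n f_def by linarith
  qed
  \<comment> \<open>A basis of J/pJ: p times the vectors for R/J, then the vectors of J. It makes
    \<open>itr (u i \<star> w j)\<close> equal to p \<open>T i j\<close> in every row.\<close>
  define u where "u i = (if i < f then of_nat p * v i else w i)" for i
  have uJ: "u i \<in> J" if "i < n" for i
  proof (cases "i < f")
    case True
    then show ?thesis using smultiple_mem[OF pbasisD(1)[OF v True], of p] idJ(2) unfolding u_def by auto
  next
    case False then show ?thesis using wJ[of i] that unfolding u_def by simp
  qed
  have itr_u: "itr (u i \<star> w j) = int p * T i j" if "i < n" "j < n" for i j
  proof (cases "i < f")
    case True
    then have "u i \<star> w j = of_nat p * (w i \<star> w j)" unfolding u_def w_def by (simp add: Z.mul_scalars)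
    then show ?thesis using itr_of_nat[OF Z.mul_mem[OF wR wR]] T[OF that] that True by (simp add: s_def)
  next
    case False then show ?thesis using T[OF that] by (simp add: u_def s_def)
  qed
  have uR: "u i \<in> R" if "i < n" for i using uJ[OF that] JR by blast
  have u_exp: "\<exists>c. y - lincomb n c u \<in> smultiple p J" if y: "y \<in> J" for y
  proof -
    obtain c where c: "y - lincomb m c x \<in> smultiple p R" using pbasisD(2)[OF x y] by blast
    then obtain r where r: "r \<in> R" "y - lincomb m c x = of_nat p * r" unfolding smultiple_def by blast
    obtain e where e: "r - lincomb f e v \<in> J" using pbasisD(2)[OF v r(1)] by blast
    have "lincomb n (cat_seq f e c) u = of_nat p * (lincomb f e v) + lincomb m c x"
      unfolding n by (simp add: sum_lessThan_add_split u_def w_def sum_distrib_left mult.left_commute)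
    then have "y - lincomb n (cat_seq f e c) u = of_nat p * (r - lincomb f e v)"
      using r(2) by (simp add: algebra_simps)
    then have "y - lincomb n (cat_seq f e c) u \<in> smultiple p J" using smultiple_mem[OF e] by simp
    then show ?thesis by blast
  qed
  have u_ind: "int p dvd c i" if c: "lincomb n c u \<in> smultiple p J" and i: "i < n" for c i
  proof -
    obtain y where y: "y \<in> J" "lincomb n c u = of_nat p * y" using c unfolding smultiple_def by blast
    have "lincomb n c u = of_nat p * (lincomb f c v) + (\<Sum>i<m. of_int (c (f + i)) * x i)"
      unfolding n by (simp add: sum_lessThan_add_split u_def w_def sum_distrib_left mult.left_commute)
    then have xs: "(\<Sum>i<m. of_int (c (f + i)) * x i) = of_nat p * (y - lincomb f c v)" using y(2) by (simp add: algebra_simps)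
    have vR: "lincomb f c v \<in> R" by (intro Z.L_closed(6,7) pbasisD(1)[OF v]) auto
    have "(\<Sum>i<m. of_int (c (f + i)) * x i) \<in> smultiple p R" unfolding xs using JR y(1) by (intro smultiple_mem Z.L_closed(2) vR) auto
    then have cx: "int p dvd c (f + i)" if "i < m" for i using pbasisD(3)[OF x, of "\<lambda>i. c (f + i)" i] that by blast
    then have "\<forall>i\<in>{..<m}. \<exists>k. c (f + i) = int p * k" by (auto simp: dvd_def)
    then obtain e where e: "\<And>i. i < m \<Longrightarrow> c (f + i) = int p * e i" by (metis lessThan_iff)
    have "(\<Sum>i<m. of_int (c (f + i)) * x i) = of_nat p * (lincomb m e x)" using e by (simp add: sum_distrib_left mult.assoc)
    then have "of_nat p * (lincomb m e x) = of_nat p * (y - lincomb f c v)" using xs by simp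
    then have "lincomb m e x = y - lincomb f c v" using qvec_of_nat_mult_cancel p_gt(3) by blast
    then have "lincomb f c v = y - lincomb m e x" by (simp add: algebra_simps)
    moreover have "\<dots> \<in> J" using pbasisD(1)[OF x] by (intro is_subgroup_diff[OF sgJ] y is_subgroup_sum[OF sgJ] is_subgroup_of_int[OF sgJ]) auto
    ultimately have cv: "int p dvd c i" if "i < f" for i using pbasisD(3)[OF v, of c i] that by simp
    show ?thesis
    proof (cases "i < f")
      case False
      then have "i = f + (i - f)" "i - f < m" using i n by auto
      then show ?thesis using cx by metis
    qed (rule cv)
  qed
  have itr_comb: "itr ((lincomb n c u) \<star> w j) = int p * (\<Sum>i<n. T i j * c i)" if "j < n" for c j
  proof -
    have "itr ((lincomb n c u) \<star> w j) = (\<Sum>i<n. c i * itr (u i \<star> w j))"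
      using uR wR[OF that] itr_combination[of "{..<n}" "\<lambda>i. u i \<star> w j" c] by (simp add: Z.mul_sum_left Z.mul_of_int_left Z.mul_mem)
    then show ?thesis using itr_u that by (simp add: sum_distrib_left ac_simps)
  qed
  \<comment> \<open>Kernel vectors on the side of J combine rows of T, so the kernel criterion is
    applied to the transposed matrix.\<close>
  have dT: "int p dvd Determinant.det (fmat n T) \<longleftrightarrow> (\<exists>c. (\<exists>i<n. \<not> int p dvd c i) \<and> (\<forall>j<n. int p dvd (\<Sum>i<n. T i j * c i)))"
    using prime_dvd_det_iff_kernel[OF prime_p', of n "\<lambda>i j. T j i"] det_transpose[of "fmat n T" n] by (simp add: fmat_transpose)
  have p2: "int p ^ 2 dvd int p * a \<longleftrightarrow> int p dvd a" for a using p_gt by (simp add: power2_eq_square)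
  have iff2: "\<not> int p dvd Determinant.det (fmat n T) \<longleftrightarrow> cond_E"
  proof
    assume T: "\<not> int p dvd Determinant.det (fmat n T)"
    show cond_E unfolding cond_E_def
    proof (intro ballI impI)
      fix y assume y: "y \<in> J" "\<forall>r\<in>R. int p ^ 2 dvd itr (y \<star> r)"
      obtain c where c: "y - lincomb n c u \<in> smultiple p J" using u_exp[OF y(1)] by blast
      then obtain y' where y': "y' \<in> J" "y - lincomb n c u = of_nat p * y'" unfolding smultiple_def by blast
      let ?s = "\<Sum>i<n. of_int (c i) * u i"
      have sR: "?s \<in> R" using uR by (intro Z.L_closed(6,7)) auto
      have "int p dvd (\<Sum>i<n. T i j * c i)" if "j < n" for j
      proof -
        have y'w: "y' \<star> w j \<in> J" by (rule Z.idlD(4)[OF idJ(1) wR[OF that] y'(1)])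
        have "?s = y - of_nat p * y'" using y'(2) by (simp add: algebra_simps)
        then have "?s \<star> w j = y \<star> w j - of_nat p * (y' \<star> w j)" by (simp add: Z.mul_diff_left Z.mul_scalars)
        then have "itr (?s \<star> w j) = itr (y \<star> w j) - int p * itr (y' \<star> w j)"
          using itr_diff[OF Z.mul_mem Z.L_closed(5), of y "w j" "y' \<star> w j" p] itr_of_nat[of "y' \<star> w j" p] JR y(1) wR[OF that] y'w by auto
        moreover have "int p ^ 2 dvd itr (y \<star> w j)" using y(2) wR[OF that] by blast
        moreover have "int p ^ 2 dvd int p * itr (y' \<star> w j)" using nilrad_trace[OF y'w] p2 by blast
        ultimately have "int p ^ 2 dvd itr (?s \<star> w j)" by simp
        then show ?thesis using itr_comb[OF that] p2 by simp
      qed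
      then have "int p dvd c i" if "i < n" for i using T dT that by blast
      then have "?s \<in> smultiple p J"
        by (intro pmult_combination_mem[OF is_subgroup_smultiple[OF sgJ], where L = J and p = p]) (use uJ smultiple_mem in auto)
      from is_subgroup_add[OF is_subgroup_smultiple[OF sgJ] c this] show "y \<in> smultiple p J" by simp
    qed
  next
    assume E: cond_E
    show "\<not> int p dvd Determinant.det (fmat n T)"
    proof
      assume "int p dvd Determinant.det (fmat n T)"
      then obtain c i where c: "i < n" "\<not> int p dvd c i" "\<And>j. j < n \<Longrightarrow> int p dvd (\<Sum>i<n. T i j * c i)" using dT by blast
      let ?s = "\<Sum>i<n. of_int (c i) * u i"
      have sJ: "?s \<in> J" using uJ by (intro is_subgroup_sum[OF sgJ] is_subgroup_of_int[OF sgJ]) auto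
      have "int p ^ 2 dvd itr (?s \<star> r)" if r: "r \<in> R" for r
      proof -
        obtain e where "r - (\<Sum>i<f + m. of_int (e i) * w i) \<in> smultiple p R" using pbasisD(2)[OF w r] by blast
        then obtain r' where r': "r' \<in> R" "r - lincomb n e w = of_nat p * r'" unfolding smultiple_def n by blast
        have sr': "?s \<star> r' \<in> J" by (rule Z.idlD(4)[OF idJ(1) r'(1) sJ])
        have sw: "?s \<star> w i \<in> R" if "i < n" for i using Z.mul_mem sJ JR wR that by blast
        have "r = lincomb n e w + of_nat p * r'" using r'(2) by (simp add: algebra_simps)
        then have "?s \<star> r = (\<Sum>i<n. of_int (e i) * (?s \<star> w i)) + of_nat p * (?s \<star> r')"
          by (simp add: Z.mul_add_right Z.mul_sum_right[of ?s] Z.mul_of_int_right[of ?s] Z.mul_of_nat_right[of ?s])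
        moreover have "(\<Sum>i<n. of_int (e i) * (?s \<star> w i)) \<in> R" using sw by (intro Z.L_closed(6,7)) auto
        moreover have "?s \<star> r' \<in> R" using sr' JR by blast
        ultimately have "itr (?s \<star> r) = (\<Sum>i<n. e i * itr (?s \<star> w i)) + int p * itr (?s \<star> r')"
          using sw itr_combination[of "{..<n}" "\<lambda>i. ?s \<star> w i" e] itr_of_nat[of "?s \<star> r'" p]
            itr_add[OF _ Z.L_closed(5), of "\<Sum>i<n. of_int (e i) * (?s \<star> w i)" "?s \<star> r'" p] by simp
        moreover have "int p ^ 2 dvd (\<Sum>i<n. e i * itr (?s \<star> w i))"
          using itr_comb c(3) p2 by (intro dvd_sum dvd_mult) auto
        moreover have "int p ^ 2 dvd int p * itr (?s \<star> r')" using nilrad_trace[OF sr'] p2 by blast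
        ultimately show ?thesis by simp
      qed
      then have "?s \<in> smultiple p J" using E sJ unfolding cond_E_def by blast
      then show False using u_ind c by blast
    qed
  qed
  show "n = Zp.pdim J + multiplicity (int p) disc \<longleftrightarrow> cond_E" using iff1 iff2 by simp
  \<comment> \<open>The side of R: the coefficients of y in \<open>w\<close> form a vector in the
    kernel of T modulo p.\<close>
  assume nf: "n = Zp.pdim J + multiplicity (int p) disc" and y: "y \<in> R" and yJ: "\<And>w. w \<in> J \<Longrightarrow> int p ^ 2 dvd itr (w \<star> y)"
  obtain c where "y - (\<Sum>i<f + m. of_int (c i) * w i) \<in> smultiple p R" using pbasisD(2)[OF w y] by blast
  then have c: "y - lincomb n c w \<in> smultiple p R" unfolding n .
  then obtain y' where y': "y' \<in> R" "y - lincomb n c w = of_nat p * y'" unfolding smultiple_def by blast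
  have "int p dvd (\<Sum>j<n. T i j * c j)" if "i < n" for i
  proof -
    have uy': "u i \<star> y' \<in> J" by (rule Z.idlD(4)[OF idJ(1) y'(1) uJ[OF that]])
    have "y = lincomb n c w + of_nat p * y'" using y'(2) by (simp add: algebra_simps)
    then have "u i \<star> y = (\<Sum>j<n. of_int (c j) * (u i \<star> w j)) + of_nat p * (u i \<star> y')"
      by (simp add: Z.mul_add_right Z.mul_sum_right Z.mul_of_int_right Z.mul_of_nat_right)
    moreover have "(\<Sum>j<n. of_int (c j) * (u i \<star> w j)) \<in> R" using uR[OF that] wR by (intro Z.L_closed(6,7) Z.mul_mem) auto
    moreover have "u i \<star> y' \<in> R" using uy' JR by blast
    ultimately have "itr (u i \<star> y) = (\<Sum>j<n. c j * itr (u i \<star> w j)) + int p * itr (u i \<star> y')"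
      using uR[OF that] wR Z.mul_mem itr_combination[of "{..<n}" "\<lambda>j. u i \<star> w j" c] itr_of_nat[of "u i \<star> y'" p]
        itr_add[OF _ Z.L_closed(5), of "\<Sum>j<n. of_int (c j) * (u i \<star> w j)" "u i \<star> y'" p] by simp
    then have "itr (u i \<star> y) = int p * (\<Sum>j<n. T i j * c j) + int p * itr (u i \<star> y')"
      using itr_u[OF that] by (simp add: sum_distrib_left ac_simps)
    moreover have "int p ^ 2 dvd itr (u i \<star> y)" by (rule yJ[OF uJ[OF that]])
    moreover have "int p ^ 2 dvd int p * itr (u i \<star> y')" using nilrad_trace[OF uy'] p2 by blast
    ultimately have "int p ^ 2 dvd int p * (\<Sum>j<n. T i j * c j)" by (simp add: dvd_add_left_iff)
    then show ?thesis using p2 by blast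
  qed
  moreover have "\<not> int p dvd Determinant.det (fmat n T)" using iff1 nf by blast
  ultimately have "int p dvd c i" if "i < n" for i
    using prime_dvd_det_iff_kernel[OF prime_p', of n T] that by blast
  then have "lincomb n c w \<in> smultiple p R"
    by (intro pmult_combination_mem[OF sgp, where L = R and p = p]) (use wR smultiple_mem in auto)
  from is_subgroup_add[OF sgp c this] show "y \<in> smultiple p R" by simp
qed

end

section \<open>The integral closure\<close>

context qalg
begin

text \<open>The elements whose powers have a common denominator; over a noetherian base these are the integral ones.\<close>

definition intcl :: "qvec set" where
  "intcl = {x \<in> qspace n. \<exists>N>0. \<forall>k. of_nat N * Q.pw x k \<in> intvecs n}"

lemma intclE:
  assumes "x \<in> intcl"
  obtains N where "N > 0" "\<And>k. of_nat N * Q.pw x k \<in> intvecs n" "x \<in> qspace n"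
  using assms unfolding intcl_def by blast

lemma intvecs_subset_intcl: "intvecs n \<subseteq> intcl"
proof
  fix x assume "x \<in> intvecs n"
  then show "x \<in> intcl"
    unfolding intcl_def using intvecs_subset_qspace Z.pw_mem[of x]
    by (auto intro!: exI[of _ "1::nat"])
qed

lemma intcl_subset_qspace: "intcl \<subseteq> qspace n"
  unfolding intcl_def by blast

lemma intcl_mult: assumes "x \<in> intcl" "y \<in> intcl" shows "x \<star> y \<in> intcl"
proof -
  obtain M where M: "M > 0" "\<And>k. of_nat M * Q.pw x k \<in> intvecs n" "x \<in> qspace n" using intclE[OF assms(1)] by blast
  obtain N where N: "N > 0" "\<And>k. of_nat N * Q.pw y k \<in> intvecs n" "y \<in> qspace n" using intclE[OF assms(2)] by blast
  have "of_nat (M * N) * Q.pw (x \<star> y) k \<in> intvecs n" for k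
  proof -
    have "of_nat (M * N) * Q.pw (x \<star> y) k = (of_nat M * Q.pw x k) \<star> (of_nat N * Q.pw y k)"
      using M(3) N(3) by (simp add: Q.pw_mult_distrib Q.mul_scalars mult.assoc)
    then show ?thesis using Z.mul_mem[OF M(2) N(2)] by simp
  qed
  then show ?thesis unfolding intcl_def using M(1,3) N(1,3) mul_qspace by (auto intro!: exI[of _ "M * N"])
qed

lemma intcl_add: assumes "x \<in> intcl" "y \<in> intcl" shows "x + y \<in> intcl"
proof -
  obtain M where M: "M > 0" "\<And>k. of_nat M * Q.pw x k \<in> intvecs n" "x \<in> qspace n" using intclE[OF assms(1)] by blast
  obtain N where N: "N > 0" "\<And>k. of_nat N * Q.pw y k \<in> intvecs n" "y \<in> qspace n" using intclE[OF assms(2)] by blast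
  have xy: "x + y \<in> qspace n" by (rule Q.L_closed(4)[OF M(3) N(3)])
  \<comment> \<open>A monomial x^i y^j is carried along so that one factor x + y can be multiplied
    out at a time; M N is a common denominator of all these monomials.\<close>
  have "of_nat (M * N) * (Q.pw x i \<star> Q.pw y j \<star> Q.pw (x + y) k) \<in> intvecs n" for i j k
  proof (induction k arbitrary: i j)
    case 0
    have "of_nat (M * N) * (Q.pw x i \<star> Q.pw y j \<star> Q.pw (x + y) 0) = (of_nat M * Q.pw x i) \<star> (of_nat N * Q.pw y j)"
      using M(3) N(3) by (simp add: Q.mul_scalars Q.mul_one Q.mul_mem Q.pw_mem mult.assoc)
    then show ?case using Z.mul_mem[OF M(2) N(2)] by simp
  next
    case (Suc k)
    have "Q.pw x i \<star> Q.pw y j \<star> Q.pw (x + y) (Suc k)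
      = Q.pw x (Suc i) \<star> Q.pw y j \<star> Q.pw (x + y) k + Q.pw x i \<star> Q.pw y (Suc j) \<star> Q.pw (x + y) k"
      by (simp add: Q.pw_Suc Q.mul_distribs Q.mul_ac)
    then have eq: "of_nat (M * N) * (Q.pw x i \<star> Q.pw y j \<star> Q.pw (x + y) (Suc k))
      = of_nat (M * N) * (Q.pw x (Suc i) \<star> Q.pw y j \<star> Q.pw (x + y) k) + of_nat (M * N) * (Q.pw x i \<star> Q.pw y (Suc j) \<star> Q.pw (x + y) k)"
      by (simp only: distrib_left)
    show ?case unfolding eq by (intro Z.L_closed(4) Suc.IH)
  qed
  from this[of 0 0] have "of_nat (M * N) * Q.pw (x + y) k \<in> intvecs n" for k
    using xy by (simp add: Q.one_mul Q.one_mem Q.pw_mem)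
  then show ?thesis unfolding intcl_def using M(1) N(1) xy by (auto intro!: exI[of _ "M * N"])
qed

lemma intcl_uminus: assumes "x \<in> intcl" shows "- x \<in> intcl"
proof -
  have "- one \<in> intcl" using intvecs_subset_intcl Z.L_closed(3)[OF Z.one_mem] by blast
  then have "(- one) \<star> x \<in> intcl" using intcl_mult assms by blast
  then show ?thesis using assms intcl_subset_qspace by (simp add: Q.mul_minus_left Q.one_mul subset_iff)
qed

lemma is_subgroup_intcl: "is_subgroup intcl"
proof (rule is_subgroupI)
  show "0 \<in> intcl" using intvecs_subset_intcl Z.L_closed(1) by blast
  fix x y assume "x \<in> intcl" "y \<in> intcl"
  then show "x - y \<in> intcl" using intcl_add[of x "- y"] intcl_uminus[of y] by simp
qed

sublocale C: mring mul one intcl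
  by unfold_locales
    (use Z.mul_assoc Z.mul_comm Z.mul_add_left is_subgroup_intcl intcl_mult intcl_subset_qspace Q.one_mul
      intvecs_subset_intcl Z.one_mem in \<open>fact | blast\<close>)+

lemma stable_lattice_trace:
  assumes L: "is_subgroup L" "L \<subseteq> intvecs n" and N: "N > 0" "\<And>r. r \<in> intvecs n \<Longrightarrow> of_nat N * r \<in> L"
    and x: "\<And>v. v \<in> L \<Longrightarrow> x \<star> v \<in> L"
  shows "tr x \<in> \<int>"
proof -
  obtain l where "zbasis n L l" using full_lattice_zbasis[OF L(1) N, where D = 1] L(2) by auto
  then show ?thesis unfolding tr_def using trace_on_lattice_Ints[OF _ Z.additive_map_mul x] by blast
qed

lemma tr_intcl: assumes "x \<in> intcl" shows "tr x \<in> \<int>"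
proof -
  obtain N where N: "N > 0" "\<And>k. of_nat N * Q.pw x k \<in> intvecs n" "x \<in> qspace n" using intclE[OF assms] by blast
  \<comment> \<open>L is stable under x and contains N Z^n, so the trace of x is that of an integral
    matrix.\<close>
  define L where "L = {v \<in> intvecs n. \<forall>k. Q.pw x k \<star> v \<in> intvecs n}"
  show ?thesis
  proof (rule stable_lattice_trace[of L N])
    show "is_subgroup L"
      by (rule is_subgroupI) (auto simp: L_def Z.L_closed Q.mul_diff_right)
    show "L \<subseteq> intvecs n" unfolding L_def by blast
    show "of_nat N * r \<in> L" if "r \<in> intvecs n" for r
    proof -
      have "Q.pw x k \<star> (of_nat N * r) = (of_nat N * Q.pw x k) \<star> r" for k by (simp add: Q.mul_scalars)
      then show ?thesis unfolding L_def using Z.mul_mem[OF N(2) that] Z.L_closed(5)[OF that] by simp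
    qed
    show "x \<star> v \<in> L" if "v \<in> L" for v
    proof -
      have v: "\<And>k. Q.pw x k \<star> v \<in> intvecs n" using that unfolding L_def by blast
      have "x \<star> v \<in> intvecs n" using v[of 1] Q.pw_1[OF N(3)] by simp
      moreover have "Q.pw x k \<star> (x \<star> v) \<in> intvecs n" for k using v[of "Suc k"] by (simp add: Q.pw_Suc Q.mul_ac)
      ultimately show ?thesis unfolding L_def by blast
    qed
  qed (rule N(1))
qed

text \<open>The coordinates of z solve a linear system whose matrix is the Gram matrix and whose
  right-hand side consists of the integers tr (z \<open>evec j\<close>); Cramer's rule bounds their
  denominators by the discriminant.\<close>

lemma disc_intcl: assumes z: "z \<in> intcl" shows "of_int disc * z \<in> intvecs n"
proof -
  have zq: "z \<in> qspace n" using z intcl_subset_qspace by blast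
  define G where "G i j = itr (evec i \<star> evec j)" for i j
  have "\<exists>t. tr (z \<star> evec j) = of_int t" if "j < n" for j
    using tr_intcl[OF intcl_mult[OF z]] intvecs_subset_intcl evec_mem[OF that] by (blast elim: Ints_cases)
  then obtain t where t: "\<And>j. j < n \<Longrightarrow> tr (z \<star> evec j) = of_int (t j)" by metis
  have tG: "of_int (t j) = (\<Sum>i<n. z i * of_int (G i j))" if "j < n" for j
  proof -
    have "z \<star> evec j = (\<Sum>i<n. cst (z i) * evec i) \<star> evec j" using qspace_expansion[OF zq] by simp
    then have "tr (z \<star> evec j) = (\<Sum>i<n. z i * tr (evec i \<star> evec j))"
      by (simp add: Q.mul_sum_left Q.mul_cst_left tr_sum tr_cst)
    also have "\<dots> = (\<Sum>i<n. z i * of_int (G i j))"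
      using that by (intro sum.cong refl) (auto simp: G_def of_int_itr Z.mul_mem evec_mem)
    finally show ?thesis using t[OF that] by simp
  qed
  define N where "N = adj_mat (fmat n G)"
  have Nc: "N \<in> carrier_mat n n" and GN: "fmat n G * N = disc \<cdot>\<^sub>m 1\<^sub>m n"
    unfolding N_def disc_def G_def using adj_mat[OF fmat_carrier, of n] by auto
  have entry: "(\<Sum>j<n. G i j * N $$ (j, k)) = (if i = k then disc else 0)" if "i < n" "k < n" for i k
  proof -
    have "(fmat n G * N) $$ (i, k) = (disc \<cdot>\<^sub>m 1\<^sub>m n) $$ (i, k)" unfolding GN ..
    then show ?thesis using that Nc by (simp add: scalar_prod_def atLeast0LessThan)
  qed
  have "of_int disc * z k = of_int (\<Sum>j<n. t j * N $$ (j, k))" if "k < n" for k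
  proof -
    have "of_int (\<Sum>j<n. t j * N $$ (j, k)) = (\<Sum>j<n. (\<Sum>i<n. z i * of_int (G i j)) * of_int (N $$ (j, k)))"
      by (simp add: tG)
    also have "\<dots> = (\<Sum>j<n. \<Sum>i<n. z i * of_int (G i j * N $$ (j, k)))" by (simp add: sum_distrib_right mult.assoc)
    also have "\<dots> = (\<Sum>i<n. \<Sum>j<n. z i * of_int (G i j * N $$ (j, k)))" by (rule sum.swap)
    also have "\<dots> = (\<Sum>i<n. z i * of_int (\<Sum>j<n. G i j * N $$ (j, k)))" by (simp add: sum_distrib_left)
    also have "\<dots> = (\<Sum>i<n. if i = k then z i * of_int disc else 0)" using that by (intro sum.cong refl) (auto simp: entry)
    finally show ?thesis using that by (simp add: mult.commute)
  qed
  then have "(of_int disc * z) k \<in> \<int>" for k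
    using zq unfolding qspace_def by (cases "k < n") (auto simp: qvec_apply simp del: of_int_sum)
  moreover have "of_int disc * z \<in> qspace n" using Q.L_closed(6)[OF zq] .
  ultimately show ?thesis unfolding intvecs_def by blast
qed

text \<open>The monic equation expresses each power from the d-th on through lower ones with
  coefficients in Z^n, so a common denominator of the first d powers serves for all.\<close>

lemma bounded_denominators_integral:
  assumes x: "x \<in> qspace n" and c: "\<And>i. i < d \<Longrightarrow> c i \<in> intvecs n" and eq: "Q.pw x d = (\<Sum>i<d. c i \<star> Q.pw x i)"
  shows "x \<in> intcl"
proof -
  obtain N where N: "\<And>i. N i > 0" "\<And>i. of_nat (N i) * Q.pw x i \<in> intvecs n"
    using qspace_common_denominator[OF Q.pw_mem[OF x]] by metis
  define M where "M = (\<Prod>i<d. N i)"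
  have M0: "M > 0" unfolding M_def using N(1) by simp
  have small: "of_nat M * Q.pw x i \<in> intvecs n" if "i < d" for i
  proof -
    have "M = (\<Prod>j\<in>{..<d} - {i}. N j) * N i" using that unfolding M_def by (simp add: prod.remove[of "{..<d}" i])
    then have "of_nat M * Q.pw x i = of_nat (\<Prod>j\<in>{..<d} - {i}. N j) * (of_nat (N i) * Q.pw x i)"
      by (simp only: of_nat_mult mult.assoc)
    then show ?thesis using Z.L_closed(5)[OF N(2)] by metis
  qed
  have "of_nat M * Q.pw x k \<in> intvecs n" for k
  proof (induction k rule: less_induct)
    case (less k)
    show ?case
    proof (cases "k < d")
      case False
      then obtain e where k: "k = d + e" using le_Suc_ex not_less by blast
      have "Q.pw x k = (\<Sum>i<d. c i \<star> Q.pw x (i + e))"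
        unfolding k Q.pw_add[OF x] eq by (simp add: Q.mul_sum_left Q.mul_assoc Q.pw_add[OF x])
      then have e: "of_nat M * Q.pw x k = (\<Sum>i<d. c i \<star> (of_nat M * Q.pw x (i + e)))"
        by (simp add: sum_distrib_left Q.mul_of_nat_right)
      show ?thesis unfolding e by (intro Z.L_closed(7) Z.mul_mem) (use c less k in auto)
    qed (rule small)
  qed
  then show ?thesis unfolding intcl_def using x M0 by blast
qed

text \<open>The trace is the rank, seen modulo primes q > n: trace 0 forces rank 0 modulo q, so e L
  lies in q L for arbitrarily large q and e vanishes.\<close>

lemma idempotent_trace_nonzero:
  assumes e: "e \<in> qspace n" "e \<star> e = e" "e \<noteq> 0"
  shows "tr e \<noteq> 0"
proof
  assume tr0: "tr e = 0"
  obtain N where N: "N > 0" "of_nat N * e \<in> intvecs n" using qspace_common_denominator[OF e(1)] by blast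
  \<comment> \<open>A full lattice stable under e, which Z^n need not be.\<close>
  define L where "L = {v \<in> intvecs n. e \<star> v \<in> intvecs n}"
  have L: "is_subgroup L" by (rule is_subgroupI) (auto simp: L_def Z.L_closed Q.mul_diff_right)
  have LR: "L \<subseteq> intvecs n" unfolding L_def by blast
  have NL: "of_nat N * r \<in> L" if "r \<in> intvecs n" for r
  proof -
    have "e \<star> (of_nat N * r) = (of_nat N * e) \<star> r" by (simp add: Q.mul_scalars)
    then show ?thesis unfolding L_def using Z.mul_mem[OF N(2) that] Z.L_closed(5)[OF that] by simp
  qed
  have ee: "e \<star> (e \<star> v) = e \<star> v" for v using e(2) by (simp flip: Q.mul_assoc)
  have eL: "e \<star> v \<in> L" if "v \<in> L" for v using that ee unfolding L_def by auto
  obtain l where l: "zbasis n L l" using full_lattice_zbasis[OF L N(1) NL, where D = 1] LR by auto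
  have vanish: "e \<star> v \<in> smultiple q L" if q: "Factorial_Ring.prime q" "q > n" and v: "v \<in> L" for q v
  proof -
    have q0: "q > 0" "q > 1" using q prime_gt_1_nat by auto
    have sgq: "is_subgroup (smultiple q L)" by (rule is_subgroup_smultiple[OF L])
    \<comment> \<open>The kernel of e modulo q. The idempotent acts as the identity on L/M and as 0
      on M/qL, so its trace is r modulo q, where r \<le> n < q.\<close>
    define M where "M = {x \<in> L. e \<star> x \<in> smultiple q L}"
    have M: "is_subgroup M"
      by (rule is_subgroupI) (auto simp: M_def Q.mul_diff_right intro: is_subgroup_closed[OF L] is_subgroup_closed[OF sgq])
    have M_sub: "M \<subseteq> L" unfolding M_def by blast
    have qM: "smultiple q L \<subseteq> M"
      unfolding M_def smultiple_def using eL is_subgroup_of_nat[OF L] by (auto simp: Q.mul_of_nat_right)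
    have fin: "finite (cosets_mod L (smultiple q L))" by (rule zbasis_finite_cosets[OF L l q0(1)])
    have qLM: "of_nat q * x \<in> M" if "x \<in> L" for x using smultiple_mem[OF that] qM by blast
    obtain r w where w: "pbasis q L M r w"
      using pbasis_exists[OF q(1) L M qLM finite_cosets_mod_mono[OF fin _ qM sgq M]] by blast
    have "of_nat q * x \<in> smultiple q L" if "x \<in> M" for x using smultiple_mem that M_sub by blast
    then obtain s u where u: "pbasis q M (smultiple q L) s u"
      using pbasis_exists[OF q(1) M sgq _ finite_cosets_mod_mono[OF fin M_sub _ sgq sgq]] by blast
    have "r + s = n"
      using pbasis_unique_dim[OF q0(2) L sgq smultiple_mem pbasis_cat[OF L M sgq M_sub qM smultiple_mem w u] zbasis_pbasis[OF L l]] .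
    have t1: "ptrace q L M (\<lambda>x. e \<star> x) (int r)"
    proof (rule ptrace_identityI[OF w])
      fix x assume "x \<in> L"
      then show "e \<star> x - x \<in> M"
        unfolding M_def using eL is_subgroup_diff[OF L] is_subgroup_zero[OF sgq] by (simp add: Q.mul_diff_right ee)
    qed
    have t2: "ptrace q M (smultiple q L) (\<lambda>x. e \<star> x) 0"
      by (rule ptrace_zeroI[OF u]) (simp add: M_def)
    have "ptrace q L (smultiple q L) (\<lambda>x. e \<star> x) (int r)"
      using ptrace_cat[OF L M sgq M_sub qM smultiple_mem t1 t2] by simp
    from trace_on_lattice_cong[OF L l Q.additive_map_mul eL this]
    obtain k where k: "tr e = of_int k" "[k = int r] (mod int q)" unfolding tr_def by blast
    then have "[0 = int r] (mod int q)" using tr0 by simp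
    from cong_sym[OF this] have "int q dvd int r" by (simp add: cong_0_iff)
    then have "r = 0" using \<open>r + s = n\<close> q(2) by (metis dvd_imp_le int_dvd_int_iff le_add1 le_less_trans not_less neq0_conv)
    then have "x \<in> M" if "x \<in> L" for x using pbasisD(2)[OF w that] by simp
    then show ?thesis using v unfolding M_def by blast
  qed
  have "e \<star> v = 0" if v: "v \<in> L" for v
  proof (rule ext)
    fix i
    have "e \<star> v \<in> intvecs n" using eL[OF v] LR by blast
    then have "(e \<star> v) i \<in> \<int>" unfolding intvecs_def by blast
    then obtain z where z: "(e \<star> v) i = of_int z" by (rule Ints_cases)
    \<comment> \<open>A coordinate of e v is an integer divisible by a prime larger than its
      absolute value.\<close>
    obtain q where q: "Factorial_Ring.prime q" "q > max n (nat \<bar>z\<bar>)" using bigger_prime by blast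
    obtain y where y: "y \<in> L" "e \<star> v = of_nat q * y" using vanish[OF q(1) _ v] q(2) unfolding smultiple_def by auto
    have "y i \<in> \<int>" using y(1) LR unfolding intvecs_def by blast
    then obtain z' where z': "y i = of_int z'" by (rule Ints_cases)
    have "of_int z = of_nat q * (of_int z' :: rat)" using z z' y(2) by (simp add: qvec_apply)
    then have "z = int q * z'" by (metis of_int_eq_iff of_int_mult of_int_of_nat_eq)
    then have "int q dvd z" by simp
    have "z = 0"
    proof (rule ccontr)
      assume "z \<noteq> 0"
      from dvd_imp_le_int[OF this \<open>int q dvd z\<close>] show False using q(2) by linarith
    qed
    then show "(e \<star> v) i = 0 i" using z by (simp add: qvec_apply)
  qed
  then have "e \<star> (of_nat N * one) = 0" using NL[OF Z.one_mem] by blast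
  then have "of_nat N * e = of_nat N * 0" using Q.mul_one[OF e(1)] by (simp add: Q.mul_of_nat_right)
  moreover have "N \<noteq> 0" using N(1) by simp
  ultimately have "e = 0" using qvec_of_nat_mult_cancel by blast
  then show False using e(3) by blast
qed

text \<open>The hypothesis is what a product of fields offers: every nonzero x divides a nonzero
  idempotent. A kernel vector of the Gram matrix is orthogonal to everything, so that idempotent
  would have trace 0.\<close>

lemma disc_nonzero:
  assumes idem: "\<And>x. x \<in> qspace n \<Longrightarrow> x \<noteq> 0 \<Longrightarrow> \<exists>y\<in>qspace n. x \<star> y \<noteq> 0 \<and> (x \<star> y) \<star> (x \<star> y) = x \<star> y"
  shows "disc \<noteq> 0"
proof
  assume "disc = 0"
  define G where "G i j = itr (evec i \<star> evec j)" for i j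
  define A where "A = map_mat rat_of_int (fmat n (\<lambda>j i. G i j))"
  have A: "A \<in> carrier_mat n n" unfolding A_def by simp
  have "Determinant.det (fmat n (\<lambda>j i. G i j)) = disc"
    using det_transpose[of "fmat n G" n] by (simp add: fmat_transpose disc_def G_def[abs_def])
  then have "Determinant.det A = 0" unfolding A_def using \<open>disc = 0\<close> by (simp add: of_int_hom.hom_det)
  then obtain v where v: "v \<in> carrier_vec n" "v \<noteq> 0\<^sub>v n" "A *\<^sub>v v = 0\<^sub>v n"
    using det_0_iff_vec_prod_zero_field[OF A] by blast
  define x where "x = (\<Sum>i<n. cst (v $ i) * evec i)"
  have xq: "x \<in> qspace n" unfolding x_def by (intro Q.L_closed(7) qspace_cst evec_qspace) auto
  have xi: "x i = v $ i" if "i < n" for i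
  proof -
    have "x i = (\<Sum>j<n. v $ j * (if i = j then 1 else 0))"
      unfolding x_def by (auto simp: qvec_apply evec_def intro!: sum.cong)
    also have "\<dots> = (\<Sum>j<n. if i = j then v $ j else 0)" by (intro sum.cong) auto
    finally show ?thesis using that by simp
  qed
  have "x \<noteq> 0"
  proof
    assume "x = 0"
    then have "v $ i = 0" if "i < n" for i using xi[OF that] by (simp add: qvec_apply)
    then have "v = 0\<^sub>v n" using v(1) by (intro eq_vecI) auto
    then show False using v(2) by blast
  qed
  then obtain y where y: "y \<in> qspace n" "x \<star> y \<noteq> 0" "(x \<star> y) \<star> (x \<star> y) = x \<star> y" using idem[OF xq] by blast
  have "tr (x \<star> evec j) = 0" if "j < n" for j
  proof -
    have "tr (x \<star> evec j) = (\<Sum>i<n. v $ i * tr (evec i \<star> evec j))"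
      unfolding x_def by (simp add: Q.mul_sum_left Q.mul_cst_left tr_sum tr_cst)
    also have "\<dots> = (\<Sum>i<n. v $ i * of_int (G i j))"
      using that by (intro sum.cong refl) (auto simp: G_def of_int_itr Z.mul_mem evec_mem)
    also have "\<dots> = (A *\<^sub>v v) $ j"
      using that v(1) by (simp add: A_def scalar_prod_def atLeast0LessThan mult.commute)
    finally show ?thesis using v(3) that by simp
  qed
  moreover have "tr (x \<star> y) = (\<Sum>j<n. y j * tr (x \<star> evec j))"
  proof -
    have "x \<star> y = x \<star> (\<Sum>j<n. cst (y j) * evec j)" using qspace_expansion[OF y(1)] by simp
    then show ?thesis by (simp add: Q.mul_sum_right Q.mul_cst_right tr_sum tr_cst)
  qed
  ultimately have "tr (x \<star> y) = 0" by simp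
  then show False using idempotent_trace_nonzero[OF mul_qspace[OF xq y(1)] y(3,2)] by blast
qed

end

section \<open>Nonzero discriminant and the index in the integral closure\<close>

locale qalg_nd = qalg +
  assumes disc_neq_0: "disc \<noteq> 0"
begin

lemma abs_disc_intcl: "z \<in> intcl \<Longrightarrow> of_nat (nat \<bar>disc\<bar>) * z \<in> intvecs n"
proof -
  assume "z \<in> intcl"
  then have "of_int \<bar>disc\<bar> * z \<in> intvecs n"
    using disc_intcl[of z] Z.L_closed(3)[of "of_int disc * z"] by (cases "disc \<ge> 0") auto
  moreover have "(of_nat (nat \<bar>disc\<bar>) :: qvec) = of_int \<bar>disc\<bar>" by simp
  ultimately show ?thesis by metis
qed

lemma intcl_zbasis: "\<exists>l. zbasis n intcl l"
  using full_lattice_zbasis[OF is_subgroup_intcl, of 1 n "nat \<bar>disc\<bar>"] abs_disc_intcl disc_neq_0 intvecs_subset_intcl by auto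

lemma finite_intcl_mod: "m > 0 \<Longrightarrow> finite (cosets_mod intcl (smultiple m intcl))"
  using intcl_zbasis zbasis_finite_cosets[OF is_subgroup_intcl] by blast

lemma finite_intcl_intvecs: "finite (cosets_mod intcl (intvecs n))"
proof (rule finite_cosets_mod_mono[OF finite_intcl_mod[of "nat \<bar>disc\<bar>"]])
  show "smultiple (nat \<bar>disc\<bar>) intcl \<subseteq> intvecs n" unfolding smultiple_def using abs_disc_intcl by blast
qed (use disc_neq_0 is_subgroup_intvecs is_subgroup_smultiple is_subgroup_intcl in auto)

lemma intcl_integral:
  assumes "x \<in> intcl"
  obtains i j where "i < j" "Q.pw x i - Q.pw x j \<in> intvecs n"
  using cosets_pigeonhole[OF finite_intcl_intvecs is_subgroup_intvecs, of "Q.pw x"] C.pw_mem[OF assms]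
  by auto

text \<open>Bounded denominators over the closure are bounded over Z^n, at the cost of the factor
  |disc|.\<close>

lemma intcl_bounded:
  assumes z: "z \<in> qspace n" and m: "m > 0" "\<And>k. of_nat m * Q.pw z k \<in> intcl"
  shows "z \<in> intcl"
proof -
  have "of_nat (nat \<bar>disc\<bar> * m) * Q.pw z k \<in> intvecs n" for k
    using abs_disc_intcl[OF m(2)[of k]] by (simp only: of_nat_mult mult.assoc)
  then show ?thesis unfolding intcl_def using z m(1) disc_neq_0
    by (intro CollectI conjI exI[of _ "nat \<bar>disc\<bar> * m"]) auto
qed

definition intcl_index :: nat where
  "intcl_index = card (cosets_mod intcl (intvecs n))"

text \<open>Both conditions concern elements of order p in the finite quotient group: there are none
  if the order is prime to p, by Lagrange and Bezout, and there is one if p divides it, by Cauchy's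
  theorem, obtained from Sylow's with exponent 1.\<close>

lemma intcl_index_coprime_iff:
  assumes p: "Factorial_Ring.prime p"
  shows "coprime intcl_index p \<longleftrightarrow> (\<forall>x\<in>intcl. of_nat p * x \<in> intvecs n \<longrightarrow> x \<in> intvecs n)"
proof -
  define G :: "qvec monoid" where "G = \<lparr>carrier = intcl, monoid.mult = (+), one = 0\<rparr>"
  interpret R: cring C.rng by (rule C.cring_rng)
  have G_simps [simp]: "carrier G = intcl" "x \<otimes>\<^bsub>G\<^esub> y = x + y" "\<one>\<^bsub>G\<^esub> = 0" for x y by (simp_all add: G_def)
  have Geq: "add_monoid C.rng = G" by (simp add: G_def C.rng_def)
  have G: "comm_group G" using R.a_comm_group unfolding Geq .
  have minus: "inv\<^bsub>G\<^esub> y = - y" if "y \<in> intcl" for y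
    using group.inv_equality[OF comm_group.axioms(2)[OF G], of "- y" y] that C.L_closed(3) by simp
  have sub: "subgroup (intvecs n) G"
  proof (rule group.subgroupI[OF comm_group.axioms(2)[OF G]])
    show "intvecs n \<subseteq> carrier G" using intvecs_subset_intcl by simp
    show "intvecs n \<noteq> {}" using Z.L_closed(1) by blast
    fix a b assume ab: "a \<in> intvecs n" "b \<in> intvecs n"
    show "a \<otimes>\<^bsub>G\<^esub> b \<in> intvecs n" using Z.L_closed(4)[OF ab] by simp
    show "inv\<^bsub>G\<^esub> a \<in> intvecs n" using minus[of a] ab(1) intvecs_subset_intcl Z.L_closed(3)[OF ab(1)] by auto
  qed
  have norm: "intvecs n \<lhd> G" by (rule comm_group.subgroup_imp_normal[OF G sub])
  let ?Q = "G Mod intvecs n"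
  interpret Q': group ?Q by (rule normal.factorgroup_is_group[OF norm])
  have coset: "intvecs n #>\<^bsub>G\<^esub> x = {y \<in> intcl. y - x \<in> intvecs n}" if "x \<in> intcl" for x
    unfolding r_coset_def using that intvecs_subset_intcl C.L_closed(4)
    by (auto simp: add.commute intro!: bexI[of _ "_ - x"] dest: subsetD)
  have carr: "carrier ?Q = cosets_mod intcl (intvecs n)"
    unfolding FactGroup_def RCOSETS_def cosets_mod_def using coset by auto
  have fin: "finite (carrier ?Q)" unfolding carr by (rule finite_intcl_intvecs)
  have ord: "order ?Q = intcl_index" unfolding order_def carr intcl_index_def ..
  have coset_eq: "intvecs n #>\<^bsub>G\<^esub> x = intvecs n #>\<^bsub>G\<^esub> y \<longleftrightarrow> x - y \<in> intvecs n" if "x \<in> intcl" "y \<in> intcl" for x y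
    using coset_eq_iff[OF is_subgroup_intvecs that] unfolding coset[OF that(1)] coset[OF that(2)] .
  have one_coset: "\<one>\<^bsub>?Q\<^esub> = intvecs n #>\<^bsub>G\<^esub> 0"
    unfolding coset[OF C.L_closed(1)] using intvecs_subset_intcl by (auto simp: FactGroup_def)
  have pow: "(intvecs n #>\<^bsub>G\<^esub> x) [^]\<^bsub>?Q\<^esub> k = intvecs n #>\<^bsub>G\<^esub> (of_nat k * x)" if "x \<in> intcl" for x and k :: nat
  proof (induction k)
    case 0 show ?case using one_coset by (simp add: nat_pow_def)
  next
    case (Suc k)
    have "(intvecs n #>\<^bsub>G\<^esub> x) [^]\<^bsub>?Q\<^esub> Suc k = (intvecs n #>\<^bsub>G\<^esub> (of_nat k * x)) <#>\<^bsub>G\<^esub> (intvecs n #>\<^bsub>G\<^esub> x)"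
      using Suc by (simp add: FactGroup_def)
    also have "\<dots> = intvecs n #>\<^bsub>G\<^esub> (of_nat k * x \<otimes>\<^bsub>G\<^esub> x)"
      by (rule normal.rcos_sum[OF norm]) (use that C.L_closed(5) in auto)
    also have "of_nat k * x \<otimes>\<^bsub>G\<^esub> x = of_nat (Suc k) * x" by (simp add: algebra_simps)
    finally show ?case .
  qed
  show ?thesis
  proof
    assume cop: "coprime intcl_index p"
    show "\<forall>x\<in>intcl. of_nat p * x \<in> intvecs n \<longrightarrow> x \<in> intvecs n"
    proof (intro ballI impI)
      fix x assume x: "x \<in> intcl" "of_nat p * x \<in> intvecs n"
      have xc: "intvecs n #>\<^bsub>G\<^esub> x \<in> carrier ?Q" unfolding carr cosets_mod_def using x(1) coset by auto
      have "(intvecs n #>\<^bsub>G\<^esub> x) [^]\<^bsub>?Q\<^esub> order ?Q = \<one>\<^bsub>?Q\<^esub>" by (rule Q'.pow_order_eq_1[OF xc])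
      then have "of_nat intcl_index * x \<in> intvecs n"
        using pow[OF x(1)] one_coset ord coset_eq[OF C.L_closed(5)[OF x(1)] C.L_closed(1)] by simp
      moreover obtain a b where ab: "a * int intcl_index + b * int p = 1"
        using cop by (metis bezout_int coprime_iff_gcd_eq_1 gcd_int_int_eq of_nat_1)
      have "x = of_int (a * int intcl_index + b * int p) * x" unfolding ab by simp
      then have "x = of_int a * (of_nat intcl_index * x) + of_int b * (of_nat p * x)" by (simp add: algebra_simps)
      ultimately show "x \<in> intvecs n" using x(2) Z.L_closed(4,6) by metis
    qed
  next
    assume max: "\<forall>x\<in>intcl. of_nat p * x \<in> intvecs n \<longrightarrow> x \<in> intvecs n"
    show "coprime intcl_index p"
    proof (rule ccontr)
      assume "\<not> coprime intcl_index p"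
      then have "p dvd intcl_index" using p by (metis coprime_commute prime_imp_coprime)
      then obtain m where "order ?Q = p ^ 1 * m" using ord by (auto simp: dvd_def)
      then obtain H where H: "subgroup H ?Q" "card H = p ^ 1"
        using sylow_thm[OF p Q'.group_axioms _ fin] by blast
      have "card H > 1" using H(2) p prime_gt_1_nat by simp
      then obtain c where c: "c \<in> H" "c \<noteq> \<one>\<^bsub>?Q\<^esub>"
        by (metis One_nat_def card_le_Suc0_iff_eq card.infinite not_less not_one_less_zero)
      have cc: "c \<in> carrier ?Q" using subgroup.subset[OF H(1)] c(1) by blast
      then obtain x where x: "x \<in> intcl" "c = intvecs n #>\<^bsub>G\<^esub> x" unfolding carr cosets_mod_def using coset by auto
      interpret H: group "?Q\<lparr>carrier := H\<rparr>" by (rule subgroup.subgroup_is_group[OF H(1) Q'.group_axioms])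
      have "c [^]\<^bsub>?Q\<lparr>carrier := H\<rparr>\<^esub> order (?Q\<lparr>carrier := H\<rparr>) = \<one>\<^bsub>?Q\<lparr>carrier := H\<rparr>\<^esub>"
        by (rule H.pow_order_eq_1) (use c in simp)
      then have "c [^]\<^bsub>?Q\<^esub> p = \<one>\<^bsub>?Q\<^esub>" using H(2) by (simp add: order_def nat_pow_def)
      then have "of_nat p * x \<in> intvecs n"
        using pow[OF x(1)] one_coset x(2) coset_eq[OF C.L_closed(5)[OF x(1)] C.L_closed(1)] by simp
      then have "x \<in> intvecs n" using max x(1) by blast
      then have "c = \<one>\<^bsub>?Q\<^esub>" using x one_coset coset_eq[OF x(1) C.L_closed(1)] by simp
      then show False using c(2) by blast
    qed
  qed
qed

end

section \<open>Equality in terms of the trace form modulo p\<close>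

locale qalg_nd_prime = qalg_nd + qalg_prime
begin

text \<open>By \<open>intcl_index_coprime_iff\<close> this says that the index of R in its integral
  closure is prime to p.\<close>

definition pmax :: bool where
  "pmax \<longleftrightarrow> (\<forall>x\<in>intcl. of_nat p * x \<in> R \<longrightarrow> x \<in> R)"

text \<open>The radical of the trace form modulo p lies in J; the opposite inclusion always holds,
  by \<open>nilrad_trace\<close>.\<close>

definition cond_a :: bool where
  "cond_a \<longleftrightarrow> (\<forall>u\<in>R. (\<forall>r\<in>R. int p dvd itr (u \<star> r)) \<longrightarrow> u \<in> J)"

lemma JR: "x \<in> J \<Longrightarrow> x \<in> R"
  using Z.idlD(2)[OF Zp.idl_nilrad(1)] .

lemma cond_E_imp_pmax:
  assumes E: cond_E shows pmax
  unfolding pmax_def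
proof (intro ballI impI)
  fix x assume x: "x \<in> intcl" "of_nat p * x \<in> R"
  have nf: "n = Zp.pdim J + multiplicity (int p) disc" using discriminant_criterion(2)[OF disc_neq_0] E by blast
  obtain l where l: "zbasis n intcl l" using intcl_zbasis by blast
  have "int p ^ 2 dvd itr (w \<star> (of_nat p * x))" if w: "w \<in> J" for w
  proof -
    obtain m r where r: "Z.pw w m = of_nat p * r" "r \<in> R" using w unfolding Zp.nilrad_def smultiple_def by blast
    define u where "u = w \<star> x"
    have wC: "w \<in> intcl" using JR[OF w] intvecs_subset_intcl by blast
    have uC: "u \<in> intcl" unfolding u_def by (rule intcl_mult[OF wC x(1)])
    have iter: "((\<lambda>v. u \<star> v) ^^ k) v = Q.pw u k \<star> v" if "v \<in> intcl" for v k
      using that C.one_mul by (induction k) (auto simp: Q.pw_Suc Q.mul_assoc)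
    \<comment> \<open>The product w x is nilpotent modulo p times the integral closure, and it need
      not lie in R; so its trace is computed on the lattice \<open>intcl\<close>.\<close>
    have "\<exists>t. trace_on n (\<lambda>v. u \<star> v) = of_int (int p * t)"
    proof (rule nilpotent_trace[OF prime_p' is_subgroup_intcl l Q.additive_map_mul])
      show "u \<star> v \<in> intcl" if "v \<in> intcl" for v by (rule intcl_mult[OF uC that])
      show "((\<lambda>v. u \<star> v) ^^ m) v \<in> smultiple p intcl" if v: "v \<in> intcl" for v
      proof -
        have "Q.pw u m = of_nat p * (r \<star> Q.pw x m)"
          unfolding u_def using C.pw_mult_distrib[OF wC x(1), of m] r(1)
          by (simp add: Q.mul_of_nat_left)
        then have eq: "((\<lambda>v. u \<star> v) ^^ m) v = of_nat p * ((r \<star> Q.pw x m) \<star> v)"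
          unfolding iter[OF v] by (simp add: Q.mul_of_nat_left)
        have "Q.pw x m \<in> intcl" using C.pw_mem[OF x(1), of m] .
        then show ?thesis unfolding eq using r(2) intvecs_subset_intcl v
          by (intro smultiple_mem intcl_mult) auto
      qed
    qed
    then obtain t where t: "tr u = of_int (int p * t)" unfolding tr_def by blast
    have "tr (w \<star> (of_nat p * x)) = of_int (int p ^ 2 * t)"
      using t by (simp add: u_def Q.mul_of_nat_right tr_of_nat power2_eq_square mult.assoc)
    then show ?thesis unfolding itr_def by (simp only: floor_of_int dvd_triv_left)
  qed
  then have "of_nat p * x \<in> smultiple p R" using discriminant_criterion(3)[OF disc_neq_0 nf x(2)] by blast
  then show "x \<in> R" unfolding smultiple_def using qvec_of_nat_mult_cancel[OF Zp.p_gt(3)] by auto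
qed

text \<open>Test \<open>cond_E\<close> on w = p u.\<close>

lemma cond_E_imp_cond_a:
  assumes E: cond_E shows cond_a
  unfolding cond_a_def
proof (intro ballI impI)
  fix u assume u: "u \<in> R" "\<forall>r\<in>R. int p dvd itr (u \<star> r)"
  have pu: "of_nat p * u \<in> J" using smultiple_mem[OF u(1)] Zp.idl_nilrad(2) by blast
  have "int p ^ 2 dvd itr ((of_nat p * u) \<star> r)" if r: "r \<in> R" for r
    using u(2) r itr_of_nat[OF Z.mul_mem[OF u(1) r], of p] by (simp add: Z.mul_of_nat_left power2_eq_square)
  then have "of_nat p * u \<in> smultiple p J" using E pu unfolding cond_E_def by blast
  then show "u \<in> J" unfolding smultiple_def using qvec_of_nat_mult_cancel[OF Zp.p_gt(3)] by auto
qed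

text \<open>If w is outside pR, pick y in wR outside pR with largest annihilator modulo p. It
  contains J, and y/p maps it into itself: for i in it, (y/p) i lies in R and pairs with R to traces
  divisible by p, so it is in J by \<open>cond_a\<close>. Since the annihilator contains p and lies
  in R, y/p is integral, hence in R by \<open>pmax\<close>, contrary to the choice of y.\<close>

lemma pmax_cond_a_imp_cond_E:
  assumes pm: pmax and a: cond_a shows cond_E
  unfolding cond_E_def
proof (intro ballI impI)
  fix w assume w: "w \<in> J" "\<forall>r\<in>R. int p ^ 2 dvd itr (w \<star> r)"
  have sgp: "is_subgroup (smultiple p R)" by (rule is_subgroup_smultiple[OF is_subgroup_intvecs])
  have idp: "Z.idl (smultiple p R)" by (rule Zp.idl_pL)
  have "w \<in> smultiple p R"
  proof (rule ccontr)
    assume wn: "w \<notin> smultiple p R"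
    define ann where "ann y = {r \<in> R. r \<star> y \<in> smultiple p R}" for y
    define S where "S = {w \<star> s |s. s \<in> R \<and> w \<star> s \<notin> smultiple p R}"
    have wR: "w \<in> R" by (rule JR[OF w(1)])
    have "w \<star> one \<in> S" unfolding S_def using wn Z.mul_one[OF wR] Z.one_mem by (intro CollectI exI[of _ one]) simp
    then obtain y where y: "y \<in> S" "\<And>z. z \<in> S \<Longrightarrow> Zp.pdim (ann y) \<le> Zp.pdim (ann z)"
      using ex_has_least_nat[of "\<lambda>y. y \<in> S" _ "\<lambda>y. Zp.pdim (ann y)"] by blast
    obtain s where s: "y = w \<star> s" "s \<in> R" "y \<notin> smultiple p R" using y(1) unfolding S_def by blast
    have yR: "y \<in> R" unfolding s(1) by (rule Z.mul_mem[OF wR s(2)])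
    have ann_idl: "Z.idl (ann z)" if "z \<in> R" for z unfolding ann_def by (rule Z.idl_colon[OF idp that])
    have p_ann: "smultiple p R \<subseteq> ann z" if "z \<in> R" for z
      unfolding ann_def using Z.idlD(2)[OF idp] Z.idlD(4)[OF idp that] by blast
    have annJ: "J \<subseteq> ann y"
    proof
      fix j assume j: "j \<in> J"
      have jR: "j \<in> R" by (rule JR[OF j])
      show "j \<in> ann y"
      proof (rule ccontr)
        assume jn: "j \<notin> ann y"
        have jy: "j \<star> y \<notin> smultiple p R" using jn jR unfolding ann_def by blast
        have "j \<star> y = w \<star> (j \<star> s)" unfolding s(1) by (rule Z.mul_left_comm)
        then have jyS: "j \<star> y \<in> S" unfolding S_def using jy Z.mul_mem[OF jR s(2)]
          by (intro CollectI exI[of _ "j \<star> s"]) simp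
        have sub: "ann y \<subseteq> ann (j \<star> y)"
          unfolding ann_def using Z.idlD(3)[OF idp jR] by (auto simp: Z.mul_left_comm[of _ j y])
        have eq: "ann (j \<star> y) = ann y"
        proof (rule ccontr)
          assume "ann (j \<star> y) \<noteq> ann y"
          then have "ann y \<subset> ann (j \<star> y)" using sub by blast
          then have "Zp.pdim (ann (j \<star> y)) < Zp.pdim (ann y)"
            using Zp.pdim_strict[OF ann_idl[OF yR] p_ann[OF yR] ann_idl[OF Z.mul_mem[OF jR yR]]] by blast
          then show False using y(2)[OF jyS] by simp
        qed
        \<comment> \<open>As j y has the same annihilator as y, factors j can be cancelled; since j
          is nilpotent modulo p, this puts \<open>one\<close> into the annihilator and y into
          pR.\<close>
        have step: "x \<in> ann y" if "x \<in> R" "x \<star> Z.pw j k \<in> ann y" for x k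
          using that
        proof (induction k arbitrary: x)
          case 0 then show ?case by (simp add: Z.mul_one)
        next
          case (Suc k)
          have "(x \<star> j) \<star> Z.pw j k \<in> ann y" using Suc.prems by (simp add: Z.pw_Suc Z.mul_assoc)
          then have "x \<star> j \<in> ann y" using Suc.IH Z.mul_mem[OF Suc.prems(1) jR] by blast
          then have "x \<in> ann (j \<star> y)" using Suc.prems(1) unfolding ann_def by (simp add: Z.mul_assoc)
          then show ?case using eq by blast
        qed
        obtain k where "Z.pw j k \<in> smultiple p R" using j unfolding Zp.nilrad_def by blast
        then have "one \<star> Z.pw j k \<in> ann y" using p_ann[OF yR] Z.one_mul[OF Z.pw_mem[OF jR]] by auto
        then have "one \<in> ann y" using step Z.one_mem by blast
        then show False using s(3) yR Z.one_mul unfolding ann_def by simp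
      qed
    qed
    define z where "z = cst (1 / of_nat p) * y"
    have pz: "of_nat p * z = y" unfolding z_def using of_nat_mult_cst(1)[OF Zp.p_gt(3)] .
    have zq: "z \<in> qspace n" unfolding z_def using yR intvecs_subset_qspace qspace_cst by blast
    have z_ann: "z \<star> i \<in> ann y" if i: "i \<in> ann y" for i
    proof -
      obtain u where u: "u \<in> R" "i \<star> y = of_nat p * u" using i unfolding ann_def smultiple_def by blast
      have iR: "i \<in> R" using i unfolding ann_def by blast
      have "of_nat p * (z \<star> i) = (of_nat p * z) \<star> i" by (simp only: Q.mul_of_nat_left)
      then have "of_nat p * (z \<star> i) = of_nat p * u" using u(2) pz Q.mul_comm by simp
      then have zi: "z \<star> i = u" using qvec_of_nat_mult_cancel[OF Zp.p_gt(3)] by blast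
      have "int p dvd itr (u \<star> r)" if r: "r \<in> R" for r
      proof -
        have "of_nat p * (u \<star> r) = (i \<star> y) \<star> r" unfolding u(2) by (simp add: Q.mul_of_nat_left)
        also have "\<dots> = w \<star> (s \<star> (i \<star> r))" unfolding s(1) by (simp add: Q.mul_ac)
        finally have "of_nat p * (u \<star> r) = w \<star> (s \<star> (i \<star> r))" .
        moreover have "s \<star> (i \<star> r) \<in> R" using s(2) iR r Z.mul_mem by blast
        ultimately have "int p ^ 2 dvd itr (of_nat p * (u \<star> r))" using w(2) by metis
        then show ?thesis using itr_of_nat[OF Z.mul_mem[OF u(1) r], of p] Zp.p_gt by (simp add: power2_eq_square)
      qed
      then have "u \<in> J" using a u(1) unfolding cond_a_def by blast
      then show ?thesis unfolding zi using annJ by blast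
    qed
    have "of_nat p * one \<in> ann y" using p_ann[OF yR] smultiple_mem[OF Z.one_mem] by blast
    then have "Q.pw z k \<star> (of_nat p * one) \<in> ann y" for k
    proof (induction k)
      case 0
      have "one \<star> (of_nat p * one) = of_nat p * one" using Z.one_mul[OF Z.L_closed(5)[OF Z.one_mem]] .
      then show ?case using 0 by simp
    next
      case (Suc k)
      have "Q.pw z (Suc k) \<star> (of_nat p * one) = z \<star> (Q.pw z k \<star> (of_nat p * one))" by (simp add: Q.pw_Suc Q.mul_assoc)
      then show ?case using z_ann[OF Suc.IH[OF Suc.prems]] by simp
    qed
    then have "of_nat p * Q.pw z k \<in> R" for k
      using Q.mul_one[OF Q.pw_mem[OF zq]] unfolding ann_def by (simp add: Q.mul_of_nat_right)
    then have "z \<in> intcl" unfolding intcl_def using zq Zp.p_gt(2) by blast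
    then have "z \<in> R" using pm pz yR unfolding pmax_def by metis
    then have "y \<in> smultiple p R" using smultiple_mem pz by metis
    then show False using s(3) by blast
  qed
  then obtain u where u: "u \<in> R" "w = of_nat p * u" unfolding smultiple_def by blast
  have "int p dvd itr (u \<star> r)" if r: "r \<in> R" for r
  proof -
    have "w \<star> r = of_nat p * (u \<star> r)" unfolding u(2) by (rule Z.mul_of_nat_left)
    moreover have "int p ^ 2 dvd itr (w \<star> r)" using w(2) r by blast
    ultimately show ?thesis using itr_of_nat[OF Z.mul_mem[OF u(1) r], of p] Zp.p_gt by (simp add: power2_eq_square)
  qed
  then have "u \<in> J" using a u(1) unfolding cond_a_def by blast
  then show "w \<in> smultiple p J" unfolding u(2) by (rule smultiple_mem)
qed

theorem criterion:
  shows "n \<le> Zp.pdim J + multiplicity (int p) disc"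
    and "n = Zp.pdim J + multiplicity (int p) disc \<longleftrightarrow> pmax \<and> cond_a"
  using discriminant_criterion(1,2)[OF disc_neq_0] cond_E_imp_pmax cond_E_imp_cond_a pmax_cond_a_imp_cond_E by blast+

end

section \<open>Ramification\<close>

lemma (in mring) rng_ideal_pow_Suc: "I [^]\<^bsub>ideals_set rng\<^esub> Suc k = (I [^]\<^bsub>ideals_set rng\<^esub> k) \<cdot>\<^bsub>rng\<^esub> I"
  by (simp add: nat_pow_def ideals_set_def)

text \<open>
  Bounded denominators replace integral closedness: this condition is all that is needed to make
  every prime above \<open>p\<close> invertible.
\<close>

locale max_pring = pring +
  assumes bounded: "of_nat p * z \<in> L \<Longrightarrow> (\<And>k. of_nat p * pw z k \<in> L) \<Longrightarrow> z \<in> L"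

section \<open>Powers of a prime above p and its ramification index\<close>

locale max_pring_prime = max_pring +
  fixes P :: "qvec set"
  assumes prm_P: "prm P" and pL_P: "pL \<subseteq> P"
begin

lemma idl_P: "idl P" by (rule prmD(1)[OF prm_P])
lemma sg_P: "is_subgroup P" by (rule idlD(1)[OF idl_P])
lemma P_L: "x \<in> P \<Longrightarrow> x \<in> L" by (rule idlD(2)[OF idl_P])
lemma sg_pL: "is_subgroup pL" by (rule idlD(1)[OF idl_pL])

text \<open>P is an associated prime of L/pL. Among the y with annihilator inside P take one with
  largest annihilator. If some x of P were outside it, ann (x y) would equal ann y; cancelling
  powers of x then puts s = 1 - x^(j-i) into P, and with it \<open>one\<close>.\<close>

lemma annihilator_prime:
  obtains y where "y \<in> L" "{r \<in> L. r \<star> y \<in> pL} = P"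
proof -
  define ann where "ann y = {r \<in> L. r \<star> y \<in> pL}" for y
  define S where "S = {y \<in> L. ann y \<subseteq> P}"
  have "one \<in> S" unfolding S_def ann_def using one_mem mul_one pL_P by auto
  then obtain y where y: "y \<in> S" "\<And>z. z \<in> S \<Longrightarrow> pdim (ann y) \<le> pdim (ann z)"
    using ex_has_least_nat[of "\<lambda>y. y \<in> S" _ "\<lambda>y. pdim (ann y)"] by blast
  have yL: "y \<in> L" and annP: "ann y \<subseteq> P" using y(1) unfolding S_def by auto
  have ann_idl: "idl (ann z)" if "z \<in> L" for z unfolding ann_def by (rule idl_colon[OF idl_pL that])
  have p_ann: "pL \<subseteq> ann z" if "z \<in> L" for z
    unfolding ann_def using idlD(2)[OF idl_pL] idlD(4)[OF idl_pL that] by blast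
  have max: "ann (t \<star> y) = ann y" if t: "t \<in> L" "ann (t \<star> y) \<subseteq> P" for t
  proof (rule ccontr)
    assume ne: "ann (t \<star> y) \<noteq> ann y"
    have "ann y \<subseteq> ann (t \<star> y)"
      unfolding ann_def using idlD(3)[OF idl_pL t(1)] by (auto simp: mul_left_comm[of _ t y])
    then have "ann y \<subset> ann (t \<star> y)" using ne by blast
    then have "pdim (ann (t \<star> y)) < pdim (ann y)"
      using pdim_strict[OF ann_idl[OF yL] p_ann[OF yL] ann_idl[OF mul_mem[OF t(1) yL]]] by blast
    moreover have "t \<star> y \<in> S" unfolding S_def using t mul_mem yL by blast
    ultimately show False using y(2) by (meson not_less)
  qed
  have ann_mult: "r \<in> ann (t \<star> y) \<longleftrightarrow> r \<star> t \<in> ann y" if "r \<in> L" "t \<in> L" for r t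
    unfolding ann_def using that mul_mem by (simp add: mul_assoc)
  have "P \<subseteq> ann y"
  proof
    fix x assume x: "x \<in> P"
    have xL: "x \<in> L" by (rule P_L[OF x])
    show "x \<in> ann y"
    proof (rule ccontr)
      assume xn: "x \<notin> ann y"
      \<comment> \<open>For t outside P, ann (t y) still lies in P, so it equals ann y by
        maximality; yet it contains x.\<close>
      have "t \<in> P" if t: "t \<in> L" "t \<star> x \<in> ann y" for t
      proof (rule ccontr)
        assume tP: "t \<notin> P"
        have "ann (t \<star> y) \<subseteq> P"
        proof
          fix r assume r: "r \<in> ann (t \<star> y)"
          then have rL: "r \<in> L" unfolding ann_def by blast
          then have "r \<star> t \<in> P" using r ann_mult[OF rL t(1)] annP by blast
          then show "r \<in> P" using prmD(3)[OF prm_P rL t(1)] tP by blast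
        qed
        then have "ann (t \<star> y) = ann y" by (rule max[OF t(1)])
        moreover have "x \<in> ann (t \<star> y)" using ann_mult[OF xL t(1)] t(2) by (simp add: mul_comm)
        ultimately show False using xn by blast
      qed
      then have "ann (x \<star> y) \<subseteq> P" using ann_mult[OF _ xL] unfolding ann_def by blast
      then have eq: "ann (x \<star> y) = ann y" by (rule max[OF xL])
      have step: "r \<in> ann y" if "r \<in> L" "r \<star> pw x k \<in> ann y" for r k
        using that
      proof (induction k arbitrary: r)
        case 0 then show ?case by (simp add: mul_one)
      next
        case (Suc k)
        have "(r \<star> x) \<star> pw x k \<in> ann y" using Suc.prems by (simp add: pw_Suc mul_assoc)
        then have "r \<star> x \<in> ann y" using Suc.IH mul_mem[OF Suc.prems(1) xL] by blast
        then show ?case using ann_mult[OF Suc.prems(1) xL] eq by blast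
      qed
      obtain i j where ij: "i < j" "pw x i - pw x j \<in> pL"
        using cosets_pigeonhole[OF finite_mod_p sg_pL, of "pw x"] pw_mem[OF xL] by blast
      define s where "s = one - pw x (j - i)"
      have sL: "s \<in> L" unfolding s_def using L_closed(2) one_mem pw_mem xL by blast
      have "j = (j - i) + i" using ij(1) by simp
      then have "pw x j = pw x (j - i) \<star> pw x i" using pw_add[OF xL, of "j - i" i] by simp
      then have "s \<star> pw x i = pw x i - pw x j" unfolding s_def by (simp add: mul_diff_left one_mul pw_mem xL)
      then have "s \<star> pw x i \<in> ann y" using ij(2) p_ann[OF yL] by auto
      then have "s \<in> P" using step[OF sL] annP by blast
      moreover have "pw x (j - i) \<in> P" using idl_pw[OF idl_P x] ij(1) by simp
      ultimately have "s + pw x (j - i) \<in> P" by (rule is_subgroup_add[OF sg_P])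
      then show False unfolding s_def using prmD(2)[OF prm_P] by simp
    qed
  qed
  then have "ann y = P" using annP by blast
  then show ?thesis using that[OF yL] unfolding ann_def by blast
qed

text \<open>
  Here \<open>z\<close> lies in the inverse fractional ideal of \<open>P\<close>, and \<open>w\<close> is a local uniformizer.
\<close>

lemma inverse_element:
  obtains z w where "of_nat p * z \<in> L" "\<And>x. x \<in> P \<Longrightarrow> z \<star> x \<in> L" "z \<notin> L" "w \<in> P" "z \<star> w \<notin> P"
proof -
  obtain y where y: "y \<in> L" "{r \<in> L. r \<star> y \<in> pL} = P" using annihilator_prime by blast
  define z where "z = cst (1 / of_nat p) * y"
  have pz: "of_nat p * z = y" unfolding z_def using of_nat_mult_cst(1)[OF p_gt(3)] .
  have zP: "z \<star> x \<in> L" if "x \<in> P" for x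
  proof -
    have "x \<star> y \<in> pL" using y(2) that by blast
    then obtain u where u: "u \<in> L" "x \<star> y = of_nat p * u" unfolding smultiple_def by blast
    have "of_nat p * (z \<star> x) = (of_nat p * z) \<star> x" by (simp only: mul_of_nat_left)
    then have "of_nat p * (z \<star> x) = of_nat p * u" using u(2) pz mul_comm by simp
    then have "z \<star> x = u" using qvec_of_nat_mult_cancel[OF p_gt(3)] by blast
    then show ?thesis using u(1) by simp
  qed
  have zL: "z \<notin> L"
  proof
    assume "z \<in> L"
    then have "y \<in> pL" using smultiple_mem pz by metis
    then have "one \<in> {r \<in> L. r \<star> y \<in> pL}" using one_mem one_mul[OF y(1)] by simp
    then show False using y(2) prmD(2)[OF prm_P] by blast
  qed
  have "\<exists>w\<in>P. z \<star> w \<notin> P"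
  proof (rule ccontr)
    \<comment> \<open>If z P stayed inside P, all p z^k would lie in P, and bounded denominators
      would put z into L.\<close>
    assume "\<not> (\<exists>w\<in>P. z \<star> w \<notin> P)"
    then have st: "z \<star> w \<in> P" if "w \<in> P" for w using that by blast
    have pP: "of_nat p * one \<in> P" using pL_P smultiple_mem[OF one_mem] by blast
    have "of_nat p * pw z k \<in> P" for k
    proof (induction k)
      case 0 then show ?case using pP by simp
    next
      case (Suc k)
      have "of_nat p * pw z (Suc k) = z \<star> (of_nat p * pw z k)" by (simp add: pw_Suc mul_of_nat_right)
      then show ?case using st[OF Suc] by simp
    qed
    then have "z \<in> L" using bounded pz y(1) P_L by blast
    then show False using zL by blast
  qed
  then show ?thesis using that[OF _ zP zL] pz y(1) by auto
qed

definition zinv :: qvec where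
  "zinv = (SOME z. of_nat p * z \<in> L \<and> (\<forall>x\<in>P. z \<star> x \<in> L) \<and> z \<notin> L \<and> (\<exists>w\<in>P. z \<star> w \<notin> P))"

lemma zinv: "of_nat p * zinv \<in> L" "x \<in> P \<Longrightarrow> zinv \<star> x \<in> L" "zinv \<notin> L" "\<exists>w\<in>P. zinv \<star> w \<notin> P"
proof -
  have "\<exists>z. of_nat p * z \<in> L \<and> (\<forall>x\<in>P. z \<star> x \<in> L) \<and> z \<notin> L \<and> (\<exists>w\<in>P. z \<star> w \<notin> P)"
    using inverse_element by metis
  from someI_ex[OF this] show "of_nat p * zinv \<in> L" "x \<in> P \<Longrightarrow> zinv \<star> x \<in> L" "zinv \<notin> L" "\<exists>w\<in>P. zinv \<star> w \<notin> P"
    unfolding zinv_def by blast+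
qed

text \<open>\<open>one\<close> is assumed neutral on L only, and \<open>zinv\<close> lies outside L;
  its multiple by p lies inside.\<close>

lemma one_zinv: "one \<star> zinv = zinv"
proof -
  have "of_nat p * (one \<star> zinv) = of_nat p * zinv" using one_mul[OF zinv(1)] by (simp add: mul_of_nat_right)
  then show ?thesis using qvec_of_nat_mult_cancel[OF p_gt(3)] by blast
qed

definition zpw :: "nat \<Rightarrow> qvec \<Rightarrow> qvec" where
  "zpw k x = pw zinv k \<star> x"

lemma zpw_0: "x \<in> L \<Longrightarrow> zpw 0 x = x" by (simp add: zpw_def one_mul)
lemma zpw_Suc: "zpw (Suc k) x = zinv \<star> zpw k x" by (simp add: zpw_def pw_Suc mul_assoc)
lemma zpw_Suc2: "zpw (Suc k) x = zpw k (zinv \<star> x)" by (simp add: zpw_def pw_Suc mul_ac)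
lemma zpw_diff: "zpw k (x - y) = zpw k x - zpw k y" by (simp add: zpw_def mul_diff_right)
lemma zpw_zero: "zpw k 0 = 0" by (simp add: zpw_def)
lemma zpw_mul: "zpw k (r \<star> x) = r \<star> zpw k x" by (simp add: zpw_def mul_left_comm)
lemma zpw_of_nat: "zpw k (of_nat m * x) = of_nat m * zpw k x" by (simp add: zpw_def mul_of_nat_right)

text \<open>The power \<open>P\<^sup>i\<close>, described by multiplication with powers of the inverse element.\<close>

definition Ppow :: "nat \<Rightarrow> qvec set" where
  "Ppow i = {x \<in> L. \<forall>j\<le>i. zpw j x \<in> L}"

lemma PpowD: "x \<in> Ppow i \<Longrightarrow> x \<in> L" "x \<in> Ppow i \<Longrightarrow> j \<le> i \<Longrightarrow> zpw j x \<in> L"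
  unfolding Ppow_def by blast+

lemma idl_Ppow: "idl (Ppow i)"
  unfolding idl_def is_subgroup_def Ppow_def
  by (auto simp: zpw_diff zpw_zero zpw_mul L_closed mul_mem)

lemma Ppow_0: "Ppow 0 = L"
  unfolding Ppow_def by (auto simp: zpw_0)

lemma Ppow_Suc_subset: "Ppow (Suc i) \<subseteq> Ppow i"
  unfolding Ppow_def by auto

text \<open>\<open>zinv \<star> w\<close> is a unit modulo P, which gives a partition of unity. It
  splits x as (zinv x) (a w) + x b and does the work of a localization at P.\<close>

lemma uniformizer:
  obtains w a b where "w \<in> P" "a \<in> L" "b \<in> P" "a \<star> (zinv \<star> w) + b = one" "zinv \<star> w \<in> L" "zinv \<star> w \<notin> P"
proof -
  obtain w where w: "w \<in> P" "zinv \<star> w \<notin> P" using zinv(4) by blast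
  obtain a where a: "a \<in> L" "(zinv \<star> w) \<star> a - one \<in> P" using prime_inverse[OF prm_P pL_P zinv(2)[OF w(1)] w(2)] by blast
  have "- ((zinv \<star> w) \<star> a - one) \<in> P" by (rule is_subgroup_uminus[OF sg_P a(2)])
  moreover have "a \<star> (zinv \<star> w) + - ((zinv \<star> w) \<star> a - one) = one" by (simp add: mul_comm)
  ultimately show ?thesis using that w a(1) zinv(2)[OF w(1)] by blast
qed

text \<open>An x outside P is invertible modulo P, so \<open>zinv \<star> x\<close> in L would bring
  \<open>zinv\<close> itself into L.\<close>

lemma zinv_mem_iff: assumes "x \<in> L" shows "zinv \<star> x \<in> L \<longleftrightarrow> x \<in> P"
proof
  assume zx: "zinv \<star> x \<in> L"
  show "x \<in> P"
  proof (rule ccontr)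
    assume "x \<notin> P"
    then obtain y where y: "y \<in> L" "x \<star> y - one \<in> P" using prime_inverse[OF prm_P pL_P assms] by blast
    have "zinv \<star> (x \<star> y - one) \<in> L" by (rule zinv(2)[OF y(2)])
    moreover have "zinv \<star> (x \<star> y) \<in> L" using mul_mem[OF zx y(1)] by (simp add: mul_assoc)
    ultimately have "zinv \<star> (x \<star> y) - zinv \<star> (x \<star> y - one) \<in> L" using L_closed(2) by blast
    then have "zinv \<star> one \<in> L" by (simp add: mul_diff_right)
    then show False using zinv(3) one_zinv mul_comm by metis
  qed
qed (rule zinv(2))

lemma Ppow_Suc_iff: "x \<in> Ppow (Suc i) \<longleftrightarrow> x \<in> Ppow i \<and> zpw i x \<in> P"
proof -
  have "x \<in> Ppow (Suc i) \<longleftrightarrow> x \<in> Ppow i \<and> zpw (Suc i) x \<in> L"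
    unfolding Ppow_def by (auto simp: le_Suc_eq)
  also have "\<dots> \<longleftrightarrow> x \<in> Ppow i \<and> zpw i x \<in> P"
    using zinv_mem_iff[of "zpw i x"] PpowD(2)[of x i i] by (auto simp: zpw_Suc)
  finally show ?thesis .
qed

lemma Ppow_mult: assumes "x \<in> Ppow i" "y \<in> P" shows "x \<star> y \<in> Ppow (Suc i)"
proof -
  have "zpw i (x \<star> y) \<in> P" using idlD(4)[OF idl_P PpowD(2)[OF assms(1) order_refl] assms(2)]
    by (simp add: mul_comm[of x] zpw_mul)
  moreover have "x \<star> y \<in> Ppow i" by (rule idlD(4)[OF idl_Ppow P_L[OF assms(2)] assms(1)])
  ultimately show ?thesis unfolding Ppow_Suc_iff by blast
qed

lemma Ppow_Suc_eq: "Ppow (Suc i) = Ppow i \<cdot>\<^bsub>rng\<^esub> P"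
proof (intro equalityI subsetI)
  fix x assume x: "x \<in> Ppow (Suc i)"
  obtain w a b where w: "w \<in> P" "a \<in> L" "b \<in> P" "a \<star> (zinv \<star> w) + b = one" by (rule uniformizer)
  have xL: "x \<in> L" by (rule PpowD(1)[OF x])
  \<comment> \<open>Partition of unity: in the first summand zinv x lies in \<open>Ppow i\<close>
    and a w in P, in the second x lies in \<open>Ppow i\<close> and b in P.\<close>
  have "x = (a \<star> (zinv \<star> w) + b) \<star> x" unfolding w(4) using one_mul[OF xL] by simp
  also have "\<dots> = (zinv \<star> x) \<star> (a \<star> w) + x \<star> b" unfolding mul_add_left by (simp only: mul_ac)
  finally have eq: "x = (zinv \<star> x) \<otimes>\<^bsub>rng\<^esub> (a \<star> w) \<oplus>\<^bsub>rng\<^esub> x \<otimes>\<^bsub>rng\<^esub> b" by simp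
  have "zpw j (zinv \<star> x) \<in> L" if "j \<le> i" for j using PpowD(2)[OF x, of "Suc j"] that by (simp add: zpw_Suc2)
  moreover have "zinv \<star> x \<in> L" using calculation[of 0] zpw_Suc2[of 0 x] zpw_Suc[of 0 x] zpw_0[OF xL] by simp
  ultimately have "zinv \<star> x \<in> Ppow i" unfolding Ppow_def by blast
  moreover have "x \<in> Ppow i" using x Ppow_Suc_subset by blast
  ultimately show "x \<in> Ppow i \<cdot>\<^bsub>rng\<^esub> P"
    by (subst eq) (intro ideal_prod.sum ideal_prod.prod idlD(3)[OF idl_P] w)
next
  fix x assume "x \<in> Ppow i \<cdot>\<^bsub>rng\<^esub> P"
  then show "x \<in> Ppow (Suc i)"
    by (induction rule: ideal_prod.induct) (simp_all add: Ppow_mult is_subgroup_add[OF idlD(1)[OF idl_Ppow]])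
qed

lemma Ppow_eq: "P [^]\<^bsub>ideals_set rng\<^esub> i = Ppow i"
proof (induction i)
  case 0 show ?case by (simp add: nat_pow_def ideals_set_def Ppow_0)
next
  case (Suc i) then show ?case unfolding rng_ideal_pow_Suc Ppow_Suc_eq by simp
qed

definition ram :: nat where
  "ram = (GREATEST e. pL \<subseteq> Ppow e)"

lemma pL_Ppow_iff: "pL \<subseteq> Ppow e \<longleftrightarrow> of_nat p * one \<in> Ppow e"
proof
  assume h: "of_nat p * one \<in> Ppow e"
  have "of_nat p * x \<in> Ppow e" if "x \<in> L" for x
    using idlD(4)[OF idl_Ppow that h] by (simp add: mul_of_nat_left one_mul that)
  then show "pL \<subseteq> Ppow e" unfolding smultiple_def by blast
next
  assume "pL \<subseteq> Ppow e" then show "of_nat p * one \<in> Ppow e" using smultiple_mem[OF one_mem] by blast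
qed

lemma Ppow_antimono: "i \<le> j \<Longrightarrow> Ppow j \<subseteq> Ppow i"
  unfolding Ppow_def by auto

text \<open>If arbitrarily high powers of P contained p, all p zinv^k would lie in L, and so would
  \<open>zinv\<close>.\<close>

lemma ram_bound: "\<exists>N. \<forall>e. pL \<subseteq> Ppow e \<longrightarrow> e \<le> N"
proof (rule ccontr)
  assume no: "\<not> ?thesis"
  have "of_nat p * pw zinv k \<in> L" for k
  proof -
    obtain e where e: "pL \<subseteq> Ppow e" "k < e" using no not_le by blast
    then have "of_nat p * one \<in> Ppow e" using pL_Ppow_iff by blast
    then have "zpw k (of_nat p * one) \<in> L" using e(2) PpowD(2)[of _ e k] by simp
    moreover have "pw zinv k \<star> one = pw zinv k"
    proof (cases k)
      case (Suc m)
      then show ?thesis using one_zinv by (simp add: pw_Suc mul_assoc mul_comm[of _ one]) (simp add: mul_left_comm[of one] flip: mul_assoc)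
    qed (simp add: one_mul one_mem)
    ultimately show ?thesis by (simp add: zpw_def mul_of_nat_right)
  qed
  then show False using bounded zinv(1,3) by blast
qed

lemma ram: "pL \<subseteq> Ppow ram" "pL \<subseteq> Ppow e \<Longrightarrow> e \<le> ram"
proof -
  obtain N where N: "\<And>e. pL \<subseteq> Ppow e \<Longrightarrow> e \<le> N" using ram_bound by blast
  have "pL \<subseteq> Ppow 0" unfolding Ppow_0 using smultiple_subset[OF subgroup_L] by blast
  then show "pL \<subseteq> Ppow ram" unfolding ram_def using GreatestI_nat[of "\<lambda>e. pL \<subseteq> Ppow e"] N by blast
  show "pL \<subseteq> Ppow e \<Longrightarrow> e \<le> ram" unfolding ram_def using Greatest_le_nat[of "\<lambda>e. pL \<subseteq> Ppow e"] N by blast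
qed

text \<open>The ideal quotient of pL by the highest power of P containing p. By
  \<open>factorization\<close> it complements that power, and by \<open>cofactor_not_subset\<close>
  it is not contained in P.\<close>

definition cofactor :: "qvec set" where
  "cofactor = {x \<in> L. \<forall>q\<in>Ppow ram. x \<star> q \<in> pL}"

lemma idl_cofactor: "idl cofactor"
  unfolding idl_def is_subgroup_def cofactor_def using is_subgroup_zero[OF sg_pL]
  by (auto simp: L_closed mul_diff_left mul_mem mul_assoc is_subgroup_diff[OF sg_pL] idlD(3)[OF idl_pL])

lemma zpw_p_cofactor: assumes "j \<le> ram" shows "zpw j (of_nat p * one) \<in> cofactor"
proof -
  have "of_nat p * one \<in> Ppow ram" using ram(1) pL_Ppow_iff by blast
  then have "zpw j (of_nat p * one) \<in> L" by (rule PpowD(2)[OF _ assms])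
  moreover have "zpw j (of_nat p * one) \<star> q \<in> pL" if q: "q \<in> Ppow ram" for q
  proof -
    have "zpw j (of_nat p * one) \<star> q = q \<star> zpw j (of_nat p * one)" by (rule mul_comm)
    also have "\<dots> = zpw j ((of_nat p * one) \<star> q)" by (simp add: zpw_mul mul_comm)
    also have "(of_nat p * one) \<star> q = of_nat p * q" using one_mul[OF PpowD(1)[OF q]] by (simp add: mul_of_nat_left)
    also have "zpw j (of_nat p * q) = of_nat p * zpw j q" by (rule zpw_of_nat)
    finally show ?thesis using smultiple_mem[OF PpowD(2)[OF q assms]] by simp
  qed
  ultimately show ?thesis unfolding cofactor_def by blast
qed

lemma cofactor_not_subset: "\<not> cofactor \<subseteq> P"
proof
  assume "cofactor \<subseteq> P"
  then have "zpw ram (of_nat p * one) \<in> P" using zpw_p_cofactor[OF order_refl] by blast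
  moreover have "of_nat p * one \<in> Ppow ram" using ram(1) pL_Ppow_iff by blast
  ultimately have "pL \<subseteq> Ppow (Suc ram)" unfolding pL_Ppow_iff Ppow_Suc_iff by blast
  then show False using ram(2)[of "Suc ram"] by simp
qed

lemma pw_Ppow: "x \<in> P \<Longrightarrow> pw x i \<in> Ppow i"
proof (induction i)
  case (Suc i) then show ?case using Ppow_mult[of "pw x i" i x] by (simp add: pw_Suc mul_comm)
qed (simp add: Ppow_0 one_mem)

lemma Ppow_mult_Ppow: "x \<in> Ppow i \<Longrightarrow> y \<in> Ppow j \<Longrightarrow> x \<star> y \<in> Ppow (i + j)"
proof (induction j arbitrary: y)
  case 0 then show ?case using idlD(4)[OF idl_Ppow] by (simp add: Ppow_0)
next
  case (Suc j)
  from Suc.prems(2) have "y \<in> Ppow j \<cdot>\<^bsub>rng\<^esub> P" unfolding Ppow_Suc_eq .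
  then show ?case
  proof (induction rule: ideal_prod.induct)
    case (prod a b)
    have "(x \<star> a) \<star> b \<in> Ppow (Suc (i + j))" using Suc.IH[OF Suc.prems(1) prod(1)] prod(2) by (rule Ppow_mult)
    then show ?case by (simp add: mul_assoc)
  next
    case (sum a b)
    then show ?case using is_subgroup_add[OF idlD(1)[OF idl_Ppow]] by (simp add: mul_add_right)
  qed
qed

text \<open>Expand p (a zinv w + b)^ram = p binomially. In each term the factors \<open>zinv\<close>
  are moved onto p, which gives an element of \<open>cofactor\<close>; what remains is a product of
  ram elements of P.\<close>

lemma factorization: "pL = Ppow ram \<cdot>\<^bsub>rng\<^esub> cofactor"
proof
  have sub: "x \<in> pL" if "x \<in> Ppow ram \<cdot>\<^bsub>rng\<^esub> cofactor" for x
    using that by (induction rule: ideal_prod.induct) (auto simp: cofactor_def mul_comm is_subgroup_add[OF sg_pL])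
  then show "Ppow ram \<cdot>\<^bsub>rng\<^esub> cofactor \<subseteq> pL" by blast
  interpret S: cring rng by (rule cring_rng)
  have "ideal (Ppow ram) rng" "ideal cofactor rng" using ideal_rng_iff idl_Ppow idl_cofactor by auto
  then have "ideal (Ppow ram \<cdot>\<^bsub>rng\<^esub> cofactor) rng" by (rule S.ideal_prod_is_ideal)
  then have id: "idl (Ppow ram \<cdot>\<^bsub>rng\<^esub> cofactor)" using ideal_rng_iff by blast
  obtain w a b where w: "w \<in> P" "a \<in> L" "b \<in> P" "a \<star> (zinv \<star> w) + b = one" "zinv \<star> w \<in> L" by (rule uniformizer)
  let ?u = "a \<star> (zinv \<star> w)"
  have uL: "?u \<in> L" by (rule mul_mem[OF w(2,5)])
  have pwu: "pw ?u j = zpw j (pw (a \<star> w) j)" for j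
  proof (induction j)
    case 0 then show ?case by (simp add: zpw_0 one_mem)
  next
    case (Suc j)
    have "pw ?u (Suc j) = ?u \<star> zpw j (pw (a \<star> w) j)" by (simp add: pw_Suc Suc)
    also have "\<dots> = zinv \<star> ((a \<star> w) \<star> zpw j (pw (a \<star> w) j))" by (simp only: mul_ac)
    also have "\<dots> = zpw (Suc j) (pw (a \<star> w) (Suc j))" by (simp only: pw_Suc zpw_Suc zpw_mul mul_left_comm)
    finally show ?case .
  qed
  have summand: "of_nat p * (pw ?u j \<star> pw b (ram - j)) \<in> Ppow ram \<cdot>\<^bsub>rng\<^esub> cofactor" if j: "j \<le> ram" for j
  proof -
    have "a \<star> w \<in> P" by (rule idlD(3)[OF idl_P w(2,1)])
    then have q: "pw (a \<star> w) j \<star> pw b (ram - j) \<in> Ppow ram"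
      using Ppow_mult_Ppow[OF pw_Ppow pw_Ppow[OF w(3)], of "a \<star> w" j "ram - j"] j by simp
    have awL: "pw (a \<star> w) j \<in> L" using pw_mem mul_mem[OF w(2) P_L[OF w(1)]] by blast
    have "of_nat p * (pw ?u j \<star> pw b (ram - j)) = zpw j ((of_nat p * one) \<star> pw (a \<star> w) j) \<star> pw b (ram - j)"
      unfolding pwu using one_mul[OF awL] by (simp add: mul_of_nat_left zpw_of_nat)
    also have "\<dots> = (pw (a \<star> w) j \<star> pw b (ram - j)) \<otimes>\<^bsub>rng\<^esub> zpw j (of_nat p * one)"
      by (simp add: mul_comm[of _ "pw (a \<star> w) j"] zpw_mul) (simp only: mul_ac)
    finally show ?thesis using ideal_prod.prod[OF q zpw_p_cofactor[OF j], of rng] by simp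
  qed
  have "pw (?u + b) ram = one" unfolding w(4) by (rule pw_one)
  then have "of_nat p * one = of_nat p * (\<Sum>j\<le>ram. of_nat (ram choose j) * (pw ?u j \<star> pw b (ram - j)))"
    using sum_choose_step[OF uL P_L[OF w(3)], of ram] by simp
  also have "\<dots> = (\<Sum>j\<le>ram. of_nat (ram choose j) * (of_nat p * (pw ?u j \<star> pw b (ram - j))))"
    by (simp add: sum_distrib_left mult.left_commute)
  also have "\<dots> \<in> Ppow ram \<cdot>\<^bsub>rng\<^esub> cofactor"
    by (intro is_subgroup_sum[OF idlD(1)[OF id]] is_subgroup_of_nat[OF idlD(1)[OF id]] summand) auto
  finally have p1: "of_nat p * one \<in> Ppow ram \<cdot>\<^bsub>rng\<^esub> cofactor" .
  have "of_nat p * x \<in> Ppow ram \<cdot>\<^bsub>rng\<^esub> cofactor" if "x \<in> L" for x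
    using idlD(4)[OF id that p1] by (simp add: mul_of_nat_left one_mul that)
  then show "pL \<subseteq> Ppow ram \<cdot>\<^bsub>rng\<^esub> cofactor" unfolding smultiple_def by blast
qed

lemma principal_p: "PIdl\<^bsub>rng\<^esub> ([p] \<cdot>\<^bsub>rng\<^esub> \<one>\<^bsub>rng\<^esub>) = pL"
proof -
  have "x \<otimes>\<^bsub>rng\<^esub> ([p] \<cdot>\<^bsub>rng\<^esub> \<one>\<^bsub>rng\<^esub>) = of_nat p * x" if "x \<in> L" for x
    using that by (simp add: rng_nat_multiple one_mem mul_of_nat_right mul_one)
  then have "PIdl\<^bsub>rng\<^esub> ([p] \<cdot>\<^bsub>rng\<^esub> \<one>\<^bsub>rng\<^esub>) = {of_nat p * x |x. x \<in> L}"
    unfolding cgenideal_def by (intro Collect_cong) (simp, metis)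
  then show ?thesis unfolding smultiple_def by auto
qed

text \<open>A factorization pL = P^e J puts pL into P^e, so no exponent exceeds \<open>ram\<close>,
  and \<open>factorization\<close> attains it.\<close>

lemma ramification_index_eq: "ramification_index rng p P = ram"
  unfolding ramification_index_def principal_p Ppow_eq
proof (rule Greatest_equality)
  show "\<exists>J. ideal J rng \<and> pL = Ppow ram \<cdot>\<^bsub>rng\<^esub> J"
    using factorization idl_cofactor ideal_rng_iff by blast
next
  fix e assume "\<exists>J. ideal J rng \<and> pL = Ppow e \<cdot>\<^bsub>rng\<^esub> J"
  then obtain J where J: "idl J" "pL = Ppow e \<cdot>\<^bsub>rng\<^esub> J" using ideal_rng_iff by blast
  have "x \<in> Ppow e" if "x \<in> Ppow e \<cdot>\<^bsub>rng\<^esub> J" for x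
    using that by (induction rule: ideal_prod.induct)
      (auto simp: is_subgroup_add[OF idlD(1)[OF idl_Ppow]] idlD(4)[OF idl_Ppow] dest: idlD(2)[OF J(1)])
  then show "e \<le> ram" using J(2) ram(2) by blast
qed

text \<open>Multiplication by W = w^i maps L/P isomorphically onto P^i/P^(i+1) and commutes with y.
  It is inverted by \<open>zpw i\<close> up to the factor u = zpw i W, a unit modulo P.\<close>

lemma graded_ptrace:
  assumes y: "y \<in> L" and t: "ptrace p L P (\<lambda>x. y \<star> x) t"
  shows "ptrace p (Ppow i) (Ppow (Suc i)) (\<lambda>x. y \<star> x) t"
proof -
  obtain r v A where v: "pbasis p L P r v" and A: "\<And>j. j < r \<Longrightarrow> y \<star> v j - (\<Sum>i<r. of_int (A i j) * v i) \<in> P"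
    and tA: "[t = (\<Sum>i<r. A i i)] (mod int p)" using t unfolding ptrace_def by blast
  obtain w a b where w: "w \<in> P" "a \<in> L" "b \<in> P" "a \<star> (zinv \<star> w) + b = one" "zinv \<star> w \<in> L" "zinv \<star> w \<notin> P" by (rule uniformizer)
  define W where "W = pw w i"
  define u where "u = zpw i W"
  have WP: "W \<in> Ppow i" unfolding W_def by (rule pw_Ppow[OF w(1)])
  have uL: "u \<in> L" unfolding u_def by (rule PpowD(2)[OF WP order_refl])
  have "zpw j (pw w j) = pw (zinv \<star> w) j" for j
  proof (induction j)
    case 0 then show ?case by (simp add: zpw_0 one_mem)
  next
    case (Suc j)
    have "zpw (Suc j) (pw w (Suc j)) = zinv \<star> (w \<star> zpw j (pw w j))" by (simp only: zpw_Suc pw_Suc zpw_mul mul_left_comm)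
    then show ?case unfolding Suc pw_Suc by (simp only: mul_assoc)
  qed
  then have uP: "u \<notin> P" unfolding u_def W_def using prm_pw[OF prm_P w(5)] w(6) by metis
  obtain u' where u': "u' \<in> L" "u \<star> u' - one \<in> P" by (rule prime_inverse[OF prm_P pL_P uL uP])
  have vL: "v k \<in> L" if "k < r" for k using pbasisD(1)[OF v that] .
  have zW: "zpw i (W \<star> x) = u \<star> x" for x unfolding u_def by (simp add: mul_comm[of _ x] zpw_mul)
  have sumW: "(\<Sum>k<r. of_int (c k) * (W \<star> v k)) = W \<star> (lincomb r c v)" for c
    by (simp add: mul_sum_right mul_of_int_right)
  have sumL: "lincomb r c v \<in> L" for c using vL by (intro L_closed(6,7)) auto
  have basis: "pbasis p (Ppow i) (Ppow (Suc i)) r (\<lambda>k. W \<star> v k)"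
    unfolding pbasis_def
  proof (intro conjI allI impI ballI)
    fix k assume "k < r" then show "W \<star> v k \<in> Ppow i" using idlD(4)[OF idl_Ppow vL WP] by blast
  next
    fix x assume x: "x \<in> Ppow i"
    have zx: "zpw i x \<in> L" by (rule PpowD(2)[OF x order_refl])
    obtain c where c: "u' \<star> zpw i x - lincomb r c v \<in> P" using pbasisD(2)[OF v mul_mem[OF u'(1) zx]] by blast
    let ?s = "\<Sum>k<r. of_int (c k) * v k"
    have "zpw i (x - W \<star> ?s) = u \<star> (u' \<star> zpw i x - ?s) - (u \<star> u' - one) \<star> zpw i x"
      by (simp add: zpw_diff zW mul_diff_right mul_diff_left mul_assoc one_mul zx)
    also have "\<dots> \<in> P" by (intro is_subgroup_diff[OF sg_P] idlD(3)[OF idl_P uL c] idlD(4)[OF idl_P zx u'(2)])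
    finally have "zpw i (x - W \<star> ?s) \<in> P" .
    moreover have "x - W \<star> ?s \<in> Ppow i"
      by (intro is_subgroup_diff[OF idlD(1)[OF idl_Ppow] x] idlD(4)[OF idl_Ppow sumL WP])
    ultimately show "\<exists>c. x - (\<Sum>k<r. of_int (c k) * (W \<star> v k)) \<in> Ppow (Suc i)"
      unfolding sumW Ppow_Suc_iff by blast
  next
    fix c k assume "(\<Sum>k<r. of_int (c k) * (W \<star> v k)) \<in> Ppow (Suc i)" and k: "k < r"
    then have "u \<star> (lincomb r c v) \<in> P" unfolding sumW Ppow_Suc_iff zW by blast
    then have "lincomb r c v \<in> P" using prmD(3)[OF prm_P uL sumL] uP by blast
    then show "int p dvd c k" using pbasisD(3)[OF v _ k] by blast
  qed
  have "y \<star> (W \<star> v j) - (\<Sum>k<r. of_int (A k j) * (W \<star> v k)) \<in> Ppow (Suc i)" if "j < r" for j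
  proof -
    have "y \<star> (W \<star> v j) - (\<Sum>k<r. of_int (A k j) * (W \<star> v k)) = W \<star> (y \<star> v j - (\<Sum>k<r. of_int (A k j) * v k))"
      unfolding sumW by (simp add: mul_diff_right mul_left_comm)
    then show ?thesis using Ppow_mult[OF WP A[OF that]] by simp
  qed
  then show ?thesis unfolding ptrace_def using basis tA by blast
qed

text \<open>The bound on i ensures that p kills L/P^i, so that the quotient is a vector space over
  F_p.\<close>

lemma ptrace_Ppow:
  assumes y: "y \<in> L" and t: "ptrace p L P (\<lambda>x. y \<star> x) t" and i: "i \<le> ram"
  shows "ptrace p L (Ppow i) (\<lambda>x. y \<star> x) (int i * t)"
  using i
proof (induction i)
  case 0
  show ?case using ptrace_zeroI[OF pbasis_self[OF subgroup_L], of "\<lambda>x. y \<star> x"] mul_mem[OF y] by (simp add: Ppow_0)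
next
  case (Suc i)
  have pm: "of_nat p * x \<in> Ppow (Suc i)" if "x \<in> L" for x
    using ram(1) Ppow_antimono[OF Suc.prems] smultiple_mem[OF that] by blast
  have "ptrace p L (Ppow (Suc i)) (\<lambda>x. y \<star> x) (int i * t + t)"
    by (rule ptrace_cat[OF subgroup_L idlD(1)[OF idl_Ppow] idlD(1)[OF idl_Ppow] _ Ppow_Suc_subset pm _ graded_ptrace[OF y t]])
      (use Suc PpowD(1) in auto)
  then show ?case by (simp add: algebra_simps)
qed

text \<open>The trace is ram t on L/P^ram and 0 on P^ram/pL, because y multiplies P^ram into
  pL.\<close>

lemma ptrace_cofactor:
  assumes y: "y \<in> cofactor" and t: "ptrace p L P (\<lambda>x. y \<star> x) t"
  shows "ptrace p L pL (\<lambda>x. y \<star> x) (int (ramification_index rng p P) * t)"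
proof -
  have yL: "y \<in> L" using y unfolding cofactor_def by blast
  obtain r v where v: "pbasis p (Ppow ram) pL r v" using ideal_pbasis[OF idl_Ppow idl_pL order_refl] by blast
  have z: "ptrace p (Ppow ram) pL (\<lambda>x. y \<star> x) 0"
    by (rule ptrace_zeroI[OF v]) (use y in \<open>auto simp: cofactor_def\<close>)
  have "ptrace p L pL (\<lambda>x. y \<star> x) (int ram * t + 0)"
    by (rule ptrace_cat[OF subgroup_L idlD(1)[OF idl_Ppow] sg_pL _ ram(1) _ ptrace_Ppow[OF yL t order_refl] z])
      (use PpowD(1) smultiple_mem in auto)
  then show ?thesis unfolding ramification_index_eq by simp
qed

end

lemma ptrace_ex:
  assumes v: "pbasis p L M r v" and \<phi>: "\<And>x. x \<in> L \<Longrightarrow> \<phi> x \<in> L"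
  shows "\<exists>t. ptrace p L M \<phi> t"
proof -
  have "\<forall>j\<in>{..<r}. \<exists>c. \<phi> (v j) - lincomb r c v \<in> M"
    using pbasisD(2)[OF v \<phi>[OF pbasisD(1)[OF v]]] by blast
  then obtain c where c: "\<And>j. j < r \<Longrightarrow> \<phi> (v j) - lincomb r (c j) v \<in> M" by (metis lessThan_iff)
  have "ptrace p L M \<phi> (\<Sum>i<r. c i i)"
    unfolding ptrace_def using v c by (intro exI[of _ r] exI[of _ v] exI[of _ "\<lambda>i j. c j i"]) auto
  then show ?thesis by blast
qed

lemma ptrace_cong_mod:
  assumes t: "ptrace p L M \<phi> t" and sg: "is_subgroup M" and eq: "\<And>x. x \<in> L \<Longrightarrow> \<psi> x - \<phi> x \<in> M"
  shows "ptrace p L M \<psi> t"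
proof -
  obtain r v A where v: "pbasis p L M r v" and A: "\<And>j. j < r \<Longrightarrow> \<phi> (v j) - (\<Sum>i<r. of_int (A i j) * v i) \<in> M"
    and t: "[t = (\<Sum>i<r. A i i)] (mod int p)" using t unfolding ptrace_def by blast
  have "\<psi> (v j) - (\<Sum>i<r. of_int (A i j) * v i) \<in> M" if "j < r" for j
    using is_subgroup_add[OF sg eq[OF pbasisD(1)[OF v that]] A[OF that]] by simp
  then show ?thesis unfolding ptrace_def using v t by blast
qed

lemma (in mring) primeideal_rng_iff: "primeideal P rng \<longleftrightarrow> prm P"
proof
  assume P: "primeideal P rng"
  then have id: "ideal P rng" and I: "idl P" using primeideal.axioms(1) ideal_rng_iff by blast+
  have "one \<notin> P"
  proof
    assume "one \<in> P"
    then have "carrier rng \<subseteq> P" using idlD(4)[OF I, of _ one] one_mul by (force simp: mul_comm)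
    then show False using primeideal.I_notcarr[OF P] idlD(2)[OF I] by auto
  qed
  then show "prm P" unfolding prm_def using I primeideal.I_prime[OF P] by auto
next
  assume P: "prm P"
  show "primeideal P rng"
  proof (rule primeidealI)
    show "ideal P rng" using prmD(1)[OF P] ideal_rng_iff by blast
    show "cring rng" by (rule cring_rng)
    show "carrier rng \<noteq> P" using prmD(2)[OF P] one_mem by auto
  qed (use prmD(3)[OF P] in auto)
qed

lemma (in pring) pL_subset_iff: "idl P \<Longrightarrow> pL \<subseteq> P \<longleftrightarrow> [p] \<cdot>\<^bsub>rng\<^esub> \<one>\<^bsub>rng\<^esub> \<in> P"
proof -
  assume P: "idl P"
  have "of_nat p * x \<in> P" if "of_nat p * one \<in> P" "x \<in> L" for x
    using idlD(4)[OF P that(2,1)] one_mul[OF that(2)] by (simp add: mul_of_nat_left)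
  then show ?thesis using rng_nat_multiple[OF one_mem, of p] smultiple_mem[OF one_mem, of p] by (auto simp: smultiple_def)
qed

section \<open>Direct factors of the integral closure\<close>

context qalg_nd
begin

text \<open>For an idempotent of the closure this is the direct factor that it cuts out, an order
  whose unit is that idempotent.\<close>

definition piece :: "qvec \<Rightarrow> qvec set" where
  "piece e = {x \<in> intcl. e \<star> x = x}"

end

locale qalg_idem = qalg_nd +
  fixes e :: qvec
  assumes e_intcl: "e \<in> intcl" and e_idem: "e \<star> e = e"
begin

lemma pieceD: "x \<in> piece e \<Longrightarrow> x \<in> intcl" "x \<in> piece e \<Longrightarrow> e \<star> x = x"
  unfolding piece_def by blast+

lemma e_mul_piece: "x \<in> intcl \<Longrightarrow> e \<star> x \<in> piece e"
  unfolding piece_def using C.mul_mem[OF e_intcl] e_idem by (simp flip: C.mul_assoc)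

sublocale S: mring mul e "piece e"
proof unfold_locales
  show "is_subgroup (piece e)"
    by (rule is_subgroupI) (auto simp: piece_def C.L_closed C.mul_diff_right)
  fix x y assume "x \<in> piece e" "y \<in> piece e"
  then show "x \<star> y \<in> piece e" unfolding piece_def using C.mul_mem by (auto simp flip: C.mul_assoc)
next
  show "x \<star> y \<star> z = x \<star> (y \<star> z)" for x y z by (rule C.mul_assoc)
  show "x \<star> y = y \<star> x" for x y by (rule C.mul_comm)
  show "(x + y) \<star> z = x \<star> z + y \<star> z" for x y z by (rule C.mul_add_left)
qed (auto simp: piece_def e_intcl e_idem)

lemma S_pw: "x \<in> qspace n \<Longrightarrow> S.pw x k = e \<star> Q.pw x k"
proof (induction k)
  case 0
  then show ?case using C.mul_one[OF e_intcl] by simp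
next
  case (Suc k)
  then show ?case by (simp add: S.pw_Suc Q.pw_Suc Q.mul_left_comm)
qed

end

locale qalg_idem_prime = qalg_idem + qalg_nd_prime
begin

lemma smultiple_piece_iff: "x \<in> piece e \<Longrightarrow> x \<in> smultiple p intcl \<longleftrightarrow> x \<in> smultiple p (piece e)"
proof
  assume x: "x \<in> piece e" "x \<in> smultiple p intcl"
  then obtain u where u: "u \<in> intcl" "x = of_nat p * u" unfolding smultiple_def by blast
  have "x = of_nat p * (e \<star> u)" using pieceD(2)[OF x(1)] u(2) by (simp add: C.mul_of_nat_right)
  then show "x \<in> smultiple p (piece e)" using smultiple_mem[OF e_mul_piece[OF u(1)]] by simp
next
  assume "x \<in> smultiple p (piece e)"
  then show "x \<in> smultiple p intcl" unfolding smultiple_def using pieceD(1) by blast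
qed

text \<open>If all p z^k lie in the piece, the powers of z have bounded denominators over the
  closure and z is integral by \<open>intcl_bounded\<close>; here integral closedness
  enters.\<close>

sublocale S: max_pring mul e "piece e" p
proof unfold_locales
  show "Factorial_Ring.prime p" by (rule prime_p')
  have fin: "finite (cosets_mod (piece e) (smultiple p intcl))"
    by (rule finite_cosets_mod_mono[OF finite_intcl_mod[OF Zp.p_gt(2)]])
      (use pieceD(1) is_subgroup_smultiple is_subgroup_intcl in auto)
  have "{y \<in> piece e. y - x \<in> smultiple p intcl} = {y \<in> piece e. y - x \<in> smultiple p (piece e)}" if "x \<in> piece e" for x
    using smultiple_piece_iff S.L_closed(2)[OF _ that] by blast
  then have "cosets_mod (piece e) (smultiple p intcl) = cosets_mod (piece e) (smultiple p (piece e))"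
    unfolding cosets_mod_def by auto
  then show "finite (cosets_mod (piece e) (smultiple p (piece e)))" using fin by simp
next
  fix z assume pz: "of_nat p * z \<in> piece e" and pw: "\<And>k. of_nat p * S.pw z k \<in> piece e"
  have pq: "of_nat p * z \<in> qspace n" using pieceD(1)[OF pz] intcl_subset_qspace by blast
  have "cst (1 / of_nat p) * (of_nat p * z) = z" using of_nat_mult_cst(2)[OF Zp.p_gt(3)] .
  then have zq: "z \<in> qspace n" using qspace_cst[OF pq, of "1 / of_nat p"] by simp
  have "of_nat p * (e \<star> z) = of_nat p * z" using pieceD(2)[OF pz] by (simp add: C.mul_of_nat_right)
  then have ez: "e \<star> z = z" using qvec_of_nat_mult_cancel[OF Zp.p_gt(3)] by blast
  have "of_nat p * Q.pw z k \<in> intcl" for k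
  proof (cases k)
    \<comment> \<open>\<open>Q.pw z 0\<close> is the unit of the whole algebra and not e, so the
      zeroth power is treated apart.\<close>
    case 0
    then show ?thesis using C.L_closed(5)[OF C.one_mem] by simp
  next
    case (Suc m)
    have "e \<star> Q.pw z k = Q.pw z k" unfolding Suc Q.pw_Suc using ez by (simp flip: Q.mul_assoc)
    then show ?thesis using pieceD(1)[OF pw[of k]] S_pw[OF zq] by simp
  qed
  then have "z \<in> intcl" using intcl_bounded[OF zq Zp.p_gt(2)] by blast
  then show "z \<in> piece e" unfolding piece_def using ez by blast
qed

text \<open>The complementary factor contributes 0: the closure modulo M is the piece modulo p, and
  y = y e kills M modulo p times the closure.\<close>

lemma piece_trace:
  assumes y: "y \<in> piece e" and t: "ptrace p (piece e) (smultiple p (piece e)) (\<lambda>x. y \<star> x) t"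
  shows "\<exists>k. tr y = of_int k \<and> [k = t] (mod int p)"
proof -
  obtain r v A where v: "pbasis p (piece e) (smultiple p (piece e)) r v"
    and A: "\<And>j. j < r \<Longrightarrow> y \<star> v j - (\<Sum>i<r. of_int (A i j) * v i) \<in> smultiple p (piece e)"
    and tA: "[t = (\<Sum>i<r. A i i)] (mod int p)" using t unfolding ptrace_def by blast
  define M where "M = {x \<in> intcl. e \<star> x \<in> smultiple p (piece e)}"
  have sgp: "is_subgroup (smultiple p intcl)" by (rule is_subgroup_smultiple[OF is_subgroup_intcl])
  have M: "is_subgroup M"
    by (rule is_subgroupI) (auto simp: M_def C.L_closed C.mul_diff_right is_subgroup_closed[OF is_subgroup_smultiple[OF S.subgroup_L]])
  have pM: "smultiple p intcl \<subseteq> M"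
    unfolding M_def smultiple_def using e_mul_piece by (auto simp: C.mul_of_nat_right C.L_closed)
  have Mp: "x \<in> M" if "x \<in> piece e" "x \<in> smultiple p (piece e)" for x using that pieceD unfolding M_def by simp
  have vp: "v i \<in> piece e" if "i < r" for i using pbasisD(1)[OF v that] .
  have sp: "lincomb r c v \<in> piece e" for c using vp by (intro S.L_closed(6,7)) auto
  have b: "pbasis p intcl M r v" unfolding pbasis_def
  proof (intro conjI allI impI ballI)
    fix i assume "i < r" then show "v i \<in> intcl" using vp pieceD(1) by blast
  next
    fix x assume x: "x \<in> intcl"
    obtain c where c: "e \<star> x - lincomb r c v \<in> smultiple p (piece e)" using pbasisD(2)[OF v e_mul_piece[OF x]] by blast
    have "e \<star> (x - lincomb r c v) = e \<star> x - lincomb r c v"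
      unfolding C.mul_diff_right pieceD(2)[OF sp] ..
    then show "\<exists>c. x - lincomb r c v \<in> M"
      unfolding M_def using c C.L_closed(2)[OF x pieceD(1)[OF sp]] by (intro exI[of _ c]) simp
  next
    fix c i assume "lincomb r c v \<in> M" and i: "i < r"
    then have "lincomb r c v \<in> smultiple p (piece e)" unfolding M_def using pieceD(2)[OF sp] by auto
    then show "int p dvd c i" using pbasisD(3)[OF v _ i] by blast
  qed
  have t1: "ptrace p intcl M (\<lambda>x. y \<star> x) t" unfolding ptrace_def
  proof (intro exI conjI allI impI)
    show "pbasis p intcl M r v" by (rule b)
    show "y \<star> v j - (\<Sum>i<r. of_int (A i j) * v i) \<in> M" if "j < r" for j
      by (rule Mp[OF S.L_closed(2)[OF S.mul_mem[OF y vp[OF that]] sp] A[OF that]])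
  qed (rule tA)
  have fin: "finite (cosets_mod M (smultiple p intcl))"
    by (rule finite_cosets_mod_mono[OF finite_intcl_mod[OF Zp.p_gt(2)] _ _ sgp sgp]) (auto simp: M_def)
  have "of_nat p * x \<in> smultiple p intcl" if "x \<in> M" for x using that smultiple_mem unfolding M_def by blast
  then obtain s w where w: "pbasis p M (smultiple p intcl) s w"
    using pbasis_exists[OF prime_p' M sgp _ fin] by blast
  have t2: "ptrace p M (smultiple p intcl) (\<lambda>x. y \<star> x) 0"
  proof (rule ptrace_zeroI[OF w])
    fix x assume "x \<in> M"
    then obtain u where u: "u \<in> piece e" "e \<star> x = of_nat p * u" unfolding M_def smultiple_def by blast
    have "y \<star> x = y \<star> (e \<star> x)" using S.mul_one[OF y] by (simp flip: C.mul_assoc)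
    then have "y \<star> x = of_nat p * (y \<star> u)" unfolding u(2) by (simp add: C.mul_of_nat_right)
    then show "y \<star> x \<in> smultiple p intcl" using smultiple_mem[OF pieceD(1)[OF S.mul_mem[OF y u(1)]]] by simp
  qed
  have "ptrace p intcl (smultiple p intcl) (\<lambda>x. y \<star> x) (t + 0)"
    by (rule ptrace_cat[OF is_subgroup_intcl M sgp _ pM smultiple_mem t1 t2]) (auto simp: M_def)
  moreover obtain l where "zbasis n intcl l" using intcl_zbasis by blast
  ultimately show ?thesis
    unfolding tr_def using trace_on_lattice_cong[OF is_subgroup_intcl _ C.additive_map_mul C.mul_mem[OF pieceD(1)[OF y]]] by auto
qed

end

section \<open>Tame ramification and the radical of the trace form\<close>

context qalg_nd_prime
begin

lemma intcl_denominator: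
  assumes pmax
  obtains d where "\<not> int p dvd d" "\<And>x. x \<in> intcl \<Longrightarrow> of_int d * x \<in> R"
proof -
  \<comment> \<open>The part of the discriminant prime to p; the factors p are removed one at a time
    with \<open>pmax\<close>.\<close>
  obtain d where d: "disc = int p ^ multiplicity (int p) disc * d" "\<not> int p dvd d"
    using multiplicity_decompose'[of disc "int p"] disc_neq_0 Zp.p_gt by auto
  have "of_int d * x \<in> R" if x: "x \<in> intcl" for x
  proof -
    have "of_int d * x \<in> R" if "of_int (int p ^ k * d) * x \<in> R" for k
      using that
    proof (induction k)
      case (Suc k)
      have "(of_int (int p ^ Suc k * d) :: qvec) * x = of_nat p * (of_int (int p ^ k * d) * x)" by (simp add: mult.assoc)
      then have "of_nat p * (of_int (int p ^ k * d) * x) \<in> R" using Suc.prems by (simp only:)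
      then have "of_int (int p ^ k * d) * x \<in> R" using assms C.L_closed(6)[OF x] unfolding pmax_def by blast
      then show ?case by (rule Suc.IH)
    qed simp
    then show ?thesis using disc_intcl[OF x] d(1) by metis
  qed
  then show ?thesis using that d(2) by blast
qed

text \<open>The multiple d r lies in R, and d is a unit modulo p.\<close>

lemma trace_dvd_extend:
  assumes d: "\<not> int p dvd d" "\<And>x. x \<in> intcl \<Longrightarrow> of_int d * x \<in> R" and u: "u \<in> R" "\<And>r. r \<in> R \<Longrightarrow> int p dvd itr (u \<star> r)"
    and r: "r \<in> intcl" and k: "tr (u \<star> r) = of_int k"
  shows "int p dvd k"
proof -
  have "itr (u \<star> (of_int d * r)) = d * k"
  proof -
    have "of_int (itr (u \<star> (of_int d * r))) = tr (u \<star> (of_int d * r))" by (rule of_int_itr[OF Z.mul_mem[OF u(1) d(2)[OF r]]])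
    also have "\<dots> = of_int (d * k)" using k by (simp add: Z.mul_of_int_right tr_of_int)
    finally show ?thesis by (simp only: of_int_eq_iff)
  qed
  then have "int p dvd d * k" using u(2)[OF d(2)[OF r]] by simp
  then show ?thesis using d(1) prime_p' by (metis prime_dvd_mult_iff prime_nat_int_transfer)
qed

text \<open>If p divides the ramification index of P, an element y of \<open>cofactor\<close>
  outside P has tr (y r) divisible by p for all r in R, by \<open>ptrace_cofactor\<close>. Then d y,
  which lies in R, is nilpotent modulo p by \<open>cond_a\<close>; so d y lies in P and, d being a
  unit modulo p, so does y.\<close>

lemma cond_a_imp_tame:
  assumes max: pmax and a: cond_a and e: "e \<in> intcl" "e \<star> e = e"
    and P: "primeideal P (mring.rng mul e (piece e))"
      "[p] \<cdot>\<^bsub>mring.rng mul e (piece e)\<^esub> \<one>\<^bsub>mring.rng mul e (piece e)\<^esub> \<in> P"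
  shows "coprime (ramification_index (mring.rng mul e (piece e)) p P) p"
proof -
  interpret E: qalg_idem_prime n mul one e p by unfold_locales (rule e)+
  have prm: "E.S.prm P" using P(1) E.S.primeideal_rng_iff by blast
  have pP: "smultiple p (piece e) \<subseteq> P" using E.S.pL_subset_iff[OF E.S.prmD(1)[OF prm]] P(2) by blast
  interpret E: max_pring_prime mul e "piece e" p P by unfold_locales (rule prm pP)+
  obtain d where d: "\<not> int p dvd d" "\<And>x. x \<in> intcl \<Longrightarrow> of_int d * x \<in> R" using intcl_denominator[OF max] by blast
  let ?e = "ramification_index (mring.rng mul e (piece e)) p P"
  show ?thesis
  proof (rule ccontr)
    assume "\<not> coprime ?e p"
    then have pe: "p dvd ?e" using prime_p' by (metis coprime_commute prime_imp_coprime)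
    obtain y where y: "y \<in> E.cofactor" "y \<notin> P" using E.cofactor_not_subset by blast
    have yS: "y \<in> piece e" using E.S.idlD(2)[OF E.idl_cofactor y(1)] .
    have yI: "y \<in> intcl" by (rule E.pieceD(1)[OF yS])
    have dyR: "of_int d * y \<in> R" by (rule d(2)[OF yI])
    have "int p dvd itr ((of_int d * y) \<star> r)" if r: "r \<in> R" for r
    proof -
      have rI: "r \<in> intcl" using r intvecs_subset_intcl by blast
      have er: "e \<star> r \<in> piece e" by (rule E.e_mul_piece[OF rI])
      have yr: "y \<star> (e \<star> r) \<in> E.cofactor" by (rule E.S.idlD(4)[OF E.idl_cofactor er y(1)])
      have eq: "y \<star> (e \<star> r) = y \<star> r" using E.S.mul_one[OF yS] by (simp flip: C.mul_assoc)
      obtain s v where v: "pbasis p (piece e) P s v" using E.S.ideal_pbasis[OF E.S.idl_L E.idl_P pP] by blast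
      have yrS: "y \<star> (e \<star> r) \<in> piece e" by (rule E.S.mul_mem[OF yS er])
      obtain t where t: "ptrace p (piece e) P (\<lambda>x. (y \<star> (e \<star> r)) \<star> x) t"
        using ptrace_ex[OF v, of "\<lambda>x. (y \<star> (e \<star> r)) \<star> x"] E.S.mul_mem[OF yrS] by blast
      obtain k where k: "tr (y \<star> r) = of_int k" "[k = int ?e * t] (mod int p)"
        using E.piece_trace[OF yrS E.ptrace_cofactor[OF yr t]] unfolding eq by blast
      have "int p dvd int ?e * t" using pe by simp
      then have "int p dvd k" using k(2) cong_dvd_iff by blast
      have "of_int (itr ((of_int d * y) \<star> r)) = tr ((of_int d * y) \<star> r)" by (rule of_int_itr[OF Z.mul_mem[OF dyR r]])
      also have "\<dots> = of_int (d * k)" using k(1) by (simp add: Z.mul_of_int_left tr_of_int)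
      finally have "itr ((of_int d * y) \<star> r) = d * k" by (simp only: of_int_eq_iff)
      then show ?thesis using \<open>int p dvd k\<close> by simp
    qed
    then have "of_int d * y \<in> J" using a dyR unfolding cond_a_def by blast
    then obtain k where k: "Q.pw (of_int d * y) k \<in> smultiple p R" unfolding Zp.nilrad_def by blast
    have dyS: "of_int d * y \<in> piece e" by (rule E.S.L_closed(6)[OF yS])
    have dyq: "of_int d * y \<in> qspace n" using dyR intvecs_subset_qspace by blast
    obtain u where u: "u \<in> R" "Q.pw (of_int d * y) k = of_nat p * u" using k unfolding smultiple_def by blast
    have "E.S.pw (of_int d * y) k = of_nat p * (e \<star> u)" unfolding E.S_pw[OF dyq] u(2) by (rule C.mul_of_nat_right)
    moreover have "e \<star> u \<in> piece e" using u(1) intvecs_subset_intcl E.e_mul_piece by blast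
    ultimately have "E.S.pw (of_int d * y) k \<in> P" using pP smultiple_mem by auto
    then have dyP: "of_int d * y \<in> P" by (rule E.S.prm_pw[OF prm dyS])
    have "coprime d (int p)" using d(1) prime_p' by (metis coprime_commute prime_imp_coprime prime_nat_int_transfer)
    then obtain a b where ab: "a * d + b * int p = 1" by (metis bezout_int coprime_iff_gcd_eq_1)
    have "y = of_int (a * d + b * int p) * y" unfolding ab by simp
    also have "\<dots> = of_int a * (of_int d * y) + of_int b * (of_nat p * y)" by (simp add: algebra_simps)
    also have "\<dots> \<in> P"
      using pP smultiple_mem[OF yS, of p] by (intro is_subgroup_add[OF E.sg_P] is_subgroup_of_int[OF E.sg_P] dyP) auto
    finally show False using y(2) by blast
  qed
qed

text \<open>A component \<open>E i \<star> u\<close> that is not nilpotent modulo p avoids some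
  prime P. Then u has a multiple q in \<open>cofactor\<close> congruent modulo P to a c of nonzero
  residue trace t. So tr q is the ramification index times t modulo p, prime to p by tameness,
  although multiples of u have traces divisible by p.\<close>

lemma tame_imp_cond_a:
  fixes E :: "nat \<Rightarrow> qvec"
  assumes max: pmax and E: "\<And>i. i < m \<Longrightarrow> E i \<in> intcl" "\<And>i. i < m \<Longrightarrow> E i \<star> E i = E i" "(\<Sum>i<m. E i) = one"
    and tame: "\<And>i P. i < m \<Longrightarrow> primeideal P (mring.rng mul (E i) (piece (E i))) \<Longrightarrow>
      [p] \<cdot>\<^bsub>mring.rng mul (E i) (piece (E i))\<^esub> \<one>\<^bsub>mring.rng mul (E i) (piece (E i))\<^esub> \<in> P \<Longrightarrow>
      coprime (ramification_index (mring.rng mul (E i) (piece (E i))) p P) p"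
  shows cond_a
  unfolding cond_a_def
proof (intro ballI impI)
  fix u assume u: "u \<in> R" "\<forall>r\<in>R. int p dvd itr (u \<star> r)"
  obtain d where d: "\<not> int p dvd d" "\<And>x. x \<in> intcl \<Longrightarrow> of_int d * x \<in> R" using intcl_denominator[OF max] by blast
  have uI: "u \<in> intcl" using u(1) intvecs_subset_intcl by blast
  have uq: "u \<in> qspace n" using u(1) intvecs_subset_qspace by blast
  have nil: "\<exists>k. \<forall>l\<ge>k. E i \<star> Q.pw u l \<in> smultiple p intcl" if i: "i < m" for i
  proof -
    interpret E: qalg_idem_prime n mul one "E i" p by unfold_locales (rule E i)+
    let ?S = "piece (E i)"
    have uS: "E i \<star> u \<in> ?S" by (rule E.e_mul_piece[OF uI])
    have "E i \<star> u \<in> E.S.nilrad"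
    proof (rule ccontr)
      assume "E i \<star> u \<notin> E.S.nilrad"
      then obtain P where P: "E.S.prm P" "smultiple p ?S \<subseteq> P" "E i \<star> u \<notin> P" using E.S.exists_prime_avoiding[OF uS] by blast
      interpret E: max_pring_prime mul "E i" ?S p P by unfold_locales (rule P)+
      let ?e = "ramification_index (mring.rng mul (E i) ?S) p P"
      have cop: "coprime ?e p"
        using tame[OF i] P(1) E.S.primeideal_rng_iff E.S.pL_subset_iff[OF E.idl_P] P(2) by blast
      obtain y where y: "y \<in> E.cofactor" "y \<notin> P" using E.cofactor_not_subset by blast
      have yS: "y \<in> ?S" using E.S.idlD(2)[OF E.idl_cofactor y(1)] .
      obtain c t where c: "c \<in> ?S" "ptrace p ?S P (\<lambda>x. c \<star> x) t" "\<not> int p dvd t" using E.S.residue_trace_nonzero[OF P(1,2)] by blast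
      have uyS: "(E i \<star> u) \<star> y \<in> ?S" by (rule E.S.mul_mem[OF uS yS])
      have "(E i \<star> u) \<star> y \<notin> P" using E.S.prmD(3)[OF P(1) uS yS] P(3) y(2) by blast
      then obtain w where w: "w \<in> ?S" "((E i \<star> u) \<star> y) \<star> w - E i \<in> P" using E.S.prime_inverse[OF P(1,2) uyS] by blast
      \<comment> \<open>w inverts E_i u y modulo P, which makes q congruent to c, while the factor y
        keeps q in \<open>cofactor\<close>.\<close>
      define q where "q = ((E i \<star> u) \<star> y) \<star> (w \<star> c)"
      have wcS: "w \<star> c \<in> ?S" by (rule E.S.mul_mem[OF w(1) c(1)])
      have "q - c = (((E i \<star> u) \<star> y) \<star> w - E i) \<star> c" unfolding q_def
        using E.S.one_mul[OF c(1)] by (simp add: C.mul_diff_left C.mul_assoc)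
      then have qc: "q - c \<in> P" using E.S.idlD(4)[OF E.idl_P c(1) w(2)] by simp
      have qcof: "q \<in> E.cofactor"
        unfolding q_def by (intro E.S.idlD(4)[OF E.idl_cofactor wcS] E.S.idlD(3)[OF E.idl_cofactor uS y(1)])
      have qS: "q \<in> ?S" using E.S.idlD(2)[OF E.idl_cofactor qcof] .
      have "q \<star> x - c \<star> x \<in> P" if "x \<in> ?S" for x
        using E.S.idlD(4)[OF E.idl_P that qc] by (simp add: C.mul_diff_left)
      then have tq: "ptrace p ?S P (\<lambda>x. q \<star> x) t" using ptrace_cong_mod[OF c(2) E.sg_P] by blast
      obtain k where k: "tr q = of_int k" "[k = int ?e * t] (mod int p)"
        using E.piece_trace[OF qS E.ptrace_cofactor[OF qcof tq]] by blast
      have "q = u \<star> (E i \<star> (y \<star> (w \<star> c)))" unfolding q_def by (simp only: C.mul_ac)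
      moreover have "E i \<star> (y \<star> (w \<star> c)) \<in> intcl"
        by (rule E.pieceD(1)[OF E.e_mul_piece[OF E.pieceD(1)[OF E.S.mul_mem[OF yS wcS]]]])
      ultimately have "int p dvd k" using trace_dvd_extend[OF d u(1) _ _] u(2) k(1) by metis
      then have "int p dvd int ?e * t" using k(2) cong_dvd_iff by blast
      moreover have "\<not> int p dvd int ?e" using cop prime_p' Zp.p_gt by (metis coprime_common_divisor dvd_refl int_dvd_int_iff nat_dvd_1_iff_1 less_numeral_extra(4))
      ultimately show False using c(3) prime_p' by (metis prime_dvd_mult_iff prime_nat_int_transfer)
    qed
    then obtain k where "E.S.pw (E i \<star> u) k \<in> smultiple p ?S" unfolding E.S.nilrad_def by blast
    moreover have pwS: "E.S.pw (E i \<star> u) k = E i \<star> Q.pw u k" for k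
    proof (induction k)
      case 0 then show ?case using C.mul_one[OF E(1)[OF i]] by simp
    next
      case (Suc k)
      have "E.S.pw (E i \<star> u) (Suc k) = (E i \<star> E i) \<star> (u \<star> Q.pw u k)"
        unfolding E.S.pw_Suc Suc by (simp only: C.mul_ac)
      then show ?case unfolding Q.pw_Suc E(2)[OF i] .
    qed
    ultimately obtain v where v: "v \<in> ?S" "E i \<star> Q.pw u k = of_nat p * v" unfolding smultiple_def by auto
    have "E i \<star> Q.pw u l \<in> smultiple p intcl" if "k \<le> l" for l
    proof -
      have "E i \<star> Q.pw u l = (E i \<star> Q.pw u k) \<star> Q.pw u (l - k)" using Q.pw_add[OF uq, of k "l - k"] that by (simp add: Q.mul_assoc)
      also have "\<dots> = of_nat p * (v \<star> Q.pw u (l - k))" unfolding v(2) by (rule C.mul_of_nat_left)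
      finally show ?thesis using smultiple_mem[OF C.mul_mem[OF E.pieceD(1)[OF v(1)] C.pw_mem[OF uI]]] by simp
    qed
    then show ?thesis by blast
  qed
  then have "\<forall>i\<in>{..<m}. \<exists>k. \<forall>l\<ge>k. E i \<star> Q.pw u l \<in> smultiple p intcl" by blast
  then obtain K where K: "\<And>i l. i < m \<Longrightarrow> K i \<le> l \<Longrightarrow> E i \<star> Q.pw u l \<in> smultiple p intcl" by (metis lessThan_iff)
  \<comment> \<open>The sum is a common exponent, since it bounds every \<open>K i\<close>.\<close>
  define k where "k = (\<Sum>i<m. K i)"
  have Kk: "K i \<le> k" if "i < m" for i unfolding k_def using that by (intro member_le_sum) auto
  have "Q.pw u k = (\<Sum>i<m. E i) \<star> Q.pw u k" unfolding E(3) using C.one_mul[OF C.pw_mem[OF uI]] by simp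
  also have "\<dots> = (\<Sum>i<m. E i \<star> Q.pw u k)" by (rule C.mul_sum_left)
  also have "\<dots> \<in> smultiple p intcl"
    using K Kk by (intro is_subgroup_sum[OF is_subgroup_smultiple[OF is_subgroup_intcl]]) auto
  finally obtain x where x: "x \<in> intcl" "Q.pw u k = of_nat p * x" unfolding smultiple_def by blast
  \<comment> \<open>Maximality at p turns nilpotence modulo p times the closure into nilpotence
    modulo pR.\<close>
  have "of_nat p * x \<in> R" using Z.pw_mem[OF u(1), of k] x(2) by simp
  then have "x \<in> R" using max x(1) unfolding pmax_def by blast
  then have "Q.pw u k \<in> smultiple p R" using x(2) smultiple_mem by auto
  then show "u \<in> J" unfolding Zp.nilrad_def using u(1) by blast
qed

theorem main_criterion:
  fixes E :: "nat \<Rightarrow> qvec"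
  assumes E: "\<And>i. i < m \<Longrightarrow> E i \<in> intcl" "\<And>i. i < m \<Longrightarrow> E i \<star> E i = E i" "(\<Sum>i<m. E i) = one"
  shows "n = Zp.pdim J + multiplicity (int p) disc \<longleftrightarrow> coprime intcl_index p \<and>
    (\<forall>i<m. \<forall>P. primeideal P (mring.rng mul (E i) (piece (E i))) \<and>
      [p] \<cdot>\<^bsub>mring.rng mul (E i) (piece (E i))\<^esub> \<one>\<^bsub>mring.rng mul (E i) (piece (E i))\<^esub> \<in> P \<longrightarrow>
      coprime (ramification_index (mring.rng mul (E i) (piece (E i))) p P) p)"
proof -
  have "coprime intcl_index p \<longleftrightarrow> pmax" unfolding pmax_def by (rule intcl_index_coprime_iff[OF prime_p'])
  then show ?thesis unfolding criterion(2) using cond_a_imp_tame E(1,2) tame_imp_cond_a[OF _ E] by blast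
qed

end

section \<open>Coordinates on the tensor product\<close>

locale based_ring = cring R for R :: "'a ring" (structure) +
  fixes n :: nat and b :: "nat \<Rightarrow> 'a"
  assumes basis: "int_basis R n b"
begin

lemma b_carrier: "i < n \<Longrightarrow> b i \<in> carrier R"
  using basis unfolding int_basis_def free_basis_def by auto

lemma combination_ex1: "x \<in> carrier R \<Longrightarrow> \<exists>!c :: nat \<Rightarrow> int. c \<in> {..<n} \<rightarrow>\<^sub>E UNIV \<and> x = (\<Oplus>i\<in>{..<n}. [c i] \<cdot> b i)"
  using basis unfolding int_basis_def free_basis_def by blast

lemma carrier_induct [consumes 1, case_names zero basis add minus]:
  assumes x: "x \<in> carrier R" and P: "P \<zero>" "\<And>i. i < n \<Longrightarrow> P (b i)"
    "\<And>x y. x \<in> carrier R \<Longrightarrow> y \<in> carrier R \<Longrightarrow> P x \<Longrightarrow> P y \<Longrightarrow> P (x \<oplus> y)"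
    "\<And>x. x \<in> carrier R \<Longrightarrow> P x \<Longrightarrow> P (\<ominus> x)"
  shows "P x"
proof -
  have nat: "P ([k] \<cdot> b i)" if "i < n" for k :: nat and i
  proof (induction k)
    case 0 then show ?case using P(1) by (simp add: add_pow_def nat_pow_def)
  next
    case (Suc k) then show ?case using P(3)[of "[k] \<cdot> b i" "b i"] P(2) b_carrier[OF that] that by simp
  qed
  have int: "P ([k] \<cdot> b i)" if i: "i < n" for k :: int and i
  proof (cases "k \<ge> 0")
    case True then show ?thesis using nat[OF i, of "nat k"] by (simp add: add_pow_int_ge)
  next
    case False
    then have "[k] \<cdot> b i = \<ominus> ([nat (- k)] \<cdot> b i)" by (simp add: add_pow_int_lt)
    then show ?thesis using P(4)[OF _ nat[OF i, of "nat (- k)"]] b_carrier[OF i] by simp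
  qed
  have "P (\<Oplus>i\<in>A. [c i] \<cdot> b i)" if "finite A" "A \<subseteq> {..<n}" for A and c :: "nat \<Rightarrow> int"
    using that
  proof (induction A rule: finite_induct)
    case (insert i A)
    have c: "(\<lambda>i. [c i] \<cdot> b i) \<in> A \<rightarrow> carrier R" "[c i] \<cdot> b i \<in> carrier R" using insert.prems b_carrier by auto
    have "(\<Oplus>i\<in>insert i A. [c i] \<cdot> b i) = [c i] \<cdot> b i \<oplus> (\<Oplus>i\<in>A. [c i] \<cdot> b i)"
      by (rule finsum_insert[OF insert.hyps c])
    moreover have "(\<Oplus>i\<in>A. [c i] \<cdot> b i) \<in> carrier R" using c(1) by (rule finsum_closed)
    ultimately show ?case using P(3)[OF c(2)] insert int by auto
  qed (simp add: P(1))
  moreover obtain c :: "nat \<Rightarrow> int" where "x = (\<Oplus>i\<in>{..<n}. [c i] \<cdot> b i)" using combination_ex1[OF x] by blast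
  ultimately show ?thesis by blast
qed

definition elt :: "qvec \<Rightarrow> 'a" where
  "elt v = (\<Oplus>i\<in>{..<n}. [\<lfloor>v i\<rfloor>] \<cdot> b i)"

lemma elt_carrier: "elt v \<in> carrier R"
  unfolding elt_def using b_carrier by (intro finsum_closed) auto

lemma elt_add: "u \<in> intvecs n \<Longrightarrow> v \<in> intvecs n \<Longrightarrow> elt (u + v) = elt u \<oplus> elt v"
proof -
  assume u: "u \<in> intvecs n" and v: "v \<in> intvecs n"
  have "elt (u + v) = (\<Oplus>i\<in>{..<n}. [\<lfloor>u i\<rfloor>] \<cdot> b i \<oplus> [\<lfloor>v i\<rfloor>] \<cdot> b i)"
    unfolding elt_def
  proof (intro finsum_cong' refl)
    fix i assume "i \<in> {..<n}"
    then have i: "b i \<in> carrier R" using b_carrier by auto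
    have "u i \<in> \<int>" "v i \<in> \<int>" using u v unfolding intvecs_def by auto
    then have "\<lfloor>(u + v) i\<rfloor> = \<lfloor>u i\<rfloor> + \<lfloor>v i\<rfloor>" by (auto elim!: Ints_cases simp: qvec_apply)
    then show "[\<lfloor>(u + v) i\<rfloor>] \<cdot> b i = [\<lfloor>u i\<rfloor>] \<cdot> b i \<oplus> [\<lfloor>v i\<rfloor>] \<cdot> b i"
      using add.int_pow_mult[OF i] by simp
  qed (use b_carrier in auto)
  also have "\<dots> = elt u \<oplus> elt v" unfolding elt_def using b_carrier by (intro finsum_addf) auto
  finally show ?thesis .
qed

lemma bij_elt: "bij_betw elt (intvecs n) (carrier R)"
  unfolding bij_betw_def
proof
  have eq: "elt v = (\<Oplus>i\<in>{..<n}. [restrict (\<lambda>i. \<lfloor>v i\<rfloor>) {..<n} i] \<cdot> b i)" for v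
    unfolding elt_def using b_carrier by (intro finsum_cong') auto
  show "inj_on elt (intvecs n)"
  proof (rule inj_onI)
    fix u v assume uv: "u \<in> intvecs n" "v \<in> intvecs n" "elt u = elt v"
    let ?P = "\<lambda>c :: nat \<Rightarrow> int. c \<in> {..<n} \<rightarrow>\<^sub>E UNIV \<and> elt u = (\<Oplus>i\<in>{..<n}. [c i] \<cdot> b i)"
    have "?P (restrict (\<lambda>i. \<lfloor>u i\<rfloor>) {..<n})" "?P (restrict (\<lambda>i. \<lfloor>v i\<rfloor>) {..<n})"
      using eq[of u] eq[of v] uv(3) by auto
    then have "restrict (\<lambda>i. \<lfloor>u i\<rfloor>) {..<n} = restrict (\<lambda>i. \<lfloor>v i\<rfloor>) {..<n}"
      using combination_ex1[OF elt_carrier[of u]] by blast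
    then have "\<lfloor>u i\<rfloor> = \<lfloor>v i\<rfloor>" if "i < n" for i using that by (metis lessThan_iff restrict_apply)
    then have "(\<Sum>i<n. of_int \<lfloor>u i\<rfloor> * evec i) = (\<Sum>i<n. of_int \<lfloor>v i\<rfloor> * evec i)" by simp
    then show "u = v" using intvecs_expansion[OF uv(1)] intvecs_expansion[OF uv(2)] by simp
  qed
  show "elt ` intvecs n = carrier R"
  proof
    show "carrier R \<subseteq> elt ` intvecs n"
    proof
      fix x assume "x \<in> carrier R"
      then obtain c :: "nat \<Rightarrow> int" where c: "x = (\<Oplus>i\<in>{..<n}. [c i] \<cdot> b i)" using combination_ex1 by blast
      define v :: qvec where "v i = (if i < n then of_int (c i) else 0)" for i
      have "v \<in> intvecs n" unfolding v_def intvecs_def qspace_def by auto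
      moreover have "x = elt v" unfolding c elt_def v_def using b_carrier by (intro finsum_cong') auto
      ultimately show "x \<in> elt ` intvecs n" by blast
    qed
  qed (use elt_carrier in blast)
qed

definition crd :: "'a \<Rightarrow> qvec" where
  "crd = inv_into (intvecs n) elt"

lemma crd_mem: "x \<in> carrier R \<Longrightarrow> crd x \<in> intvecs n"
  unfolding crd_def using bij_elt by (metis bij_betw_imp_surj_on inv_into_into)

lemma elt_crd: "x \<in> carrier R \<Longrightarrow> elt (crd x) = x"
  unfolding crd_def using bij_elt by (simp add: bij_betw_inv_into_right)

lemma crd_elt: "v \<in> intvecs n \<Longrightarrow> crd (elt v) = v"
  unfolding crd_def using bij_elt by (simp add: bij_betw_inv_into_left)

lemma crd_add: "x \<in> carrier R \<Longrightarrow> y \<in> carrier R \<Longrightarrow> crd (x \<oplus> y) = crd x + crd y"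
  using crd_elt[of "crd x + crd y"] elt_add[OF crd_mem crd_mem, of x y] elt_crd crd_mem
    is_subgroup_add[OF is_subgroup_intvecs] by metis

lemma crd_zero: "crd \<zero> = 0"
  using crd_add[of \<zero> \<zero>] by simp

lemma crd_minus: "x \<in> carrier R \<Longrightarrow> crd (\<ominus> x) = - crd x"
  using crd_add[of "\<ominus> x" x] crd_zero l_neg[of x] by (simp add: eq_neg_iff_add_eq_0)

lemma crd_b: "i < n \<Longrightarrow> crd (b i) = evec i"
proof -
  assume i: "i < n"
  have "elt (evec i) = (\<Oplus>j\<in>{..<n}. if i = j then b j else \<zero>)"
    unfolding elt_def by (intro finsum_cong') (auto simp: evec_def b_carrier add_pow_int_ge)
  also have "\<dots> = b i" using i b_carrier by (intro finsum_singleton) auto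
  finally show ?thesis using crd_elt[OF evec_mem[OF i]] by simp
qed

text \<open>The structure constants of R extended bilinearly over Q. Only coordinates below n enter,
  so the ring laws hold on all vectors, as \<open>mring\<close> demands.\<close>

definition qmul :: "qvec \<Rightarrow> qvec \<Rightarrow> qvec" where
  "qmul u v = (\<Sum>i<n. \<Sum>j<n. cst (u i * v j) * crd (b i \<otimes> b j))"

definition qone :: qvec where "qone = crd \<one>"

lemma qmul_comm: "qmul u v = qmul v u"
proof -
  have "qmul u v = (\<Sum>j<n. \<Sum>i<n. cst (u i * v j) * crd (b i \<otimes> b j))" unfolding qmul_def by (rule sum.swap)
  also have "\<dots> = qmul v u" unfolding qmul_def using b_carrier by (intro sum.cong refl) (simp add: m_comm mult.commute)
  finally show ?thesis .
qed

lemma qmul_add_left: "qmul (u + v) w = qmul u w + qmul v w"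
  by (simp add: qmul_def qvec_apply cst_simps distrib_right sum.distrib)

lemma qmul_additive: "additive_map (\<lambda>u. qmul u v)" "additive_map (qmul u)"
  unfolding additive_map_def using qmul_add_left qmul_comm by metis+

lemma qmul_evec: "i < n \<Longrightarrow> qmul (evec i) v = (\<Sum>j<n. cst (v j) * crd (b i \<otimes> b j))"
proof -
  assume i: "i < n"
  have "qmul (evec i) v = (\<Sum>k<n. if k = i then (\<Sum>j<n. cst (v j) * crd (b i \<otimes> b j)) else 0)"
    unfolding qmul_def by (intro sum.cong refl) (auto simp: evec_def cst_simps)
  then show ?thesis using i by simp
qed

lemma qmul_evec_evec: "i < n \<Longrightarrow> j < n \<Longrightarrow> qmul (evec i) (evec j) = crd (b i \<otimes> b j)"
proof -
  assume i: "i < n" and j: "j < n"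
  have "qmul (evec i) (evec j) = (\<Sum>k<n. if k = j then crd (b i \<otimes> b k) else 0)"
    unfolding qmul_evec[OF i] by (intro sum.cong refl) (auto simp: evec_def cst_simps)
  then show ?thesis using j by simp
qed

lemma crd_mult: "x \<in> carrier R \<Longrightarrow> y \<in> carrier R \<Longrightarrow> crd (x \<otimes> y) = qmul (crd x) (crd y)"
proof (induction x rule: carrier_induct)
  case zero then show ?case by (simp add: crd_zero additive_map_zero[OF qmul_additive(1)])
next
  case (basis i)
  from basis(2) show ?case
  proof (induction y rule: carrier_induct)
    case zero then show ?case using b_carrier[OF basis(1)] by (simp add: crd_zero additive_map_zero[OF qmul_additive(2)])
  next
    case (basis j) then show ?case using crd_b \<open>i < n\<close> qmul_evec_evec by simp
  next
    case (add x y) then show ?case using b_carrier[OF basis(1)]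
      by (simp add: r_distr crd_add additive_map_add[OF qmul_additive(2)])
  next
    case (minus x) then show ?case using b_carrier[OF basis(1)]
      by (simp add: r_minus crd_minus additive_map_uminus[OF qmul_additive(2)])
  qed
next
  case (add x y) then show ?case by (simp add: l_distr crd_add qmul_add_left)
next
  case (minus x) then show ?case by (simp add: l_minus crd_minus additive_map_uminus[OF qmul_additive(1)])
qed

lemma qmul_expand_left: "qmul u v = (\<Sum>i<n. cst (u i) * qmul (evec i) v)"
proof -
  have "(\<Sum>j<n. cst (u i * v j) * crd (b i \<otimes> b j)) = cst (u i) * qmul (evec i) v" if "i < n" for i
    unfolding qmul_evec[OF that] by (simp add: sum_distrib_left cst_simps mult.assoc)
  then show ?thesis unfolding qmul_def[of u v] by simp
qed

lemma qmul_expand_right: "qmul u v = (\<Sum>j<n. cst (v j) * qmul u (evec j))"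
  using qmul_expand_left[of v u] by (simp add: qmul_comm)

text \<open>By trilinearity it suffices to treat basis vectors, where this is associativity in
  R.\<close>

lemma qmul_assoc: "qmul (qmul u v) w = qmul u (qmul v w)"
proof -
  have base: "qmul (qmul (evec i) (evec j)) (evec k) = qmul (evec i) (qmul (evec j) (evec k))"
    if "i < n" "j < n" "k < n" for i j k
    using that b_carrier crd_mult[of "b i \<otimes> b j" "b k"] crd_mult[of "b i" "b j \<otimes> b k"]
    by (simp add: qmul_evec_evec crd_b m_assoc)
  note lin = additive_map_sum[OF qmul_additive(1)] additive_map_sum[OF qmul_additive(2)]
    additive_map_cst[OF qmul_additive(1)] additive_map_cst[OF qmul_additive(2)]
  have "qmul (qmul u v) w = (\<Sum>i<n. cst (u i) * (\<Sum>j<n. cst (v j) * (\<Sum>k<n. cst (w k) * qmul (qmul (evec i) (evec j)) (evec k))))"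
    by (subst qmul_expand_left[of u v], subst qmul_expand_right[of "evec _" v], simp only: lin)
      (intro sum.cong refl arg_cong2[where f = "(*)"] qmul_expand_right)
  also have "\<dots> = (\<Sum>i<n. cst (u i) * (\<Sum>j<n. cst (v j) * (\<Sum>k<n. cst (w k) * qmul (evec i) (qmul (evec j) (evec k)))))"
    using base by simp
  also have "\<dots> = (\<Sum>i<n. cst (u i) * qmul (evec i) (\<Sum>j<n. cst (v j) * (\<Sum>k<n. cst (w k) * qmul (evec j) (evec k))))"
    by (simp only: lin)
  also have "\<dots> = (\<Sum>i<n. cst (u i) * qmul (evec i) (\<Sum>j<n. cst (v j) * qmul (evec j) w))"
    unfolding qmul_expand_right[of _ w, symmetric] ..
  finally show ?thesis unfolding qmul_expand_left[of v w, symmetric] qmul_expand_left[of u, symmetric] .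
qed

lemma crd_one: "crd \<one> = qone"
  by (simp add: qone_def)

sublocale A: qalg n qmul qone
proof (unfold_locales)
  show "qmul (qmul x y) z = qmul x (qmul y z)" for x y z by (rule qmul_assoc)
  show "qmul x y = qmul y x" for x y by (rule qmul_comm)
  show "qmul (x + y) z = qmul x z + qmul y z" for x y z by (rule qmul_add_left)
  show "is_subgroup (intvecs n)" by (rule is_subgroup_intvecs)
  show "qone \<in> intvecs n" unfolding qone_def by (rule crd_mem) simp
  show "qmul x y \<in> intvecs n" if "x \<in> intvecs n" "y \<in> intvecs n" for x y
    using that crd_mult[OF elt_carrier elt_carrier, of x y] crd_elt crd_mem[of "elt x \<otimes> elt y"] elt_carrier by auto
  show "qmul qone x = x" if "x \<in> intvecs n" for x
    using crd_mult[OF one_closed elt_carrier, of x] crd_elt[OF that] elt_carrier unfolding qone_def by simp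
qed

lemma crd_ring_iso: "crd \<in> ring_iso R A.Z.rng"
  unfolding ring_iso_def
proof (intro CollectI conjI)
  show "crd \<in> ring_hom R A.Z.rng"
    by (rule ring_hom_memI) (auto simp: crd_mem crd_mult crd_add crd_one)
  show "bij_betw crd (carrier R) (carrier A.Z.rng)"
    unfolding crd_def using bij_betw_inv_into[OF bij_elt] by simp
qed

text \<open>The coordinates of \<open>\<Sum> k (x \<otimes> q)\<close>; the kernel turns out to be the ideal of bilinearity relations.\<close>

definition kap :: "('a \<times> rat \<Rightarrow>\<^sub>0 int) \<Rightarrow> qvec" where
  "kap f = (\<Sum>k\<in>Poly_Mapping.keys f. of_int (Poly_Mapping.lookup f k) * (cst (snd k) * crd (fst k)))"

lemma kap_superset:
  "finite S \<Longrightarrow> Poly_Mapping.keys f \<subseteq> S \<Longrightarrow>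
    kap f = (\<Sum>k\<in>S. of_int (Poly_Mapping.lookup f k) * (cst (snd k) * crd (fst k)))"
  unfolding kap_def by (rule sum.mono_neutral_left) (auto simp: in_keys_iff)

lemma kap_add: "kap (f + g) = kap f + kap g"
  using kap_superset[of "Poly_Mapping.keys f \<union> Poly_Mapping.keys g"] keys_add[of f g]
  by (simp add: lookup_add distrib_right sum.distrib)

lemma kap_diff: "kap (f - g) = kap f - kap g"
  using kap_add[of "f - g" g] by simp

lemma kap_zero: "kap 0 = 0"
  by (simp add: kap_def)

lemma kap_of: "kap (frag_of (x, q)) = cst q * crd x"
  by (simp add: kap_def)

section \<open>The monoid ring and the ideal of bilinearity relations\<close>

abbreviation "M \<equiv> pair_monoid_ring R"
abbreviation "I \<equiv> bilinear_ideal R"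

lemma M_simps [simp]: "carrier M = {f. Poly_Mapping.keys f \<subseteq> carrier R \<times> UNIV}" "\<one>\<^bsub>M\<^esub> = frag_of (\<one>, 1)"
  "\<zero>\<^bsub>M\<^esub> = 0" "f \<oplus>\<^bsub>M\<^esub> g = f + g"
  by (simp_all add: pair_monoid_ring_def)

lemma M_mult: "f \<otimes>\<^bsub>M\<^esub> g = frag_extend (\<lambda>(x, q). frag_extend (\<lambda>(y, r). frag_of (x \<otimes> y, q * r)) g) f"
  by (simp add: pair_monoid_ring_def)

lemma M_mult_of: "frag_of (x, q) \<otimes>\<^bsub>M\<^esub> frag_of (y, r) = frag_of (x \<otimes> y, q * r)"
  by (simp add: M_mult)

lemma M_mult_diff_left: "(f - g) \<otimes>\<^bsub>M\<^esub> h = f \<otimes>\<^bsub>M\<^esub> h - g \<otimes>\<^bsub>M\<^esub> h"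
  by (simp add: M_mult frag_extend_diff)

lemma M_mult_diff_right: "h \<otimes>\<^bsub>M\<^esub> (f - g) = h \<otimes>\<^bsub>M\<^esub> f - h \<otimes>\<^bsub>M\<^esub> g"
proof -
  have "frag_cmul k (a - c) = frag_cmul k a - frag_cmul k c" for k and a c :: "'a \<times> rat \<Rightarrow>\<^sub>0 int"
    using frag_cmul_distrib2[of k "a - c" c] by simp
  then show ?thesis
    unfolding M_mult frag_extend_def[of _ h]
    by (simp add: frag_extend_diff case_prod_beta sum_subtractf)
qed

lemma M_mult_zero: "0 \<otimes>\<^bsub>M\<^esub> h = 0" "h \<otimes>\<^bsub>M\<^esub> 0 = 0"
  using M_mult_diff_left[of 0 0 h] M_mult_diff_right[of h 0 0] by simp_all

lemma M_mult_add: "(f + g) \<otimes>\<^bsub>M\<^esub> h = f \<otimes>\<^bsub>M\<^esub> h + g \<otimes>\<^bsub>M\<^esub> h"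
  by (simp add: M_mult frag_extend_add)

lemma M_mult_closed: "f \<in> carrier M \<Longrightarrow> g \<in> carrier M \<Longrightarrow> f \<otimes>\<^bsub>M\<^esub> g \<in> carrier M"
proof -
  assume f: "f \<in> carrier M" and g: "g \<in> carrier M"
  have "Poly_Mapping.keys f \<subseteq> carrier R \<times> UNIV" using f by simp
  then have "Poly_Mapping.keys (f \<otimes>\<^bsub>M\<^esub> g) \<subseteq> carrier R \<times> UNIV"
  proof (induction f rule: frag_induction)
    case (one k)
    obtain x q where k: "k = (x, q)" by (cases k)
    have "Poly_Mapping.keys g \<subseteq> carrier R \<times> UNIV" using g by simp
    then show ?case
    proof (induction g rule: frag_induction)
      case (one l)
      then show ?case using \<open>k \<in> carrier R \<times> UNIV\<close> by (cases l) (auto simp: k M_mult_of)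
    next
      case (diff a c)
      then show ?case using keys_diff[of "frag_of k \<otimes>\<^bsub>M\<^esub> a" "frag_of k \<otimes>\<^bsub>M\<^esub> c"] unfolding M_mult_diff_right by blast
    qed (simp add: M_mult_zero)
  next
    case (diff a c)
    then show ?case using keys_diff[of "a \<otimes>\<^bsub>M\<^esub> g" "c \<otimes>\<^bsub>M\<^esub> g"] unfolding M_mult_diff_left by blast
  qed (simp add: M_mult_zero)
  then show ?thesis by simp
qed

lemma M_comm: "f \<in> carrier M \<Longrightarrow> g \<in> carrier M \<Longrightarrow> f \<otimes>\<^bsub>M\<^esub> g = g \<otimes>\<^bsub>M\<^esub> f"
proof -
  assume f: "f \<in> carrier M" and g: "g \<in> carrier M"
  have "Poly_Mapping.keys f \<subseteq> carrier R \<times> UNIV" using f by simp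
  then show ?thesis
  proof (induction f rule: frag_induction)
    case (one k)
    have "Poly_Mapping.keys g \<subseteq> carrier R \<times> UNIV" using g by simp
    then show ?case
    proof (induction g rule: frag_induction)
      case (one l)
      then show ?case using \<open>k \<in> carrier R \<times> UNIV\<close> by (cases k, cases l) (auto simp: M_mult_of m_comm mult.commute)
    qed (simp_all add: M_mult_zero M_mult_diff_left M_mult_diff_right)
  qed (simp_all add: M_mult_zero M_mult_diff_left M_mult_diff_right)
qed

lemma M_assoc:
  assumes "f \<in> carrier M" "g \<in> carrier M" "h \<in> carrier M"
  shows "f \<otimes>\<^bsub>M\<^esub> g \<otimes>\<^bsub>M\<^esub> h = f \<otimes>\<^bsub>M\<^esub> (g \<otimes>\<^bsub>M\<^esub> h)"
proof -
  have K: "Poly_Mapping.keys f \<subseteq> carrier R \<times> UNIV" "Poly_Mapping.keys g \<subseteq> carrier R \<times> UNIV" "Poly_Mapping.keys h \<subseteq> carrier R \<times> UNIV"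
    using assms by simp_all
  note lin = M_mult_zero M_mult_diff_left M_mult_diff_right
  from K(1) show ?thesis
  proof (induction f rule: frag_induction)
    case k: (one k)
    from K(2) show ?case
    proof (induction g rule: frag_induction)
      case l: (one l)
      from K(3) show ?case
      proof (induction h rule: frag_induction)
        case (one m)
        then show ?case using k l by (cases k, cases l, cases m) (auto simp: M_mult_of m_assoc mult.assoc)
      qed (simp_all add: lin)
    qed (simp_all add: lin)
  qed (simp_all add: lin)
qed

lemma M_one: assumes "f \<in> carrier M" shows "\<one>\<^bsub>M\<^esub> \<otimes>\<^bsub>M\<^esub> f = f"
proof -
  have "Poly_Mapping.keys f \<subseteq> carrier R \<times> UNIV" using assms by simp
  then show ?thesis
  proof (induction f rule: frag_induction)
    case (one k) then show ?case by (cases k) (auto simp: M_mult_of)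
  qed (simp_all add: M_mult_zero M_mult_diff_right)
qed

lemma cring_M: "cring M"
proof (rule cringI)
  show "abelian_group M"
  proof (rule abelian_groupI)
    show "f \<oplus>\<^bsub>M\<^esub> g \<in> carrier M" if "f \<in> carrier M" "g \<in> carrier M" for f g
      using that keys_add[of f g] by auto
    show "\<exists>g\<in>carrier M. g \<oplus>\<^bsub>M\<^esub> f = \<zero>\<^bsub>M\<^esub>" if "f \<in> carrier M" for f
      using that by (intro bexI[of _ "- f"]) auto
  qed (auto simp: add.assoc add.commute)
  show "comm_monoid M"
    using M_mult_closed M_assoc M_one M_comm by (intro comm_monoidI) auto
  show "(f \<oplus>\<^bsub>M\<^esub> g) \<otimes>\<^bsub>M\<^esub> h = f \<otimes>\<^bsub>M\<^esub> h \<oplus>\<^bsub>M\<^esub> g \<otimes>\<^bsub>M\<^esub> h" for f g h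
    by (simp add: M_mult_add)
qed

lemma kap_mult:
  assumes "f \<in> carrier M" "g \<in> carrier M"
  shows "kap (f \<otimes>\<^bsub>M\<^esub> g) = qmul (kap f) (kap g)"
proof -
  have K: "Poly_Mapping.keys f \<subseteq> carrier R \<times> UNIV" "Poly_Mapping.keys g \<subseteq> carrier R \<times> UNIV" using assms by simp_all
  note lin = M_mult_zero M_mult_diff_left M_mult_diff_right kap_zero kap_diff A.Q.mul_diff_left A.Q.mul_diff_right
  from K(1) show ?thesis
  proof (induction f rule: frag_induction)
    case k: (one k)
    from K(2) show ?case
    proof (induction g rule: frag_induction)
      case (one l)
      then show ?case using k by (cases k, cases l) (auto simp: M_mult_of kap_of crd_mult A.Q.mul_scalars cst_simps mult.assoc)
    qed (simp_all add: lin)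
  qed (simp_all add: lin)
qed

lemma crd_qspace: "x \<in> carrier R \<Longrightarrow> crd x \<in> qspace n"
  using crd_mem intvecs_subset_qspace by blast

lemma kap_qspace: "f \<in> carrier M \<Longrightarrow> kap f \<in> qspace n"
  unfolding kap_def using crd_qspace by (intro A.Q.L_closed(6,7) qspace_cst) auto

sublocale K: ring_hom_ring M A.Q.rng kap
  by (rule ring_hom_ringI2[OF cring.axioms(1)[OF cring_M] cring.axioms(1)[OF A.Q.cring_rng]])
    (rule ring_hom_memI, use kap_qspace kap_mult kap_add in \<open>auto simp: kap_of crd_one cst_simps\<close>)

text \<open>The normal form of the tensor with coordinates v; modulo the relations every f in the
  monoid ring equals \<open>nrm (kap f)\<close>.\<close>

definition nrm :: "qvec \<Rightarrow> 'a \<times> rat \<Rightarrow>\<^sub>0 int" where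
  "nrm v = (\<Sum>i<n. frag_of (b i, v i))"

lemma kap_sum: "kap (sum f S) = (\<Sum>i\<in>S. kap (f i))"
  by (induction S rule: infinite_finite_induct) (auto simp: kap_zero kap_add)

lemma kap_nrm: "v \<in> qspace n \<Longrightarrow> kap (nrm v) = v"
  using qspace_expansion[of v n] by (simp add: nrm_def kap_sum kap_of crd_b)

lemma nrm_carrier: "nrm v \<in> carrier M"
proof -
  have "Poly_Mapping.keys (nrm v) \<subseteq> (\<Union>i\<in>{..<n}. Poly_Mapping.keys (frag_of (b i, v i)))"
    unfolding nrm_def by (rule keys_sum)
  also have "\<dots> \<subseteq> carrier R \<times> UNIV" using b_carrier by auto
  finally show ?thesis by simp
qed

lemma relations_carrier: "bilinear_relations R \<subseteq> carrier M"
proof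
  fix f assume "f \<in> bilinear_relations R"
  then consider (1) x y q where "f = frag_of (x \<oplus> y, q) - frag_of (x, q) - frag_of (y, q)" "x \<in> carrier R" "y \<in> carrier R"
    | (2) x q r where "f = frag_of (x, q + r) - frag_of (x, q) - frag_of (x, r)" "x \<in> carrier R"
    unfolding bilinear_relations_def by blast
  then show "f \<in> carrier M"
  proof cases
    case 1
    have "Poly_Mapping.keys f \<subseteq> Poly_Mapping.keys (frag_of (x \<oplus> y, q)) \<union> Poly_Mapping.keys (frag_of (x, q)) \<union> Poly_Mapping.keys (frag_of (y, q))"
      unfolding 1(1) using keys_diff[of "frag_of (x \<oplus> y, q) - frag_of (x, q)" "frag_of (y, q)"] keys_diff[of "frag_of (x \<oplus> y, q)" "frag_of (x, q)"] by blast
    then show ?thesis using 1(2,3) by auto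
  next
    case 2
    have "Poly_Mapping.keys f \<subseteq> Poly_Mapping.keys (frag_of (x, q + r)) \<union> Poly_Mapping.keys (frag_of (x, q)) \<union> Poly_Mapping.keys (frag_of (x, r))"
      unfolding 2(1) using keys_diff[of "frag_of (x, q + r) - frag_of (x, q)" "frag_of (x, r)"] keys_diff[of "frag_of (x, q + r)" "frag_of (x, q)"] by blast
    then show ?thesis using 2(2) by auto
  qed
qed

lemma ideal_I: "ideal I M"
  unfolding bilinear_ideal_def by (rule ring.genideal_ideal[OF cring.axioms(1)[OF cring_M] relations_carrier])

lemma relations_I: "bilinear_relations R \<subseteq> I"
  unfolding bilinear_ideal_def by (rule ring.genideal_self[OF cring.axioms(1)[OF cring_M] relations_carrier])

lemma I_zero: "0 \<in> I"
  using additive_subgroup.zero_closed[OF ideal.axioms(1)[OF ideal_I]] by simp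

lemma I_add: "f \<in> I \<Longrightarrow> g \<in> I \<Longrightarrow> f + g \<in> I"
  using additive_subgroup.a_closed[OF ideal.axioms(1)[OF ideal_I], of f g] by simp

lemma I_uminus: "f \<in> I \<Longrightarrow> - f \<in> I"
proof -
  assume f: "f \<in> I"
  have fM: "f \<in> carrier M" using ideal.Icarr[OF ideal_I f] .
  have "\<ominus>\<^bsub>M\<^esub> f = - f"
    using abelian_group.minus_equality[OF ring.is_abelian_group[OF cring.axioms(1)[OF cring_M]], of "- f" f] fM by simp
  then show ?thesis using additive_subgroup.a_inv_closed[OF ideal.axioms(1)[OF ideal_I] f] by simp
qed

lemma I_diff: "f \<in> I \<Longrightarrow> g \<in> I \<Longrightarrow> f - g \<in> I"
  using I_add[of f "- g"] I_uminus by simp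

lemma I_sum: "(\<And>i. i \<in> S \<Longrightarrow> f i \<in> I) \<Longrightarrow> sum f S \<in> I"
  by (induction S rule: infinite_finite_induct) (auto intro: I_zero I_add)

lemma I_left: "x \<in> carrier R \<Longrightarrow> y \<in> carrier R \<Longrightarrow> frag_of (x \<oplus> y, q) - frag_of (x, q) - frag_of (y, q) \<in> I"
  using relations_I unfolding bilinear_relations_def by blast

lemma I_right: "x \<in> carrier R \<Longrightarrow> frag_of (x, q + r) - frag_of (x, q) - frag_of (x, r) \<in> I"
  using relations_I unfolding bilinear_relations_def by blast

lemma I_zero_right: "x \<in> carrier R \<Longrightarrow> frag_of (x, 0) \<in> I"
  using I_uminus[OF I_right[of x 0 0]] by simp

lemma I_zero_left: "frag_of (\<zero>, q) \<in> I"
  using I_uminus[OF I_left[of \<zero> \<zero> q]] by simp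

lemma nrm_add: "nrm (u + v) - nrm u - nrm v \<in> I"
proof -
  have "nrm (u + v) - nrm u - nrm v = (\<Sum>i<n. frag_of (b i, u i + v i) - frag_of (b i, u i) - frag_of (b i, v i))"
    by (simp add: nrm_def sum_subtractf qvec_apply)
  then show ?thesis using I_right b_carrier by (auto intro!: I_sum)
qed

lemma nrm_zero: "nrm 0 \<in> I"
  unfolding nrm_def by (intro I_sum) (simp add: qvec_apply I_zero_right b_carrier)

lemma frag_of_nrm: "x \<in> carrier R \<Longrightarrow> frag_of (x, q) - nrm (cst q * crd x) \<in> I"
proof (induction x rule: carrier_induct)
  case zero
  show ?case using I_diff[OF I_zero_left nrm_zero] by (simp add: crd_zero)
next
  case (basis i)
  have "nrm (cst q * evec i) = (\<Sum>j\<in>{..<n}. frag_of (b j, if j = i then q else 0))"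
    unfolding nrm_def by (intro sum.cong) (auto simp: evec_def qvec_apply)
  also have "\<dots> = frag_of (b i, q) + (\<Sum>j\<in>{..<n} - {i}. frag_of (b j, 0))"
    using basis by (subst sum.remove[of _ i]) (auto intro!: sum.cong)
  finally have "frag_of (b i, q) - nrm (cst q * crd (b i)) = - (\<Sum>j\<in>{..<n} - {i}. frag_of (b j, 0))"
    using crd_b[OF basis] by simp
  moreover have "(\<Sum>j\<in>{..<n} - {i}. frag_of (b j, 0)) \<in> I" using I_zero_right b_carrier by (auto intro!: I_sum)
  ultimately show ?case using I_uminus by simp
next
  case (add x y)
  have "frag_of (x \<oplus> y, q) - nrm (cst q * crd (x \<oplus> y))
    = (frag_of (x \<oplus> y, q) - frag_of (x, q) - frag_of (y, q)) + (frag_of (x, q) - nrm (cst q * crd x))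
      + (frag_of (y, q) - nrm (cst q * crd y)) - (nrm (cst q * crd x + cst q * crd y) - nrm (cst q * crd x) - nrm (cst q * crd y))"
    using crd_add[OF add(1,2)] by (simp add: distrib_left)
  also have "\<dots> \<in> I" by (intro I_diff I_add I_left nrm_add add)
  finally show ?case .
next
  case (minus x)
  have e1: "\<ominus> x \<oplus> x = \<zero>" using minus(1) by (rule l_neg)
  have e2: "cst q * crd (\<ominus> x) + cst q * crd x = 0" using crd_minus[OF minus(1)] by simp
  \<comment> \<open>Every bracket is a relation, the induction hypothesis, or a term for a sum equal
    to 0, and so lies in the ideal.\<close>
  have "frag_of (\<ominus> x, q) - nrm (cst q * crd (\<ominus> x))
    = frag_of (\<ominus> x \<oplus> x, q) - (frag_of (\<ominus> x \<oplus> x, q) - frag_of (\<ominus> x, q) - frag_of (x, q)) - (frag_of (x, q) - nrm (cst q * crd x))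
      + (nrm (cst q * crd (\<ominus> x) + cst q * crd x) - nrm (cst q * crd (\<ominus> x)) - nrm (cst q * crd x)) - nrm (cst q * crd (\<ominus> x) + cst q * crd x)"
    by simp
  also have "\<dots> \<in> I"
    using minus(1) by (intro I_diff I_add I_left nrm_add minus) (auto simp: e1 e2 I_zero_left nrm_zero)
  finally show ?case .
qed

text \<open>\<open>kap\<close> is bilinear and so kills the relations. Conversely every f agrees
  with its normal form modulo the relations, and the normal form of 0 lies in the ideal.\<close>

lemma kernel_eq: "a_kernel M A.Q.rng kap = I"
proof
  show "I \<subseteq> a_kernel M A.Q.rng kap"
    unfolding bilinear_ideal_def
  proof (rule ring.genideal_minimal[OF cring.axioms(1)[OF cring_M] K.kernel_is_ideal])
    show "bilinear_relations R \<subseteq> a_kernel M A.Q.rng kap"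
    proof
      fix f assume f: "f \<in> bilinear_relations R"
      then have "kap f = 0"
        unfolding bilinear_relations_def by (auto simp: kap_diff kap_of crd_add cst_simps distrib_left distrib_right)
      then show "f \<in> a_kernel M A.Q.rng kap" unfolding a_kernel_def' using f relations_carrier by auto
    qed
  qed
  show "a_kernel M A.Q.rng kap \<subseteq> I"
  proof
    fix f assume "f \<in> a_kernel M A.Q.rng kap"
    then have f: "Poly_Mapping.keys f \<subseteq> carrier R \<times> UNIV" "kap f = 0" unfolding a_kernel_def' by auto
    have "f - nrm (kap f) \<in> I" using f(1)
    proof (induction f rule: frag_induction)
      case zero show ?case using I_uminus[OF nrm_zero] by (simp add: kap_zero)
    next
      case (one k) then show ?case using frag_of_nrm by (cases k) (auto simp: kap_of)
    next
      case (diff f g)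
      have "f - g - nrm (kap (f - g)) = (f - nrm (kap f)) - (g - nrm (kap g)) + (nrm (kap (f - g) + kap g) - nrm (kap (f - g)) - nrm (kap g))"
        by (simp add: kap_diff)
      also have "\<dots> \<in> I" by (intro I_diff I_add nrm_add diff)
      finally show ?case .
    qed
    then show "f \<in> I" using I_add[OF _ nrm_zero] f(2) by fastforce
  qed
qed

definition iota :: "('a \<times> rat \<Rightarrow>\<^sub>0 int) set \<Rightarrow> qvec" where
  "iota U = the_elem (kap ` U)"

lemma iota_iso: "iota \<in> ring_iso (rat_tensor R) A.Q.rng"
proof -
  have "kap ` carrier M = carrier A.Q.rng"
  proof
    show "carrier A.Q.rng \<subseteq> kap ` carrier M"
    proof
      fix v assume "v \<in> carrier A.Q.rng"
      then have "kap (nrm v) = v" using kap_nrm by simp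
      then show "v \<in> kap ` carrier M" using nrm_carrier by (metis image_eqI)
    qed
  qed (use kap_qspace in auto)
  from K.FactRing_iso_set[OF this] show ?thesis unfolding iota_def[abs_def] rat_tensor_def kernel_eq .
qed

lemma iota_pure: "x \<in> carrier R \<Longrightarrow> iota (pure_tensor R x q) = cst q * crd x"
proof -
  assume "x \<in> carrier R"
  then have "frag_of (x, q) \<in> carrier M" by simp
  from K.the_elem_simp[OF this] show ?thesis
    unfolding iota_def pure_tensor_def kernel_eq by (simp add: kap_of)
qed

lemma pure_carrier: "x \<in> carrier R \<Longrightarrow> pure_tensor R x q \<in> carrier (rat_tensor R)"
  unfolding pure_tensor_def rat_tensor_def FactRing_def A_RCOSETS_def'
  by (auto intro!: exI[of _ "frag_of (x, q)"])

end

lemma (in mring) hom_finsum_rng: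
  assumes h: "ring_hom_ring B rng h" and I: "finite I" "\<And>i. i \<in> I \<Longrightarrow> f i \<in> carrier B"
  shows "h (finsum B f I) = (\<Sum>i\<in>I. h (f i))"
  using I
proof (induction I rule: finite_induct)
  interpret H: ring_hom_ring B rng h by (rule h)
  case (insert i I)
  then show ?case using H.R.finsum_insert[of I i f] H.R.finsum_closed[of f I] by auto
next
  interpret H: ring_hom_ring B rng h by (rule h)
  case empty show ?case using H.hom_zero by simp
qed

text \<open>The coordinates of \<open>evec k\<close> in \<open>l\<close> serve as functionals.
  Expanding \<open>l i\<close> in the standard basis and back gives a second coefficient family for
  \<open>l i\<close>; uniqueness of coefficients is the required duality.\<close>

lemma qbasis_of_free:
  assumes l: "\<And>i. i < r \<Longrightarrow> l i \<in> qspace n"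
    and free: "\<And>v. v \<in> qspace n \<Longrightarrow> \<exists>!c. c \<in> {..<r} \<rightarrow>\<^sub>E UNIV \<and> v = (\<Sum>i<r. cst (c i) * l i)"
  shows "\<exists>m. qbasis n r l m"
proof -
  have "\<forall>k\<in>{..<n}. \<exists>c. evec k = (\<Sum>i<r. cst (c i) * l i)" using free evec_qspace by blast
  then obtain c where c: "\<And>k. k < n \<Longrightarrow> evec k = (\<Sum>i<r. cst (c k i) * l i)" by (metis lessThan_iff)
  have "(\<Sum>k<n. c k j * l i k) = (if i = j then 1 else 0)" if i: "i < r" and j: "j < r" for i j
  proof -
    have "l i = (\<Sum>k<n. cst (l i k) * (\<Sum>j<r. cst (c k j) * l j))"
      using qspace_expansion[OF l[OF i]] c by simp
    also have "\<dots> = (\<Sum>k<n. \<Sum>j<r. cst (c k j * l i k) * l j)" by (simp add: sum_distrib_left cst_simps ac_simps)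
    also have "\<dots> = (\<Sum>j<r. \<Sum>k<n. cst (c k j * l i k) * l j)" by (rule sum.swap)
    also have "\<dots> = (\<Sum>j<r. cst (restrict (\<lambda>j. \<Sum>k<n. c k j * l i k) {..<r} j) * l j)"
      by (simp add: cst_sum sum_distrib_right)
    finally have 1: "l i = (\<Sum>j<r. cst (restrict (\<lambda>j. \<Sum>k<n. c k j * l i k) {..<r} j) * l j)" .
    have "(\<Sum>j<r. cst (restrict (\<lambda>j. if i = j then 1 else 0) {..<r} j) * l j) = (\<Sum>j<r. if i = j then l j else 0)"
      by (intro sum.cong refl) (auto simp: cst_simps)
    then have 2: "l i = (\<Sum>j<r. cst (restrict (\<lambda>j. if i = j then 1 else 0) {..<r} j) * l j)" using i by simp
    let ?P = "\<lambda>d. d \<in> {..<r} \<rightarrow>\<^sub>E UNIV \<and> l i = (\<Sum>j<r. cst (d j) * l j)"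
    have "?P (restrict (\<lambda>j. \<Sum>k<n. c k j * l i k) {..<r})" "?P (restrict (\<lambda>j. if i = j then 1 else 0) {..<r})"
      using 1 2 by (simp_all only: restrict_PiE_iff UNIV_I) simp_all
    then have "restrict (\<lambda>j. \<Sum>k<n. c k j * l i k) {..<r} = restrict (\<lambda>j. if i = j then 1 else 0) {..<r}"
      using free[OF l[OF i]] by blast
    from fun_cong[OF this, of j] show ?thesis using j by simp
  qed
  then have "qbasis n r l (\<lambda>j k. c k j)" unfolding qbasis_def using l c by auto
  then show ?thesis by blast
qed

section \<open>Trace and discriminant in coordinates\<close>

context based_ring
begin

abbreviation "T \<equiv> rat_tensor R"

lemma cring_T: "cring T"
  unfolding rat_tensor_def using ideal.quotient_is_cring[OF ideal_I cring_M] .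

sublocale N: ring_hom_ring T A.Q.rng iota
  by (rule ring_hom_ringI2[OF cring.axioms(1)[OF cring_T] cring.axioms(1)[OF A.Q.cring_rng]])
    (use iota_iso in \<open>simp add: ring_iso_def\<close>)

sublocale V: ring_hom_ring R A.Z.rng crd
  by (rule ring_hom_ringI2[OF ring_axioms cring.axioms(1)[OF A.Z.cring_rng]])
    (use crd_ring_iso in \<open>simp add: ring_iso_def\<close>)

lemma bij_iota: "bij_betw iota (carrier T) (qspace n)"
  using iota_iso unfolding ring_iso_def by simp

lemma iota_inj: "u \<in> carrier T \<Longrightarrow> v \<in> carrier T \<Longrightarrow> iota u = iota v \<Longrightarrow> u = v"
  using bij_iota unfolding bij_betw_def inj_on_def by blast

lemma iota_inj_iff: "u \<in> carrier T \<Longrightarrow> v \<in> carrier T \<Longrightarrow> u = v \<longleftrightarrow> iota u = iota v"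
  using iota_inj by blast

lemma iota_mem: "u \<in> carrier T \<Longrightarrow> iota u \<in> qspace n"
  using bij_iota bij_betwE by blast

lemma iota_surj: "v \<in> qspace n \<Longrightarrow> \<exists>u\<in>carrier T. iota u = v"
  using bij_iota unfolding bij_betw_def by (metis imageE)

lemma iota_mult: "u \<in> carrier T \<Longrightarrow> v \<in> carrier T \<Longrightarrow> iota (u \<otimes>\<^bsub>T\<^esub> v) = qmul (iota u) (iota v)"
  using N.hom_mult by simp

lemma rat_scale_carrier: "u \<in> carrier T \<Longrightarrow> rat_scale R q u \<in> carrier T"
  unfolding rat_scale_def using pure_carrier[OF one_closed] N.R.m_closed by blast

lemma iota_scale: "u \<in> carrier T \<Longrightarrow> iota (rat_scale R q u) = cst q * iota u"
  unfolding rat_scale_def using iota_mult[OF pure_carrier[OF one_closed]]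
  by (simp add: iota_pure crd_one A.Q.mul_cst_left A.Q.one_mul iota_mem)

lemma iota_combination:
  "(\<And>i. i < r \<Longrightarrow> l i \<in> carrier T) \<Longrightarrow>
    iota (\<Oplus>\<^bsub>T\<^esub>i\<in>{..<r::nat}. rat_scale R (c i) (l i)) = (\<Sum>i<r. cst (c i) * iota (l i))"
proof -
  assume l: "\<And>i. i < r \<Longrightarrow> l i \<in> carrier T"
  have "iota (\<Oplus>\<^bsub>T\<^esub>i\<in>{..<r}. rat_scale R (c i) (l i)) = (\<Sum>i<r. iota (rat_scale R (c i) (l i)))"
    by (rule A.Q.hom_finsum_rng[OF N.ring_hom_ring_axioms]) (auto intro: rat_scale_carrier l)
  also have "\<dots> = (\<Sum>i<r. cst (c i) * iota (l i))" by (intro sum.cong refl) (auto intro: iota_scale l)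
  finally show ?thesis .
qed

lemma combination_carrier:
  "(\<And>i. i < r \<Longrightarrow> l i \<in> carrier T) \<Longrightarrow> (\<Oplus>\<^bsub>T\<^esub>i\<in>{..<r::nat}. rat_scale R (c i) (l i)) \<in> carrier T"
  by (rule N.R.finsum_closed) (auto intro: rat_scale_carrier)

lemma rat_basis_qbasis:
  assumes "free_basis T (rat_scale R) r l"
  shows "\<exists>m. qbasis n r (\<lambda>i. iota (l i)) m"
proof (rule qbasis_of_free)
  have l: "l i \<in> carrier T" if "i < r" for i using assms that unfolding free_basis_def by auto
  show "iota (l i) \<in> qspace n" if "i < r" for i using iota_mem l that by blast
  fix v assume v: "v \<in> qspace n"
  obtain u where u: "u \<in> carrier T" "iota u = v" using iota_surj[OF v] by blast
  have "\<exists>!c. c \<in> {..<r} \<rightarrow>\<^sub>E UNIV \<and> u = (\<Oplus>\<^bsub>T\<^esub>i\<in>{..<r}. rat_scale R (c i) (l i))"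
    by (rule bspec[OF conjunct2[OF assms[unfolded free_basis_def]] u(1)])
  moreover have "u = (\<Oplus>\<^bsub>T\<^esub>i\<in>{..<r}. rat_scale R (c i) (l i)) \<longleftrightarrow> v = (\<Sum>i<r. cst (c i) * iota (l i))" for c
  proof -
    have cc: "(\<Oplus>\<^bsub>T\<^esub>i\<in>{..<r}. rat_scale R (c i) (l i)) \<in> carrier T" by (rule combination_carrier) (rule l)
    have "iota (\<Oplus>\<^bsub>T\<^esub>i\<in>{..<r}. rat_scale R (c i) (l i)) = (\<Sum>i<r. cst (c i) * iota (l i))"
      by (rule iota_combination) (rule l)
    then show ?thesis using iota_inj_iff[OF u(1) cc] u(2) by simp
  qed
  ultimately show "\<exists>!c. c \<in> {..<r} \<rightarrow>\<^sub>E UNIV \<and> v = (\<Sum>i<r. cst (c i) * iota (l i))" by simp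
qed

lemma pure_combination:
  "(\<Oplus>\<^bsub>T\<^esub>i\<in>{..<n}. rat_scale R (c i) (pure_tensor R (b i) 1)) \<in> carrier T"
  "iota (\<Oplus>\<^bsub>T\<^esub>i\<in>{..<n}. rat_scale R (c i) (pure_tensor R (b i) 1)) = (\<Sum>i<n. cst (c i) * evec i)"
proof -
  have l: "pure_tensor R (b i) 1 \<in> carrier T" if "i < n" for i using pure_carrier[OF b_carrier[OF that]] .
  show "(\<Oplus>\<^bsub>T\<^esub>i\<in>{..<n}. rat_scale R (c i) (pure_tensor R (b i) 1)) \<in> carrier T"
    by (rule combination_carrier) (rule l)
  have "iota (\<Oplus>\<^bsub>T\<^esub>i\<in>{..<n}. rat_scale R (c i) (pure_tensor R (b i) 1)) = (\<Sum>i<n. cst (c i) * iota (pure_tensor R (b i) 1))"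
    by (rule iota_combination) (rule l)
  also have "\<dots> = (\<Sum>i<n. cst (c i) * evec i)"
    by (intro sum.cong refl) (simp add: iota_pure b_carrier crd_b cst_simps)
  finally show "iota (\<Oplus>\<^bsub>T\<^esub>i\<in>{..<n}. rat_scale R (c i) (pure_tensor R (b i) 1)) = (\<Sum>i<n. cst (c i) * evec i)" .
qed

lemma pure_basis: "free_basis T (rat_scale R) n (\<lambda>i. pure_tensor R (b i) 1)"
  unfolding free_basis_def
proof (intro conjI ballI)
  let ?l = "\<lambda>i. pure_tensor R (b i) 1"
  have l: "?l i \<in> carrier T" if "i < n" for i using pure_carrier[OF b_carrier[OF that]] .
  then show "?l \<in> {..<n} \<rightarrow> carrier T" by auto
  fix u assume u: "u \<in> carrier T"
  have comb: "u = (\<Oplus>\<^bsub>T\<^esub>i\<in>{..<n}. rat_scale R (c i) (?l i)) \<longleftrightarrow> iota u = (\<Sum>i<n. cst (c i) * evec i)" for c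
    using iota_inj_iff[OF u pure_combination(1)] unfolding pure_combination(2) .
  show "\<exists>!c. c \<in> {..<n} \<rightarrow>\<^sub>E UNIV \<and> u = (\<Oplus>\<^bsub>T\<^esub>i\<in>{..<n}. rat_scale R (c i) (?l i))"
    unfolding comb
  proof (intro ex1I[of _ "restrict (iota u) {..<n}"] conjI)
    show "iota u = (\<Sum>i<n. cst (restrict (iota u) {..<n} i) * evec i)"
      using qspace_expansion[OF iota_mem[OF u]] by simp
    fix c assume c: "c \<in> {..<n} \<rightarrow>\<^sub>E UNIV \<and> iota u = (\<Sum>i<n. cst (c i) * evec i)"
    have "iota u j = c j" if "j < n" for j
    proof -
      have "iota u j = (\<Sum>i<n. c i * evec i j)" using c by (simp add: qvec_apply)
      also have "\<dots> = (\<Sum>i<n. if j = i then c i else 0)" by (intro sum.cong) (auto simp: evec_def)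
      finally show ?thesis using that by simp
    qed
    then show "c = restrict (iota u) {..<n}" using c by (intro ext) (auto simp: PiE_def extensional_def)
  qed auto
qed

text \<open>The defining trace ranges over bases of any length. Through \<open>iota\<close> each of
  them becomes a \<open>qbasis\<close>, so all give the same value; the pure tensors of the integral
  basis show that there is one.\<close>

lemma ring_trace_eq: assumes a: "a \<in> carrier R" shows "ring_trace R a = A.tr (crd a)"
  unfolding ring_trace_def rat_linear_trace_def
proof (rule the_equality)
  let ?l = "\<lambda>i. pure_tensor R (b i) 1"
  have l: "?l i \<in> carrier T" if "i < n" for i using pure_carrier[OF b_carrier[OF that]] .
  have pa: "pure_tensor R a 1 \<in> carrier T" by (rule pure_carrier[OF a])
  show "\<exists>m l M. free_basis T (rat_scale R) m l \<and>
    (\<forall>j<m. pure_tensor R a 1 \<otimes>\<^bsub>T\<^esub> l j = (\<Oplus>\<^bsub>T\<^esub>i\<in>{..<m}. rat_scale R (M i j) (l i))) \<and> A.tr (crd a) = (\<Sum>i<m. M i i)"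
  proof (intro exI[of _ n] exI[of _ ?l] exI[of _ "\<lambda>i j. qmul (crd a) (evec j) i"] conjI allI impI)
    show "free_basis T (rat_scale R) n ?l" by (rule pure_basis)
    show "A.tr (crd a) = (\<Sum>i<n. qmul (crd a) (evec i) i)" unfolding A.tr_def trace_on_def ..
    fix j assume j: "j < n"
    have "iota (pure_tensor R a 1 \<otimes>\<^bsub>T\<^esub> ?l j) = qmul (crd a) (evec j)"
      using iota_mult[OF pa l[OF j]] a b_carrier[OF j] by (simp add: iota_pure crd_b[OF j] cst_simps)
    also have "\<dots> = (\<Sum>i<n. cst (qmul (crd a) (evec j) i) * evec i)"
      by (intro qspace_expansion A.mul_qspace crd_qspace a evec_qspace j)
    also have "\<dots> = iota (\<Oplus>\<^bsub>T\<^esub>i\<in>{..<n}. rat_scale R (qmul (crd a) (evec j) i) (?l i))"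
      unfolding pure_combination(2) ..
    finally show "pure_tensor R a 1 \<otimes>\<^bsub>T\<^esub> ?l j = (\<Oplus>\<^bsub>T\<^esub>i\<in>{..<n}. rat_scale R (qmul (crd a) (evec j) i) (?l i))"
      by (rule iota_inj[OF N.R.m_closed[OF pa l[OF j]] pure_combination(1)])
  qed
  fix t assume "\<exists>m l M. free_basis T (rat_scale R) m l \<and>
    (\<forall>j<m. pure_tensor R a 1 \<otimes>\<^bsub>T\<^esub> l j = (\<Oplus>\<^bsub>T\<^esub>i\<in>{..<m}. rat_scale R (M i j) (l i))) \<and> t = (\<Sum>i<m. M i i)"
  then obtain m l M where fb: "free_basis T (rat_scale R) m l" and t: "t = (\<Sum>i<m. M i i)"
    and M: "\<And>j. j < m \<Longrightarrow> pure_tensor R a 1 \<otimes>\<^bsub>T\<^esub> l j = (\<Oplus>\<^bsub>T\<^esub>i\<in>{..<m}. rat_scale R (M i j) (l i))" by blast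
  have l: "l i \<in> carrier T" if "i < m" for i using fb that unfolding free_basis_def by auto
  obtain m' where m': "qbasis n m (\<lambda>i. iota (l i)) m'" using rat_basis_qbasis[OF fb] by blast
  have "A.tr (crd a) = (\<Sum>i<m. M i i)"
    unfolding A.tr_def
  proof (rule trace_on_qbasis[OF A.Z.additive_map_mul m', where A = M])
    fix j assume j: "j < m"
    have "qmul (crd a) (iota (l j)) = iota (pure_tensor R a 1 \<otimes>\<^bsub>T\<^esub> l j)"
      using iota_mult[OF pa l[OF j]] a by (simp add: iota_pure cst_simps)
    also have "\<dots> = (\<Sum>i<m. cst (M i j) * iota (l i))" unfolding M[OF j] by (rule iota_combination) (rule l)
    finally show "qmul (crd a) (iota (l j)) = (\<Sum>i<m. cst (M i j) * iota (l i))" .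
  qed
  then show "t = A.tr (crd a)" using t by simp
qed

lemma crd_int_combination:
  "(\<And>i. i < r \<Longrightarrow> x i \<in> carrier R) \<Longrightarrow> crd (\<Oplus>i\<in>{..<r::nat}. add_pow R (c i :: int) (x i)) = (\<Sum>i<r. of_int (c i) * crd (x i))"
proof -
  assume x: "\<And>i. i < r \<Longrightarrow> x i \<in> carrier R"
  have "crd (\<Oplus>i\<in>{..<r}. add_pow R (c i) (x i)) = (\<Sum>i<r. crd (add_pow R (c i) (x i)))"
    by (rule A.Z.hom_finsum_rng[OF V.ring_hom_ring_axioms]) (auto intro: x)
  also have "\<dots> = (\<Sum>i<r. of_int (c i) * crd (x i))"
    by (intro sum.cong refl) (simp add: x hom_add_pow(2)[OF ring_axioms cring.axioms(1)[OF A.Z.cring_rng] V.homh] A.Z.rng_int_multiple crd_mem)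
  finally show ?thesis .
qed

lemma crd_expand_basis:
  assumes B: "based_ring R m b'" and x: "x \<in> carrier R" and i: "i < n"
  shows "crd x i = (\<Sum>j<m. based_ring.crd R m b' x j * crd (b' j) i)"
proof -
  interpret B: based_ring R m b' by (rule B)
  have "x = B.elt (B.crd x)" using B.elt_crd[OF x] ..
  then have "crd x = crd (\<Oplus>i\<in>{..<m}. add_pow R \<lfloor>B.crd x i\<rfloor> (b' i))" unfolding B.elt_def by simp
  also have "\<dots> = (\<Sum>j<m. of_int \<lfloor>B.crd x j\<rfloor> * crd (b' j))" by (rule crd_int_combination) (rule B.b_carrier)
  finally have "crd x i = (\<Sum>j<m. of_int \<lfloor>B.crd x j\<rfloor> * crd (b' j) i)" by (simp add: qvec_apply)
  moreover have "of_int \<lfloor>B.crd x j\<rfloor> = B.crd x j" for j using B.crd_mem[OF x] unfolding intvecs_def by (auto simp: of_int_floor)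
  ultimately show ?thesis by simp
qed

lemma trace_gram: "x \<in> carrier R \<Longrightarrow> y \<in> carrier R \<Longrightarrow> ring_trace R (x \<otimes> y) = of_int (A.itr (qmul (crd x) (crd y)))"
  using ring_trace_eq[of "x \<otimes> y"] A.of_int_itr[OF A.Z.mul_mem[OF crd_mem crd_mem], of x y] by (simp add: crd_mult)

text \<open>C and D are the integral base changes, inverse to each other. Comparing the traces of C
  D and D C gives m = n, and det C is 1 or -1, so its square, by which the Gram determinants differ,
  is 1.\<close>

lemma other_basis:
  assumes B: "based_ring R m b'"
  shows "m = n"
    and "Determinant.det (Matrix.mat m m (\<lambda>(i, j). ring_trace R (b' i \<otimes> b' j))) = of_int A.disc"
proof -
  interpret B: based_ring R m b' by (rule B)
  define C where "C i k = \<lfloor>crd (b' i) k\<rfloor>" for i k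
  define D where "D k j = \<lfloor>B.crd (b k) j\<rfloor>" for k j
  have C: "of_int (C i k) = crd (b' i) k" if "i < m" for i k
    using crd_mem[OF B.b_carrier[OF that]] unfolding C_def intvecs_def by (auto simp: of_int_floor)
  have D: "of_int (D k j) = B.crd (b k) j" if "k < n" for k j
    using B.crd_mem[OF b_carrier[OF that]] unfolding D_def intvecs_def by (auto simp: of_int_floor)
  have CD: "(\<Sum>k<n. C i k * D k j) = (if i = j then 1 else 0)" if i: "i < m" and j: "j < m" for i j
  proof -
    have "evec i j = (\<Sum>k<n. crd (b' i) k * B.crd (b k) j)"
      using B.crd_expand_basis[OF based_ring_axioms B.b_carrier[OF i] j] B.crd_b[OF i] by simp
    then have "of_int (\<Sum>k<n. C i k * D k j) = evec i j" using C[OF i] D by simp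
    also have "\<dots> = of_int (if i = j then 1 else 0)" by (auto simp: evec_def)
    finally show ?thesis by (simp only: of_int_eq_iff)
  qed
  have DC: "(\<Sum>j<m. D k j * C j l) = (if k = l then 1 else 0)" if k: "k < n" and l: "l < n" for k l
  proof -
    have "evec k l = (\<Sum>j<m. B.crd (b k) j * crd (b' j) l)"
      using crd_expand_basis[OF B b_carrier[OF k] l] crd_b[OF k] by simp
    then have "of_int (\<Sum>j<m. D k j * C j l) = evec k l" using C D[OF k] by simp
    also have "\<dots> = of_int (if k = l then 1 else 0)" by (auto simp: evec_def)
    finally show ?thesis by (simp only: of_int_eq_iff)
  qed
  have "int m = (\<Sum>i<m. \<Sum>k<n. C i k * D k i)" using CD by simp
  also have "\<dots> = (\<Sum>k<n. \<Sum>i<m. D k i * C i k)" by (subst sum.swap) (simp add: mult.commute)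
  also have "\<dots> = int n" using DC by simp
  finally show mn: "m = n" by simp
  define G where "G i j = A.itr (qmul (evec i) (evec j))" for i j
  have entry: "ring_trace R (b' i \<otimes> b' j) = of_int (\<Sum>k<n. (\<Sum>l<n. C i l * G l k) * C j k)" if i: "i < n" and j: "j < n" for i j
  proof -
    have ex: "crd (b' i) = lincomb n (C i) evec" if "i < n" for i
      using intvecs_expansion[OF crd_mem[OF B.b_carrier]] that mn unfolding C_def by simp
    have "qmul (crd (b' i)) (crd (b' j)) = (\<Sum>l<n. of_int (C i l) * qmul (evec l) (crd (b' j)))"
      unfolding ex[OF i] by (simp add: A.Z.mul_sum_left A.Z.mul_of_int_left)
    also have "\<dots> = (\<Sum>l<n. of_int (C i l) * (\<Sum>k<n. of_int (C j k) * qmul (evec l) (evec k)))"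
      unfolding ex[OF j] by (simp add: A.Z.mul_sum_right A.Z.mul_of_int_right)
    finally have "A.itr (qmul (crd (b' i)) (crd (b' j))) = A.itr (\<Sum>l<n. of_int (C i l) * (\<Sum>k<n. of_int (C j k) * qmul (evec l) (evec k)))"
      by simp
    also have "\<dots> = (\<Sum>l<n. C i l * A.itr (\<Sum>k<n. of_int (C j k) * qmul (evec l) (evec k)))"
      by (rule A.itr_combination) (auto intro!: A.Z.L_closed(6,7) A.Z.mul_mem evec_mem)
    also have "\<dots> = (\<Sum>l<n. C i l * (\<Sum>k<n. C j k * G l k))"
      unfolding G_def by (intro sum.cong refl arg_cong2[where f = "(*)"] A.itr_combination A.Z.mul_mem evec_mem) auto
    also have "\<dots> = (\<Sum>l<n. \<Sum>k<n. C i l * G l k * C j k)" by (simp add: sum_distrib_left mult_ac)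
    also have "\<dots> = (\<Sum>k<n. (\<Sum>l<n. C i l * G l k) * C j k)" by (subst sum.swap) (simp add: sum_distrib_right)
    finally show ?thesis using trace_gram[OF B.b_carrier B.b_carrier] i j mn by simp
  qed
  have mat_eq: "Matrix.mat m m (\<lambda>(i, j). ring_trace R (b' i \<otimes> b' j)) = map_mat of_int (fmat n (\<lambda>i j. \<Sum>k<n. (\<Sum>l<n. C i l * G l k) * C j k))"
    unfolding mn using entry by (intro eq_matI) auto
  have f: "fmat n (\<lambda>i j. \<Sum>k<n. (\<Sum>l<n. C i l * G l k) * C j k) = (fmat n C * fmat n G) * transpose_mat (fmat n C)"
    by (simp add: fmat_transpose fmat_mult)
  have "fmat n C * fmat n G \<in> carrier_mat n n" "transpose_mat (fmat n C) \<in> carrier_mat n n" by (simp_all add: fmat_mult fmat_transpose)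
  then have d1: "Determinant.det (fmat n (\<lambda>i j. \<Sum>k<n. (\<Sum>l<n. C i l * G l k) * C j k)) = Determinant.det (fmat n C * fmat n G) * Determinant.det (transpose_mat (fmat n C))"
    unfolding f by (rule det_mult)
  have d2: "Determinant.det (fmat n C * fmat n G) = Determinant.det (fmat n C) * A.disc"
    using det_mult[OF fmat_carrier fmat_carrier, of n C G] by (simp add: A.disc_def G_def[abs_def])
  have d3: "Determinant.det (transpose_mat (fmat n C)) = Determinant.det (fmat n C)" by (rule det_transpose[OF fmat_carrier])
  have "fmat n C * fmat n D = (1\<^sub>m n :: int mat)" unfolding fmat_mult using CD mn by (intro eq_matI) auto
  then have "Determinant.det (fmat n C) * Determinant.det (fmat n D) = 1"
    using det_mult[OF fmat_carrier fmat_carrier, of n C D] by simp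
  then have "\<bar>Determinant.det (fmat n C)\<bar> = 1" by (metis zmult_eq_1_iff abs_1 abs_minus_cancel)
  then have "Determinant.det (fmat n C) * Determinant.det (fmat n C) = 1" by (metis abs_mult_self_eq mult_1)
  then have "Determinant.det (fmat n (\<lambda>i j. \<Sum>k<n. (\<Sum>l<n. C i l * G l k) * C j k)) = A.disc"
    unfolding d1 d2 d3 by (simp add: mult.commute mult.left_commute)
  then show "Determinant.det (Matrix.mat m m (\<lambda>(i, j). ring_trace R (b' i \<otimes> b' j))) = of_int A.disc"
    unfolding mat_eq by (simp add: of_int_hom.hom_det)
qed

lemma discriminant_eq: "discriminant R = A.disc"
  unfolding discriminant_def
proof (rule the_equality)
  show "\<exists>m b'. int_basis R m b' \<and> of_int A.disc = Determinant.det (Matrix.mat m m (\<lambda>(i, j). ring_trace R (b' i \<otimes> b' j)))"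
    using basis other_basis(2)[OF based_ring_axioms] by metis
  fix d assume "\<exists>m b'. int_basis R m b' \<and> of_int d = Determinant.det (Matrix.mat m m (\<lambda>(i, j). ring_trace R (b' i \<otimes> b' j)))"
  then obtain m b' where mb: "int_basis R m b'" "of_int d = Determinant.det (Matrix.mat m m (\<lambda>(i, j). ring_trace R (b' i \<otimes> b' j)))" by blast
  have "based_ring R m b'" by unfold_locales (rule mb(1))
  then have "(of_int d :: rat) = of_int A.disc" using other_basis(2) mb(2) by metis
  then show "d = A.disc" by simp
qed

end

section \<open>Integral closure, index and points in coordinates\<close>

lemma integral_closure_in_iso:
  assumes A: "ring A" and B: "ring B" and h: "h \<in> ring_iso A B" and S: "S \<subseteq> carrier A"
  shows "integral_closure_in (h ` S) B = h ` integral_closure_in S A"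
proof -
  have hom: "ring_hom_ring A B h" using ring_hom_ringI2[OF A B] h unfolding ring_iso_def by blast
  have bij: "bij_betw h (carrier A) (carrier B)" using h unfolding ring_iso_def by blast
  interpret H: ring_hom_ring A B h by (rule hom)
  have inj: "u = v" if "u \<in> carrier A" "v \<in> carrier A" "h u = h v" for u v
    using that bij unfolding bij_betw_def inj_on_def by blast
  have ev: "h (ring.eval A f x) = ring.eval B (map h f) (h x)" if "x \<in> carrier A" "set f \<subseteq> S" for x f
    using H.eval_hom'[OF that(1)] that(2) S by blast
  show ?thesis
  proof (intro equalityI subsetI)
    fix y assume y: "y \<in> integral_closure_in (h ` S) B"
    then obtain g where g: "y \<in> carrier B" "g \<noteq> []" "set g \<subseteq> h ` S" "hd g = \<one>\<^bsub>B\<^esub>" "ring.eval B g y = \<zero>\<^bsub>B\<^esub>"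
      unfolding integral_closure_in_def by blast
    obtain x where x: "x \<in> carrier A" "y = h x" using g(1) bij unfolding bij_betw_def by blast
    have f: "g = map h (map (inv_into S h) g)" using g(3) by (auto simp: f_inv_into_f intro!: map_idI[symmetric])
    define f where "f = map (inv_into S h) g"
    have f: "g = map h f" "set f \<subseteq> S" using f g(3) unfolding f_def by (auto intro: inv_into_into)
    have fc: "f \<noteq> []" using f(1) g(2) by simp
    have "hd f \<in> carrier A" using f(2) S fc by (meson hd_in_set subset_eq)
    moreover have "h (hd f) = h \<one>\<^bsub>A\<^esub>" using g(4) f(1) fc by (simp add: hd_map)
    ultimately have "hd f = \<one>\<^bsub>A\<^esub>" by (intro inj) auto
    moreover have "ring.eval A f x = \<zero>\<^bsub>A\<^esub>"
    proof (rule inj)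
      show "ring.eval A f x \<in> carrier A" by (rule H.R.eval_in_carrier) (use f(2) S x in auto)
      show "h (ring.eval A f x) = h \<zero>\<^bsub>A\<^esub>" using ev[OF x(1) f(2)] g(5) f(1) x(2) by simp
    qed simp
    ultimately show "y \<in> h ` integral_closure_in S A" unfolding integral_closure_in_def using x f(2) fc by blast
  next
    fix y assume "y \<in> h ` integral_closure_in S A"
    then obtain x f where x: "x \<in> carrier A" "y = h x" and f: "f \<noteq> []" "set f \<subseteq> S" "hd f = \<one>\<^bsub>A\<^esub>" "ring.eval A f x = \<zero>\<^bsub>A\<^esub>"
      unfolding integral_closure_in_def by blast
    have "map h f \<noteq> [] \<and> set (map h f) \<subseteq> h ` S \<and> hd (map h f) = \<one>\<^bsub>B\<^esub> \<and> ring.eval B (map h f) y = \<zero>\<^bsub>B\<^esub>"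
      using f ev[OF x(1) f(2)] x(2) by (auto simp: hd_map)
    then show "y \<in> integral_closure_in (h ` S) B" unfolding integral_closure_in_def using x
      by (intro CollectI conjI exI[of _ "map h f"]) auto
  qed
qed

lemma card_hom_iso:
  assumes h: "h \<in> ring_iso A B" and A: "ring A" and B: "ring B"
  shows "card (ring_hom A K \<inter> extensional (carrier A)) = card (ring_hom B K \<inter> extensional (carrier B))"
proof -
  define g where "g = inv_into (carrier A) h"
  have bij: "bij_betw h (carrier A) (carrier B)" and hh: "h \<in> ring_hom A B" using h unfolding ring_iso_def by auto
  have gg: "g \<in> ring_hom B A" using ring_iso_set_sym[OF A h] unfolding g_def ring_iso_def by blast
  have gh: "g (h x) = x" "h x \<in> carrier B" if "x \<in> carrier A" for x
    unfolding g_def using bij that by (auto simp: bij_betw_inv_into_left dest: bij_betwE)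
  have hg: "h (g y) = y" "g y \<in> carrier A" if "y \<in> carrier B" for y
    unfolding g_def using bij that by (auto simp: bij_betw_inv_into_right bij_betw_def intro: inv_into_into)
  note closed = ring.ring_simprules(1,5,6)
  have 1: "restrict (f \<circ> g) (carrier B) \<in> ring_hom B K" if "f \<in> ring_hom A K" for f
    using ring_hom_trans[OF gg that] closed[OF B] by (auto simp: ring_hom_def)
  have 2: "restrict (f \<circ> h) (carrier A) \<in> ring_hom A K" if "f \<in> ring_hom B K" for f
    using ring_hom_trans[OF hh that] closed[OF A] by (auto simp: ring_hom_def)
  have "bij_betw (\<lambda>f. restrict (f \<circ> g) (carrier B)) (ring_hom A K \<inter> extensional (carrier A)) (ring_hom B K \<inter> extensional (carrier B))"
  proof (rule bij_betwI[where g = "\<lambda>f. restrict (f \<circ> h) (carrier A)"])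
    show "(\<lambda>f. restrict (f \<circ> g) (carrier B)) \<in> ring_hom A K \<inter> extensional (carrier A) \<rightarrow> ring_hom B K \<inter> extensional (carrier B)"
      using 1 by auto
    show "(\<lambda>f. restrict (f \<circ> h) (carrier A)) \<in> ring_hom B K \<inter> extensional (carrier B) \<rightarrow> ring_hom A K \<inter> extensional (carrier A)"
      using 2 by auto
    show "restrict (restrict (f \<circ> g) (carrier B) \<circ> h) (carrier A) = f" if "f \<in> ring_hom A K \<inter> extensional (carrier A)" for f
      using that gh by (intro ext) (auto simp: restrict_def extensional_def)
    show "restrict (restrict (f \<circ> h) (carrier A) \<circ> g) (carrier B) = f" if "f \<in> ring_hom B K \<inter> extensional (carrier B)" for f
      using that hg by (intro ext) (auto simp: restrict_def extensional_def)
  qed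
  then show ?thesis by (rule bij_betw_same_card)
qed

lemma (in mring) rng_pow: "x \<in> L \<Longrightarrow> x [^]\<^bsub>rng\<^esub> (k::nat) = pw x k"
proof -
  assume x: "x \<in> L"
  interpret S: cring rng by (rule cring_rng)
  show ?thesis
  proof (induction k)
    case (Suc k) then show ?case using S.nat_pow_Suc2[of x k] x by (simp add: pw_Suc)
  qed simp
qed

lemma (in mring) eval_rng:
  assumes "set f \<subseteq> L" "x \<in> L"
  shows "ring.eval rng f x = (\<Sum>i<length f. (rev f ! i) \<star> pw x i)"
  using assms(1)
proof (induction f)
  interpret S: cring rng by (rule cring_rng)
  case Nil show ?case by simp
next
  interpret S: cring rng by (rule cring_rng)
  case (Cons a f)
  have "(\<Sum>i<length f. (rev (a # f) ! i) \<star> pw x i) = (\<Sum>i<length f. (rev f ! i) \<star> pw x i)"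
    by (intro sum.cong refl) (simp add: nth_append)
  moreover have "rev (a # f) ! length f = a" by (simp add: nth_append)
  ultimately show ?case using Cons assms(2) by (simp add: rng_pow add.commute)
qed

lemma (in qalg_nd) integral_closure_intvecs: "integral_closure_in (intvecs n) Q.rng = intcl"
proof (intro equalityI subsetI)
  fix x assume "x \<in> integral_closure_in (intvecs n) Q.rng"
  then obtain f where x: "x \<in> qspace n" and f: "f \<noteq> []" "set f \<subseteq> intvecs n" "hd f = one" "ring.eval Q.rng f x = 0"
    unfolding integral_closure_in_def by auto
  have fq: "set f \<subseteq> qspace n" using f(2) intvecs_subset_qspace by blast
  obtain d where d: "length f = Suc d" using f(1) by (cases f) auto
  have "rev f ! d = one" using f(1,3) d by (simp add: rev_nth hd_conv_nth)
  then have "(\<Sum>i<d. (rev f ! i) \<star> Q.pw x i) + Q.pw x d = 0"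
    using Q.eval_rng[OF fq x] f(4) d Q.one_mul[OF Q.pw_mem[OF x]] by simp
  then have "Q.pw x d = - (\<Sum>i<d. (rev f ! i) \<star> Q.pw x i)" by (simp add: eq_neg_iff_add_eq_0 add.commute)
  then have eq: "Q.pw x d = (\<Sum>i<d. (- (rev f ! i)) \<star> Q.pw x i)" by (simp add: sum_negf Q.mul_minus_left)
  show "x \<in> intcl"
  proof (rule bounded_denominators_integral[OF x _ eq])
    fix i assume "i < d"
    then have "rev f ! i \<in> set (rev f)" using d by (intro nth_mem) simp
    then show "- (rev f ! i) \<in> intvecs n" using f(2) by (intro Z.L_closed(3)) auto
  qed
next
  fix x assume x: "x \<in> intcl"
  obtain i j where ij: "i < j" "Q.pw x i - Q.pw x j \<in> intvecs n" using intcl_integral[OF x] by blast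
  \<comment> \<open>The monic polynomial X^j - X^i + (x^i - x^j), whose constant term contains an
    element of Z^n. Constant term and X^i are added up rather than separated by cases because i = 0
    is possible.\<close>
  define c where "c k = (if k = j then one else (if k = 0 then Q.pw x i - Q.pw x j else 0) - (if k = i then one else 0))" for k
  define f where "f = map c (rev [0..<Suc j])"
  have xq: "x \<in> qspace n" using x intcl_subset_qspace by blast
  have c: "c k \<in> intvecs n" for k unfolding c_def using Z.one_mem Z.L_closed(1,2,3) ij(2) by auto
  have f1: "f \<noteq> []" "set f \<subseteq> intvecs n" using c unfolding f_def by auto
  have f2: "hd f = one" unfolding f_def c_def by simp
  have "ring.eval Q.rng f x = (\<Sum>k<Suc j. (rev f ! k) \<star> Q.pw x k)"
    using Q.eval_rng[of f x] f1(2) intvecs_subset_qspace xq unfolding f_def by auto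
  also have "\<dots> = (\<Sum>k<Suc j. c k \<star> Q.pw x k)"
    unfolding f_def by (intro sum.cong refl) (simp add: rev_map[symmetric] del: upt_Suc)
  also have "\<dots> = (\<Sum>k<j. c k \<star> Q.pw x k) + Q.pw x j"
    using Q.one_mul[OF Q.pw_mem[OF xq]] by (simp add: c_def)
  also have "(\<Sum>k<j. c k \<star> Q.pw x k) = (\<Sum>k<j. (if k = 0 then Q.pw x i - Q.pw x j else 0) - (if k = i then Q.pw x i else 0))"
    using Q.one_mul[OF Q.pw_mem[OF xq]] Q.mul_one[OF Q.pw_mem[OF xq]] Q.mul_one[OF Q.one_mem] Q.mul_one[OF Q.L_closed(2)[OF Q.pw_mem[OF xq] Q.pw_mem[OF xq]]]
    by (intro sum.cong refl) (auto simp: c_def Q.mul_diff_left Q.mul_minus_left)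
  also have "\<dots> = - Q.pw x j" using ij(1) by (simp add: sum_subtractf)
  finally have "ring.eval Q.rng f x = 0" by simp
  then show "x \<in> integral_closure_in (intvecs n) Q.rng"
    unfolding integral_closure_in_def using xq f1 f2 by (intro CollectI conjI exI[of _ f]) auto
qed

context based_ring
begin

lemma iota_tensor_image: "iota ` tensor_image R = intvecs n"
proof -
  have "iota ` tensor_image R = crd ` carrier R"
    unfolding tensor_image_def image_image by (intro image_cong refl) (simp add: iota_pure cst_simps)
  also have "\<dots> = intvecs n"
    using crd_ring_iso unfolding ring_iso_def bij_betw_def by simp
  finally show ?thesis .
qed

lemma tensor_image_carrier: "tensor_image R \<subseteq> carrier T"
  unfolding tensor_image_def using pure_carrier by auto

lemma iota_normalization:
  assumes "A.disc \<noteq> 0" shows "iota ` normalization_carrier R = A.intcl"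
proof -
  interpret A: qalg_nd n qmul qone by unfold_locales (rule assms)
  show ?thesis
    unfolding normalization_carrier_def A.integral_closure_intvecs[symmetric] iota_tensor_image[symmetric]
    by (rule integral_closure_in_iso[symmetric, OF cring.axioms(1)[OF cring_T] cring.axioms(1)[OF A.Q.cring_rng] iota_iso tensor_image_carrier])
qed

lemma normalization_index_eq:
  assumes disc: "A.disc \<noteq> 0" shows "normalization_index R = qalg_nd.intcl_index n qmul qone"
proof -
  interpret A: qalg_nd n qmul qone by unfold_locales (rule disc)
  let ?N = "normalization_carrier R"
  have NT: "?N \<subseteq> carrier T" unfolding normalization_carrier_def integral_closure_in_def by blast
  have coset: "iota ` (tensor_image R +>\<^bsub>T\<lparr>carrier := ?N\<rparr>\<^esub> u) = {y \<in> A.intcl. y - iota u \<in> intvecs n}" if u: "u \<in> ?N" for u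
  proof -
    have uT: "u \<in> carrier T" using u NT by blast
    have uI: "iota u \<in> A.intcl" using u iota_normalization[OF disc] by blast
    have "iota ` (tensor_image R +>\<^bsub>T\<lparr>carrier := ?N\<rparr>\<^esub> u) = (\<lambda>h. iota (h \<oplus>\<^bsub>T\<^esub> u)) ` tensor_image R"
      by (auto simp: a_r_coset_def r_coset_def)
    also have "\<dots> = (\<lambda>h. iota h + iota u) ` tensor_image R"
      using tensor_image_carrier N.hom_add uT by (intro image_cong refl) auto
    also have "\<dots> = (\<lambda>h. h + iota u) ` (iota ` tensor_image R)" by (simp add: image_image)
    also have "\<dots> = {y \<in> A.intcl. y - iota u \<in> intvecs n}"
      unfolding iota_tensor_image using uI A.intvecs_subset_intcl A.C.L_closed(4) by (auto intro!: image_eqI[of _ _ "_ - iota u"])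
    finally show ?thesis .
  qed
  have sub: "tensor_image R +>\<^bsub>T\<lparr>carrier := ?N\<rparr>\<^esub> u \<subseteq> carrier T" if "u \<in> ?N" for u
    using that NT tensor_image_carrier N.R.a_closed by (auto simp: a_r_coset_def r_coset_def)
  have rc: "a_rcosets\<^bsub>T\<lparr>carrier := ?N\<rparr>\<^esub> (tensor_image R) = (\<lambda>u. tensor_image R +>\<^bsub>T\<lparr>carrier := ?N\<rparr>\<^esub> u) ` ?N"
    by (auto simp: A_RCOSETS_def RCOSETS_def a_r_coset_def)
  have "inj_on (image iota) (a_rcosets\<^bsub>T\<lparr>carrier := ?N\<rparr>\<^esub> (tensor_image R))"
    unfolding rc
  proof (rule inj_onI)
    fix U W assume "U \<in> (\<lambda>u. tensor_image R +>\<^bsub>T\<lparr>carrier := ?N\<rparr>\<^esub> u) ` ?N" "W \<in> (\<lambda>u. tensor_image R +>\<^bsub>T\<lparr>carrier := ?N\<rparr>\<^esub> u) ` ?N"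
      and eq: "iota ` U = iota ` W"
    then have "U \<subseteq> carrier T" "W \<subseteq> carrier T" using sub by blast+
    then show "U = W" using eq bij_iota by (meson bij_betw_def inj_on_image_eq_iff)
  qed
  moreover have "image iota ` (a_rcosets\<^bsub>T\<lparr>carrier := ?N\<rparr>\<^esub> (tensor_image R)) = cosets_mod A.intcl (intvecs n)"
  proof -
    have "image iota ` (a_rcosets\<^bsub>T\<lparr>carrier := ?N\<rparr>\<^esub> (tensor_image R)) = (\<lambda>u. {y \<in> A.intcl. y - iota u \<in> intvecs n}) ` ?N"
      unfolding rc image_image by (intro image_cong refl coset)
    also have "\<dots> = (\<lambda>x. {y \<in> A.intcl. y - x \<in> intvecs n}) ` (iota ` ?N)" by (simp add: image_image)
    finally show ?thesis unfolding iota_normalization[OF disc] cosets_mod_def by auto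
  qed
  ultimately show ?thesis
    unfolding normalization_index_def A.intcl_index_def by (metis card_image)
qed

lemma card_geometric_points:
  assumes p: "Factorial_Ring.prime p"
  shows "card (geometric_points p R) = pring.pdim (intvecs n) p (pring.nilrad qmul qone (intvecs n) p)"
proof -
  interpret A: qalg_prime n qmul qone p by unfold_locales (rule p)
  interpret F: residues_prime p "residue_ring (int p)" by unfold_locales (use p in auto)
  interpret K: algebraic_closure "F.alg_closure" "F.indexed_const ` carrier (residue_ring (int p))" by (rule F.alg_closureE(1))
  have hom: "F.indexed_const \<in> ring_hom (residue_ring (int p)) F.alg_closure" by (rule F.alg_closureE(2))
  interpret H: ring_hom_ring "residue_ring (int p)" F.alg_closure F.indexed_const
    by (rule ring_hom_ringI2[OF F.ring_axioms K.ring_axioms hom])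
  have m: "[k] \<cdot>\<^bsub>F.alg_closure\<^esub> \<one>\<^bsub>F.alg_closure\<^esub> = F.indexed_const (int k mod int p)" for k :: nat
  proof (induction k)
    case 0
    have "F.indexed_const 0 = \<zero>\<^bsub>F.alg_closure\<^esub>" using H.hom_zero by (simp add: F.zero_cong)
    then show ?case by (simp add: add_pow_def nat_pow_def)
  next
    case (Suc k)
    have "F.indexed_const (int (Suc k) mod int p) = F.indexed_const ((int k mod int p) \<oplus>\<^bsub>residue_ring (int p)\<^esub> \<one>\<^bsub>residue_ring (int p)\<^esub>)"
      by (simp add: F.res_add_eq F.res_one_eq mod_simps add.commute)
    also have "\<dots> = F.indexed_const (int k mod int p) \<oplus>\<^bsub>F.alg_closure\<^esub> F.indexed_const \<one>\<^bsub>residue_ring (int p)\<^esub>"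
      by (rule H.hom_add) (use F.mod_in_carrier in auto)
    finally show ?case using Suc by simp
  qed
  have "F.indexed_const (int p mod int p) = \<zero>\<^bsub>F.alg_closure\<^esub>" using H.hom_zero by (simp add: F.res_zero_eq)
  then have p0: "[p] \<cdot>\<^bsub>F.alg_closure\<^esub> \<one>\<^bsub>F.alg_closure\<^esub> = \<zero>\<^bsub>F.alg_closure\<^esub>" using m[of p] by simp
  have "card (geometric_points p R) = card (ring_hom A.Z.rng F.alg_closure \<inter> extensional (carrier A.Z.rng))"
    unfolding geometric_points_def
    by (rule card_hom_iso[OF crd_ring_iso ring_axioms cring.axioms(1)[OF A.Z.cring_rng]])
  also have "\<dots> = card (A.Zp.points F.alg_closure)" unfolding A.Zp.points_def by simp
  also have "\<dots> = A.Zp.pdim A.Zp.nilrad" by (rule A.Zp.card_points[OF K.algebraically_closed_axioms p0])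
  finally show ?thesis .
qed

end

section \<open>Products of fields\<close>

lemma ring_iso_inverse:
  assumes "h \<in> ring_iso A B" "ring A"
  obtains g where "g \<in> ring_iso B A" "\<And>x. x \<in> carrier A \<Longrightarrow> g (h x) = x" "\<And>y. y \<in> carrier B \<Longrightarrow> h (g y) = y"
    "\<And>y. y \<in> carrier B \<Longrightarrow> g y \<in> carrier A"
proof -
  have bij: "bij_betw h (carrier A) (carrier B)" using assms(1) unfolding ring_iso_def by auto
  show ?thesis
  proof (rule that[of "inv_into (carrier A) h"])
    show "inv_into (carrier A) h \<in> ring_iso B A" by (rule ring_iso_set_sym[OF assms(2,1)])
  qed (use bij in \<open>auto simp: bij_betw_inv_into_left bij_betw_inv_into_right bij_betw_def intro: inv_into_into\<close>)
qed

lemma image_eq_vimage_inverse: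
  assumes "h \<in> ring_iso A B" "\<And>x. x \<in> carrier A \<Longrightarrow> g (h x) = x" "\<And>y. y \<in> carrier B \<Longrightarrow> h (g y) = y"
    "\<And>y. y \<in> carrier B \<Longrightarrow> g y \<in> carrier A" "I \<subseteq> carrier A"
  shows "h ` I = {y \<in> carrier B. g y \<in> I}"
  using assms ring_iso_memE(1)[OF assms(1)] by (auto simp: subset_iff image_iff) metis

lemma ideal_image_iso:
  assumes h: "h \<in> ring_iso A B" and A: "ring A" and B: "ring B" and I: "ideal I A"
  shows "ideal (h ` I) B"
proof -
  obtain g where g: "g \<in> ring_iso B A" "\<And>x. x \<in> carrier A \<Longrightarrow> g (h x) = x" "\<And>y. y \<in> carrier B \<Longrightarrow> h (g y) = y"
    "\<And>y. y \<in> carrier B \<Longrightarrow> g y \<in> carrier A" using ring_iso_inverse[OF h A] by metis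
  have "ring_hom_ring B A g" using ring_hom_ringI2[OF B A] g(1) unfolding ring_iso_def by blast
  from ring_hom_ring.ideal_vimage[OF this I] show ?thesis
    using image_eq_vimage_inverse[OF h g(2,3,4)] ideal.Icarr[OF I] by (simp add: subset_iff)
qed

lemma ideal_prod_image_iso:
  assumes h: "h \<in> ring_iso A B" and A: "ring A" and I: "I \<subseteq> carrier A" "J \<subseteq> carrier A"
  shows "h ` (I \<cdot>\<^bsub>A\<^esub> J) = (h ` I) \<cdot>\<^bsub>B\<^esub> (h ` J)"
proof (intro equalityI subsetI)
  have carr: "x \<in> carrier A" if "x \<in> I \<cdot>\<^bsub>A\<^esub> J" for x
    using that
  proof (induction rule: ideal_prod.induct)
    case (prod i j) then show ?case using I ring.ring_simprules(5)[OF A] by blast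
  next
    case (sum s t) then show ?case using ring.ring_simprules(1)[OF A] by blast
  qed
  fix y
  {
    assume "y \<in> h ` (I \<cdot>\<^bsub>A\<^esub> J)"
    then obtain x where x: "x \<in> I \<cdot>\<^bsub>A\<^esub> J" "y = h x" by blast
    from x(1) have "h x \<in> (h ` I) \<cdot>\<^bsub>B\<^esub> (h ` J)"
    proof (induction rule: ideal_prod.induct)
      case (prod i j)
      then have "h (i \<otimes>\<^bsub>A\<^esub> j) = h i \<otimes>\<^bsub>B\<^esub> h j" using ring_iso_memE(2)[OF h] I by blast
      then show ?case using prod by (auto intro: ideal_prod.prod)
    next
      case (sum s t)
      have "h (s \<oplus>\<^bsub>A\<^esub> t) = h s \<oplus>\<^bsub>B\<^esub> h t" using ring_iso_memE(3)[OF h carr carr] sum by blast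
      then show ?case using ideal_prod.sum[OF sum.IH] by simp
    qed
    then show "y \<in> (h ` I) \<cdot>\<^bsub>B\<^esub> (h ` J)" unfolding x(2) .
  }
  assume "y \<in> (h ` I) \<cdot>\<^bsub>B\<^esub> (h ` J)"
  then show "y \<in> h ` (I \<cdot>\<^bsub>A\<^esub> J)"
  proof (induction rule: ideal_prod.induct)
    case (prod i j)
    then obtain a b where ab: "a \<in> I" "b \<in> J" "i = h a" "j = h b" by blast
    then have "h (a \<otimes>\<^bsub>A\<^esub> b) = i \<otimes>\<^bsub>B\<^esub> j" using ring_iso_memE(2)[OF h] I by blast
    then show ?case using ideal_prod.prod[OF ab(1,2)] by (metis image_eqI)
  next
    case (sum s t)
    then obtain a b where ab: "a \<in> I \<cdot>\<^bsub>A\<^esub> J" "b \<in> I \<cdot>\<^bsub>A\<^esub> J" "s = h a" "t = h b" by blast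
    then have "h (a \<oplus>\<^bsub>A\<^esub> b) = s \<oplus>\<^bsub>B\<^esub> t" using ring_iso_memE(3)[OF h carr carr] by blast
    then show ?case using ideal_prod.sum[OF ab(1,2)] by (metis image_eqI)
  qed
qed

lemma ideals_set_pow_closed:
  assumes "ring A" "ideal P A" shows "ideal (P [^]\<^bsub>ideals_set A\<^esub> (e::nat)) A"
proof (induction e)
  case 0
  interpret ring A by (rule assms(1))
  show ?case using oneideal by (simp add: nat_pow_def ideals_set_def)
next
  case (Suc e)
  have "P [^]\<^bsub>ideals_set A\<^esub> Suc e = (P [^]\<^bsub>ideals_set A\<^esub> e) \<cdot>\<^bsub>A\<^esub> P" by (simp add: nat_pow_def ideals_set_def)
  then show ?case using ring.ideal_prod_is_ideal[OF assms(1) Suc assms(2)] by simp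
qed

lemma ideals_set_pow_image_iso:
  assumes h: "h \<in> ring_iso A B" and A: "ring A" and P: "ideal P A"
  shows "h ` (P [^]\<^bsub>ideals_set A\<^esub> (e::nat)) = (h ` P) [^]\<^bsub>ideals_set B\<^esub> e"
proof (induction e)
  case 0
  have "h ` carrier A = carrier B" using ring_iso_memE(5)[OF h] unfolding bij_betw_def by blast
  then show ?case by (simp add: nat_pow_def ideals_set_def)
next
  case (Suc e)
  have S: "P [^]\<^bsub>ideals_set A\<^esub> Suc e = (P [^]\<^bsub>ideals_set A\<^esub> e) \<cdot>\<^bsub>A\<^esub> P"
    "(h ` P) [^]\<^bsub>ideals_set B\<^esub> Suc e = ((h ` P) [^]\<^bsub>ideals_set B\<^esub> e) \<cdot>\<^bsub>B\<^esub> (h ` P)"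
    by (simp_all add: nat_pow_def ideals_set_def)
  have sub: "P [^]\<^bsub>ideals_set A\<^esub> e \<subseteq> carrier A" "P \<subseteq> carrier A"
    using ideal.Icarr[OF ideals_set_pow_closed[OF A P]] ideal.Icarr[OF P] by blast+
  show ?case unfolding S Suc[symmetric] by (rule ideal_prod_image_iso[OF h A sub])
qed

lemma iso_nat_multiple_one:
  fixes p :: nat
  assumes h: "h \<in> ring_iso A B" and A: "ring A" and B: "ring B"
  shows "h ([p] \<cdot>\<^bsub>A\<^esub> \<one>\<^bsub>A\<^esub>) = [p] \<cdot>\<^bsub>B\<^esub> \<one>\<^bsub>B\<^esub>"
proof -
  have "h \<in> ring_hom A B" using h unfolding ring_iso_def by blast
  then show ?thesis
    using hom_add_pow(1)[OF A B _ monoid.one_closed[OF ring.is_monoid[OF A]], of h p] ring_iso_memE(4)[OF h] by simp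
qed

lemma principal_image_iso:
  assumes h: "h \<in> ring_iso A B" and a: "a \<in> carrier A"
  shows "h ` (PIdl\<^bsub>A\<^esub> a) = PIdl\<^bsub>B\<^esub> (h a)"
proof -
  have surj: "carrier B = h ` carrier A" using ring_iso_memE(5)[OF h] unfolding bij_betw_def by blast
  have "PIdl\<^bsub>A\<^esub> a = (\<lambda>x. x \<otimes>\<^bsub>A\<^esub> a) ` carrier A" "PIdl\<^bsub>B\<^esub> (h a) = (\<lambda>x. x \<otimes>\<^bsub>B\<^esub> h a) ` carrier B"
    unfolding cgenideal_def by auto
  then show ?thesis unfolding surj image_image using ring_iso_memE(2)[OF h _ a] by (simp add: image_image cong: image_cong)
qed

lemma ramification_index_iso:
  assumes h: "h \<in> ring_iso A B" and A: "cring A" and B: "cring B" and P: "ideal P A"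
  shows "ramification_index B p (h ` P) = ramification_index A p P"
proof -
  note Ar = cring.axioms(1)[OF A] and Br = cring.axioms(1)[OF B]
  obtain g where g: "g \<in> ring_iso B A" "\<And>x. x \<in> carrier A \<Longrightarrow> g (h x) = x" "\<And>y. y \<in> carrier B \<Longrightarrow> h (g y) = y"
    "\<And>y. y \<in> carrier B \<Longrightarrow> g y \<in> carrier A" using ring_iso_inverse[OF h Ar] by metis
  have inj: "inj_on h (carrier A)" using ring_iso_memE(5)[OF h] unfolding bij_betw_def by blast
  have pc: "[p] \<cdot>\<^bsub>A\<^esub> \<one>\<^bsub>A\<^esub> \<in> carrier A"
  proof -
    interpret cring A by (rule A)
    show ?thesis by simp
  qed
  have PI: "h ` (PIdl\<^bsub>A\<^esub> ([p] \<cdot>\<^bsub>A\<^esub> \<one>\<^bsub>A\<^esub>)) = PIdl\<^bsub>B\<^esub> ([p] \<cdot>\<^bsub>B\<^esub> \<one>\<^bsub>B\<^esub>)"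
    using principal_image_iso[OF h pc] iso_nat_multiple_one[OF h Ar Br] by simp
  have PIc: "PIdl\<^bsub>A\<^esub> ([p] \<cdot>\<^bsub>A\<^esub> \<one>\<^bsub>A\<^esub>) \<subseteq> carrier A"
    using ideal.Icarr[OF cring.cgenideal_ideal[OF A pc]] by blast
  have prod: "h ` ((P [^]\<^bsub>ideals_set A\<^esub> e) \<cdot>\<^bsub>A\<^esub> J) = ((h ` P) [^]\<^bsub>ideals_set B\<^esub> e) \<cdot>\<^bsub>B\<^esub> (h ` J)" if "ideal J A" for J and e :: nat
  proof -
    have sub: "P [^]\<^bsub>ideals_set A\<^esub> e \<subseteq> carrier A" "J \<subseteq> carrier A"
      using ideal.Icarr[OF ideals_set_pow_closed[OF Ar P]] ideal.Icarr[OF that] by blast+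
    show ?thesis unfolding ideal_prod_image_iso[OF h Ar sub] ideals_set_pow_image_iso[OF h Ar P] ..
  qed
  have "(\<exists>J. ideal J B \<and> PIdl\<^bsub>B\<^esub> ([p] \<cdot>\<^bsub>B\<^esub> \<one>\<^bsub>B\<^esub>) = ((h ` P) [^]\<^bsub>ideals_set B\<^esub> e) \<cdot>\<^bsub>B\<^esub> J) \<longleftrightarrow>
    (\<exists>J. ideal J A \<and> PIdl\<^bsub>A\<^esub> ([p] \<cdot>\<^bsub>A\<^esub> \<one>\<^bsub>A\<^esub>) = (P [^]\<^bsub>ideals_set A\<^esub> e) \<cdot>\<^bsub>A\<^esub> J)" for e :: nat
  proof
    assume "\<exists>J. ideal J B \<and> PIdl\<^bsub>B\<^esub> ([p] \<cdot>\<^bsub>B\<^esub> \<one>\<^bsub>B\<^esub>) = ((h ` P) [^]\<^bsub>ideals_set B\<^esub> e) \<cdot>\<^bsub>B\<^esub> J"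
    then obtain J where J: "ideal J B" "PIdl\<^bsub>B\<^esub> ([p] \<cdot>\<^bsub>B\<^esub> \<one>\<^bsub>B\<^esub>) = ((h ` P) [^]\<^bsub>ideals_set B\<^esub> e) \<cdot>\<^bsub>B\<^esub> J" by blast
    have gJ: "ideal (g ` J) A" by (rule ideal_image_iso[OF g(1) Br Ar J(1)])
    have hgJ: "h ` g ` J = J" using g(3) ideal.Icarr[OF J(1)] by (force simp: image_image)
    have "h ` (PIdl\<^bsub>A\<^esub> ([p] \<cdot>\<^bsub>A\<^esub> \<one>\<^bsub>A\<^esub>)) = h ` ((P [^]\<^bsub>ideals_set A\<^esub> e) \<cdot>\<^bsub>A\<^esub> (g ` J))"
      unfolding PI prod[OF gJ] hgJ by (rule J(2))
    moreover have "(P [^]\<^bsub>ideals_set A\<^esub> e) \<cdot>\<^bsub>A\<^esub> (g ` J) \<subseteq> carrier A"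
      using ideal.Icarr[OF ring.ideal_prod_is_ideal[OF Ar ideals_set_pow_closed[OF Ar P] gJ]] by blast
    ultimately have "PIdl\<^bsub>A\<^esub> ([p] \<cdot>\<^bsub>A\<^esub> \<one>\<^bsub>A\<^esub>) = (P [^]\<^bsub>ideals_set A\<^esub> e) \<cdot>\<^bsub>A\<^esub> (g ` J)"
      using inj_on_image_eq_iff[OF inj PIc] by blast
    then show "\<exists>J. ideal J A \<and> PIdl\<^bsub>A\<^esub> ([p] \<cdot>\<^bsub>A\<^esub> \<one>\<^bsub>A\<^esub>) = (P [^]\<^bsub>ideals_set A\<^esub> e) \<cdot>\<^bsub>A\<^esub> J" using gJ by blast
  next
    assume "\<exists>J. ideal J A \<and> PIdl\<^bsub>A\<^esub> ([p] \<cdot>\<^bsub>A\<^esub> \<one>\<^bsub>A\<^esub>) = (P [^]\<^bsub>ideals_set A\<^esub> e) \<cdot>\<^bsub>A\<^esub> J"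
    then obtain J where J: "ideal J A" "PIdl\<^bsub>A\<^esub> ([p] \<cdot>\<^bsub>A\<^esub> \<one>\<^bsub>A\<^esub>) = (P [^]\<^bsub>ideals_set A\<^esub> e) \<cdot>\<^bsub>A\<^esub> J" by blast
    have "PIdl\<^bsub>B\<^esub> ([p] \<cdot>\<^bsub>B\<^esub> \<one>\<^bsub>B\<^esub>) = ((h ` P) [^]\<^bsub>ideals_set B\<^esub> e) \<cdot>\<^bsub>B\<^esub> (h ` J)"
      unfolding PI[symmetric] prod[OF J(1), symmetric] J(2) ..
    then show "\<exists>J. ideal J B \<and> PIdl\<^bsub>B\<^esub> ([p] \<cdot>\<^bsub>B\<^esub> \<one>\<^bsub>B\<^esub>) = ((h ` P) [^]\<^bsub>ideals_set B\<^esub> e) \<cdot>\<^bsub>B\<^esub> J"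
      using ideal_image_iso[OF h Ar Br J(1)] by blast
  qed
  then show ?thesis unfolding ramification_index_def by simp
qed

text \<open>Stated for a ring instead of a field, so that it can be carried from a factor of the
  closure to a ring of integers.\<close>

definition tame_at :: "nat \<Rightarrow> 'k ring \<Rightarrow> bool" where
  "tame_at p A \<longleftrightarrow> (\<forall>P. primeideal P A \<and> [p] \<cdot>\<^bsub>A\<^esub> \<one>\<^bsub>A\<^esub> \<in> P \<longrightarrow> coprime (ramification_index A p P) p)"

lemma tame_at_iso_imp:
  assumes h: "h \<in> ring_iso A B" and A: "cring A" and B: "cring B" and t: "tame_at p A"
  shows "tame_at p B"
  unfolding tame_at_def
proof (intro allI impI)
  fix Q assume Q: "primeideal Q B \<and> [p] \<cdot>\<^bsub>B\<^esub> \<one>\<^bsub>B\<^esub> \<in> Q"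
  note Ar = cring.axioms(1)[OF A] and Br = cring.axioms(1)[OF B]
  define P where "P = {x \<in> carrier A. h x \<in> Q}"
  have hom: "ring_hom_ring A B h" using ring_hom_ringI2[OF Ar Br] h unfolding ring_iso_def by blast
  have P: "primeideal P A" unfolding P_def using ring_hom_ring.primeideal_vimage[OF hom A] Q by blast
  have "[p] \<cdot>\<^bsub>A\<^esub> \<one>\<^bsub>A\<^esub> \<in> carrier A"
  proof -
    interpret cring A by (rule A)
    show ?thesis by simp
  qed
  then have "[p] \<cdot>\<^bsub>A\<^esub> \<one>\<^bsub>A\<^esub> \<in> P" unfolding P_def using Q iso_nat_multiple_one[OF h Ar Br, of p] by simp
  then have cop: "coprime (ramification_index A p P) p" using t P unfolding tame_at_def by blast
  have surj: "h ` carrier A = carrier B" using ring_iso_memE(5)[OF h] unfolding bij_betw_def by blast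
  have "h ` P = Q"
  proof
    show "Q \<subseteq> h ` P"
    proof
      fix y assume y: "y \<in> Q"
      have "y \<in> h ` carrier A" unfolding surj by (rule ideal.Icarr[OF primeideal.axioms(1)[OF conjunct1[OF Q]] y])
      then obtain x where "x \<in> carrier A" "y = h x" by (rule imageE)
      then show "y \<in> h ` P" unfolding P_def using y by auto
    qed
  qed (auto simp: P_def)
  then show "coprime (ramification_index B p Q) p"
    using ramification_index_iso[OF h A B primeideal.axioms(1)[OF P], of p] cop by simp
qed

lemma tame_at_iso:
  assumes h: "h \<in> ring_iso A B" and A: "cring A" and B: "cring B"
  shows "tame_at p A \<longleftrightarrow> tame_at p B"
  using tame_at_iso_imp[OF h A B] tame_at_iso_imp[OF ring_iso_set_sym[OF cring.axioms(1)[OF A] h] B A] by blast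

lemma tamely_ramified_iff: "tamely_ramified p K \<longleftrightarrow> tame_at p (ring_of_integers K)"
proof -
  have "[p] \<cdot>\<^bsub>ring_of_integers K\<^esub> \<one>\<^bsub>ring_of_integers K\<^esub> = [p] \<cdot>\<^bsub>K\<^esub> \<one>\<^bsub>K\<^esub>"
    by (simp add: ring_of_integers_def add_pow_def nat_pow_def)
  then show ?thesis unfolding tamely_ramified_def tame_at_def by simp
qed

section \<open>Components of a product of fields\<close>

lemma RDirProd_list_Cons_ops:
  assumes "a \<in> carrier R" "b \<in> carrier R" "x \<in> carrier (RDirProd_list Rs)" "y \<in> carrier (RDirProd_list Rs)"
  shows "(a # x) \<otimes>\<^bsub>RDirProd_list (R # Rs)\<^esub> (b # y) = (a \<otimes>\<^bsub>R\<^esub> b) # (x \<otimes>\<^bsub>RDirProd_list Rs\<^esub> y)"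
    "(a # x) \<oplus>\<^bsub>RDirProd_list (R # Rs)\<^esub> (b # y) = (a \<oplus>\<^bsub>R\<^esub> b) # (x \<oplus>\<^bsub>RDirProd_list Rs\<^esub> y)"
proof -
  note hom = RDirProd_list_hom1[of R Rs]
  have c: "(a, x) \<in> carrier (RDirProd R (RDirProd_list Rs))" "(b, y) \<in> carrier (RDirProd R (RDirProd_list Rs))"
    using assms by (auto simp: RDirProd_carrier)
  show "(a # x) \<otimes>\<^bsub>RDirProd_list (R # Rs)\<^esub> (b # y) = (a \<otimes>\<^bsub>R\<^esub> b) # (x \<otimes>\<^bsub>RDirProd_list Rs\<^esub> y)"
    using ring_hom_mult[OF hom c] by (simp add: RDirProd_def DirProd_def monoid.defs)
  show "(a # x) \<oplus>\<^bsub>RDirProd_list (R # Rs)\<^esub> (b # y) = (a \<oplus>\<^bsub>R\<^esub> b) # (x \<oplus>\<^bsub>RDirProd_list Rs\<^esub> y)"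
    using ring_hom_add[OF hom c] by (simp add: RDirProd_def DirProd_def monoid.defs)
qed

lemma RDirProd_list_Cons_one: "\<one>\<^bsub>RDirProd_list (R # Rs)\<^esub> = \<one>\<^bsub>R\<^esub> # \<one>\<^bsub>RDirProd_list Rs\<^esub>"
  by (simp add: RDirProd_list_one)

lemma RDirProd_list_nth_hom: "i < length Rs \<Longrightarrow> (\<lambda>x. x ! i) \<in> ring_hom (RDirProd_list Rs) (Rs ! i)"
proof (induction Rs arbitrary: i)
  case (Cons R Rs)
  note ops = RDirProd_list_Cons_ops[of _ R _ _ Rs]
  show ?case
  proof (cases i)
    case 0
    then show ?thesis
      by (intro ring_hom_memI) (auto simp: RDirProd_list_carrier ops RDirProd_list_Cons_one)
  next
    case (Suc j)
    have hom: "(\<lambda>x. x ! j) \<in> ring_hom (RDirProd_list Rs) (Rs ! j)" using Cons Suc by simp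
    show ?thesis unfolding Suc
      by (intro ring_hom_memI)
        (auto simp: RDirProd_list_carrier ops RDirProd_list_Cons_one ring_hom_closed[OF hom] ring_hom_mult[OF hom] ring_hom_add[OF hom] ring_hom_one[OF hom])
  qed
qed simp

context qalg
begin

lemma idempotent_intcl: assumes e: "e \<in> qspace n" "e \<star> e = e" shows "e \<in> intcl"
proof -
  obtain N where N: "N > 0" "of_nat N * e \<in> intvecs n" using qspace_common_denominator[OF e(1)] by blast
  have pw: "Q.pw e (Suc k) = e" for k using e Q.mul_one by (induction k) (auto simp: Q.pw_Suc)
  have "of_nat N * Q.pw e k \<in> intvecs n" for k
    using N(2) pw Z.L_closed(5)[OF Z.one_mem] by (cases k) auto
  then show ?thesis unfolding intcl_def using e(1) N(1) by blast
qed

text \<open>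
  If \<open>N\<close> clears the denominators of all powers of \<open>x\<close>, then the group generated by the \<open>N x\<^sup>k\<close> is
  finitely generated.
\<close>

lemma intcl_int_relation:
  assumes "x \<in> intcl"
  obtains d and c :: "nat \<Rightarrow> int" where "Q.pw x d = lincomb d c (Q.pw x)"
proof -
  obtain N where N: "N > 0" "\<And>k. of_nat N * Q.pw x k \<in> intvecs n" using intclE[OF assms] by metis
  define y where "y k = of_nat N * Q.pw x k" for k
  define L where "L = {v. \<exists>d (c :: nat \<Rightarrow> int). (\<forall>j\<ge>d. c j = 0) \<and> v = lincomb d c y}"
  have ext: "lincomb d c y = lincomb D c y"
    if "\<forall>j\<ge>d. c j = 0" "d \<le> D" for c :: "nat \<Rightarrow> int" and d D
    using that by (intro sum.mono_neutral_left) auto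
  have "is_subgroup L"
  proof (rule is_subgroupI)
    show "0 \<in> L" unfolding L_def by (auto intro!: exI[of _ 0] exI[of _ "\<lambda>_. 0"])
    fix u v assume "u \<in> L" "v \<in> L"
    then obtain d e :: nat and c f :: "nat \<Rightarrow> int" where *: "\<forall>j\<ge>d. c j = 0" "u = lincomb d c y"
      "\<forall>j\<ge>e. f j = 0" "v = lincomb e f y" unfolding L_def by blast
    have "u - v = (\<Sum>j<max d e. of_int (c j - f j) * y j)"
      using ext[OF *(1), of "max d e"] ext[OF *(3), of "max d e"] *(2,4) by (simp add: left_diff_distrib sum_subtractf)
    then show "u - v \<in> L" unfolding L_def using *(1,3)
      by (intro CollectI exI[of _ "max d e"] exI[of _ "\<lambda>j. c j - f j"]) auto
  qed
  moreover have "L \<subseteq> intvecs n"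
    unfolding L_def y_def using N(2) by (auto intro!: Z.L_closed(6,7))
  ultimately obtain B where B: "\<And>i. i < n \<Longrightarrow> B i \<in> L" "\<And>v. v \<in> L \<Longrightarrow> \<exists>c. v = lincomb n c B"
    using intvecs_subgroup_generators by metis
  have "\<forall>i\<in>{..<n}. \<exists>d (c :: nat \<Rightarrow> int). (\<forall>j\<ge>d. c j = 0) \<and> B i = lincomb d c y"
    using B(1) unfolding L_def by blast
  then obtain d and c :: "nat \<Rightarrow> nat \<Rightarrow> int" where dc: "\<And>i j. i < n \<Longrightarrow> j \<ge> d i \<Longrightarrow> c i j = 0"
    "\<And>i. i < n \<Longrightarrow> B i = (\<Sum>j<d i. of_int (c i j) * y j)" by (metis lessThan_iff)
  \<comment> \<open>D bounds the lengths of all generators, so N x^D is an integral combination of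
    the N x^j with j < D, and N cancels.\<close>
  define D where "D = (\<Sum>i<n. d i)"
  have dD: "d i \<le> D" if "i < n" for i unfolding D_def using that by (intro member_le_sum) auto
  have BD: "B i = lincomb D (c i) y" if "i < n" for i
    using dc(2)[OF that] ext[of "d i" "c i" D] dc(1)[OF that] dD[OF that] by simp
  have "(\<Sum>j<Suc D. of_int (if j = D then 1 else 0) * y j) = y D" by simp
  then have "y D \<in> L" unfolding L_def by (intro CollectI exI[of _ "Suc D"] exI[of _ "\<lambda>j. if j = D then 1 else 0"]) auto
  then obtain e where "y D = lincomb n e B" using B(2) by blast
  also have "\<dots> = (\<Sum>i<n. \<Sum>j<D. of_int (e i * c i j) * y j)"
    by (intro sum.cong refl) (simp add: BD sum_distrib_left mult.assoc)
  also have "\<dots> = (\<Sum>j<D. of_int (\<Sum>i<n. e i * c i j) * y j)"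
    by (subst sum.swap) (simp add: sum_distrib_right)
  also have "\<dots> = of_nat N * (\<Sum>j<D. of_int (\<Sum>i<n. e i * c i j) * Q.pw x j)"
    unfolding y_def by (simp add: sum_distrib_left mult.left_commute)
  finally have "of_nat N * Q.pw x D = of_nat N * (\<Sum>j<D. of_int (\<Sum>i<n. e i * c i j) * Q.pw x j)" unfolding y_def .
  moreover have "N \<noteq> 0" using N(1) by simp
  ultimately have "Q.pw x D = (\<Sum>j<D. of_int (\<Sum>i<n. e i * c i j) * Q.pw x j)" using qvec_of_nat_mult_cancel by blast
  then show ?thesis by (rule that)
qed

end

locale product_ring = based_ring +
  fixes Ks :: "'k ring list" and h :: "qvec \<Rightarrow> 'k list"
  assumes Ks_field: "i < length Ks \<Longrightarrow> field (Ks ! i)"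
    and h_iso: "h \<in> ring_iso A.Q.rng (RDirProd_list Ks)"
begin

abbreviation "m \<equiv> length Ks"

definition com :: "nat \<Rightarrow> qvec \<Rightarrow> 'k" where
  "com i v = h v ! i"

lemma bij_h: "bij_betw h (qspace n) (carrier (RDirProd_list Ks))"
  using h_iso unfolding ring_iso_def by simp

lemma com_hom: "i < m \<Longrightarrow> ring_hom_ring A.Q.rng (Ks ! i) (com i)"
proof -
  assume i: "i < m"
  have "h \<in> ring_hom A.Q.rng (RDirProd_list Ks)" using h_iso unfolding ring_iso_def by blast
  from ring_hom_trans[OF this RDirProd_list_nth_hom[OF i]] have "com i \<in> ring_hom A.Q.rng (Ks ! i)"
    unfolding com_def comp_def .
  then show ?thesis
    using ring_hom_ringI2[OF cring.axioms(1)[OF A.Q.cring_rng]] fieldE(1)[OF Ks_field[OF i]] cring.axioms(1) by blast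
qed

lemma com_ops:
  assumes "i < m"
  shows "u \<in> qspace n \<Longrightarrow> com i u \<in> carrier (Ks ! i)"
    "u \<in> qspace n \<Longrightarrow> v \<in> qspace n \<Longrightarrow> com i (qmul u v) = com i u \<otimes>\<^bsub>Ks ! i\<^esub> com i v"
    "u \<in> qspace n \<Longrightarrow> v \<in> qspace n \<Longrightarrow> com i (u + v) = com i u \<oplus>\<^bsub>Ks ! i\<^esub> com i v"
    "com i qone = \<one>\<^bsub>Ks ! i\<^esub>" "com i 0 = \<zero>\<^bsub>Ks ! i\<^esub>"
proof -
  interpret H: ring_hom_ring A.Q.rng "Ks ! i" "com i" by (rule com_hom[OF assms])
  show "u \<in> qspace n \<Longrightarrow> com i u \<in> carrier (Ks ! i)" using H.hom_closed by simp
  show "u \<in> qspace n \<Longrightarrow> v \<in> qspace n \<Longrightarrow> com i (qmul u v) = com i u \<otimes>\<^bsub>Ks ! i\<^esub> com i v" using H.hom_mult by simp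
  show "u \<in> qspace n \<Longrightarrow> v \<in> qspace n \<Longrightarrow> com i (u + v) = com i u \<oplus>\<^bsub>Ks ! i\<^esub> com i v" using H.hom_add by simp
  show "com i qone = \<one>\<^bsub>Ks ! i\<^esub>" using H.hom_one by simp
  show "com i 0 = \<zero>\<^bsub>Ks ! i\<^esub>" using H.hom_zero by simp
qed

lemma com_ext:
  assumes "u \<in> qspace n" "v \<in> qspace n" "\<And>i. i < m \<Longrightarrow> com i u = com i v"
  shows "u = v"
proof -
  have c: "h u \<in> carrier (RDirProd_list Ks)" "h v \<in> carrier (RDirProd_list Ks)" using bij_h assms(1,2) bij_betwE by blast+
  have "h u = h v"
    using RDirProd_list_carrier_mem(1)[OF c(1)] RDirProd_list_carrier_mem(1)[OF c(2)] assms(3)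
    unfolding com_def by (intro nth_equalityI) auto
  then show ?thesis using bij_h assms(1,2) unfolding bij_betw_def inj_on_def by blast
qed

lemma com_exists:
  assumes "\<And>i. i < m \<Longrightarrow> y i \<in> carrier (Ks ! i)"
  shows "\<exists>v\<in>qspace n. \<forall>i<m. com i v = y i"
proof -
  have "map y [0..<m] \<in> carrier (RDirProd_list Ks)"
    by (rule RDirProd_list_carrier_memI) (use assms in auto)
  then obtain v where "v \<in> qspace n" "h v = map y [0..<m]" using bij_h unfolding bij_betw_def by (metis imageE)
  then show ?thesis unfolding com_def by (intro bexI[of _ v]) auto
qed

text \<open>The idempotent that belongs to the i-th factor field.\<close>

definition eps :: "nat \<Rightarrow> qvec" where
  "eps i = (SOME v. v \<in> qspace n \<and> (\<forall>j<m. com j v = (if j = i then \<one>\<^bsub>Ks ! j\<^esub> else \<zero>\<^bsub>Ks ! j\<^esub>)))"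

lemma eps: "eps i \<in> qspace n" "j < m \<Longrightarrow> com j (eps i) = (if j = i then \<one>\<^bsub>Ks ! j\<^esub> else \<zero>\<^bsub>Ks ! j\<^esub>)"
proof -
  have "\<exists>v\<in>qspace n. \<forall>j<m. com j v = (if j = i then \<one>\<^bsub>Ks ! j\<^esub> else \<zero>\<^bsub>Ks ! j\<^esub>)"
  proof (rule com_exists)
    fix j assume "j < m"
    then interpret F: field "Ks ! j" by (rule Ks_field)
    show "(if j = i then \<one>\<^bsub>Ks ! j\<^esub> else \<zero>\<^bsub>Ks ! j\<^esub>) \<in> carrier (Ks ! j)" by (rule if_split[THEN iffD2]) (intro conjI impI F.one_closed F.zero_closed)
  qed
  then have "\<exists>v. v \<in> qspace n \<and> (\<forall>j<m. com j v = (if j = i then \<one>\<^bsub>Ks ! j\<^esub> else \<zero>\<^bsub>Ks ! j\<^esub>))" by blast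
  from someI_ex[OF this] show "eps i \<in> qspace n" "j < m \<Longrightarrow> com j (eps i) = (if j = i then \<one>\<^bsub>Ks ! j\<^esub> else \<zero>\<^bsub>Ks ! j\<^esub>)"
    unfolding eps_def[symmetric] by blast+
qed

lemma com_eps_mul:
  assumes "x \<in> qspace n" "j < m"
  shows "com j (qmul (eps i) x) = (if j = i then com j x else \<zero>\<^bsub>Ks ! j\<^esub>)"
proof -
  interpret F: field "Ks ! j" by (rule Ks_field[OF assms(2)])
  note l = F.l_one[OF com_ops(1)[OF assms(2,1)]] F.l_null[OF com_ops(1)[OF assms(2,1)]]
  have "com j (qmul (eps i) x) = (if j = i then \<one>\<^bsub>Ks ! j\<^esub> else \<zero>\<^bsub>Ks ! j\<^esub>) \<otimes>\<^bsub>Ks ! j\<^esub> com j x"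
    by (simp only: com_ops(2)[OF assms(2) eps(1) assms(1)] eps(2)[OF assms(2)])
  then show ?thesis using l by presburger
qed

lemma eps_idem: "qmul (eps i) (eps i) = eps i"
  by (rule com_ext) (simp_all add: A.mul_qspace eps com_eps_mul)

lemma eps_intcl: "eps i \<in> A.intcl"
  by (rule A.idempotent_intcl[OF eps(1) eps_idem])

lemma eps_sum: "(\<Sum>i<m. eps i) = qone"
proof -
  have sq: "(\<Sum>i<k. eps i) \<in> qspace n" for k by (intro A.Q.L_closed(7) eps)
  have "com j (\<Sum>i<k. eps i) = (if j < k then \<one>\<^bsub>Ks ! j\<^esub> else \<zero>\<^bsub>Ks ! j\<^esub>)" if j: "j < m" for j k
  proof (induction k)
    case 0 then show ?case using com_ops(5)[OF j] by simp
  next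
    case (Suc k)
    interpret F: field "Ks ! j" by (rule Ks_field[OF j])
    have "com j (\<Sum>i<Suc k. eps i) = com j (\<Sum>i<k. eps i) \<oplus>\<^bsub>Ks ! j\<^esub> com j (eps k)"
      using com_ops(3)[OF j sq eps(1)[of k], of k] by simp
    then show ?case using Suc eps(2)[OF j, of k] F.l_zero[OF F.one_closed] F.r_zero[OF F.one_closed] F.l_zero[OF F.zero_closed]
      by (metis less_Suc_eq less_irrefl)
  qed
  then show ?thesis
    by (intro com_ext) (use sq A.Q.one_mem com_ops(4) in auto)
qed

text \<open>Invert x in a component where it is nonzero and take 0 elsewhere: the product with x is
  the idempotent \<open>eps i\<close>.\<close>

lemma disc_nonzero: "A.disc \<noteq> 0"
proof (rule A.disc_nonzero)
  fix x assume x: "x \<in> qspace n" "x \<noteq> 0"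
  obtain i where i: "i < m" "com i x \<noteq> com i 0" using com_ext[OF x(1) A.Q.L_closed(1)] x(2) by blast
  interpret F: field "Ks ! i" by (rule Ks_field[OF i(1)])
  have cx: "com i x \<in> carrier (Ks ! i)" "com i x \<noteq> \<zero>\<^bsub>Ks ! i\<^esub>" using com_ops(1,5)[OF i(1)] x(1) i(2) by auto
  have "com i x \<in> Units (Ks ! i)" using cx F.field_Units by blast
  then obtain w where w: "w \<in> carrier (Ks ! i)" "com i x \<otimes>\<^bsub>Ks ! i\<^esub> w = \<one>\<^bsub>Ks ! i\<^esub>" using F.Units_r_inv_ex by blast
  have "\<exists>y\<in>qspace n. \<forall>j<m. com j y = (if j = i then w else \<zero>\<^bsub>Ks ! j\<^esub>)"
  proof (rule com_exists)
    fix j assume "j < m"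
    then interpret Fj: field "Ks ! j" by (rule Ks_field)
    show "(if j = i then w else \<zero>\<^bsub>Ks ! j\<^esub>) \<in> carrier (Ks ! j)" using w Fj.zero_closed by auto
  qed
  then obtain y where y: "y \<in> qspace n" "\<And>j. j < m \<Longrightarrow> com j y = (if j = i then w else \<zero>\<^bsub>Ks ! j\<^esub>)" by blast
  have "qmul x y = eps i"
  proof (rule com_ext[OF A.mul_qspace[OF x(1) y(1)] eps(1)])
    fix j assume j: "j < m"
    interpret Fj: field "Ks ! j" by (rule Ks_field[OF j])
    show "com j (qmul x y) = com j (eps i)"
      using com_ops(1,2)[OF j] x(1) y eps(2)[OF j] w j Fj.r_null by auto
  qed
  moreover have "eps i \<noteq> 0"
    using eps(2)[OF i(1), of i] com_ops(5)[OF i(1)] F.one_not_zero by auto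
  ultimately show "\<exists>y\<in>qspace n. qmul x y \<noteq> 0 \<and> qmul (qmul x y) (qmul x y) = qmul x y"
    using y(1) eps_idem by metis
qed

sublocale A: qalg_nd n qmul qone
  by unfold_locales (rule disc_nonzero)

lemma com_int: "i < m \<Longrightarrow> com i (of_int k * qone) = [k] \<cdot>\<^bsub>Ks ! i\<^esub> \<one>\<^bsub>Ks ! i\<^esub>"
proof -
  assume i: "i < m"
  note h = com_hom[OF i]
  show ?thesis
    using hom_add_pow(2)[OF ring_hom_ring.axioms(1,2)[OF h] ring_hom_ring.homh[OF h], where x = qone and l = k]
    by (simp add: A.Q.rng_int_multiple A.Q.one_mem com_ops(4)[OF i])
qed

lemma com_eval:
  "i < m \<Longrightarrow> set f \<subseteq> qspace n \<Longrightarrow> x \<in> qspace n \<Longrightarrow> com i (ring.eval A.Q.rng f x) = ring.eval (Ks ! i) (map (com i) f) (com i x)"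
  using ring_hom_ring.eval_hom'[OF com_hom, of i x f] by simp

text \<open>The ring of integers asks for an equation over Z, whereas an equation over R only yields
  coefficients in the image of R; hence the relation from \<open>intcl_int_relation\<close>.\<close>

lemma com_intcl_integral:
  assumes i: "i < m" and x: "x \<in> A.intcl"
  shows "com i x \<in> integral_closure_in (range (\<lambda>k::int. [k] \<cdot>\<^bsub>Ks ! i\<^esub> \<one>\<^bsub>Ks ! i\<^esub>)) (Ks ! i)"
proof -
  have xq: "x \<in> qspace n" using x A.intcl_subset_qspace by blast
  obtain d c where dc: "A.Q.pw x d = lincomb d c (A.Q.pw x)" using A.intcl_int_relation[OF x] by blast
  define e where "e j = (if j = d then 1 else - c j)" for j
  define f where "f = map (\<lambda>j. of_int (e j) * qone) (rev [0..<Suc d])"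
  have fq: "set f \<subseteq> qspace n" unfolding f_def using A.Q.L_closed(6)[OF A.Q.one_mem] by auto
  have "ring.eval A.Q.rng f x = (\<Sum>j<Suc d. qmul (rev f ! j) (A.Q.pw x j))"
    using A.Q.eval_rng[OF fq xq] unfolding f_def by simp
  also have "\<dots> = lincomb (Suc d) e (A.Q.pw x)"
  proof (intro sum.cong refl)
    fix j assume "j \<in> {..<Suc d}"
    then have "rev f ! j = of_int (e j) * qone" unfolding f_def by (simp add: rev_map[symmetric] del: upt_Suc)
    then show "qmul (rev f ! j) (A.Q.pw x j) = of_int (e j) * A.Q.pw x j"
      using A.Q.one_mul[OF A.Q.pw_mem[OF xq]] by (simp add: A.Q.mul_of_int_left)
  qed
  also have "\<dots> = 0" using dc by (simp add: e_def sum_negf)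
  finally have "ring.eval (Ks ! i) (map (com i) f) (com i x) = \<zero>\<^bsub>Ks ! i\<^esub>"
    using com_eval[OF i fq xq] com_ops(5)[OF i] by simp
  moreover have "map (com i) f = map (\<lambda>j. [e j] \<cdot>\<^bsub>Ks ! i\<^esub> \<one>\<^bsub>Ks ! i\<^esub>) (rev [0..<Suc d])"
    unfolding f_def by (simp add: com_int[OF i])
  moreover have "add_pow (Ks ! i) (1::int) \<one>\<^bsub>Ks ! i\<^esub> = \<one>\<^bsub>Ks ! i\<^esub>"
    using com_int[OF i, of 1] com_ops(4)[OF i] by simp
  ultimately have f: "ring.eval (Ks ! i) (map (com i) f) (com i x) = \<zero>\<^bsub>Ks ! i\<^esub>"
    "set (map (com i) f) \<subseteq> range (\<lambda>k::int. [k] \<cdot>\<^bsub>Ks ! i\<^esub> \<one>\<^bsub>Ks ! i\<^esub>)"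
    "hd (map (com i) f) = \<one>\<^bsub>Ks ! i\<^esub>" "map (com i) f \<noteq> []"
  proof -
    assume *: "ring.eval (Ks ! i) (map (com i) f) (com i x) = \<zero>\<^bsub>Ks ! i\<^esub>"
      "map (com i) f = map (\<lambda>j. [e j] \<cdot>\<^bsub>Ks ! i\<^esub> \<one>\<^bsub>Ks ! i\<^esub>) (rev [0..<Suc d])"
      "add_pow (Ks ! i) (1::int) \<one>\<^bsub>Ks ! i\<^esub> = \<one>\<^bsub>Ks ! i\<^esub>"
    show "ring.eval (Ks ! i) (map (com i) f) (com i x) = \<zero>\<^bsub>Ks ! i\<^esub>" by (rule *(1))
    show "set (map (com i) f) \<subseteq> range (\<lambda>k::int. [k] \<cdot>\<^bsub>Ks ! i\<^esub> \<one>\<^bsub>Ks ! i\<^esub>)"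
      unfolding *(2) set_map by blast
    show "hd (map (com i) f) = \<one>\<^bsub>Ks ! i\<^esub>" unfolding *(2) using *(3) by (simp add: e_def)
    show "map (com i) f \<noteq> []" unfolding *(2) by simp
  qed
  then show ?thesis unfolding integral_closure_in_def using com_ops(1)[OF i xq] by blast
qed

text \<open>An equation in the i-th field says nothing about the other components. Multiplying it by
  x, which vanishes there, gives a monic equation in the whole algebra; in coefficient lists this
  appends a 0.\<close>

lemma integral_com_intcl:
  assumes i: "i < m" and x: "x \<in> qspace n" "qmul (eps i) x = x"
    and int: "com i x \<in> integral_closure_in (range (\<lambda>k::int. [k] \<cdot>\<^bsub>Ks ! i\<^esub> \<one>\<^bsub>Ks ! i\<^esub>)) (Ks ! i)"
  shows "x \<in> A.intcl"
proof -
  obtain g where g: "g \<noteq> []" "set g \<subseteq> range (\<lambda>k::int. [k] \<cdot>\<^bsub>Ks ! i\<^esub> \<one>\<^bsub>Ks ! i\<^esub>)" "hd g = \<one>\<^bsub>Ks ! i\<^esub>"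
    "ring.eval (Ks ! i) g (com i x) = \<zero>\<^bsub>Ks ! i\<^esub>" using int unfolding integral_closure_in_def by blast
  have "\<exists>ks. tl g = map (\<lambda>k::int. [k] \<cdot>\<^bsub>Ks ! i\<^esub> \<one>\<^bsub>Ks ! i\<^esub>) ks"
    unfolding ex_map_conv using g(1,2) by (cases g) auto
  then obtain ks where ks: "tl g = map (\<lambda>k::int. [k] \<cdot>\<^bsub>Ks ! i\<^esub> \<one>\<^bsub>Ks ! i\<^esub>) ks" by blast
  \<comment> \<open>The leading coefficient is lifted to the unit itself, which keeps the equation
    monic; the other coefficients are lifted to integer multiples of the unit.\<close>
  define f where "f = qone # map (\<lambda>k. of_int k * qone) ks"
  have fR: "set f \<subseteq> intvecs n" unfolding f_def using A.Z.one_mem A.Z.L_closed(6)[OF A.Z.one_mem] by auto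
  have fq: "set f \<subseteq> qspace n" using fR intvecs_subset_qspace by blast
  have "map (com i) f = hd g # tl g" unfolding f_def ks g(3) by (simp add: com_int[OF i] com_ops(4)[OF i])
  then have "map (com i) f = g" using g(1) by simp
  then have ci: "com i (ring.eval A.Q.rng f x) = \<zero>\<^bsub>Ks ! i\<^esub>" using com_eval[OF i fq x(1)] g(4) by simp
  let ?v = "ring.eval A.Q.rng f x"
  have vq: "?v \<in> qspace n"
    using ring.eval_in_carrier[OF cring.axioms(1)[OF A.Q.cring_rng], of f x] fq x(1) by simp
  have "qmul (eps i) ?v = 0"
    by (rule com_ext[OF A.mul_qspace[OF eps(1) vq] A.Q.L_closed(1)]) (use ci com_eps_mul[OF vq] com_ops(5) in auto)
  then have "qmul x ?v = 0" using x(2) A.Q.mul_left_comm[of x "eps i" ?v] by (metis A.Q.mul_assoc A.Q.mul_comm A.Q.mul_zero_right)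
  moreover have "ring.eval A.Q.rng (f @ [0]) x = qmul x ?v"
  proof -
    have "set (f @ [0]) \<subseteq> qspace n" using fq A.Q.L_closed(1) by auto
    then have "ring.eval A.Q.rng (f @ [0]) x = (\<Sum>j<Suc (length f). qmul (rev (f @ [0]) ! j) (A.Q.pw x j))"
      using A.Q.eval_rng[of "f @ [0]" x] x(1) by simp
    also have "\<dots> = (\<Sum>j<length f. qmul (rev f ! j) (A.Q.pw x (Suc j)))"
      by (simp add: sum.lessThan_Suc_shift del: sum.lessThan_Suc)
    also have "\<dots> = qmul x (\<Sum>j<length f. qmul (rev f ! j) (A.Q.pw x j))"
      by (simp add: A.Q.mul_sum_right A.Q.pw_Suc A.Q.mul_left_comm)
    finally show ?thesis using A.Q.eval_rng[OF fq x(1)] by simp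
  qed
  ultimately have "ring.eval A.Q.rng (f @ [0]) x = 0" by simp
  moreover have "set (f @ [0]) \<subseteq> intvecs n" using fR A.Z.L_closed(1) by auto
  moreover have "hd (f @ [0]) = qone" unfolding f_def by simp
  ultimately have "x \<in> integral_closure_in (intvecs n) A.Q.rng"
    unfolding integral_closure_in_def using x(1) by (intro CollectI conjI exI[of _ "f @ [0]"]) auto
  then show ?thesis unfolding A.integral_closure_intvecs .
qed

lemma com_piece_iso:
  assumes i: "i < m"
  shows "com i \<in> ring_iso (mring.rng qmul (eps i) (A.piece (eps i))) (ring_of_integers (Ks ! i))"
proof -
  interpret E: qalg_idem n qmul qone "eps i" by unfold_locales (rule eps_intcl eps_idem)+
  let ?K = "Ks ! i" and ?O = "ring_of_integers (Ks ! i)"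
  let ?I = "integral_closure_in (range (\<lambda>k::int. [k] \<cdot>\<^bsub>?K\<^esub> \<one>\<^bsub>?K\<^esub>)) ?K"
  have O: "carrier ?O = ?I" "x \<otimes>\<^bsub>?O\<^esub> y = x \<otimes>\<^bsub>?K\<^esub> y" "x \<oplus>\<^bsub>?O\<^esub> y = x \<oplus>\<^bsub>?K\<^esub> y" "\<one>\<^bsub>?O\<^esub> = \<one>\<^bsub>?K\<^esub>" for x y
    unfolding ring_of_integers_def by simp_all
  have pq: "x \<in> qspace n" "qmul (eps i) x = x" "x \<in> A.intcl" if "x \<in> A.piece (eps i)" for x
    using E.pieceD[OF that] A.intcl_subset_qspace by auto
  have mem: "com i x \<in> carrier ?O" if "x \<in> A.piece (eps i)" for x
    unfolding O by (rule com_intcl_integral[OF i pq(3)[OF that]])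
  have "bij_betw (com i) (A.piece (eps i)) (carrier ?O)"
    unfolding bij_betw_def
  proof (intro conjI inj_onI equalityI)
    fix x y assume xy: "x \<in> A.piece (eps i)" "y \<in> A.piece (eps i)" "com i x = com i y"
    show "x = y"
    proof (rule com_ext[OF pq(1)[OF xy(1)] pq(1)[OF xy(2)]])
      fix j assume j: "j < m"
      show "com j x = com j y"
        using com_eps_mul[OF pq(1)[OF xy(1)] j, of i] com_eps_mul[OF pq(1)[OF xy(2)] j, of i] pq(2)[OF xy(1)] pq(2)[OF xy(2)] xy(3)
        by (cases "j = i") auto
    qed
  next
    show "carrier ?O \<subseteq> com i ` A.piece (eps i)"
    proof
      fix y assume y: "y \<in> carrier ?O"
      then have yK: "y \<in> carrier ?K" unfolding O integral_closure_in_def by blast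
      have "\<exists>v\<in>qspace n. \<forall>j<m. com j v = (if j = i then y else \<zero>\<^bsub>Ks ! j\<^esub>)"
      proof (rule com_exists)
        fix j assume "j < m"
        then interpret F: field "Ks ! j" by (rule Ks_field)
        show "(if j = i then y else \<zero>\<^bsub>Ks ! j\<^esub>) \<in> carrier (Ks ! j)" using yK by simp
      qed
      then obtain x where x: "x \<in> qspace n" "\<And>j. j < m \<Longrightarrow> com j x = (if j = i then y else \<zero>\<^bsub>Ks ! j\<^esub>)" by blast
      have ex: "qmul (eps i) x = x"
        by (rule com_ext[OF A.mul_qspace[OF eps(1) x(1)] x(1)]) (use com_eps_mul[OF x(1)] x(2) in auto)
      have cy: "com i x = y" using x(2)[OF i] by simp
      then have "x \<in> A.intcl" using integral_com_intcl[OF i x(1) ex] y unfolding O by simp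
      then have "x \<in> A.piece (eps i)" unfolding A.piece_def using ex by blast
      then show "y \<in> com i ` A.piece (eps i)" using cy by blast
    qed
  qed (use mem in blast)
  moreover have "com i \<in> ring_hom E.S.rng ?O"
    by (rule ring_hom_memI) (use mem pq(1) com_ops[OF i] eps(2)[OF i, of i] in \<open>simp_all add: O\<close>)
  ultimately show ?thesis unfolding ring_iso_def by simp
qed

theorem product_criterion:
  assumes p: "Factorial_Ring.prime p"
  shows "n \<le> card (geometric_points p R) + multiplicity (int p) (discriminant R)"
    and "n = card (geometric_points p R) + multiplicity (int p) (discriminant R) \<longleftrightarrow>
      coprime (normalization_index R) p \<and> (\<forall>K\<in>set Ks. tamely_ramified p K)"
proof -
  interpret AP: qalg_nd_prime n qmul qone p by unfold_locales (rule p)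
  have f: "card (geometric_points p R) = AP.Zp.pdim AP.J" by (rule card_geometric_points[OF p])
  show "n \<le> card (geometric_points p R) + multiplicity (int p) (discriminant R)"
    unfolding f discriminant_eq by (rule AP.criterion(1))
  have tame: "tame_at p (mring.rng qmul (eps i) (A.piece (eps i))) \<longleftrightarrow> tamely_ramified p (Ks ! i)" if i: "i < m" for i
  proof -
    interpret E: qalg_idem n qmul qone "eps i" by unfold_locales (rule eps_intcl eps_idem)+
    let ?O = "ring_of_integers (Ks ! i)"
    have iso: "com i \<in> ring_iso E.S.rng ?O" by (rule com_piece_iso[OF i])
    interpret F: field "Ks ! i" by (rule Ks_field[OF i])
    have zero: "com i \<zero>\<^bsub>E.S.rng\<^esub> = \<zero>\<^bsub>?O\<^esub>" unfolding ring_of_integers_def using com_ops(5)[OF i] by simp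
    \<comment> \<open>Transport of structure replaces the zero of the record by the image of zero;
      here that changes nothing.\<close>
    have "?O\<lparr>zero := com i \<zero>\<^bsub>E.S.rng\<^esub>\<rparr> = ?O" unfolding zero by simp
    then have "cring ?O" using cring.ring_iso_imp_img_cring[OF E.S.cring_rng iso] by simp
    then show ?thesis unfolding tamely_ramified_iff by (rule tame_at_iso[OF iso E.S.cring_rng])
  qed
  have "n = AP.Zp.pdim AP.J + multiplicity (int p) A.disc \<longleftrightarrow> coprime A.intcl_index p \<and>
    (\<forall>i<m. tame_at p (mring.rng qmul (eps i) (A.piece (eps i))))"
    unfolding tame_at_def by (rule AP.main_criterion[OF eps_intcl eps_idem eps_sum])
  also have "\<dots> \<longleftrightarrow> coprime (normalization_index R) p \<and> (\<forall>i<m. tamely_ramified p (Ks ! i))"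
    using tame by (simp add: normalization_index_eq[OF disc_nonzero])
  also have "\<dots> \<longleftrightarrow> coprime (normalization_index R) p \<and> (\<forall>K\<in>set Ks. tamely_ramified p K)"
    by (simp add: all_set_conv_all_nth)
  finally show "n = card (geometric_points p R) + multiplicity (int p) (discriminant R) \<longleftrightarrow>
      coprime (normalization_index R) p \<and> (\<forall>K\<in>set Ks. tamely_ramified p K)"
    unfolding f discriminant_eq .
qed

end

theorem theorem5p5:
  fixes R :: "'a ring" and Ks :: "'k ring list" and n p :: nat
  assumes "finite_SQ_ring R Ks" and "has_int_rank R n" and "Factorial_Ring.prime p"
  shows "int (card (geometric_points p R)) \<ge> int n - int (multiplicity (int p) (discriminant R)) \<and>
    (int (card (geometric_points p R)) = int n - int (multiplicity (int p) (discriminant R)) \<longleftrightarrow>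
      coprime (normalization_index R) p \<and> (\<forall>K \<in> set Ks. tamely_ramified p K))"
proof -
  obtain b where b: "int_basis R n b" using assms(2) unfolding has_int_rank_def by blast
  have R: "cring R" and fields: "\<And>K. K \<in> set Ks \<Longrightarrow> field K" and iso: "rat_tensor R \<simeq> RDirProd_list Ks"
    using assms(1) unfolding finite_SQ_ring_def number_field_def by blast+
  interpret B: based_ring R n b by (rule based_ring.intro[OF R]) (unfold_locales, rule b)
  obtain k where k: "k \<in> ring_iso (rat_tensor R) (RDirProd_list Ks)" using iso unfolding is_ring_iso_def by blast
  \<comment> \<open>Composed with the inverse of \<open>iota\<close>, the given isomorphism starts
    at the coordinate algebra.\<close>
  have "inv_into (carrier (rat_tensor R)) B.iota \<in> ring_iso B.A.Q.rng (rat_tensor R)"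
    by (rule ring_iso_set_sym[OF cring.axioms(1)[OF B.cring_T] B.iota_iso])
  from ring_iso_set_trans[OF this k]
  have "product_ring_axioms R n b Ks (k \<circ> inv_into (carrier (rat_tensor R)) B.iota)"
    using fields by (intro product_ring_axioms.intro) auto
  then interpret P: product_ring R n b Ks "k \<circ> inv_into (carrier (rat_tensor R)) B.iota"
    by (rule product_ring.intro[OF B.based_ring_axioms])
  show ?thesis using P.product_criterion[OF assms(3)] by linarith
qed

end
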